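(* Let $\alpha\in(0,1]$, and let $\Phi$ be a Young function which is of lower type $p_0$ and of upper type $p_1$ with $1<p_0\le p_1<\infty$. Let $\varphi_1,\varphi_2$ be positive measurable functions on $\mathbb{R}^n\times(0,\infty)$ such that there is a constant $C$, independent of $x$ and $r$, with $$\int_{r}^{\infty} \Big(\operatorname*{ess\,inf}_{t<s<\infty}\frac{\varphi_1(x,s)}{\Phi^{-1}(s^{-n})}\Big)\, \Phi^{-1}(t^{-n})\,\frac{dt}{t} \le C \, \varphi_2(x,r)\qquad\text{for all }x\in\mathbb{R}^n,\ r>0.$$ Then $g_{\alpha}$ is bounded from $M^{\Phi,\varphi_1}(\mathbb{R}^n)$ to $M^{\Phi,\varphi_2}(\mathbb{R}^n)$, i.e. there is a constant $C'$ such that $\|g_\alpha f\|_{M^{\Phi,\varphi_2}}\le C'\|f\|_{M^{\Phi,\varphi_1}}$ for all $f\in M^{\Phi,\varphi_1}(\mathbb{R}^n)$.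
   Context: A Young function is a convex, left-continuous $\Phi:[0,\infty)\to[0,\infty]$ with $\lim_{r\to+0}\Phi(r)=\Phi(0)=0$ and $\lim_{r\to\infty}\Phi(r)=\infty$. Its generalized inverse is $\Phi^{-1}(s)=\inf\{r\ge 0:\Phi(r)>s\}$ ($\inf\emptyset=+\infty$). $\Phi$ is of upper type $p$ (resp. lower type $p$) if there is a positive constant $C$ such that $\Phi(st)\le Ct^p\Phi(s)$ for all $t\in[1,\infty)$ (resp. $t\in[0,1]$) and all $s\in[0,\infty)$. Luxemburg norm: $\|f\|_{L^{\Phi}}=\inf\{\lambda>0:\int_{\mathbb{R}^n}\Phi(|f(x)|/\lambda)\,dx\le 1\}$. For a ball $B$, $\|f\|_{L^\Phi(B)}=\|f\chi_B\|_{L^\Phi}$. $L^\Phi_{\rm loc}(\mathbb{R}^n)$ is the set of $f$ with $f\chi_B\in L^\Phi(\mathbb{R}^n)$ for every ball $B$, where $L^\Phi(\mathbb{R}^n)$ is the set of locally integrable $f$ with $\int_{\mathbb{R}^n}\Phi(k|f|)<\infty$ for some $k>0$. $B(x,r)$ is the ball of center $x$ and radius $r$. Generalized Orlicz-Morrey space: for a positive measurable $\varphi$ on $\mathbb{R}^n\times(0,\infty)$, $M^{\Phi,\varphi}(\mathbb{R}^n)$ is the set of $f\in L^\Phi_{\rm loc}(\mathbb{R}^n)$ with $\|f\|_{M^{\Phi,\varphi}}=\sup_{x\in\mathbb{R}^n,r>0}\varphi(x,r)^{-1}\Phi^{-1}(r^{-n})\|f\|_{L^\Phi(B(x,r))}<\infty$.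 Intrinsic Littlewood-Paley $g$-function: for $0<\alpha\le1$, $C_\alpha$ is the family of $\phi:\mathbb{R}^n\to\mathbb{R}$ supported in $\{|x|\le1\}$ with $\int\phi\,dx=0$ and $|\phi(x)-\phi(x')|\le|x-x'|^\alpha$ for all $x,x'\in\mathbb{R}^n$. Put $\phi_t(y)=t^{-n}\phi(y/t)$. For $f\in L^1_{\rm loc}(\mathbb{R}^n)$ and $(y,t)\in\mathbb{R}^n\times(0,\infty)$ let $A_\alpha f(t,y)=\sup_{\phi\in C_\alpha}|f*\phi_t(y)|$, and $$g_\alpha f(x)=\Big(\int_0^\infty (A_\alpha f(t,x))^2\frac{dt}{t}\Big)^{1/2}.$$ *)

theory Defs
  imports "HOL-Analysis.Analysis"
begin

text \<open>
  \<open>\<real>\<^sup>n\<close> is an arbitrary type \<open>'a::euclidean_space\<close>, with \<open>n = DIM('a)\<close>.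
\<close>

text \<open>
  A Young function \<open>\<Phi> : [0,\<infinity>) \<rightarrow> [0,\<infinity>]\<close> is a function \<open>real \<Rightarrow> ennreal\<close> of which only the values
  on \<open>[0,\<infinity>)\<close> matter. The library's \<open>convex_on\<close> is for real-valued functions only, so convexity
  is written out.
\<close>

definition young_function :: "(real \<Rightarrow> ennreal) \<Rightarrow> bool" where
  "young_function \<Phi> \<longleftrightarrow>
     (\<forall>r\<ge>0. \<forall>s\<ge>0. \<forall>u\<in>{0..1}.
        \<Phi> ((1 - u) * r + u * s) \<le> ennreal (1 - u) * \<Phi> r + ennreal u * \<Phi> s) \<and>
     (\<forall>r>0. (\<Phi> \<longlongrightarrow> \<Phi> r) (at_left r)) \<and>
     \<Phi> 0 = 0 \<and> (\<Phi> \<longlongrightarrow> 0) (at_right 0) \<and>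
     (\<Phi> \<longlongrightarrow> \<infinity>) at_top"

definition young_inv :: "(real \<Rightarrow> ennreal) \<Rightarrow> real \<Rightarrow> ennreal" where
  "young_inv \<Phi> s = Inf (ennreal ` {r. r \<ge> 0 \<and> \<Phi> r > ennreal s})"

definition upper_type :: "real \<Rightarrow> (real \<Rightarrow> ennreal) \<Rightarrow> bool" where
  "upper_type p \<Phi> \<longleftrightarrow>
     (\<exists>C>0. \<forall>t\<ge>1. \<forall>s\<ge>0. \<Phi> (s * t) \<le> ennreal (C * t powr p) * \<Phi> s)"

definition lower_type :: "real \<Rightarrow> (real \<Rightarrow> ennreal) \<Rightarrow> bool" where
  "lower_type p \<Phi> \<longleftrightarrow>
     (\<exists>C>0. \<forall>t\<in>{0..1}. \<forall>s\<ge>0. \<Phi> (s * t) \<le> ennreal (C * t powr p) * \<Phi> s)"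

definition locally_integrable :: "('a::euclidean_space \<Rightarrow> 'b::{banach, second_countable_topology}) \<Rightarrow> bool" where
  "locally_integrable f \<longleftrightarrow> (\<forall>x r. set_integrable lebesgue (ball x r) f)"

definition luxemburg_norm :: "(real \<Rightarrow> ennreal) \<Rightarrow> ('a::euclidean_space \<Rightarrow> 'b::{banach, second_countable_topology}) \<Rightarrow> ennreal" where
  "luxemburg_norm \<Phi> f =
     Inf (ennreal ` {c. c > 0 \<and> (\<integral>\<^sup>+x. \<Phi> (norm (f x) / c) \<partial>lebesgue) \<le> 1})"

definition orlicz_space :: "(real \<Rightarrow> ennreal) \<Rightarrow> ('a::euclidean_space \<Rightarrow> 'b::{banach, second_countable_topology}) set" where
  "orlicz_space \<Phi> =
     {f. locally_integrable f \<and> (\<exists>k>0. (\<integral>\<^sup>+x. \<Phi> (k * norm (f x)) \<partial>lebesgue) < \<infinity>)}"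

definition cut_off :: "'a set \<Rightarrow> ('a \<Rightarrow> 'b::real_vector) \<Rightarrow> 'a \<Rightarrow> 'b" where
  "cut_off B f x = indicator B x *\<^sub>R f x"

definition orlicz_loc :: "(real \<Rightarrow> ennreal) \<Rightarrow> ('a::euclidean_space \<Rightarrow> 'b::{banach, second_countable_topology}) set" where
  "orlicz_loc \<Phi> = {f. \<forall>x. \<forall>r>0. cut_off (ball x r) f \<in> orlicz_space \<Phi>}"

definition positive_measurable_weight :: "('a::euclidean_space \<Rightarrow> real \<Rightarrow> real) \<Rightarrow> bool" where
  "positive_measurable_weight \<phi> \<longleftrightarrow>
     (\<forall>x. \<forall>r>0. \<phi> x r > 0) \<and>
     (\<lambda>(x, r). \<phi> x r) \<in> borel_measurable (lebesgue_on (UNIV \<times> {0<..}))"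

definition orlicz_morrey_norm ::
  "(real \<Rightarrow> ennreal) \<Rightarrow> ('a \<Rightarrow> real \<Rightarrow> real) \<Rightarrow>
   ('a::euclidean_space \<Rightarrow> 'b::{banach, second_countable_topology}) \<Rightarrow> ennreal" where
  "orlicz_morrey_norm \<Phi> \<phi> f =
     (SUP x. SUP r\<in>{0<..}. inverse (ennreal (\<phi> x r)) * young_inv \<Phi> (r powr (- real DIM('a))) *
                luxemburg_norm \<Phi> (cut_off (ball x r) f))"

definition orlicz_morrey ::
  "(real \<Rightarrow> ennreal) \<Rightarrow> ('a \<Rightarrow> real \<Rightarrow> real) \<Rightarrow>
   ('a::euclidean_space \<Rightarrow> 'b::{banach, second_countable_topology}) set" where
  "orlicz_morrey \<Phi> \<phi> = {f \<in> orlicz_loc \<Phi>. orlicz_morrey_norm \<Phi> \<phi> f < \<infinity>}"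

definition C_class :: "real \<Rightarrow> ('a::euclidean_space \<Rightarrow> real) set" where
  "C_class \<alpha> =
     {\<psi>. (\<forall>x. norm x > 1 \<longrightarrow> \<psi> x = 0) \<and>
         (\<integral>x. \<psi> x \<partial>lebesgue) = 0 \<and>
         (\<forall>x x'. \<bar>\<psi> x - \<psi> x'\<bar> \<le> norm (x - x') powr \<alpha>)}"

definition dilate :: "real \<Rightarrow> ('a::euclidean_space \<Rightarrow> real) \<Rightarrow> 'a \<Rightarrow> real" where
  "dilate t \<psi> y = t powr (- real DIM('a)) * \<psi> (y /\<^sub>R t)"

definition conv :: "('a::euclidean_space \<Rightarrow> 'b::{banach, second_countable_topology}) \<Rightarrow> ('a \<Rightarrow> real) \<Rightarrow> 'a \<Rightarrow> 'b" where
  "conv f \<psi> y = (\<integral>z. \<psi> (y - z) *\<^sub>R f z \<partial>lebesgue)"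

definition A_sup ::
  "real \<Rightarrow> ('a::euclidean_space \<Rightarrow> 'b::{banach, second_countable_topology}) \<Rightarrow> real \<Rightarrow> 'a \<Rightarrow> ennreal" where
  "A_sup \<alpha> f t y = (SUP \<psi>\<in>C_class \<alpha>. ennreal (norm (conv f (dilate t \<psi>) y)))"

definition ennreal_sqrt :: "ennreal \<Rightarrow> ennreal" where
  "ennreal_sqrt u = (if u = \<infinity> then \<infinity> else ennreal (sqrt (enn2real u)))"

definition g_fun ::
  "real \<Rightarrow> ('a::euclidean_space \<Rightarrow> 'b::{banach, second_countable_topology}) \<Rightarrow> 'a \<Rightarrow> ennreal" where
  "g_fun \<alpha> f x =
     ennreal_sqrt (\<integral>\<^sup>+t\<in>{0<..}. (A_sup \<alpha> f t x)\<^sup>2 * ennreal (1 / t) \<partial>lebesgue)"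

text \<open>
  Dual to \<open>esssup\<close> of \<open>HOL-Probability.Essential_Supremum\<close>, without its convention for
  non-measurable functions: for a Lebesgue measurable \<open>\<phi>\<close> on the product, the section at a fixed
  \<open>x\<close> need not be measurable for every \<open>x\<close>.
\<close>

definition essinf :: "'a measure \<Rightarrow> ('a \<Rightarrow> ennreal) \<Rightarrow> ennreal" where
  "essinf M f = Liminf (ae_filter M) f"

end

theory Submission
  imports Defs
begin

text \<open>
  The kernels \<open>\<psi>\<^sub>t\<close> with \<open>\<psi> \<in> C_class \<alpha>\<close> are almost orthogonal across scales, even when \<open>\<psi>\<close> is selected
  depending on \<open>(t, x)\<close>; this bounds \<open>g\<^sub>\<alpha>\<close> on \<open>L\<^sup>2\<close>. Replacing \<open>x\<close> by a point at distance at most \<open>t\<close> costs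
  only a constant and a doubling of \<open>t\<close>, which propagates the bound to \<open>L\<^sup>2\<^sup>m\<close> for every \<open>m\<close>. Together
  with a Calderon-Zygmund decomposition at each height this yields a good distribution inequality, which
  is integrated against \<open>d\<Phi>\<close> to a modular inequality for \<open>g\<^sub>\<alpha>\<close> on \<open>L\<^sup>\<Phi>\<close>. On a ball \<open>B(x, r)\<close> the part of
  \<open>f\<close> inside \<open>B(x, 2 r)\<close> is handled by this bound and the remaining part pointwise, so that
  \<open>\<Phi>\<^sup>-\<^sup>1(r\<^sup>-\<^sup>n) \<parallel>g\<^sub>\<alpha> f\<parallel>\<close> is at most a multiple of the integral over \<open>t > r\<close> of
  \<open>\<parallel>f\<parallel> \<Phi>\<^sup>-\<^sup>1(t\<^sup>-\<^sup>n) / t\<close>, with the norm of \<open>f\<close> taken on \<open>B(x, t)\<close>. Since that norm increases with \<open>t\<close>, it is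
  at most \<open>\<parallel>f\<parallel>\<close> in the Morrey space times the essential infimum in the hypothesis.
\<close>

text \<open>The supremum over \<open>C_class\<close> makes \<open>g_fun\<close> nonlinear in f, so
  duality is not at hand and the exponents above 2 have to be reached directly. Once a kernel has
  been selected at every (t, x), the operator is linear but has no regularity in (t, x). Everything
  therefore rests on properties in the integration variable, which no selection can destroy:
  support, mean value zero and Hoelder continuity. Two selected kernels of scales s \<le> t have a
  pairing of relative size (s / t)^\<alpha>, which is integrable against ds / s on either side of s
  = t; and the bad part of a decomposition is controlled by the Hoelder bound alone. As p1 can be
  arbitrarily large, some exponent 2 m > p1 is needed at the upper end; at the lower end the weak
  (1, 1) behaviour of the bad part is enough, because p0 > 1. \<open>marcinkiewicz_weight\<close>
  records both ends in one inequality, and the strict inequalities p1 < 2 m and 1 < p0 are what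
  makes its integral against \<Phi>(2 l) dl / l converge at infinity and at 0.\<close>

lemma emeasure_ball_eq:
  fixes x :: "'a::euclidean_space"
  assumes "r \<ge> 0"
  shows "emeasure lborel (ball x r) = ennreal (unit_ball_vol (real DIM('a)) * r ^ DIM('a))"
  using emeasure_ball[OF assms, of x] by simp

lemma emeasure_cball_eq:
  fixes x :: "'a::euclidean_space"
  assumes "r \<ge> 0"
  shows "emeasure lborel (cball x r) = ennreal (unit_ball_vol (real DIM('a)) * r ^ DIM('a))"
  using emeasure_cball[OF assms, of x] by simp

lemma powr_minus_DIM:
  assumes "t > 0"
  shows "t powr (- real n) = inverse (t ^ n)"
  using assms by (simp add: powr_minus powr_realpow)

lemma nn_integral_powr_atLeast:
  fixes a s :: real
  assumes "a > 0" "s > 0"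
  shows "(\<integral>\<^sup>+t\<in>{s..}. ennreal (t powr (- a - 1)) \<partial>lborel) = ennreal (s powr (- a) / a)"
proof -
  have "(\<integral>\<^sup>+t. ennreal (t powr (- a - 1)) * indicator {s..} t \<partial>lborel)
     = ennreal (0 - (- (s powr (- a) / a)))"
  proof (rule nn_integral_FTC_atLeast)
    show "((\<lambda>t. - (t powr (- a) / a)) has_real_derivative t powr (- a - 1)) (at t)" if "s \<le> t" for t
      using that assms by (auto intro!: derivative_eq_intros simp: field_simps)
    show "((\<lambda>t. - (t powr (- a) / a)) \<longlongrightarrow> 0) at_top"
    proof -
      have "((\<lambda>t::real. t powr (- a)) \<longlongrightarrow> 0) at_top"
        using assms by (intro tendsto_neg_powr filterlim_ident) auto
      from tendsto_minus[OF tendsto_divide[OF this tendsto_const[of a]]] show ?thesis using assms by simp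
    qed
  qed (use assms in auto)
  then show ?thesis by simp
qed

lemma nn_integral_powr_from_0:
  fixes a s :: real
  assumes "a > 0" "s \<ge> 0"
  shows "(\<integral>\<^sup>+t\<in>{0..s}. ennreal (t powr (a - 1)) \<partial>lborel) = ennreal (s powr a / a)"
proof -
  have "((\<lambda>t. t powr (a - 1)) has_integral (s powr (a - 1 + 1) / (a - 1 + 1))) {0..s}"
    by (rule has_integral_powr_from_0) (use assms in auto)
  then have "(\<integral>\<^sup>+t. ennreal (indicator {0..s} t *\<^sub>R t powr (a - 1)) \<partial>lborel) = ennreal (s powr a / a)"
  proof (intro nn_integral_has_integral_lborel)
    assume *: "((\<lambda>t. t powr (a - 1)) has_integral (s powr (a - 1 + 1) / (a - 1 + 1))) {0..s}"
    have "(\<lambda>t. indicator {0..s} t *\<^sub>R t powr (a - 1)) = (\<lambda>t. if t \<in> {0..s} then t powr (a - 1) else 0)"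
      by (auto simp: indicator_def)
    then show "((\<lambda>t. indicator {0..s} t *\<^sub>R t powr (a - 1)) has_integral (s powr a / a)) UNIV"
      using * assms has_integral_restrict_UNIV[of "{0..s}" "\<lambda>t. t powr (a - 1)"] by simp
  qed auto
  also have "(\<integral>\<^sup>+t. ennreal (indicator {0..s} t *\<^sub>R t powr (a - 1)) \<partial>lborel)
    = (\<integral>\<^sup>+t\<in>{0..s}. ennreal (t powr (a - 1)) \<partial>lborel)"
    by (intro nn_integral_cong) (auto simp: indicator_def)
  finally show ?thesis .
qed

subsection \<open>The kernel class\<close>

text \<open>Comparison with a point \<open>u\<close> of norm 2, where \<psi> vanishes: its distance
  from any point of the unit ball is at most 3, and 3 to the power \<alpha> is at most 3.\<close>

lemma C_class_bound:
  fixes \<psi> :: "'a::euclidean_space \<Rightarrow> real"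
  assumes "\<psi> \<in> C_class \<alpha>" "0 < \<alpha>" "\<alpha> \<le> 1"
  shows "\<bar>\<psi> x\<bar> \<le> 3"
proof (cases "norm x > 1")
  case True
  then show ?thesis using assms by (auto simp: C_class_def)
next
  case False
  obtain u :: 'a where u: "norm u = 2" using vector_choose_size[of 2] by auto
  have "\<psi> u = 0" using u assms by (auto simp: C_class_def)
  moreover have "\<bar>\<psi> x - \<psi> u\<bar> \<le> norm (x - u) powr \<alpha>" using assms by (auto simp: C_class_def)
  ultimately have "\<bar>\<psi> x\<bar> \<le> norm (x - u) powr \<alpha>" by simp
  also have "\<dots> \<le> 3 powr \<alpha>"
    using False u norm_triangle_ineq4[of x u] assms by (intro powr_mono2) auto
  also have "\<dots> \<le> 3 powr 1" using assms by (intro powr_mono) auto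
  finally show ?thesis by simp
qed

lemma C_class_continuous:
  fixes \<psi> :: "'a::euclidean_space \<Rightarrow> real"
  assumes "\<psi> \<in> C_class \<alpha>" "0 < \<alpha>"
  shows "continuous_on UNIV \<psi>"
proof -
  have "(\<psi> \<longlongrightarrow> \<psi> x) (at x)" for x
  proof -
    have "((\<lambda>y. norm (y - x) powr \<alpha>) \<longlongrightarrow> 0) (at x)"
      using assms by (auto intro!: tendsto_eq_intros)
    then show ?thesis
      apply (subst tendsto_dist_iff)
      apply (rule tendsto_sandwich[of "\<lambda>_. 0" _ _ "\<lambda>y. norm (y - x) powr \<alpha>"])
      using assms by (auto simp: C_class_def dist_norm)
  qed
  then show ?thesis by (auto simp: continuous_on_def intro: tendsto_within_subset)
qed

lemma C_class_measurable:
  fixes \<psi> :: "'a::euclidean_space \<Rightarrow> real"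
  assumes "\<psi> \<in> C_class \<alpha>" "0 < \<alpha>"
  shows "\<psi> \<in> borel_measurable borel"
  using C_class_continuous[OF assms] by (rule borel_measurable_continuous_onI)

text \<open>Keeps the family over which suprema are taken nonempty, as its enumeration in
  \<open>A_sup_countable\<close> requires.\<close>

lemma zero_in_C_class: "(\<lambda>_. 0) \<in> C_class \<alpha>"
  by (auto simp: C_class_def)

lemma dilate_bound:
  fixes \<psi> :: "'a::euclidean_space \<Rightarrow> real"
  assumes "\<psi> \<in> C_class \<alpha>" "0 < \<alpha>" "\<alpha> \<le> 1" "t > 0"
  shows "\<bar>dilate t \<psi> y\<bar> \<le> 3 * t powr (- real DIM('a)) * indicator (cball 0 t) y"
proof (cases "norm y \<le> t")
  case True
  have "t powr (- real DIM('a)) * \<bar>\<psi> (y /\<^sub>R t)\<bar> \<le> t powr (- real DIM('a)) * 3"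
    using C_class_bound[OF assms(1-3)] by (intro mult_left_mono) auto
  then show ?thesis using True by (simp add: dilate_def abs_mult mult.commute)
next
  case False
  then have "norm (y /\<^sub>R t) > 1" using assms by (simp add: field_simps)
  then have "\<psi> (y /\<^sub>R t) = 0" using assms(1) unfolding C_class_def by blast
  then show ?thesis by (simp add: dilate_def)
qed

lemma dilate_holder:
  fixes \<psi> :: "'a::euclidean_space \<Rightarrow> real"
  assumes "\<psi> \<in> C_class \<alpha>" "t > 0"
  shows "\<bar>dilate t \<psi> y - dilate t \<psi> y'\<bar> \<le> t powr (- real DIM('a)) * (norm (y - y') / t) powr \<alpha>"
proof -
  have "\<bar>dilate t \<psi> y - dilate t \<psi> y'\<bar> = t powr (- real DIM('a)) * \<bar>\<psi> (y /\<^sub>R t) - \<psi> (y' /\<^sub>R t)\<bar>"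
    by (simp add: dilate_def abs_mult flip: right_diff_distrib)
  also have "\<dots> \<le> t powr (- real DIM('a)) * norm (y /\<^sub>R t - y' /\<^sub>R t) powr \<alpha>"
    using assms(1) by (intro mult_left_mono) (auto simp: C_class_def)
  also have "norm (y /\<^sub>R t - y' /\<^sub>R t) = norm (y - y') / t"
    using assms(2) by (simp flip: scaleR_diff_right add: divide_inverse mult.commute)
  finally show ?thesis .
qed

lemma dilate_measurable:
  fixes \<psi> :: "'a::euclidean_space \<Rightarrow> real"
  assumes "\<psi> \<in> C_class \<alpha>" "0 < \<alpha>"
  shows "(\<lambda>(t, y). dilate t \<psi> y) \<in> borel_measurable (borel \<Otimes>\<^sub>M borel)"
    and "dilate t \<psi> \<in> borel_measurable borel"
proof -
  note [measurable] = C_class_measurable[OF assms]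
  show "(\<lambda>(t, y). dilate t \<psi> y) \<in> borel_measurable (borel \<Otimes>\<^sub>M borel)"
    unfolding dilate_def by measurable
  show "dilate t \<psi> \<in> borel_measurable borel"
    unfolding dilate_def by measurable
qed

subsection \<open>Locally integrable functions\<close>

lemma locally_integrable_measurable:
  fixes f :: "'a::euclidean_space \<Rightarrow> 'b::{banach, second_countable_topology}"
  assumes "locally_integrable f"
  shows "f \<in> borel_measurable lebesgue"
proof (rule borel_measurable_LIMSEQ_metric)
  show "(\<lambda>x. indicator (ball 0 (real k)) x *\<^sub>R f x) \<in> borel_measurable lebesgue" for k
    using assms by (auto simp: locally_integrable_def set_integrable_def dest: borel_measurable_integrable)
  show "(\<lambda>k. indicator (ball 0 (real k)) x *\<^sub>R f x) \<longlonglongrightarrow> f x" for x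
  proof (rule tendsto_eventually)
    obtain N :: nat where "norm x < real N" using reals_Archimedean2 by blast
    then show "\<forall>\<^sub>F k in sequentially. indicator (ball 0 (real k)) x *\<^sub>R f x = f x"
      by (auto simp: eventually_sequentially intro!: exI[of _ N])
  qed
qed

lemma locally_integrable_scaleR_integrable:
  fixes f :: "'a::euclidean_space \<Rightarrow> 'b::{banach, second_countable_topology}"
  assumes f: "locally_integrable f" and k: "k \<in> borel_measurable lebesgue"
    and b: "\<And>z. \<bar>k z\<bar> \<le> M * indicator (ball x R) z"
  shows "integrable lebesgue (\<lambda>z. k z *\<^sub>R f z)"
proof (rule Bochner_Integration.integrable_bound)
  have "integrable lebesgue (\<lambda>z. indicator (ball x R) z *\<^sub>R f z)"
    using f by (simp add: locally_integrable_def set_integrable_def)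
  then show "integrable lebesgue (\<lambda>z. M * norm (indicator (ball x R) z *\<^sub>R f z))"
    by (intro integrable_mult_right integrable_norm)
  show "(\<lambda>z. k z *\<^sub>R f z) \<in> borel_measurable lebesgue"
    using k locally_integrable_measurable[OF f] by measurable
  show "AE z in lebesgue. norm (k z *\<^sub>R f z) \<le> norm (M * norm (indicator (ball x R) z *\<^sub>R f z))"
  proof (rule AE_I2)
    fix z
    show "norm (k z *\<^sub>R f z) \<le> norm (M * norm (indicator (ball x R) z *\<^sub>R f z))"
      using mult_right_mono[OF order_trans[OF b[of z] mult_right_mono[OF abs_ge_self[of M]]], of "norm (f z)"]
      by (auto simp: abs_mult indicator_def split: if_splits)
  qed
qed

lemma conv_integrable:
  fixes f :: "'a::euclidean_space \<Rightarrow> 'b::{banach, second_countable_topology}"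
  assumes f: "locally_integrable f" and psi: "\<psi> \<in> C_class \<alpha>" "0 < \<alpha>" "\<alpha> \<le> 1" "t > 0"
  shows "integrable lebesgue (\<lambda>z. dilate t \<psi> (y - z) *\<^sub>R f z)"
proof (rule locally_integrable_scaleR_integrable[OF f])
  note [measurable] = dilate_measurable(2)[OF psi(1,2)]
  have "(\<lambda>z. dilate t \<psi> (y - z)) \<in> borel_measurable borel" by measurable
  then show "(\<lambda>z. dilate t \<psi> (y - z)) \<in> borel_measurable lebesgue"
    by (simp add: measurable_completion)
  show "\<bar>dilate t \<psi> (y - z)\<bar> \<le> 3 * t powr (- real DIM('a)) * indicator (ball y (t + 1)) z" for z
    using dilate_bound[OF psi, of "y - z"] psi(4)
    by (cases "norm (y - z) \<le> t") (auto simp: indicator_def dist_norm norm_minus_commute)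
qed

text \<open>If the integrand is not Bochner integrable, \<open>conv\<close> has the default value 0.
  \<open>nn_integral\<close> takes the same value over a measure and its completion, which is why
  \<open>lborel\<close> can stand on the right for a merely Lebesgue measurable
  \<open>f\<close>.\<close>

lemma conv_norm_le:
  fixes f :: "'a::euclidean_space \<Rightarrow> 'b::{banach, second_countable_topology}"
  shows "ennreal (norm (conv f \<psi> y)) \<le> (\<integral>\<^sup>+z. ennreal (\<bar>\<psi> (y - z)\<bar>) * ennreal (norm (f z)) \<partial>lborel)"
proof (cases "integrable lebesgue (\<lambda>z. \<psi> (y - z) *\<^sub>R f z)")
  case True
  then have "ennreal (norm (conv f \<psi> y)) \<le> (\<integral>\<^sup>+z. norm (\<psi> (y - z) *\<^sub>R f z) \<partial>lebesgue)"
    unfolding conv_def by (rule integral_norm_bound_ennreal)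
  then show ?thesis by (simp add: nn_integral_completion ennreal_mult)
next
  case False
  then show ?thesis by (simp add: conv_def not_integrable_integral_eq)
qed

text \<open>Cancellation is given up here: only size and support of the kernels enter, so the bound
  is a multiple of the mean of |f| over the ball of radius t.\<close>

lemma A_sup_le:
  fixes f :: "'a::euclidean_space \<Rightarrow> 'b::{banach, second_countable_topology}"
  assumes "0 < \<alpha>" "\<alpha> \<le> 1" "t > 0"
  shows "A_sup \<alpha> f t y \<le> (\<integral>\<^sup>+z. ennreal (3 * t powr (- real DIM('a))) * (ennreal (norm (f z)) * indicator (cball y t) z) \<partial>lborel)"
  unfolding A_sup_def
proof (rule SUP_least)
  fix \<psi> :: "'a \<Rightarrow> real" assume psi: "\<psi> \<in> C_class \<alpha>"
  have "ennreal (norm (conv f (dilate t \<psi>) y)) \<le> (\<integral>\<^sup>+z. ennreal (\<bar>dilate t \<psi> (y - z)\<bar>) * ennreal (norm (f z)) \<partial>lborel)"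
    by (rule conv_norm_le)
  also have "\<dots> \<le> (\<integral>\<^sup>+z. ennreal (3 * t powr (- real DIM('a))) * (ennreal (norm (f z)) * indicator (cball y t) z) \<partial>lborel)"
  proof (rule nn_integral_mono)
    fix z
    have "ennreal \<bar>dilate t \<psi> (y - z)\<bar> \<le> ennreal (3 * t powr (- real DIM('a)) * indicator (cball 0 t) (y - z))"
      by (rule ennreal_leI) (rule dilate_bound[OF psi assms])
    also have "\<dots> = ennreal (3 * t powr (- real DIM('a))) * indicator (cball y t) z"
      using assms(3) by (auto simp: indicator_def dist_norm norm_minus_commute)
    finally have "ennreal \<bar>dilate t \<psi> (y - z)\<bar> * ennreal (norm (f z))
        \<le> ennreal (3 * t powr (- real DIM('a))) * indicator (cball y t) z * ennreal (norm (f z))"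
      by (rule mult_right_mono) simp
    then show "ennreal (\<bar>dilate t \<psi> (y - z)\<bar>) * ennreal (norm (f z)) \<le> ennreal (3 * t powr (- real DIM('a))) * (ennreal (norm (f z)) * indicator (cball y t) z)"
      by (simp add: mult_ac)
  qed
  finally show "ennreal (norm (conv f (dilate t \<psi>) y)) \<le> \<dots>" .
qed

text \<open>Joint continuity in scale and centre is what allows the uncountable supremum in
  \<open>A_sup\<close> to be replaced by a countable one. Along a convergent sequence the factors
  t^(-n), the scales and the centres stay bounded, so a multiple of |f| on one fixed ball dominates
  all integrands.\<close>

lemma conv_continuous:
  fixes f :: "'a::euclidean_space \<Rightarrow> 'b::{banach, second_countable_topology}"
  assumes f: "locally_integrable f" and psi: "\<psi> \<in> C_class \<alpha>" "0 < \<alpha>" "\<alpha> \<le> 1"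
  shows "continuous_on ({0<..} \<times> UNIV) (\<lambda>(t, x). conv f (dilate t \<psi>) x)"
proof (rule continuous_on_sequentiallyI)
  fix u :: "nat \<Rightarrow> real \<times> 'a" and a
  assume u: "\<forall>n. u n \<in> {0<..} \<times> UNIV" and a: "a \<in> {0<..} \<times> UNIV" and lima: "u \<longlonglongrightarrow> a"
  obtain t x where tx: "a = (t, x)" by fastforce
  have t: "t \<in> {0<..}" and lim: "u \<longlonglongrightarrow> (t, x)" using a lima by (auto simp: tx)
  define T X where "T = (\<lambda>n. fst (u n))" and "X = (\<lambda>n. snd (u n))"
  have T: "T \<longlonglongrightarrow> t" and X: "X \<longlonglongrightarrow> x"
    using tendsto_fst[OF lim] tendsto_snd[OF lim] by (auto simp: T_def X_def)
  have Tpos: "T n > 0" for n using u by (auto simp: T_def mem_Times_iff)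
  have "(\<lambda>n. T n powr (- real DIM('a))) \<longlonglongrightarrow> t powr (- real DIM('a))"
    using T t by (auto intro!: tendsto_intros)
  then obtain M where M: "\<And>n. \<bar>T n powr (- real DIM('a))\<bar> \<le> M"
    by (metis convergentI convergent_imp_Bseq Bseq_def real_norm_def)
  obtain R1 where R1: "\<And>n. \<bar>T n\<bar> \<le> R1" using T
    by (metis convergentI convergent_imp_Bseq Bseq_def real_norm_def)
  obtain R2 where R2: "\<And>n. norm (X n) \<le> R2" using X
    by (metis convergentI convergent_imp_Bseq Bseq_def)
  have cont: "continuous_on UNIV \<psi>" by (rule C_class_continuous) (use psi in auto)
  have "(\<lambda>n. \<integral>z. dilate (T n) \<psi> (X n - z) *\<^sub>R f z \<partial>lebesgue) \<longlonglongrightarrow> (\<integral>z. dilate t \<psi> (x - z) *\<^sub>R f z \<partial>lebesgue)"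
  proof (rule integral_dominated_convergence)
    show "(\<lambda>z. dilate t \<psi> (x - z) *\<^sub>R f z) \<in> borel_measurable lebesgue"
      using conv_integrable[OF f psi] t by auto
    show "(\<lambda>z. dilate (T n) \<psi> (X n - z) *\<^sub>R f z) \<in> borel_measurable lebesgue" for n
      using conv_integrable[OF f psi Tpos] by auto
    have "(\<lambda>z::'a. 3 * M * indicator (ball 0 (R1 + R2 + 1)) z) \<in> borel_measurable borel"
      by (intro borel_measurable_times borel_measurable_indicator borel_measurable_const) auto
    then have bm: "(\<lambda>z::'a. 3 * M * indicator (ball 0 (R1 + R2 + 1)) z) \<in> borel_measurable lebesgue"
      by (simp add: measurable_completion)
    show "integrable lebesgue (\<lambda>z. norm ((3 * M * indicator (ball 0 (R1 + R2 + 1)) z) *\<^sub>R f z))"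
      by (intro integrable_norm locally_integrable_scaleR_integrable[OF f, where M="\<bar>3*M\<bar>" and x=0 and R="R1 + R2 + 1"])
        (use bm in simp, simp add: abs_mult)
    show "AE z in lebesgue. (\<lambda>n. dilate (T n) \<psi> (X n - z) *\<^sub>R f z) \<longlonglongrightarrow> dilate t \<psi> (x - z) *\<^sub>R f z"
    proof (rule AE_I2, rule tendsto_scaleR[OF _ tendsto_const])
      fix z
      have "(\<lambda>n. (X n - z) /\<^sub>R T n) \<longlonglongrightarrow> (x - z) /\<^sub>R t"
        using T X t by (auto intro!: tendsto_intros)
      then have "(\<lambda>n. \<psi> ((X n - z) /\<^sub>R T n)) \<longlonglongrightarrow> \<psi> ((x - z) /\<^sub>R t)"
        by (rule continuous_on_tendsto_compose[OF cont]) auto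
      then show "(\<lambda>n. dilate (T n) \<psi> (X n - z)) \<longlonglongrightarrow> dilate t \<psi> (x - z)"
        unfolding dilate_def using T t by (auto intro!: tendsto_intros)
    qed
    show "AE z in lebesgue. norm (dilate (T n) \<psi> (X n - z) *\<^sub>R f z) \<le> norm ((3 * M * indicator (ball 0 (R1 + R2 + 1)) z) *\<^sub>R f z)" for n
    proof (rule AE_I2)
      fix z
      have M0: "0 \<le> M" using M[of 0] abs_ge_zero order_trans by blast
      have "\<bar>dilate (T n) \<psi> (X n - z)\<bar> \<le> 3 * T n powr (- real DIM('a)) * indicator (cball 0 (T n)) (X n - z)"
        by (rule dilate_bound[OF psi Tpos])
      also have "\<dots> \<le> 3 * M * indicator (ball 0 (R1 + R2 + 1)) z"
      proof (cases "norm (X n - z) \<le> T n")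
        case True
        have "norm z \<le> norm (X n - z) + norm (X n)" using norm_triangle_ineq4[of "X n" "X n - z"] by simp
        also have "\<dots> \<le> R1 + R2" using True R1[of n] R2[of n] by linarith
        finally show ?thesis using True M[of n] by simp
      qed (use M0 in auto)
      finally have "\<bar>dilate (T n) \<psi> (X n - z)\<bar> \<le> \<bar>3 * M * indicator (ball 0 (R1 + R2 + 1)) z\<bar>" by linarith
      then show "norm (dilate (T n) \<psi> (X n - z) *\<^sub>R f z) \<le> norm ((3 * M * indicator (ball 0 (R1 + R2 + 1)) z) *\<^sub>R f z)"
        unfolding norm_scaleR real_norm_def by (rule mult_right_mono) simp
    qed
  qed
  then show "(\<lambda>n. case u n of (t, x) \<Rightarrow> conv f (dilate t \<psi>) x) \<longlonglongrightarrow> (case a of (t, x) \<Rightarrow> conv f (dilate t \<psi>) x)"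
    by (simp add: tx conv_def T_def X_def case_prod_beta)
qed

text \<open>A strict superlevel set of the supremum is a union of open sets, one for each index, so
  by Lindelof countably many indices already cover it. Doing this for the rational levels determines
  the supremum at every point.\<close>

lemma SUP_continuous_countable:
  fixes F :: "'i \<Rightarrow> 'c::second_countable_topology \<Rightarrow> real"
  assumes "open U" and "\<And>i. i \<in> I \<Longrightarrow> continuous_on U (F i)" and nz: "I \<noteq> {}"
    and nn: "\<And>i p. F i p \<ge> 0"
  obtains D where "countable D" "D \<subseteq> I" "D \<noteq> {}"
    "\<And>p. p \<in> U \<Longrightarrow> (SUP i\<in>I. ennreal (F i p)) = (SUP i\<in>D. ennreal (F i p))"
proof -
  define W where "W q i = {p\<in>U. F i p > q}" for q i
  have op: "open (W q i)" if "i \<in> I" for q i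
  proof -
    have "open (U \<inter> F i -` {q<..})"
      by (rule continuous_open_preimage[OF assms(2)[OF that] assms(1)]) simp
    moreover have "U \<inter> F i -` {q<..} = W q i" by (auto simp: W_def)
    ultimately show ?thesis by simp
  qed
  have "\<exists>J. countable J \<and> J \<subseteq> I \<and> (\<Union>i\<in>J. W q i) = (\<Union>i\<in>I. W q i)" for q
  proof -
    obtain F' where F': "F' \<subseteq> W q ` I" "countable F'" "\<Union>F' = \<Union>(W q ` I)"
      using Lindelof[of "W q ` I"] op by blast
    from F'(1,2) have "\<exists>J. countable J \<and> J \<subseteq> I \<and> F' = W q ` J"
      by (simp only: countable_subset_image[symmetric])
    then obtain J where "J \<subseteq> I" "countable J" "F' = W q ` J" by metis
    then show ?thesis using F'(3) by (intro exI[of _ J]) simp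
  qed
  then obtain J where J: "\<And>q. countable (J q)" "\<And>q. J q \<subseteq> I" "\<And>q. (\<Union>i\<in>J q. W q i) = (\<Union>i\<in>I. W q i)"
    by metis
  obtain i0 where i0: "i0 \<in> I" using nz by auto
  \<comment> \<open>The index \<open>i0\<close> makes \<open>D\<close> nonempty, so that it can
    later be listed by the natural numbers.\<close>
  define D where "D = insert i0 (\<Union>q\<in>\<rat>. J q)"
  have D: "countable D" "D \<subseteq> I" "D \<noteq> {}"
    using J i0 countable_rat by (auto simp: D_def)
  have "(SUP i\<in>I. ennreal (F i p)) = (SUP i\<in>D. ennreal (F i p))" if p: "p \<in> U" for p
  proof (rule antisym)
    show "(SUP i\<in>D. ennreal (F i p)) \<le> (SUP i\<in>I. ennreal (F i p))"
      using D(2) by (rule SUP_subset_mono) auto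
    show "(SUP i\<in>I. ennreal (F i p)) \<le> (SUP i\<in>D. ennreal (F i p))"
    proof (rule SUP_least, rule ccontr)
      fix i assume i: "i \<in> I" and "\<not> ennreal (F i p) \<le> (SUP i\<in>D. ennreal (F i p))"
      then have lt: "(SUP i\<in>D. ennreal (F i p)) < ennreal (F i p)" by simp
      then obtain c where c: "(SUP i\<in>D. ennreal (F i p)) = ennreal c" "0 \<le> c" "c < F i p"
        by (cases "SUP i\<in>D. ennreal (F i p)") (auto simp: ennreal_less_iff)
      then obtain q where q: "q \<in> \<rat>" "c < q" "q < F i p" using Rats_dense_in_real by blast
      then have "p \<in> W q i" using p by (simp add: W_def)
      then obtain j where "j \<in> J q" "p \<in> W q j" using i J(3)[of q] by blast
      then have "j \<in> D" "F j p > q" using q by (auto simp: D_def W_def)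
      then have "ennreal (F j p) \<le> ennreal c" unfolding c(1)[symmetric] by (intro SUP_upper)
      then show False using \<open>F j p > q\<close> q c by (auto simp: ennreal_le_iff)
    qed
  qed
  then show thesis using D that by blast
qed

lemma A_sup_countable:
  fixes f :: "'a::euclidean_space \<Rightarrow> 'b::{banach, second_countable_topology}"
  assumes f: "locally_integrable f" and a: "0 < \<alpha>" "\<alpha> \<le> 1"
  obtains \<psi> where "\<And>i::nat. \<psi> i \<in> C_class \<alpha>"
    "\<And>t x. t > 0 \<Longrightarrow> A_sup \<alpha> f t x = (SUP i. ennreal (norm (conv f (dilate t (\<psi> i)) x)))"
proof -
  obtain D :: "('a \<Rightarrow> real) set" where D: "countable D" "D \<subseteq> C_class \<alpha>" "D \<noteq> {}"
    "\<And>p. p \<in> {0<..} \<times> UNIV \<Longrightarrow> (SUP \<psi>\<in>C_class \<alpha>. ennreal (norm (conv f (dilate (fst p) \<psi>) (snd p))))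
       = (SUP \<psi>\<in>D. ennreal (norm (conv f (dilate (fst p) \<psi>) (snd p))))"
  proof (rule SUP_continuous_countable[of "{0<..} \<times> UNIV" "C_class \<alpha>" "\<lambda>\<psi> p. norm (conv f (dilate (fst p) \<psi>) (snd p))"])
    show "open ({0<..} \<times> UNIV :: (real \<times> 'a) set)" by (intro open_Times) auto
    show "continuous_on ({0<..} \<times> UNIV) (\<lambda>p. norm (conv f (dilate (fst p) \<psi>) (snd p)))" if "\<psi> \<in> C_class \<alpha>" for \<psi>
      using conv_continuous[OF f that a] by (intro continuous_on_norm) (simp add: case_prod_beta)
    show "C_class \<alpha> \<noteq> {}" using zero_in_C_class by auto
  qed (auto)
  obtain \<psi> :: "nat \<Rightarrow> 'a \<Rightarrow> real" where psi: "range \<psi> = D" using D(1,3) by (metis range_from_nat_into)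
  show thesis
  proof
    show "\<psi> i \<in> C_class \<alpha>" for i using psi D(2) by auto
    show "A_sup \<alpha> f t x = (SUP i. ennreal (norm (conv f (dilate t (\<psi> i)) x)))" if "t > 0" for t x
      using D(4)[of "(t, x)"] that unfolding A_sup_def by (simp add: psi[symmetric] image_image)
  qed
qed

text \<open>The convolutions are continuous only for positive scales; the indicator cuts off the
  others.\<close>

lemma A_sup_measurable:
  fixes f :: "'a::euclidean_space \<Rightarrow> 'b::{banach, second_countable_topology}"
  assumes f: "locally_integrable f" and a: "0 < \<alpha>" "\<alpha> \<le> 1"
  shows "(\<lambda>(t, x). A_sup \<alpha> f t x * indicator {0<..} t) \<in> borel_measurable (borel \<Otimes>\<^sub>M borel)"
proof -
  obtain \<psi> where psi: "\<And>i::nat. \<psi> i \<in> C_class \<alpha>"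
    "\<And>t x. t > 0 \<Longrightarrow> A_sup \<alpha> f t x = (SUP i. ennreal (norm (conv f (dilate t (\<psi> i)) x)))"
    using A_sup_countable[OF assms] by blast
  have m: "(\<lambda>p. indicator ({0<..} \<times> UNIV) p *\<^sub>R (case p of (t, x) \<Rightarrow> norm (conv f (dilate t (\<psi> i)) x))) \<in> borel_measurable borel" for i
  proof (rule borel_measurable_continuous_on_indicator)
    show "continuous_on ({0<..} \<times> UNIV) (\<lambda>(t, x). norm (conv f (dilate t (\<psi> i)) x))"
      using continuous_on_norm[OF conv_continuous[OF f psi(1) a]] by (simp add: case_prod_beta)
    show "{0<..} \<times> UNIV \<in> sets (borel :: (real \<times> 'a) measure)"
      by (intro borel_open open_Times) auto
  qed
  have "(\<lambda>p. SUP i. ennreal (indicator ({0<..} \<times> UNIV) p *\<^sub>R (case p of (t, x) \<Rightarrow> norm (conv f (dilate t (\<psi> i)) x)))) \<in> borel_measurable borel"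
    using m by measurable
  also have "(\<lambda>p. SUP i. ennreal (indicator ({0<..} \<times> UNIV) p *\<^sub>R (case p of (t, x) \<Rightarrow> norm (conv f (dilate t (\<psi> i)) x))))
     = (\<lambda>(t, x). A_sup \<alpha> f t x * indicator {0<..} t)"
    by (auto simp: fun_eq_iff psi(2) indicator_def)
  finally show ?thesis by (simp add: borel_prod)
qed

subsection \<open>The quadratic estimate\<close>

text \<open>One constant serves both as a bound and as a radius of the support. The class is stable
  under multiplication by bounded Borel functions and under integration in one of two variables, and
  its members are integrable, so every application of Fubini in the quadratic estimate is
  automatic.\<close>

definition bounded_support :: "('a::euclidean_space \<Rightarrow> real) \<Rightarrow> bool" where
  "bounded_support f \<longleftrightarrow> f \<in> borel_measurable borel \<and> (\<exists>M. \<forall>x. \<bar>f x\<bar> \<le> M * indicator (cball 0 M) x)"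

lemma bounded_supportI:
  assumes "f \<in> borel_measurable borel" "\<And>x. \<bar>f x\<bar> \<le> M" "\<And>x. norm x > M \<Longrightarrow> f x = 0"
  shows "bounded_support f"
  unfolding bounded_support_def
proof (intro conjI exI[of _ M] allI)
  fix x show "\<bar>f x\<bar> \<le> M * indicator (cball 0 M) x"
    using assms(2)[of x] assms(3)[of x] by (cases "norm x \<le> M") (auto simp: indicator_def)
qed fact

lemma bounded_supportE:
  assumes "bounded_support f"
  obtains M where "f \<in> borel_measurable borel" "M > 0" "\<And>x. \<bar>f x\<bar> \<le> M" "\<And>x. norm x > M \<Longrightarrow> f x = 0"
proof -
  obtain M where M: "f \<in> borel_measurable borel" "\<And>x. \<bar>f x\<bar> \<le> M * indicator (cball 0 M) x"
    using assms unfolding bounded_support_def by blast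
  have "\<bar>f x\<bar> \<le> M * indicator (cball 0 M) x" for x by (rule M)
  then have "\<bar>f x\<bar> \<le> max M 1" "norm x > max M 1 \<Longrightarrow> f x = 0" for x
    by (smt (verit, best) indicator_simps max_def mem_cball_0 mult_cancel_left1 mult_cancel_right1 mult_not_zero)+
  then show thesis using M(1) by (intro that[of "max M 1"]) auto
qed

lemma bounded_support_integrable:
  assumes "bounded_support f"
  shows "integrable lborel f"
proof -
  obtain M where M: "f \<in> borel_measurable borel" "M > 0" "\<And>x. \<bar>f x\<bar> \<le> M" "\<And>x. norm x > M \<Longrightarrow> f x = 0"
    using bounded_supportE[OF assms] by blast
  show ?thesis
  proof (rule Bochner_Integration.integrable_bound)
    show "integrable lborel (\<lambda>x. M * indicator (cball 0 M) x)"
      by (intro integrable_mult_right integrable_real_indicator) (auto simp: emeasure_cball_eq M(2) less_imp_le)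
    show "AE x in lborel. norm (f x) \<le> norm (M * indicator (cball 0 M) x)"
    proof (rule AE_I2)
      fix x show "norm (f x) \<le> norm (M * indicator (cball 0 M) x)"
        using M(2) M(3)[of x] M(4)[of x] by (cases "norm x \<le> M") (auto simp: indicator_def)
    qed
  qed (use M in auto)
qed

lemma bounded_support_pair:
  fixes h :: "'e::euclidean_space \<Rightarrow> 'a::euclidean_space \<Rightarrow> real"
  assumes "case_prod h \<in> borel_measurable (borel \<Otimes>\<^sub>M borel)" "\<And>e z. \<bar>h e z\<bar> \<le> M"
    "\<And>e z. norm e > M \<Longrightarrow> h e z = 0" "\<And>e z. norm z > M \<Longrightarrow> h e z = 0"
  shows "bounded_support (case_prod h)"
proof (rule bounded_supportI)
  show "case_prod h \<in> borel_measurable borel" using assms(1) by (simp add: borel_prod)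
  have M0: "M \<ge> 0" using assms(2)[of 0 0] by simp
  show "\<bar>case_prod h p\<bar> \<le> 2 * M" for p using assms(2)[of "fst p" "snd p"] M0 by (simp add: case_prod_beta)
  fix p :: "'e \<times> 'a" assume p: "2 * M < norm p"
  have "norm p \<le> norm (fst p) + norm (snd p)" by (metis norm_Pair_le prod.collapse)
  then have "norm (fst p) > M \<or> norm (snd p) > M" using p by linarith
  then show "case_prod h p = 0" using assms(3)[of "fst p" "snd p"] assms(4)[of "snd p" "fst p"] by (auto simp: case_prod_beta)
qed

lemma bounded_support_mult:
  assumes "bounded_support f" "g \<in> borel_measurable borel" "\<And>x. \<bar>g x\<bar> \<le> B"
  shows "bounded_support (\<lambda>x. f x * g x)"
proof -
  obtain M where M: "f \<in> borel_measurable borel" "M > 0" "\<And>x. \<bar>f x\<bar> \<le> M" "\<And>x. norm x > M \<Longrightarrow> f x = 0"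
    using bounded_supportE[OF assms(1)] by blast
  have B: "B \<ge> 0" using assms(3)[of undefined] by simp
  show ?thesis
  proof (rule bounded_supportI[of _ "M * B + M"])
    show "(\<lambda>x. f x * g x) \<in> borel_measurable borel" using M(1) assms(2) by measurable
    show "\<bar>f x * g x\<bar> \<le> M * B + M" for x
      using mult_mono[OF M(3)[of x] assms(3)[of x]] M(2) by (simp add: abs_mult)
    show "f x * g x = 0" if "M * B + M < norm x" for x
      using that M(2) M(4)[of x] B by (smt (verit) mult_nonneg_nonneg mult_eq_0_iff)
  qed
qed

lemma bounded_support_bound:
  assumes "bounded_support f"
  obtains B where "\<And>x. \<bar>f x\<bar> \<le> B"
  using bounded_supportE[OF assms] by metis

lemma bounded_support_integral:
  fixes h :: "'e::euclidean_space \<Rightarrow> 'a::euclidean_space \<Rightarrow> real"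
  assumes "bounded_support (case_prod h)"
  shows "bounded_support (\<lambda>e. \<integral>z. h e z \<partial>lborel)" "bounded_support (\<lambda>z. \<integral>e. h e z \<partial>lborel)"
    "(\<integral>e. (\<integral>z. h e z \<partial>lborel) \<partial>lborel) = (\<integral>z. (\<integral>e. h e z \<partial>lborel) \<partial>lborel)"
proof -
  obtain M where M: "case_prod h \<in> borel_measurable borel" "M > 0" "\<And>e z. \<bar>h e z\<bar> \<le> M" "\<And>e z. norm (e, z) > M \<Longrightarrow> h e z = 0"
    using bounded_supportE[OF assms] by (metis case_prod_conv)
  have hm[measurable]: "case_prod h \<in> borel_measurable (borel \<Otimes>\<^sub>M borel)" using M(1) by (simp add: borel_prod)
  have z1: "h e z = 0" if "norm e > M" for e z using M(4)[of e z] that norm_fst_le[of e z] by simp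
  have z2: "h e z = 0" if "norm z > M" for e z using M(4)[of e z] that norm_snd_le[of z e] by simp
  define V1 where "V1 = measure lborel (cball (0::'a) M)"
  define V2 where "V2 = measure lborel (cball (0::'e) M)"
  have V: "V1 \<ge> 0" "V2 \<ge> 0" by (auto simp: V1_def V2_def)
  have b1: "\<bar>\<integral>z. h e z \<partial>lborel\<bar> \<le> M * V1" for e
  proof -
    have "\<bar>\<integral>z. h e z \<partial>lborel\<bar> \<le> (\<integral>z. M * indicator (cball (0::'a) M) z \<partial>lborel)"
    proof (rule Bochner_Integration.integral_abs_bound_integral)
      show "integrable lborel (h e)"
        by (rule bounded_support_integrable, rule bounded_supportI[of _ M]) (use M z2 in auto)
      show "\<bar>h e z\<bar> \<le> M * indicator (cball 0 M) z" for z
        using M(3)[of e z] z2[of z e] by (cases "norm z \<le> M") (auto simp: indicator_def)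
      show "integrable lborel (\<lambda>z. M * indicator (cball (0::'a) M) z)"
        by (intro integrable_mult_right integrable_real_indicator) (auto simp: emeasure_cball_eq M(2) less_imp_le)
    qed
    then show ?thesis by (simp add: V1_def)
  qed
  have b2: "\<bar>\<integral>e. h e z \<partial>lborel\<bar> \<le> M * V2" for z
  proof -
    have "\<bar>\<integral>e. h e z \<partial>lborel\<bar> \<le> (\<integral>e. M * indicator (cball (0::'e) M) e \<partial>lborel)"
    proof (rule Bochner_Integration.integral_abs_bound_integral)
      show "integrable lborel (\<lambda>e. h e z)"
        by (rule bounded_support_integrable, rule bounded_supportI[of _ M]) (use M z1 in auto)
      show "\<bar>h e z\<bar> \<le> M * indicator (cball 0 M) e" for e
        using M(3)[of e z] z1[of e z] by (cases "norm e \<le> M") (auto simp: indicator_def)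
      show "integrable lborel (\<lambda>e. M * indicator (cball (0::'e) M) e)"
        by (intro integrable_mult_right integrable_real_indicator) (auto simp: emeasure_cball_eq M(2) less_imp_le)
    qed
    then show ?thesis by (simp add: V2_def)
  qed
  show "bounded_support (\<lambda>e. \<integral>z. h e z \<partial>lborel)"
  proof (rule bounded_supportI[of _ "M * V1 + M"])
    show "\<bar>\<integral>z. h e z \<partial>lborel\<bar> \<le> M * V1 + M" for e using b1[of e] M(2) by simp
    show "(\<integral>z. h e z \<partial>lborel) = 0" if "M * V1 + M < norm e" for e
    proof -
      have "norm e > M" using that V(1) M(2) by (smt (verit) mult_nonneg_nonneg)
      then show ?thesis by (simp add: z1)
    qed
  qed measurable
  show "bounded_support (\<lambda>z. \<integral>e. h e z \<partial>lborel)"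
  proof (rule bounded_supportI[of _ "M * V2 + M"])
    show "\<bar>\<integral>e. h e z \<partial>lborel\<bar> \<le> M * V2 + M" for z using b2[of z] M(2) by simp
    show "(\<integral>e. h e z \<partial>lborel) = 0" if "M * V2 + M < norm z" for z
    proof -
      have "norm z > M" using that V(2) M(2) by (smt (verit) mult_nonneg_nonneg)
      then show ?thesis by (simp add: z2)
    qed
  qed measurable
  show "(\<integral>e. (\<integral>z. h e z \<partial>lborel) \<partial>lborel) = (\<integral>z. (\<integral>e. h e z \<partial>lborel) \<partial>lborel)"
    using lborel_pair.Fubini_integral[of h] bounded_support_integrable[OF assms]
    by (simp add: lborel_prod)
qed

lemma bounded_support_kernel_mult:
  fixes h :: "'e::euclidean_space \<Rightarrow> 'a::euclidean_space \<Rightarrow> real"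
  assumes "bounded_support (case_prod h)" "a \<in> borel_measurable borel" "\<And>e. \<bar>a e\<bar> \<le> A"
   "b \<in> borel_measurable borel" "\<And>z. \<bar>b z\<bar> \<le> B"
  shows "bounded_support (\<lambda>(e, z). h e z * (a e * b z))"
proof -
  have "bounded_support (\<lambda>p. case_prod h p * (a (fst p) * b (snd p)))"
  proof (rule bounded_support_mult[OF assms(1), where B="A * B"])
    have "(\<lambda>p. a (fst p) * b (snd p)) \<in> borel_measurable (borel \<Otimes>\<^sub>M borel)"
      using assms(2,4) by measurable
    then show "(\<lambda>p. a (fst p) * b (snd p)) \<in> borel_measurable borel" by (simp add: borel_prod)
    show "\<bar>a (fst p) * b (snd p)\<bar> \<le> A * B" for p
      unfolding abs_mult by (intro mult_mono assms) (use assms(3)[of undefined] in auto)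
  qed
  then show ?thesis by (simp add: case_prod_beta')
qed

text \<open>
  The \<open>T T\<^sup>*\<close> argument: expanding \<open>0 \<le> \<integral> (f - C\<^sup>-\<^sup>1 T\<^sup>*(T f))\<^sup>2\<close> and applying Schur's test to
  \<open>T T\<^sup>*\<close> avoids any duality between \<open>L\<^sup>2\<close> spaces.
\<close>

lemma schur_square_bound:
  fixes k :: "'e::euclidean_space \<Rightarrow> 'a::euclidean_space \<Rightarrow> real"
  assumes k: "bounded_support (case_prod k)"
    and w: "w \<in> borel_measurable borel" "\<And>e. 0 \<le> w e" "\<And>e. w e \<le> W"
    and C: "C > 0"
    and schur: "\<And>e. (\<integral>\<^sup>+e'. ennreal (w e' * \<bar>\<integral>z. k e z * k e' z \<partial>lborel\<bar>) \<partial>lborel) \<le> ennreal C"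
    and f: "bounded_support f"
  shows "(\<integral>\<^sup>+e. ennreal (w e * (\<integral>z. k e z * f z \<partial>lborel)\<^sup>2) \<partial>lborel) \<le> ennreal C * (\<integral>\<^sup>+z. ennreal ((f z)\<^sup>2) \<partial>lborel)"
proof -
  \<comment> \<open>\<open>F\<close> is the operator with kernel \<open>k\<close> applied to
    \<open>f\<close>, \<open>T\<close> is its adjoint with respect to the measure w(e) de applied to
    \<open>F\<close>, and \<open>K\<close> is the kernel of operator times adjoint.\<close>
  define F where "F = (\<lambda>e. \<integral>z. k e z * f z \<partial>lborel)"
  define T where "T = (\<lambda>z. \<integral>e. k e z * (w e * F e) \<partial>lborel)"
  define K where "K = (\<lambda>e e'. \<integral>z. k e z * k e' z \<partial>lborel)"
  obtain Bf where Bf: "\<And>x. \<bar>f x\<bar> \<le> Bf" using bounded_support_bound[OF f] by blast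
  obtain Bk where Bk: "\<And>e z. \<bar>k e z\<bar> \<le> Bk" using bounded_support_bound[OF k] by (metis case_prod_conv)
  have fm[measurable]: "f \<in> borel_measurable borel" using f by (simp add: bounded_support_def)
  have km[measurable]: "case_prod k \<in> borel_measurable (borel \<Otimes>\<^sub>M borel)"
    using k by (simp add: bounded_support_def borel_prod)
  note w(1)[measurable]
  have kf: "bounded_support (\<lambda>(e, z). k e z * f z)"
    using bounded_support_kernel_mult[OF k, of "\<lambda>_. 1" 1 f Bf] Bf by auto
  have F: "bounded_support F" unfolding F_def by (rule bounded_support_integral(1)[OF kf])
  then have Fm[measurable]: "F \<in> borel_measurable borel" by (simp add: bounded_support_def)
  have wF: "bounded_support (\<lambda>e. w e * F e)"
    using bounded_support_mult[OF F w(1), of W] w(2,3) by (simp add: mult.commute)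
  obtain Bw where Bw: "\<And>e. \<bar>w e * F e\<bar> \<le> Bw" using bounded_support_bound[OF wF] by blast
  have kwF: "bounded_support (\<lambda>(e, z). k e z * (w e * F e))"
    using bounded_support_kernel_mult[OF k, of "\<lambda>e. w e * F e" Bw "\<lambda>_. 1" 1] Bw by auto
  have T: "bounded_support T" unfolding T_def by (rule bounded_support_integral(2)[OF kwF])
  then have Tm[measurable]: "T \<in> borel_measurable borel" by (simp add: bounded_support_def)
  obtain BT where BT: "\<And>z. \<bar>T z\<bar> \<le> BT" using bounded_support_bound[OF T] by blast
  obtain BF where BF: "\<And>z. \<bar>F z\<bar> \<le> BF" using bounded_support_bound[OF F] by blast
  have Km[measurable]: "(\<lambda>(e, e'). K e e') \<in> borel_measurable (borel \<Otimes>\<^sub>M borel)"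
    unfolding K_def by measurable
  define X where "X = (\<integral>e. w e * (F e)\<^sup>2 \<partial>lborel)"
  have iX: "integrable lborel (\<lambda>e. w e * (F e)\<^sup>2)"
    using bounded_support_integrable[OF bounded_support_mult[OF wF Fm BF]] by (simp add: power2_eq_square mult.assoc)
  have iff: "integrable lborel (\<lambda>z. (f z)\<^sup>2)"
    using bounded_support_integrable[OF bounded_support_mult[OF f fm Bf]] by (simp add: power2_eq_square)
  have ifT: "integrable lborel (\<lambda>z. f z * T z)"
    using bounded_support_integrable[OF bounded_support_mult[OF f Tm BT]] .
  have iTT: "integrable lborel (\<lambda>z. (T z)\<^sup>2)"
    using bounded_support_integrable[OF bounded_support_mult[OF T Tm BT]] by (simp add: power2_eq_square)
  \<comment> \<open>Adjointness: pairing \<open>f\<close> with \<open>T\<close> gives the weighted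
    square norm of \<open>F\<close>.\<close>
  have fT: "(\<integral>z. f z * T z \<partial>lborel) = X"
  proof -
    have b: "bounded_support (\<lambda>(e, z). k e z * ((w e * F e) * f z))"
      by (rule bounded_support_kernel_mult[OF k _ Bw _ Bf]) auto
    have "(\<integral>z. f z * T z \<partial>lborel) = (\<integral>z. (\<integral>e. k e z * ((w e * F e) * f z) \<partial>lborel) \<partial>lborel)"
      unfolding T_def by (subst integral_mult_right_zero[symmetric]) (simp add: mult_ac)
    also have "\<dots> = (\<integral>e. (\<integral>z. k e z * ((w e * F e) * f z) \<partial>lborel) \<partial>lborel)"
      by (rule bounded_support_integral(3)[OF b, symmetric])
    also have "\<dots> = (\<integral>e. (w e * F e) * F e \<partial>lborel)"
    proof (rule Bochner_Integration.integral_cong[OF refl])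
      fix e
      have "(\<integral>z. k e z * ((w e * F e) * f z) \<partial>lborel) = (\<integral>z. (w e * F e) * (k e z * f z) \<partial>lborel)"
        by (simp add: mult_ac)
      also have "\<dots> = w e * F e * F e"
        unfolding integral_mult_right_zero by (simp add: F_def)
      finally show "(\<integral>z. k e z * ((w e * F e) * f z) \<partial>lborel) = w e * F e * F e" .
    qed
    finally show ?thesis by (simp add: X_def power2_eq_square mult.assoc)
  qed
  have TT: "ennreal (\<integral>z. (T z)\<^sup>2 \<partial>lborel) \<le> ennreal (C * X)"
  proof -
    have b: "bounded_support (\<lambda>(e, z). k e z * ((w e * F e) * T z))"
      by (rule bounded_support_kernel_mult[OF k _ Bw _ BT]) auto
    have b2: "bounded_support (\<lambda>(e', z). k e' z * ((w e' * F e') * k e z))" for e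
      by (rule bounded_support_kernel_mult[OF k _ Bw _ Bk[of e]]) auto
    have kT: "(\<integral>z. k e z * T z \<partial>lborel) = (\<integral>e'. w e' * F e' * K e e' \<partial>lborel)" for e
    proof -
      have "(\<integral>z. k e z * T z \<partial>lborel) = (\<integral>z. (\<integral>e'. k e' z * ((w e' * F e') * k e z) \<partial>lborel) \<partial>lborel)"
        unfolding T_def by (subst integral_mult_right_zero[symmetric]) (simp add: mult_ac)
      also have "\<dots> = (\<integral>e'. (\<integral>z. k e' z * ((w e' * F e') * k e z) \<partial>lborel) \<partial>lborel)"
        by (rule bounded_support_integral(3)[OF b2, symmetric])
      also have "\<dots> = (\<integral>e'. w e' * F e' * K e e' \<partial>lborel)"
        unfolding K_def by (subst integral_mult_right_zero[symmetric]) (simp add: mult_ac)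
      finally show ?thesis .
    qed
    have bT: "(\<integral>z. k e z * ((w e * F e) * T z) \<partial>lborel) = w e * F e * (\<integral>e'. w e' * F e' * K e e' \<partial>lborel)" for e
      unfolding kT[symmetric] by (subst integral_mult_right_zero[symmetric]) (simp add: mult_ac)
    have "(\<integral>z. (T z)\<^sup>2 \<partial>lborel) = (\<integral>z. (\<integral>e. k e z * ((w e * F e) * T z) \<partial>lborel) \<partial>lborel)"
      unfolding power2_eq_square by (subst (2) T_def, subst integral_mult_right_zero[symmetric]) (simp add: mult_ac)
    also have "\<dots> = (\<integral>e. (\<integral>z. k e z * ((w e * F e) * T z) \<partial>lborel) \<partial>lborel)"
      by (rule bounded_support_integral(3)[OF b, symmetric])
    also have "\<dots> = (\<integral>e. w e * F e * (\<integral>e'. w e' * F e' * K e e' \<partial>lborel) \<partial>lborel)"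
      by (simp only: bT)
    finally have "ennreal (\<integral>z. (T z)\<^sup>2 \<partial>lborel) \<le> ennreal (norm (\<integral>e. w e * F e * (\<integral>e'. w e' * F e' * K e e' \<partial>lborel) \<partial>lborel))"
      by (simp add: ennreal_leI)
    also have "\<dots> \<le> (\<integral>\<^sup>+e. ennreal (norm (w e * F e * (\<integral>e'. w e' * F e' * K e e' \<partial>lborel))) \<partial>lborel)"
      by (rule integral_norm_bound_ennreal) (use bounded_support_integrable[OF bounded_support_integral(1)[OF b]] in \<open>simp only: bT\<close>)
    also have "\<dots> \<le> (\<integral>\<^sup>+e. (\<integral>\<^sup>+e'. ennreal (w e * \<bar>F e\<bar>) * ennreal (w e' * \<bar>F e'\<bar> * \<bar>K e e'\<bar>) \<partial>lborel) \<partial>lborel)"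
    proof (rule nn_integral_mono)
      fix e
      have "ennreal (norm (\<integral>e'. w e' * F e' * K e e' \<partial>lborel)) \<le> (\<integral>\<^sup>+e'. ennreal (norm (w e' * F e' * K e e')) \<partial>lborel)"
        by (cases "integrable lborel (\<lambda>e'. w e' * F e' * K e e')")
          (use integral_norm_bound_ennreal[of lborel "\<lambda>e'. w e' * F e' * K e e'"] in \<open>auto simp: not_integrable_integral_eq\<close>)
      then have "ennreal (w e * \<bar>F e\<bar>) * ennreal (norm (\<integral>e'. w e' * F e' * K e e' \<partial>lborel)) \<le> ennreal (w e * \<bar>F e\<bar>) * (\<integral>\<^sup>+e'. ennreal (norm (w e' * F e' * K e e')) \<partial>lborel)"
        by (rule mult_left_mono) simp
      also have "\<dots> = (\<integral>\<^sup>+e'. ennreal (w e * \<bar>F e\<bar>) * ennreal (w e' * \<bar>F e'\<bar> * \<bar>K e e'\<bar>) \<partial>lborel)"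
        by (subst nn_integral_cmult[symmetric]) (auto simp: abs_mult w(2))
      finally show "ennreal (norm (w e * F e * (\<integral>e'. w e' * F e' * K e e' \<partial>lborel)))
        \<le> (\<integral>\<^sup>+e'. ennreal (w e * \<bar>F e\<bar>) * ennreal (w e' * \<bar>F e'\<bar> * \<bar>K e e'\<bar>) \<partial>lborel)"
        by (simp add: abs_mult w(2) ennreal_mult flip: mult.assoc)
    qed
    \<comment> \<open>Schur's test: |F e| |F e'| is at most half the sum of the squares. Since
      \<open>K\<close> is symmetric, the two resulting double integrals coincide, and the row bound
      \<open>schur\<close> applies to each.\<close>
    also have "\<dots> \<le> (\<integral>\<^sup>+e. (\<integral>\<^sup>+e'. ennreal (w e * (F e)\<^sup>2 / 2) * ennreal (w e' * \<bar>K e e'\<bar>) + ennreal (w e' * (F e')\<^sup>2 / 2) * ennreal (w e * \<bar>K e e'\<bar>) \<partial>lborel) \<partial>lborel)"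
    proof (intro nn_integral_mono)
      fix e e'
      have "w e * \<bar>F e\<bar> * (w e' * \<bar>F e'\<bar> * \<bar>K e e'\<bar>) = w e * w e' * \<bar>K e e'\<bar> * (\<bar>F e\<bar> * \<bar>F e'\<bar>)" by (simp add: mult_ac)
      also have "\<dots> \<le> w e * w e' * \<bar>K e e'\<bar> * (((F e)\<^sup>2 + (F e')\<^sup>2) / 2)"
        using sum_squares_bound[of "\<bar>F e\<bar>" "\<bar>F e'\<bar>"] by (intro mult_left_mono) (auto simp: w(2))
      also have "\<dots> = w e * (F e)\<^sup>2 / 2 * (w e' * \<bar>K e e'\<bar>) + w e' * (F e')\<^sup>2 / 2 * (w e * \<bar>K e e'\<bar>)"
        by (simp add: field_simps)
      finally show "ennreal (w e * \<bar>F e\<bar>) * ennreal (w e' * \<bar>F e'\<bar> * \<bar>K e e'\<bar>) \<le> ennreal (w e * (F e)\<^sup>2 / 2) * ennreal (w e' * \<bar>K e e'\<bar>) + ennreal (w e' * (F e')\<^sup>2 / 2) * ennreal (w e * \<bar>K e e'\<bar>)"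
        by (simp add: w(2) flip: ennreal_mult ennreal_plus)
    qed
    also have "\<dots> = (\<integral>\<^sup>+e. (\<integral>\<^sup>+e'. ennreal (w e * (F e)\<^sup>2 / 2) * ennreal (w e' * \<bar>K e e'\<bar>) \<partial>lborel) \<partial>lborel) + (\<integral>\<^sup>+e. (\<integral>\<^sup>+e'. ennreal (w e' * (F e')\<^sup>2 / 2) * ennreal (w e * \<bar>K e e'\<bar>) \<partial>lborel) \<partial>lborel)"
      by (simp add: nn_integral_add)
    also have "(\<integral>\<^sup>+e. (\<integral>\<^sup>+e'. ennreal (w e' * (F e')\<^sup>2 / 2) * ennreal (w e * \<bar>K e e'\<bar>) \<partial>lborel) \<partial>lborel)
      = (\<integral>\<^sup>+e'. (\<integral>\<^sup>+e. ennreal (w e' * (F e')\<^sup>2 / 2) * ennreal (w e * \<bar>K e e'\<bar>) \<partial>lborel) \<partial>lborel)"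
      by (rule lborel_pair.Fubini'[symmetric]) measurable
    also have "\<dots> = (\<integral>\<^sup>+e. (\<integral>\<^sup>+e'. ennreal (w e * (F e)\<^sup>2 / 2) * ennreal (w e' * \<bar>K e e'\<bar>) \<partial>lborel) \<partial>lborel)"
      unfolding K_def by (simp add: mult.commute)
    also have "(\<integral>\<^sup>+e. (\<integral>\<^sup>+e'. ennreal (w e * (F e)\<^sup>2 / 2) * ennreal (w e' * \<bar>K e e'\<bar>) \<partial>lborel) \<partial>lborel)
      \<le> (\<integral>\<^sup>+e. ennreal (w e * (F e)\<^sup>2 / 2) * ennreal C \<partial>lborel)" (is "?L \<le> _")
    proof (rule nn_integral_mono)
      fix e
      have "(\<integral>\<^sup>+e'. ennreal (w e * (F e)\<^sup>2 / 2) * ennreal (w e' * \<bar>K e e'\<bar>) \<partial>lborel) = ennreal (w e * (F e)\<^sup>2 / 2) * (\<integral>\<^sup>+e'. ennreal (w e' * \<bar>K e e'\<bar>) \<partial>lborel)"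
        by (rule nn_integral_cmult) measurable
      also have "\<dots> \<le> ennreal (w e * (F e)\<^sup>2 / 2) * ennreal C"
        using schur[of e] unfolding K_def by (rule mult_left_mono) simp
      finally show "(\<integral>\<^sup>+e'. ennreal (w e * (F e)\<^sup>2 / 2) * ennreal (w e' * \<bar>K e e'\<bar>) \<partial>lborel) \<le> \<dots>" .
    qed
    also have "(\<integral>\<^sup>+e. ennreal (w e * (F e)\<^sup>2 / 2) * ennreal C \<partial>lborel) = ennreal (X / 2) * ennreal C"
    proof -
      have "(\<integral>\<^sup>+e. ennreal (w e * (F e)\<^sup>2 / 2) \<partial>lborel) = ennreal (\<integral>e. w e * (F e)\<^sup>2 / 2 \<partial>lborel)"
        by (rule nn_integral_eq_integral) (use iX w(2) in auto)
      then show ?thesis by (subst nn_integral_multc) (auto simp: X_def)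
    qed
    also have "ennreal (X / 2) * ennreal C + ennreal (X / 2) * ennreal C = ennreal (C * X)"
      using C by (simp add: X_def w(2) mult.commute flip: ennreal_mult ennreal_plus)
    finally show ?thesis by (simp add: add_mono)
  qed
  have X0: "X \<ge> 0" unfolding X_def by (intro integral_nonneg_AE) (simp add: w(2))
  have TT': "(\<integral>z. (T z)\<^sup>2 \<partial>lborel) \<le> C * X" using TT C X0 by (simp add: ennreal_le_iff)
  \<comment> \<open>Among the multiples of \<open>T\<close> that could be subtracted, 1 / C is the
    one for which |f|^2 - 2 s X + s^2 C X is smallest.\<close>
  have "0 \<le> (\<integral>z. (f z - T z / C)\<^sup>2 \<partial>lborel)" by (intro integral_nonneg_AE) simp
  also have "(\<lambda>z. (f z - T z / C)\<^sup>2) = (\<lambda>z. (f z)\<^sup>2 - 2 / C * (f z * T z) + 1 / C\<^sup>2 * (T z)\<^sup>2)"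
    using C by (simp add: fun_eq_iff power2_diff field_simps power2_eq_square)
  also have "(\<integral>z. (f z)\<^sup>2 - 2 / C * (f z * T z) + 1 / C\<^sup>2 * (T z)\<^sup>2 \<partial>lborel) =
     (\<integral>z. (f z)\<^sup>2 \<partial>lborel) - 2 / C * X + 1 / C\<^sup>2 * (\<integral>z. (T z)\<^sup>2 \<partial>lborel)"
    using iff ifT iTT by (simp add: fT)
  also have "\<dots> \<le> (\<integral>z. (f z)\<^sup>2 \<partial>lborel) - 2 / C * X + 1 / C\<^sup>2 * (C * X)"
    using TT' C by (intro add_left_mono mult_left_mono) auto
  also have "\<dots> = (\<integral>z. (f z)\<^sup>2 \<partial>lborel) - X / C" using C by (simp add: power2_eq_square field_simps)
  finally have "X \<le> C * (\<integral>z. (f z)\<^sup>2 \<partial>lborel)" using C by (simp add: field_simps)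
  then have "ennreal X \<le> ennreal C * ennreal (\<integral>z. (f z)\<^sup>2 \<partial>lborel)"
    using C by (simp add: ennreal_leI flip: ennreal_mult')
  moreover have "ennreal X = (\<integral>\<^sup>+e. ennreal (w e * (F e)\<^sup>2) \<partial>lborel)"
    unfolding X_def by (rule nn_integral_eq_integral[symmetric]) (use iX w(2) in auto)
  moreover have "ennreal (\<integral>z. (f z)\<^sup>2 \<partial>lborel) = (\<integral>\<^sup>+z. ennreal ((f z)\<^sup>2) \<partial>lborel)"
    by (rule nn_integral_eq_integral[symmetric]) (use iff in auto)
  ultimately show ?thesis unfolding F_def by simp
qed

section \<open>Dilated kernels and their almost orthogonality\<close>

lemma lborel_integral_affine:
  fixes g :: "'a::euclidean_space \<Rightarrow> real"
  assumes [measurable]: "g \<in> borel_measurable borel" and c: "c \<noteq> 0"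
  shows "(\<integral>z. g z \<partial>lborel) = \<bar>c\<bar> ^ DIM('a) * (\<integral>x. g (t + c *\<^sub>R x) \<partial>lborel)"
  by (subst lborel_affine[OF c, of t]) (simp add: integral_density integral_distr)

lemma dilate_le:
  fixes \<psi> :: "'a::euclidean_space \<Rightarrow> real"
  assumes psi: "\<psi> \<in> C_class \<alpha>" "0 < \<alpha>" "\<alpha> \<le> 1" and t: "t > 0"
  shows "\<bar>dilate t \<psi> y\<bar> \<le> 3 * t powr (- real DIM('a))"
proof -
  have "3 * t powr (- real DIM('a)) * indicator (cball 0 t) y \<le> 3 * t powr (- real DIM('a)) * 1"
    by (rule mult_left_mono) (auto simp: indicator_def)
  then show ?thesis using dilate_bound[OF assms, of y] by simp
qed

lemma dilate_eq_0:
  fixes \<psi> :: "'a::euclidean_space \<Rightarrow> real"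
  assumes psi: "\<psi> \<in> C_class \<alpha>" "0 < \<alpha>" "\<alpha> \<le> 1" and t: "t > 0" and y: "norm y > t"
  shows "dilate t \<psi> y = 0"
  using dilate_bound[OF psi t, of y] y by simp

lemma dilate_bound_cball:
  fixes \<psi> :: "'a::euclidean_space \<Rightarrow> real"
  assumes psi: "\<psi> \<in> C_class \<alpha>" "0 < \<alpha>" "\<alpha> \<le> 1" and t: "t > 0"
  shows "\<bar>dilate t \<psi> (y - z)\<bar> \<le> 3 * t powr (- real DIM('a)) * indicator (cball y t) z"
  using dilate_le[OF assms, of "y - z"] dilate_eq_0[OF assms, of "y - z"]
  by (cases "norm (y - z) \<le> t") (auto simp: dist_norm)

lemma dilate_bounded_support:
  fixes \<psi> :: "'a::euclidean_space \<Rightarrow> real"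
  assumes psi: "\<psi> \<in> C_class \<alpha>" "0 < \<alpha>" "\<alpha> \<le> 1" and t: "t > 0"
  shows "bounded_support (\<lambda>z. dilate t \<psi> (y - z))"
proof (rule bounded_supportI[of _ "3 * t powr (- real DIM('a)) + (norm y + t)"])
  note [measurable] = dilate_measurable(2)[OF psi(1,2)]
  show "(\<lambda>z. dilate t \<psi> (y - z)) \<in> borel_measurable borel" by measurable
  show "\<bar>dilate t \<psi> (y - z)\<bar> \<le> 3 * t powr (- real DIM('a)) + (norm y + t)" for z
    using dilate_le[OF psi t, of "y - z"] t norm_ge_zero[of y] by linarith
  fix z :: 'a assume "3 * t powr (- real DIM('a)) + (norm y + t) < norm z"
  moreover have "norm z \<le> norm y + norm (y - z)" using norm_triangle_ineq4[of y "y - z"] by simp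
  moreover have "3 * t powr (- real DIM('a)) \<ge> 0" by simp
  ultimately have "norm (y - z) > t" by linarith
  then show "dilate t \<psi> (y - z) = 0" by (rule dilate_eq_0[OF psi t])
qed

lemma dilate_mean_zero:
  fixes \<psi> :: "'a::euclidean_space \<Rightarrow> real"
  assumes psi: "\<psi> \<in> C_class \<alpha>" "0 < \<alpha>" "t > 0"
  shows "(\<integral>z. dilate t \<psi> (y - z) \<partial>(lborel :: 'a measure)) = 0"
proof -
  note [measurable] = dilate_measurable(2)[OF psi(1,2)] C_class_measurable[OF psi(1,2)]
  have "(\<integral>z. dilate t \<psi> (y - z) \<partial>lborel) = \<bar>- t\<bar> ^ DIM('a) * (\<integral>x. dilate t \<psi> (y - (y + (- t) *\<^sub>R x)) \<partial>lborel)"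
    by (rule lborel_integral_affine) (use psi in auto)
  also have "(\<lambda>x. dilate t \<psi> (y - (y + (- t) *\<^sub>R x))) = (\<lambda>x. t powr (- real DIM('a)) * \<psi> x)"
    using psi by (auto simp: dilate_def fun_eq_iff)
  also have "(\<integral>x. t powr (- real DIM('a)) * \<psi> x \<partial>lborel) = t powr (- real DIM('a)) * (\<integral>x. \<psi> x \<partial>lebesgue)"
    by (simp add: integral_completion)
  also have "(\<integral>x. \<psi> x \<partial>lebesgue) = 0" using psi(1) by (simp add: C_class_def)
  finally show ?thesis by simp
qed

lemma dilate_abs_integral:
  fixes \<psi> :: "'a::euclidean_space \<Rightarrow> real"
  assumes psi: "\<psi> \<in> C_class \<alpha>" "0 < \<alpha>" "\<alpha> \<le> 1" and t: "t > 0"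
  shows "(\<integral>z. \<bar>dilate t \<psi> (y - z)\<bar> \<partial>lborel) \<le> 3 * unit_ball_vol (real DIM('a))"
proof -
  have "(\<integral>z. \<bar>dilate t \<psi> (y - z)\<bar> \<partial>lborel) \<le> (\<integral>z. 3 * t powr (- real DIM('a)) * indicator (cball y t) z \<partial>lborel)"
  proof (rule integral_mono)
    show "integrable lborel (\<lambda>z. \<bar>dilate t \<psi> (y - z)\<bar>)"
      using bounded_support_integrable[OF dilate_bounded_support[OF assms]] by simp
    show "integrable lborel (\<lambda>z. 3 * t powr (- real DIM('a)) * indicator (cball y t) z)"
      using t by (intro integrable_mult_right integrable_real_indicator) (auto simp: emeasure_cball_eq)
    show "\<bar>dilate t \<psi> (y - z)\<bar> \<le> 3 * t powr (- real DIM('a)) * indicator (cball y t) z" for z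
      by (rule dilate_bound_cball[OF psi t])
  qed
  also have "\<dots> = 3 * t powr (- real DIM('a)) * (unit_ball_vol (real DIM('a)) * t ^ DIM('a))"
    using t content_cball[of t y] by simp
  also have "\<dots> = 3 * unit_ball_vol (real DIM('a))"
    using t by (simp add: powr_minus_DIM)
  finally show ?thesis .
qed

text \<open>The kernel of the smaller scale s has mean value zero, so the other one may be replaced
  by its difference from its value at z = y. Where the small kernel lives, this difference is at
  most t^(-n) (s / t)^\<alpha> by Hoelder continuity; the factor 3 V is the bound for the integral
  of the absolute value of the small kernel.\<close>

lemma dilate_almost_orthogonal:
  fixes \<psi> \<psi>' :: "'a::euclidean_space \<Rightarrow> real"
  assumes psi: "\<psi> \<in> C_class \<alpha>" "\<psi>' \<in> C_class \<alpha>" and a: "0 < \<alpha>" "\<alpha> \<le> 1" and t: "0 < s" "s \<le> t"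
  shows "\<bar>\<integral>z. dilate t \<psi> (x - z) * dilate s \<psi>' (y - z) \<partial>lborel\<bar>
    \<le> 3 * unit_ball_vol (real DIM('a)) * t powr (- real DIM('a)) * (s / t) powr \<alpha> * indicator (cball x (2 * t)) y"
proof (cases "y \<in> cball x (2 * t)")
  case False
  have z0: "dilate t \<psi> (x - z) * dilate s \<psi>' (y - z) = 0" for z
  proof (rule ccontr)
    assume "dilate t \<psi> (x - z) * dilate s \<psi>' (y - z) \<noteq> 0"
    then have "norm (x - z) \<le> t" "norm (y - z) \<le> s"
      using dilate_eq_0[OF psi(1) a, of t "x - z"] dilate_eq_0[OF psi(2) a, of s "y - z"] t
      by (auto simp: not_less[symmetric])
    then have "dist x y \<le> t + s" using dist_triangle2[of x y z] by (simp add: dist_norm)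
    then show False using False t by simp
  qed
  show ?thesis unfolding z0 using False by simp
next
  case True
  have t0: "t > 0" using t by simp
  have i1: "integrable lborel (\<lambda>z. dilate s \<psi>' (y - z))"
    by (rule bounded_support_integrable[OF dilate_bounded_support[OF psi(2) a t(1)]])
  note [measurable] = dilate_measurable(2)[OF psi(1) a(1)]
  have i2: "integrable lborel (\<lambda>z. dilate t \<psi> (x - z) * dilate s \<psi>' (y - z))"
  proof -
    obtain B where "\<And>z. \<bar>dilate t \<psi> (x - z)\<bar> \<le> B"
      using bounded_support_bound[OF dilate_bounded_support[OF psi(1) a t0]] by blast
    then have "bounded_support (\<lambda>z. dilate s \<psi>' (y - z) * dilate t \<psi> (x - z))"
      by (intro bounded_support_mult[OF dilate_bounded_support[OF psi(2) a t(1)]]) auto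
    from bounded_support_integrable[OF this] show ?thesis by (simp add: mult.commute)
  qed
  have "(\<integral>z. dilate t \<psi> (x - z) * dilate s \<psi>' (y - z) \<partial>lborel)
    = (\<integral>z. dilate t \<psi> (x - z) * dilate s \<psi>' (y - z) \<partial>lborel) - (\<integral>z. dilate t \<psi> (x - y) * dilate s \<psi>' (y - z) \<partial>lborel)"
    using dilate_mean_zero[OF psi(2) a(1) t(1)] by simp
  also have "\<dots> = (\<integral>z. (dilate t \<psi> (x - z) - dilate t \<psi> (x - y)) * dilate s \<psi>' (y - z) \<partial>lborel)"
    using i1 i2 by (simp add: left_diff_distrib)
  also have "\<bar>\<dots>\<bar> \<le> (\<integral>z. t powr (- real DIM('a)) * (s / t) powr \<alpha> * \<bar>dilate s \<psi>' (y - z)\<bar> \<partial>lborel)"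
  proof (rule Bochner_Integration.integral_abs_bound_integral)
    show "integrable lborel (\<lambda>z. (dilate t \<psi> (x - z) - dilate t \<psi> (x - y)) * dilate s \<psi>' (y - z))"
      using i1 i2 by (simp add: left_diff_distrib)
    show "integrable lborel (\<lambda>z. t powr (- real DIM('a)) * (s / t) powr \<alpha> * \<bar>dilate s \<psi>' (y - z)\<bar>)"
      using i1 by auto
    fix z
    show "\<bar>(dilate t \<psi> (x - z) - dilate t \<psi> (x - y)) * dilate s \<psi>' (y - z)\<bar> \<le> t powr (- real DIM('a)) * (s / t) powr \<alpha> * \<bar>dilate s \<psi>' (y - z)\<bar>"
    proof (cases "norm (y - z) \<le> s")
      case True
      have "\<bar>dilate t \<psi> (x - z) - dilate t \<psi> (x - y)\<bar> \<le> t powr (- real DIM('a)) * (norm ((x - z) - (x - y)) / t) powr \<alpha>"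
        by (rule dilate_holder[OF psi(1) t0])
      also have "\<dots> \<le> t powr (- real DIM('a)) * (s / t) powr \<alpha>"
        using True t0 a t by (intro mult_left_mono powr_mono2 divide_right_mono) auto
      finally show ?thesis unfolding abs_mult by (rule mult_right_mono) simp
    next
      case False
      then have "dilate s \<psi>' (y - z) = 0" using dilate_eq_0[OF psi(2) a t(1), of "y - z"] by simp
      then show ?thesis by simp
    qed
  qed
  also have "\<dots> = t powr (- real DIM('a)) * (s / t) powr \<alpha> * (\<integral>z. \<bar>dilate s \<psi>' (y - z)\<bar> \<partial>lborel)" by simp
  also have "\<dots> \<le> t powr (- real DIM('a)) * (s / t) powr \<alpha> * (3 * unit_ball_vol (real DIM('a)))"
    using dilate_abs_integral[OF psi(2) a t(1)] by (intro mult_left_mono) auto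
  finally show ?thesis using True by (simp add: mult_ac)
qed

text \<open>The row bound for Schur's test with respect to dy ds / s. Integration in y yields the
  volume of a ball whose radius is twice the larger scale, which cancels the power of that scale.
  What is left is (s / t)^\<alpha> ds / s over s \<le> t and (t / s)^\<alpha> ds / s over s \<ge> t,
  each with integral 1 / \<alpha>.\<close>

lemma schur_kernel_integral:
  fixes x :: "'a::euclidean_space"
  assumes a: "0 < \<alpha>" and t: "t > 0" and V: "V = unit_ball_vol (real DIM('a))"
  shows "(\<integral>\<^sup>+(s, y). ennreal (indicator {0..t} s * (1 / s * (3 * V * t powr (- real DIM('a)) * (s / t) powr \<alpha>)) * indicator (cball x (2 * t)) y
     + indicator {t..} s * (1 / s * (3 * V * s powr (- real DIM('a)) * (t / s) powr \<alpha>)) * indicator (cball x (2 * s)) y) \<partial>(lborel :: (real \<times> 'a) measure))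
    \<le> ennreal (6 * V\<^sup>2 * 2 ^ DIM('a) / \<alpha>)"
proof -
  define n where "n = DIM('a)"
  have V0: "V \<ge> 0" using V by simp
  define h1 where "h1 = (\<lambda>s. indicator {0..t} s * (1 / s * (3 * V * t powr (- real n) * (s / t) powr \<alpha>)))"
  define h2 where "h2 = (\<lambda>s. indicator {t..} s * (1 / s * (3 * V * s powr (- real n) * (t / s) powr \<alpha>)))"
  have [measurable]: "h1 \<in> borel_measurable borel" "h2 \<in> borel_measurable borel" unfolding h1_def h2_def by measurable
  have h0: "h1 s \<ge> 0" "h2 s \<ge> 0" for s using V0 t by (auto simp: h1_def h2_def indicator_def)
  have c2: "(\<lambda>(s, y). indicator (cball x (2 * s)) y :: real) = (\<lambda>(s, y). if dist x y \<le> 2 * s then 1 else 0)"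
    by (auto simp: indicator_def)
  have [measurable]: "(\<lambda>(s, y). indicator (cball x (2 * s)) y :: real) \<in> borel_measurable (borel \<Otimes>\<^sub>M borel)"
    unfolding c2 by measurable
  have "(\<integral>\<^sup>+(s, y). ennreal (h1 s * indicator (cball x (2 * t)) y + h2 s * indicator (cball x (2 * s)) y) \<partial>(lborel \<Otimes>\<^sub>M lborel))
     = (\<integral>\<^sup>+s. (\<integral>\<^sup>+y. ennreal (h1 s * indicator (cball x (2 * t)) y + h2 s * indicator (cball x (2 * s)) y) \<partial>lborel) \<partial>lborel)"
    by (subst lborel.nn_integral_fst[symmetric]) (auto simp: case_prod_beta' intro!: measurable_ident)
  also have "\<dots> = (\<integral>\<^sup>+s. ennreal (3 * V\<^sup>2 * 2 ^ n) * (ennreal (t powr (- \<alpha>)) * (ennreal (s powr (\<alpha> - 1)) * indicator {0..t} s)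
     + ennreal (t powr \<alpha>) * (ennreal (s powr (- \<alpha> - 1)) * indicator {t..} s)) \<partial>lborel)"
  proof (rule nn_integral_cong)
    fix s :: real
    have vol: "s \<ge> 0 \<Longrightarrow> emeasure lborel (cball x (2 * s)) = ennreal (V * (2 * s) ^ n)" for s
      using emeasure_cball_eq[of "2 * s" x] by (simp add: V n_def)
    have "(\<integral>\<^sup>+y. ennreal (h1 s * indicator (cball x (2 * t)) y + h2 s * indicator (cball x (2 * s)) y) \<partial>lborel)
      = (\<integral>\<^sup>+y. ennreal (h1 s) * indicator (cball x (2 * t)) y + ennreal (h2 s) * indicator (cball x (2 * s)) y \<partial>lborel)"
      by (intro nn_integral_cong) (auto simp: indicator_def h0)
    also have "\<dots> = ennreal (h1 s) * emeasure lborel (cball x (2 * t)) + ennreal (h2 s) * emeasure lborel (cball x (2 * s))"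
      by (subst nn_integral_add) (auto simp: nn_integral_cmult_indicator intro!: borel_measurable_times_ennreal borel_measurable_indicator)
    also have "ennreal (h1 s) * emeasure lborel (cball x (2 * t)) = ennreal (3 * V\<^sup>2 * 2 ^ n) * (ennreal (t powr (- \<alpha>)) * (ennreal (s powr (\<alpha> - 1)) * indicator {0..t} s))"
    proof (cases "s \<in> {0<..t}")
      case True
      have "h1 s * (V * (2 * t) ^ n) = 3 * V\<^sup>2 * 2 ^ n * (t powr (- \<alpha>) * s powr (\<alpha> - 1))"
        using True t by (simp add: h1_def powr_minus_DIM powr_divide powr_minus powr_diff powr_realpow field_simps power2_eq_square)
      then show ?thesis using True t h0(1)[of s] V0 vol[of t]
        by (simp flip: ennreal_mult' add: ennreal_mult'[symmetric])
    next
      case False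
      then show ?thesis using t by (cases "s = 0") (auto simp: h1_def indicator_def)
    qed
    also have "ennreal (h2 s) * emeasure lborel (cball x (2 * s)) = ennreal (3 * V\<^sup>2 * 2 ^ n) * (ennreal (t powr \<alpha>) * (ennreal (s powr (- \<alpha> - 1)) * indicator {t..} s))"
    proof (cases "s \<in> {t..}")
      case True
      then have s: "s > 0" using t by auto
      have "h2 s * (V * (2 * s) ^ n) = 3 * V\<^sup>2 * 2 ^ n * (t powr \<alpha> * s powr (- \<alpha> - 1))"
        using True s t by (simp add: h2_def powr_minus_DIM powr_divide powr_minus powr_diff powr_realpow field_simps power2_eq_square)
      then show ?thesis using True s h0(2)[of s] V0 vol[of s]
        by (simp flip: ennreal_mult' add: ennreal_mult'[symmetric])
    next
      case False
      then show ?thesis by (auto simp: h2_def indicator_def)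
    qed
    finally show "(\<integral>\<^sup>+y. ennreal (h1 s * indicator (cball x (2 * t)) y + h2 s * indicator (cball x (2 * s)) y) \<partial>lborel)
      = ennreal (3 * V\<^sup>2 * 2 ^ n) * (ennreal (t powr (- \<alpha>)) * (ennreal (s powr (\<alpha> - 1)) * indicator {0..t} s)
     + ennreal (t powr \<alpha>) * (ennreal (s powr (- \<alpha> - 1)) * indicator {t..} s))"
      by (simp add: distrib_left)
  qed
  also have "\<dots> = ennreal (3 * V\<^sup>2 * 2 ^ n) * (ennreal (t powr (- \<alpha>)) * ennreal (t powr \<alpha> / \<alpha>)
     + ennreal (t powr \<alpha>) * ennreal (t powr (- \<alpha>) / \<alpha>))"
    using nn_integral_powr_from_0[of \<alpha> t] nn_integral_powr_atLeast[of \<alpha> t] a t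
    by (simp add: nn_integral_cmult nn_integral_add)
  also have "\<dots> = ennreal (3 * V\<^sup>2 * 2 ^ n * (t powr (- \<alpha>) * (t powr \<alpha> / \<alpha>) + t powr \<alpha> * (t powr (- \<alpha>) / \<alpha>)))"
    using a by (simp flip: ennreal_mult ennreal_plus)
  also have "3 * V\<^sup>2 * 2 ^ n * (t powr (- \<alpha>) * (t powr \<alpha> / \<alpha>) + t powr \<alpha> * (t powr (- \<alpha>) / \<alpha>)) = 6 * V\<^sup>2 * 2 ^ n / \<alpha>"
    using t a by (simp add: powr_minus field_simps)
  finally show ?thesis by (simp add: h1_def h2_def n_def lborel_prod)
qed

section \<open>Monotone limits and the quadratic estimate for the square function\<close>

lemma SUP_mult_incseq:
  fixes a b :: "nat \<Rightarrow> ennreal"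
  assumes "incseq a" "incseq b"
  shows "(SUP n. a n) * (SUP n. b n) = (SUP n. a n * b n)"
proof (rule antisym)
  have "(SUP n. a n) * (SUP n. b n) = (SUP n. (SUP m. a m) * b n)"
    by (simp add: SUP_mult_left_ennreal)
  also have "\<dots> = (SUP n. (SUP m. a m * b n))" by (simp add: SUP_mult_right_ennreal)
  also have "\<dots> \<le> (SUP n. a n * b n)"
  proof (intro SUP_least)
    fix n m
    have "a m * b n \<le> a (max n m) * b (max n m)"
      using assms by (intro mult_mono) (auto simp: incseq_def)
    then show "a m * b n \<le> (SUP n. a n * b n)"
      by (intro SUP_upper2[of "max n m"]) auto
  qed
  finally show "(SUP n. a n) * (SUP n. b n) \<le> (SUP n. a n * b n)" .
  show "(SUP n. a n * b n) \<le> (SUP n. a n) * (SUP n. b n)"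
    by (intro SUP_least mult_mono SUP_upper) auto
qed

lemma SUP_power_incseq:
  fixes a :: "nat \<Rightarrow> ennreal"
  assumes "incseq a"
  shows "(SUP n. a n) ^ m = (SUP n. a n ^ m)"
proof (induction m)
  case (Suc m)
  have "incseq (\<lambda>n. a n ^ m)" using assms by (auto simp: incseq_def intro: power_mono)
  then show ?case using SUP_mult_incseq[OF assms] Suc by simp
qed simp

text \<open>The square of \<open>g_fun\<close> restricted to the scales in \<open>I\<close>.
  Restricted ranges give finite quantities, which can be absorbed, and allow small and large scales
  to be treated differently.\<close>

definition g_sq :: "real \<Rightarrow> ('a::euclidean_space \<Rightarrow> 'b::{banach, second_countable_topology}) \<Rightarrow> real set \<Rightarrow> 'a \<Rightarrow> ennreal" where
  "g_sq \<alpha> f I x = (\<integral>\<^sup>+t\<in>I. (A_sup \<alpha> f t x)\<^sup>2 * ennreal (1 / t) \<partial>lborel)"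

lemma bounded_support_locally_integrable:
  assumes "bounded_support f"
  shows "locally_integrable f"
proof -
  have "integrable lebesgue f"
    using bounded_support_integrable[OF assms] by (simp add: integrable_completion)
  then show ?thesis
    unfolding locally_integrable_def set_integrable_def
    by (intro allI integrable_mult_indicator) (auto simp: sets_completionI_sets)
qed

lemma conv_lborel:
  fixes f :: "'a::euclidean_space \<Rightarrow> real"
  assumes [measurable]: "f \<in> borel_measurable borel" and psi: "\<psi> \<in> C_class \<alpha>" "0 < \<alpha>"
  shows "conv f (dilate t \<psi>) x = (\<integral>z. dilate t \<psi> (x - z) * f z \<partial>lborel)"
proof -
  note [measurable] = dilate_measurable(2)[OF psi]
  show ?thesis unfolding conv_def by (subst integral_completion) auto
qed

text \<open>Among finitely many kernels the one with the largest convolution at (t, x) can be chosen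
  measurably. The choice turns the maximum into the modulus of one linear operator, to which
  \<open>schur_square_bound\<close> applies with a constant that does not depend on the choice.
  Monotone convergence, in the number of kernels and in the range of (t, x) at the same time, gives
  the claim.\<close>

theorem g_sq_L2:
  fixes f :: "'a::euclidean_space \<Rightarrow> real"
  assumes a: "0 < \<alpha>" "\<alpha> \<le> 1" and f: "bounded_support f"
  shows "(\<integral>\<^sup>+x. g_sq \<alpha> f {0<..} x \<partial>lborel)
     \<le> ennreal (6 * (unit_ball_vol (real DIM('a)))\<^sup>2 * 2 ^ DIM('a) / \<alpha>) * (\<integral>\<^sup>+x. ennreal ((f x)\<^sup>2) \<partial>lborel)"
proof -
  define V where "V = unit_ball_vol (real DIM('a))"
  define C where "C = 6 * V\<^sup>2 * 2 ^ DIM('a) / \<alpha>"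
  have V0: "V > 0" by (simp add: V_def)
  have C0: "C > 0" using V0 a by (simp add: C_def)
  have fm[measurable]: "f \<in> borel_measurable borel" using f by (simp add: bounded_support_def)
  note lif = bounded_support_locally_integrable[OF f]
  obtain \<psi> where psi: "\<And>i::nat. \<psi> i \<in> C_class \<alpha>"
    "\<And>t x. t > 0 \<Longrightarrow> A_sup \<alpha> f t x = (SUP i. ennreal (norm (conv f (dilate t (\<psi> i)) x)))"
    using A_sup_countable[OF lif a] by blast
  define c where "c = (\<lambda>j e. \<bar>\<integral>z. dilate (fst e) (\<psi> j) (snd e - z) * f z \<partial>lborel\<bar>)"
  have dm[measurable]: "(\<lambda>p. dilate (fst p) (\<psi> j) (snd p)) \<in> borel_measurable (borel \<Otimes>\<^sub>M borel)" for j
    using dilate_measurable(1)[OF psi(1) a(1)] by (simp add: case_prod_beta')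
  have dm': "(\<lambda>(e, z). dilate (fst e) (\<psi> j) (snd e - z)) \<in> borel_measurable ((borel \<Otimes>\<^sub>M borel) \<Otimes>\<^sub>M borel)" for j
  proof -
    have "(\<lambda>p. dilate (fst (fst (fst p), snd (fst p) - snd p)) (\<psi> j) (snd (fst (fst p), snd (fst p) - snd p)))
       \<in> borel_measurable ((borel \<Otimes>\<^sub>M borel) \<Otimes>\<^sub>M borel)"
      by (rule measurable_compose[OF _ dm]) measurable
    then show ?thesis by (simp add: case_prod_beta')
  qed
  have [measurable]: "c j \<in> borel_measurable (borel \<Otimes>\<^sub>M borel)" for j
    unfolding c_def using dm'[of j] by measurable
  \<comment> \<open>The index of a largest value among the first N + 1 kernels; taking the least
    such index makes it a measurable function of e = (t, x).\<close>
  define i where "i = (\<lambda>N e. LEAST i. i \<le> N \<and> (\<forall>j\<le>N. c j e \<le> c i e))"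
  have i: "i N e \<le> N \<and> (\<forall>j\<le>N. c j e \<le> c (i N e) e)" for N e
    unfolding i_def
  proof (rule LeastI_ex)
    have "\<exists>m\<in>{..N}. \<forall>j\<in>{..N}. c j e \<le> c m e"
      using obtains_MAX[of "{..N}" "\<lambda>j. c j e"] by (metis atMost_iff finite_atMost Max_ge empty_iff finite_imageI imageI le0)
    then show "\<exists>i\<le>N. \<forall>j\<le>N. c j e \<le> c i e" by auto
  qed
  have im[measurable]: "i N \<in> measurable (borel \<Otimes>\<^sub>M borel) (count_space UNIV)" for N
    unfolding i_def by measurable
  \<comment> \<open>Bounded ranges of scales, away from 0, and of centres: on them the selected
    kernel \<open>k\<close> is bounded with bounded support, and the density \<open>w\<close> of the
    measure dt / t is bounded.\<close>
  define box where "box = (\<lambda>N. {1 / real (Suc N) .. real (Suc N)} \<times> cball (0::'a) (real (Suc N)))"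
  define k where "k = (\<lambda>N e z. indicator (box N) e * dilate (fst e) (\<psi> (i N e)) (snd e - z))"
  define w where "w = (\<lambda>N e. indicator (box N) e / fst e)"
  have bm[measurable]: "box N \<in> sets (borel \<Otimes>\<^sub>M borel)" for N
    unfolding box_def by measurable
  have boxD: "t > 0" "t \<le> real (Suc N)" "1 / real (Suc N) \<le> t" "norm x \<le> real (Suc N)" if "(t, x) \<in> box N" for t x N
    using that by (auto simp: box_def intro: less_le_trans[rotated])
  have ks: "bounded_support (case_prod (k N))" for N
  proof (rule bounded_support_pair)
    have "(\<lambda>(e, z). dilate (fst e) (\<psi> (i N e)) (snd e - z)) \<in> borel_measurable ((borel \<Otimes>\<^sub>M borel) \<Otimes>\<^sub>M borel)"
      unfolding case_prod_beta'
      by (rule measurable_compose_countable[where f="\<lambda>j p. dilate (fst (fst p)) (\<psi> j) (snd (fst p) - snd p)"])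
        (use dm' in \<open>auto simp: case_prod_beta'\<close>)
    then have "case_prod (k N) \<in> borel_measurable ((borel \<Otimes>\<^sub>M borel) \<Otimes>\<^sub>M borel)"
      unfolding k_def by (simp add: case_prod_beta')
    then show "case_prod (k N) \<in> borel_measurable (borel \<Otimes>\<^sub>M borel)" by (simp add: borel_prod)
    define M where "M = 3 * real (Suc N) powr real DIM('a) + 2 * real (Suc N)"
    fix e :: "real \<times> 'a" and z :: 'a
    obtain t x where e: "e = (t, x)" by fastforce
    show "\<bar>k N e z\<bar> \<le> M"
    proof (cases "e \<in> box N")
      case True
      then have t: "t > 0" "1 / real (Suc N) \<le> t" using boxD e by auto
      have "\<bar>k N e z\<bar> \<le> 3 * t powr (- real DIM('a))"
        using dilate_le[OF psi(1) a t(1)] True by (simp add: k_def e)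
      also have "\<dots> \<le> 3 * (1 / real (Suc N)) powr (- real DIM('a))"
        using t by (intro mult_left_mono powr_mono2') auto
      also have "\<dots> \<le> M" by (simp add: M_def powr_divide powr_minus field_simps)
      finally show ?thesis .
    qed (simp add: k_def M_def)
    have M: "M \<ge> 2 * real (Suc N)" by (simp add: M_def)
    show "k N e z = 0" if "norm e > M"
    proof (rule ccontr)
      assume "k N e z \<noteq> 0"
      then have "e \<in> box N" by (auto simp: k_def indicator_def split: if_splits)
      then have "norm t \<le> real (Suc N)" "norm x \<le> real (Suc N)" using boxD[of t x N] e by auto
      then have "norm (t, x) \<le> real (Suc N) + real (Suc N)"
        by (intro order_trans[OF norm_Pair_le add_mono])
      then show False using that M by (simp add: e)
    qed
    show "k N e z = 0" if "norm z > M"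
    proof (rule ccontr)
      assume *: "k N e z \<noteq> 0"
      then have "e \<in> box N" by (auto simp: k_def indicator_def split: if_splits)
      then have t: "t > 0" "t \<le> real (Suc N)" "norm x \<le> real (Suc N)" using boxD[of t x N] e by auto
      have "norm (x - z) \<le> t"
        using * dilate_eq_0[OF psi(1) a t(1), of "x - z" "i N e"] by (auto simp: k_def e not_less[symmetric])
      then show False using that M t norm_triangle_ineq4[of x "x - z"] by simp
    qed
  qed
  have wm: "w N \<in> borel_measurable borel" for N
  proof -
    have "w N \<in> borel_measurable (borel \<Otimes>\<^sub>M borel)" unfolding w_def by measurable
    then show ?thesis by (simp add: borel_prod)
  qed
  have w0: "0 \<le> w N e" for N e
    by (cases e) (auto simp: w_def indicator_def dest: boxD(1))
  have wb: "w N e \<le> real (Suc N)" for N e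
  proof (cases e)
    case (Pair t x)
    then show ?thesis using boxD(1,3)[of t x N] by (auto simp: w_def indicator_def field_simps)
  qed
  have schur: "(\<integral>\<^sup>+e'. ennreal (w N e' * \<bar>\<integral>z. k N e z * k N e' z \<partial>lborel\<bar>) \<partial>lborel) \<le> ennreal C" for N e
  proof (cases "e \<in> box N")
    case False
    then show ?thesis by (simp add: k_def)
  next
    case True
    obtain t x where e: "e = (t, x)" by fastforce
    have t: "t > 0" using boxD(1) True e by blast
    have "(\<integral>\<^sup>+e'. ennreal (w N e' * \<bar>\<integral>z. k N e z * k N e' z \<partial>lborel\<bar>) \<partial>lborel)
      \<le> (\<integral>\<^sup>+(s, y). ennreal (indicator {0..t} s * (1 / s * (3 * V * t powr (- real DIM('a)) * (s / t) powr \<alpha>)) * indicator (cball x (2 * t)) y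
     + indicator {t..} s * (1 / s * (3 * V * s powr (- real DIM('a)) * (t / s) powr \<alpha>)) * indicator (cball x (2 * s)) y) \<partial>lborel)"
    proof (rule nn_integral_mono, clarsimp simp del: times_divide_eq_left times_divide_eq_right)
      fix s :: real and y :: 'a
      show "ennreal (w N (s, y) * \<bar>\<integral>z. k N e z * k N (s, y) z \<partial>lborel\<bar>) \<le> ennreal (indicator {0..t} s * (1 / s * (3 * V * t powr (- real DIM('a)) * (s / t) powr \<alpha>)) * indicator (cball x (2 * t)) y
     + indicator {t..} s * (1 / s * (3 * V * s powr (- real DIM('a)) * (t / s) powr \<alpha>)) * indicator (cball x (2 * s)) y)"
      proof (cases "(s, y) \<in> box N")
        case False
        then show ?thesis by (simp add: w_def)
      next
        case B: True
        have s: "s > 0" using boxD(1) B by blast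
        define K where "K = \<bar>\<integral>z. dilate t (\<psi> (i N e)) (x - z) * dilate s (\<psi> (i N (s, y))) (y - z) \<partial>lborel\<bar>"
        have K: "\<bar>\<integral>z. k N e z * k N (s, y) z \<partial>lborel\<bar> = K" using True B by (simp add: k_def K_def e)
        show ?thesis
        proof (cases "s \<le> t")
          case st: True
          have "1 / s * K \<le> 1 / s * (3 * V * t powr (- real DIM('a)) * (s / t) powr \<alpha> * indicator (cball x (2 * t)) y)"
            unfolding K_def V_def using s by (intro mult_left_mono dilate_almost_orthogonal[OF psi(1) psi(1) a s st]) auto
          also have "\<dots> \<le> indicator {0..t} s * (1 / s * (3 * V * t powr (- real DIM('a)) * (s / t) powr \<alpha>)) * indicator (cball x (2 * t)) y
     + indicator {t..} s * (1 / s * (3 * V * s powr (- real DIM('a)) * (t / s) powr \<alpha>)) * indicator (cball x (2 * s)) y"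
            using st s V0 by (auto simp: indicator_def)
          finally show ?thesis using B by (intro ennreal_leI) (simp add: w_def K)
        next
          case False
          then have ts: "t \<le> s" by simp
          \<comment> \<open>Now t is the smaller scale and provides the cancellation, so the factors
            change places before the bound is applied.\<close>
          have "K = \<bar>\<integral>z. dilate s (\<psi> (i N (s, y))) (y - z) * dilate t (\<psi> (i N e)) (x - z) \<partial>lborel\<bar>"
            unfolding K_def by (simp add: mult.commute)
          also have "\<dots> \<le> 3 * V * s powr (- real DIM('a)) * (t / s) powr \<alpha> * indicator (cball y (2 * s)) x"
            unfolding V_def by (rule dilate_almost_orthogonal[OF psi(1) psi(1) a t ts])
          finally have "1 / s * K \<le> 1 / s * (3 * V * s powr (- real DIM('a)) * (t / s) powr \<alpha> * indicator (cball y (2 * s)) x)"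
            using s by (intro mult_left_mono) auto
          also have "\<dots> \<le> indicator {0..t} s * (1 / s * (3 * V * t powr (- real DIM('a)) * (s / t) powr \<alpha>)) * indicator (cball x (2 * t)) y
     + indicator {t..} s * (1 / s * (3 * V * s powr (- real DIM('a)) * (t / s) powr \<alpha>)) * indicator (cball x (2 * s)) y"
            using ts False s V0 by (auto simp: indicator_def dist_commute)
          finally show ?thesis using B by (intro ennreal_leI) (simp add: w_def K)
        qed
      qed
    qed
    also have "\<dots> \<le> ennreal C" unfolding C_def by (rule schur_kernel_integral[OF a(1) t V_def])
    finally show ?thesis .
  qed
  define u where "u = (\<lambda>N e. ennreal (w N e * (c (i N e) e)\<^sup>2))"
  have um[measurable]: "u N \<in> borel_measurable (borel \<Otimes>\<^sub>M borel)" for N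
  proof -
    have [measurable]: "(\<lambda>e. c (i N e) e) \<in> borel_measurable (borel \<Otimes>\<^sub>M borel)"
      by (rule measurable_compose_countable[where f=c]) auto
    have [measurable]: "w N \<in> borel_measurable (borel \<Otimes>\<^sub>M borel)" using wm by (simp add: borel_prod)
    show ?thesis unfolding u_def by measurable
  qed
  have uint: "(\<integral>\<^sup>+e. u N e \<partial>lborel) \<le> ennreal C * (\<integral>\<^sup>+x. ennreal ((f x)\<^sup>2) \<partial>lborel)" for N
  proof -
    have "(\<integral>\<^sup>+e. u N e \<partial>lborel) = (\<integral>\<^sup>+e. ennreal (w N e * (\<integral>z. k N e z * f z \<partial>lborel)\<^sup>2) \<partial>lborel)"
      by (rule nn_integral_cong) (auto simp: u_def w_def k_def c_def indicator_def)
    also have "\<dots> \<le> ennreal C * (\<integral>\<^sup>+x. ennreal ((f x)\<^sup>2) \<partial>lborel)"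
      by (rule schur_square_bound[OF ks wm w0 wb C0 schur f])
    finally show ?thesis .
  qed
  have inc_c: "c (i M e) e \<le> c (i N e) e" if "M \<le> N" for M N e
    using i[of M e] i[of N e] that by auto
  have inc_w: "w M e \<le> w N e" if "M \<le> N" for M N e
  proof (cases "e \<in> box M")
    case True
    obtain t x where e: "e = (t, x)" by fastforce
    have "1 / real (Suc N) \<le> 1 / real (Suc M)" using that by (intro divide_left_mono) auto
    then have "e \<in> box N" using True that by (auto simp: box_def e)
    then show ?thesis using True by (simp add: w_def)
  next
    case False
    then show ?thesis using w0[of N e] by (simp add: w_def)
  qed
  have incu: "incseq u"
    unfolding incseq_def le_fun_def u_def
    by (auto intro!: ennreal_leI mult_mono power_mono inc_c inc_w w0) (simp add: c_def)
  have key: "(A_sup \<alpha> f t x)\<^sup>2 * ennreal (1 / t) * indicator {0<..} t \<le> (SUP N. u N (t, x))" for t x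
  proof (cases "t > 0")
    case False
    then show ?thesis by simp
  next
    case t: True
    let ?a = "\<lambda>N. ennreal (c (i N (t, x)) (t, x))"
    have inca: "incseq ?a" unfolding incseq_def by (auto intro: ennreal_leI inc_c)
    have "A_sup \<alpha> f t x = (SUP j. ennreal (c j (t, x)))"
      unfolding psi(2)[OF t] c_def by (simp add: conv_lborel[OF fm psi(1) a(1)])
    also have "\<dots> \<le> (SUP N. ?a N)"
    proof (rule SUP_mono)
      fix j
      show "\<exists>m\<in>UNIV. ennreal (c j (t, x)) \<le> ?a m"
        using i[of j "(t, x)"] by (intro bexI[of _ j] ennreal_leI) auto
    qed
    finally have "(A_sup \<alpha> f t x)\<^sup>2 * ennreal (1 / t) \<le> (SUP N. ?a N)\<^sup>2 * ennreal (1 / t)"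
      by (intro mult_right_mono power_mono) auto
    also have "\<dots> = (SUP N. ennreal (1 / t) * (?a N)\<^sup>2)"
      unfolding SUP_power_incseq[OF inca] by (subst mult.commute) (simp add: SUP_mult_left_ennreal)
    also have "\<dots> \<le> (SUP N. u N (t, x))"
    proof (rule SUP_least)
      fix N
      obtain N0 :: nat where N0: "max (max t (norm x)) (1 / t) < real N0" using reals_Archimedean2 by blast
      \<comment> \<open>\<open>N\<close> is the number of kernels compared and \<open>N0\<close>
        brings (t, x) into the box; both effects are monotone, so the maximum has both.\<close>
      define M where "M = max N N0"
      have "real N0 < real (Suc M)" by (simp add: M_def)
      then have M: "max (max t (norm x)) (1 / t) < real (Suc M)" using N0 by (rule order.strict_trans[rotated])
      then have b: "(t, x) \<in> box M" using t by (auto simp: box_def field_simps)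
      have "ennreal (1 / t) * (?a N)\<^sup>2 \<le> ennreal (1 / t) * (?a M)\<^sup>2"
        by (intro mult_left_mono power_mono ennreal_leI inc_c) (auto simp: M_def)
      also have "\<dots> = u M (t, x)" using b t by (simp add: u_def w_def c_def ennreal_power flip: ennreal_mult)
      also have "\<dots> \<le> (SUP N. u N (t, x))" by (rule SUP_upper) simp
      finally show "ennreal (1 / t) * (?a N)\<^sup>2 \<le> (SUP N. u N (t, x))" .
    qed
    finally show ?thesis using t by simp
  qed
  have "(\<integral>\<^sup>+x. g_sq \<alpha> f {0<..} x \<partial>lborel) \<le> (\<integral>\<^sup>+x. (\<integral>\<^sup>+t. (SUP N. u N (t, x)) \<partial>lborel) \<partial>lborel)"
    unfolding g_sq_def by (intro nn_integral_mono key)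
  also have "\<dots> = (\<integral>\<^sup>+e. (SUP N. u N e) \<partial>(lborel \<Otimes>\<^sub>M lborel))"
    by (subst lborel_pair.nn_integral_snd[symmetric]) auto
  also have "\<dots> = (SUP N. (\<integral>\<^sup>+e. u N e \<partial>(lborel \<Otimes>\<^sub>M lborel)))"
    by (rule nn_integral_monotone_convergence_SUP[OF incu]) auto
  also have "\<dots> \<le> ennreal C * (\<integral>\<^sup>+x. ennreal ((f x)\<^sup>2) \<partial>lborel)"
    by (rule SUP_least) (use uint in \<open>simp add: lborel_prod\<close>)
  finally show ?thesis unfolding C_def V_def .
qed

subsection \<open>Translating the centre of the kernels\<close>

text \<open>Since |h| \<le> 1, a point w with |w| > 1 has |h + 2 w| > 1, so the support stays in the
  unit ball. The inner factor 2 multiplies the Hoelder constant by 2^\<alpha> \<le> 2, and the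
  division by 2 restores it.\<close>

lemma C_class_recentre:
  fixes \<psi> :: "'a::euclidean_space \<Rightarrow> real"
  assumes psi: "\<psi> \<in> C_class \<alpha>" and a: "0 < \<alpha>" "\<alpha> \<le> 1" and h: "norm h \<le> 1"
  shows "(\<lambda>w. \<psi> (h + 2 *\<^sub>R w) / 2) \<in> C_class \<alpha>"
  unfolding C_class_def
proof (intro CollectI conjI allI impI)
  have p: "\<And>x. norm x > 1 \<Longrightarrow> \<psi> x = 0" "(\<integral>x. \<psi> x \<partial>lebesgue) = 0"
    "\<And>x x'. \<bar>\<psi> x - \<psi> x'\<bar> \<le> norm (x - x') powr \<alpha>" using psi by (auto simp: C_class_def)
  note [measurable] = C_class_measurable[OF psi a(1)]
  show "\<psi> (h + 2 *\<^sub>R x) / 2 = 0" if "norm x > 1" for x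
  proof -
    have "norm (2 *\<^sub>R x) \<le> norm (h + 2 *\<^sub>R x) + norm h" using norm_triangle_ineq4[of "h + 2 *\<^sub>R x" h] by simp
    then have "norm (h + 2 *\<^sub>R x) > 1" using that h by simp
    then show ?thesis using p by simp
  qed
  show "\<bar>\<psi> (h + 2 *\<^sub>R x) / 2 - \<psi> (h + 2 *\<^sub>R x') / 2\<bar> \<le> norm (x - x') powr \<alpha>" for x x'
  proof -
    have "\<bar>\<psi> (h + 2 *\<^sub>R x) - \<psi> (h + 2 *\<^sub>R x')\<bar> \<le> norm (2 *\<^sub>R (x - x')) powr \<alpha>"
      using p(3)[of "h + 2 *\<^sub>R x" "h + 2 *\<^sub>R x'"] by (simp add: algebra_simps)
    also have "\<dots> = 2 powr \<alpha> * norm (x - x') powr \<alpha>" by (simp add: powr_mult)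
    also have "\<dots> \<le> 2 powr 1 * norm (x - x') powr \<alpha>" using a by (intro mult_right_mono powr_mono) auto
    finally show ?thesis by (simp flip: diff_divide_distrib)
  qed
  have "(\<integral>z. \<psi> z \<partial>lborel) = \<bar>2\<bar> ^ DIM('a) * (\<integral>x. \<psi> (h + 2 *\<^sub>R x) \<partial>lborel)"
    by (rule lborel_integral_affine) auto
  moreover have "(\<integral>z. \<psi> z \<partial>lborel) = 0" using p(2) by (simp add: integral_completion)
  ultimately show "(\<integral>x. \<psi> (h + 2 *\<^sub>R x) / 2 \<partial>lebesgue) = 0"
    by (simp add: integral_completion)
qed

text \<open>With h = (x - x') / t, a kernel of scale t seen from x is a multiple of the recentred
  kernel of scale 2 t seen from x'. Of the factor 2^(n + 1), the part 2^n compensates the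
  normalisation (2 t)^(-n) and one more 2 the halving in \<open>C_class_recentre\<close>.\<close>

lemma A_sup_shift:
  fixes f :: "'a::euclidean_space \<Rightarrow> 'b::{banach, second_countable_topology}"
  assumes a: "0 < \<alpha>" "\<alpha> \<le> 1" and t: "t > 0" and x: "dist x x' \<le> t"
  shows "A_sup \<alpha> f t x \<le> ennreal (2 ^ (DIM('a) + 1)) * A_sup \<alpha> f (2 * t) x'"
  unfolding A_sup_def
proof (rule SUP_least)
  fix \<psi> :: "'a \<Rightarrow> real" assume psi: "\<psi> \<in> C_class \<alpha>"
  define h where "h = (x - x') /\<^sub>R t"
  define \<psi>' where "\<psi>' = (\<lambda>w. \<psi> (h + 2 *\<^sub>R w) / 2)"
  have "norm h = norm (x - x') / t" unfolding h_def norm_scaleR using t by (simp add: divide_inverse mult.commute)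
  then have h: "norm h \<le> 1" using x t by (simp add: dist_norm)
  have psi': "\<psi>' \<in> C_class \<alpha>" unfolding \<psi>'_def by (rule C_class_recentre[OF psi a h])
  have eq: "dilate t \<psi> (x - z) = 2 ^ (DIM('a) + 1) * dilate (2 * t) \<psi>' (x' - z)" for z
  proof -
    have "h + 2 *\<^sub>R ((x' - z) /\<^sub>R (2 * t)) = (x - z) /\<^sub>R t"
      using t by (simp add: h_def flip: scaleR_add_right)
    moreover have "(2 * t) powr (- real DIM('a)) = t powr (- real DIM('a)) / 2 ^ DIM('a)"
      using t by (simp add: powr_minus_DIM power_mult_distrib field_simps)
    ultimately show ?thesis by (simp add: dilate_def \<psi>'_def)
  qed
  have "conv f (dilate t \<psi>) x = (2 ^ (DIM('a) + 1)) *\<^sub>R conv f (dilate (2 * t) \<psi>') x'"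
    unfolding conv_def eq by (simp flip: scaleR_scaleR)
  then have "ennreal (norm (conv f (dilate t \<psi>) x)) = ennreal (2 ^ (DIM('a) + 1)) * ennreal (norm (conv f (dilate (2 * t) \<psi>') x'))"
    by (simp flip: ennreal_mult')
  also have "\<dots> \<le> ennreal (2 ^ (DIM('a) + 1)) * (SUP \<psi>\<in>C_class \<alpha>. ennreal (norm (conv f (dilate (2 * t) \<psi>) x')))"
    by (intro mult_left_mono SUP_upper psi') simp
  finally show "ennreal (norm (conv f (dilate t \<psi>) x)) \<le> \<dots>" .
qed

subsection \<open>The maximal function\<close>

text \<open>The uncentred Hardy-Littlewood maximal function: the point has to lie in the ball but
  need not be its centre. Superlevel sets are then unions of open balls.\<close>

definition maximal :: "('a::euclidean_space \<Rightarrow> ennreal) \<Rightarrow> 'a \<Rightarrow> ennreal" where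
  "maximal h x = (SUP (y, r)\<in>{(y, r). r > 0 \<and> x \<in> ball y r}.
     (\<integral>\<^sup>+z\<in>ball y r. h z \<partial>lborel) / ennreal (unit_ball_vol (real DIM('a)) * r ^ DIM('a)))"

lemma ennreal_divide_le_iff:
  assumes "v > 0"
  shows "a / ennreal v \<le> b \<longleftrightarrow> a \<le> ennreal v * b"
proof
  assume "a / ennreal v \<le> b"
  then have "ennreal v * (a / ennreal v) \<le> ennreal v * b" by (rule mult_left_mono) simp
  then show "a \<le> ennreal v * b" using assms by (simp add: ennreal_mult_divide_eq ennreal_times_divide mult.commute)
next
  assume "a \<le> ennreal v * b"
  then have "a / ennreal v \<le> (ennreal v * b) / ennreal v" by (rule divide_right_mono_ennreal)
  then show "a / ennreal v \<le> b" using assms by (simp add: ennreal_mult_divide_eq mult.commute)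
qed

lemma ball_integral_le_maximal:
  fixes h :: "'a::euclidean_space \<Rightarrow> ennreal"
  assumes "r > 0" "x \<in> ball y r"
  shows "(\<integral>\<^sup>+z\<in>ball y r. h z \<partial>lborel) \<le> ennreal (unit_ball_vol (real DIM('a)) * r ^ DIM('a)) * maximal h x"
proof -
  have "(\<integral>\<^sup>+z\<in>ball y r. h z \<partial>lborel) / ennreal (unit_ball_vol (real DIM('a)) * r ^ DIM('a)) \<le> maximal h x"
    unfolding maximal_def by (rule SUP_upper2[of "(y, r)"]) (use assms in auto)
  then show ?thesis using assms by (subst (asm) ennreal_divide_le_iff) auto
qed

text \<open>Shows that superlevel sets are open for every \<open>h\<close>; lower semicontinuity and
  measurability of \<open>maximal\<close> follow, and the balls in the union are those fed to the
  covering lemma.\<close>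

lemma maximal_superlevel:
  fixes h :: "'a::euclidean_space \<Rightarrow> ennreal"
  shows "{x. maximal h x > c} = (\<Union>(y, r)\<in>{(y, r). r > 0 \<and> (\<integral>\<^sup>+z\<in>ball y r. h z \<partial>lborel) > ennreal (unit_ball_vol (real DIM('a)) * r ^ DIM('a)) * c}. ball y r)"
proof -
  have *: "a / ennreal (unit_ball_vol (real DIM('a)) * r ^ DIM('a)) > c
      \<longleftrightarrow> a > ennreal (unit_ball_vol (real DIM('a)) * r ^ DIM('a)) * c" if "r > 0" for a and r :: real
  proof -
    have "unit_ball_vol (real DIM('a)) * r ^ DIM('a) > 0" using that by simp
    from ennreal_divide_le_iff[OF this, of a c] show ?thesis by (simp only: not_le[symmetric])
  qed
  have "c < maximal h x \<longleftrightarrow> (\<exists>y r. r > 0 \<and> x \<in> ball y r \<and>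
      (\<integral>\<^sup>+z\<in>ball y r. h z \<partial>lborel) > ennreal (unit_ball_vol (real DIM('a)) * r ^ DIM('a)) * c)" for x
    unfolding maximal_def less_SUP_iff using * by auto
  then show ?thesis by auto blast
qed

lemma open_maximal_superlevel: "open {x. maximal h x > c}"
  unfolding maximal_superlevel by (intro open_UN) auto

lemma maximal_measurable[measurable]: "maximal h \<in> borel_measurable borel"
  by (rule borel_measurableI_greater) (simp add: open_maximal_superlevel borel_open)

lemma emeasure_UN_countable_le:
  assumes "countable I" "\<And>i. i \<in> I \<Longrightarrow> X i \<in> sets M"
  shows "emeasure M (\<Union>i\<in>I. X i) \<le> (\<integral>\<^sup>+i. emeasure M (X i) \<partial>count_space I)"
proof -
  have U: "(\<Union>i\<in>I. X i) \<in> sets M" using assms by (intro sets.countable_UN') auto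
  have "emeasure M (\<Union>i\<in>I. X i) = (\<integral>\<^sup>+x. indicator (\<Union>i\<in>I. X i) x \<partial>M)"
    using U by simp
  also have "\<dots> \<le> (\<integral>\<^sup>+x. (\<integral>\<^sup>+i. indicator (X i) x \<partial>count_space I) \<partial>M)"
  proof (rule nn_integral_mono)
    fix x
    show "indicator (\<Union>i\<in>I. X i) x \<le> (\<integral>\<^sup>+i. (indicator (X i) x :: ennreal) \<partial>count_space I)"
    proof (cases "x \<in> (\<Union>i\<in>I. X i)")
      case True
      then obtain j where j: "j \<in> I" "x \<in> X j" by auto
      then have "1 = (\<integral>\<^sup>+i. indicator {j} i \<partial>count_space I)" by simp
      also have "\<dots> \<le> (\<integral>\<^sup>+i. (indicator (X i) x :: ennreal) \<partial>count_space I)"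
        by (rule nn_integral_mono) (use j in \<open>auto simp: indicator_def\<close>)
      finally show ?thesis using True by simp
    qed simp
  qed
  also have "\<dots> = (\<integral>\<^sup>+i. (\<integral>\<^sup>+x. indicator (X i) x \<partial>M) \<partial>count_space I)"
    by (rule nn_integral_count_space_nn_integral) (use assms in auto)
  also have "\<dots> = (\<integral>\<^sup>+i. emeasure M (X i) \<partial>count_space I)"
    by (rule nn_integral_cong) (use assms in auto)
  finally show ?thesis .
qed

text \<open>Vitali covering: the balls with large average contain a countable disjoint subfamily
  whose fivefold enlargements cover the superlevel set. On the disjoint balls the averages can be
  added up to at most the integral of \<open>h\<close>.\<close>

lemma maximal_weak_type_aux:
  fixes h :: "'a::euclidean_space \<Rightarrow> ennreal"
  assumes [measurable]: "h \<in> borel_measurable borel" and l: "l > 0"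
  shows "ennreal l * emeasure lborel {x. maximal h x > ennreal l} \<le> ennreal (5 ^ DIM('a)) * (\<integral>\<^sup>+x. h x \<partial>lborel)"
proof (cases "(\<integral>\<^sup>+x. h x \<partial>lborel) = \<infinity>")
  case True
  then show ?thesis by (simp add: ennreal_mult_eq_top_iff)
next
  case False
  then obtain I where I: "I \<ge> 0" "(\<integral>\<^sup>+x. h x \<partial>lborel) = ennreal I" by (cases "(\<integral>\<^sup>+x. h x \<partial>lborel)") auto
  define V where "V = unit_ball_vol (real DIM('a))"
  have V: "V > 0" by (simp add: V_def)
  define n where "n = DIM('a)"
  have n: "n > 0" by (simp add: n_def)
  define K where "K = {(y::'a, r). r > 0 \<and> (\<integral>\<^sup>+z\<in>ball y r. h z \<partial>lborel) > ennreal (V * r ^ n) * ennreal l}"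
  have S: "{x. maximal h x > ennreal l} = (\<Union>i\<in>K. ball (fst i) (snd i))"
    unfolding maximal_superlevel K_def V_def n_def by (auto simp: case_prod_beta)
  \<comment> \<open>A large average over a ball of radius r forces V r^n l < I. As r \<le> r^n holds
    only from r = 1 on, the common bound for the radii contains a 1.\<close>
  have rb: "0 < snd i \<and> snd i \<le> max 1 (I / (V * l))" if "i \<in> K" for i
  proof -
    obtain y r where i: "i = (y, r)" by fastforce
    have r: "r > 0" "ennreal (V * r ^ n) * ennreal l < (\<integral>\<^sup>+z\<in>ball y r. h z \<partial>lborel)" using that by (auto simp: K_def i)
    have "(\<integral>\<^sup>+z\<in>ball y r. h z \<partial>lborel) \<le> (\<integral>\<^sup>+z. h z \<partial>lborel)"
      by (rule nn_integral_mono) (auto simp: indicator_def)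
    then have "ennreal (V * r ^ n * l) < ennreal I"
      using r V l I by (simp add: ennreal_mult less_le_trans)
    then have *: "V * r ^ n * l < I" using I by (metis ennreal_less_iff V l r(1) less_imp_le mult_nonneg_nonneg zero_le_power)
    have "r \<le> max 1 (I / (V * l))"
    proof (cases "r \<le> 1")
      case False
      then have "r \<le> r ^ n" using n self_le_power[of r n] by simp
      also have "\<dots> \<le> I / (V * l)" using * V l by (simp add: field_simps)
      finally show ?thesis by simp
    qed simp
    then show ?thesis using r by (simp add: i)
  qed
  obtain C where C: "countable C" "C \<subseteq> K"
     "pairwise (\<lambda>i j. disjnt (ball (fst i) (snd i)) (ball (fst j) (snd j))) C"
     "{x. maximal h x > ennreal l} \<subseteq> (\<Union>i\<in>C. ball (fst i) (5 * snd i))"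
    using Vitali_covering_lemma_balls[of "{x. maximal h x > ennreal l}" fst snd K "max 1 (I / (V * l))"] S rb by auto
  have disj: "disjoint_family_on (\<lambda>i. ball (fst i) (snd i)) C"
    using C(3) by (auto simp: disjoint_family_on_def pairwise_def disjnt_def)
  have "ennreal l * emeasure lborel {x. maximal h x > ennreal l} \<le> ennreal l * emeasure lborel (\<Union>i\<in>C. ball (fst i) (5 * snd i))"
    by (intro mult_left_mono emeasure_mono C(4)) (auto intro!: borel_open open_UN)
  also have "\<dots> \<le> ennreal l * (\<integral>\<^sup>+i. emeasure lborel (ball (fst i) (5 * snd i)) \<partial>count_space C)"
    by (intro mult_left_mono emeasure_UN_countable_le C) auto
  also have "\<dots> = (\<integral>\<^sup>+i. ennreal l * emeasure lborel (ball (fst i) (5 * snd i)) \<partial>count_space C)"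
    by (rule nn_integral_cmult[symmetric]) auto
  also have "\<dots> \<le> (\<integral>\<^sup>+i. ennreal (5 ^ n) * emeasure (density lborel h) (ball (fst i) (snd i)) \<partial>count_space C)"
  proof (rule nn_integral_mono)
    fix i assume "i \<in> space (count_space C)"
    then have iK: "i \<in> K" using C(2) by auto
    obtain y r where i: "i = (y, r)" by fastforce
    have r: "r > 0" "ennreal (V * r ^ n) * ennreal l < (\<integral>\<^sup>+z\<in>ball y r. h z \<partial>lborel)" using iK by (auto simp: K_def i)
    have "ennreal l * emeasure lborel (ball (fst i) (5 * snd i)) = ennreal (5 ^ n) * (ennreal (V * r ^ n) * ennreal l)"
      using r(1) V l emeasure_ball_eq[of "5 * r" y] by (simp add: i V_def n_def power_mult_distrib mult_ac flip: ennreal_mult)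
    also have "\<dots> \<le> ennreal (5 ^ n) * (\<integral>\<^sup>+z\<in>ball y r. h z \<partial>lborel)"
      using r(2) by (intro mult_left_mono) auto
    finally show "ennreal l * emeasure lborel (ball (fst i) (5 * snd i)) \<le> ennreal (5 ^ n) * emeasure (density lborel h) (ball (fst i) (snd i))"
      by (simp add: i emeasure_density)
  qed
  also have "\<dots> = ennreal (5 ^ n) * (\<integral>\<^sup>+i. emeasure (density lborel h) (ball (fst i) (snd i)) \<partial>count_space C)"
    by (rule nn_integral_cmult) auto
  also have "(\<integral>\<^sup>+i. emeasure (density lborel h) (ball (fst i) (snd i)) \<partial>count_space C) = emeasure (density lborel h) (\<Union>i\<in>C. ball (fst i) (snd i))"
    by (rule emeasure_UN_countable[symmetric]) (use C disj in auto)
  also have "\<dots> \<le> emeasure (density lborel h) (space (density lborel h))" by (rule emeasure_space)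
  also have "\<dots> = (\<integral>\<^sup>+x. h x \<partial>lborel)" by (simp add: emeasure_density)
  finally show ?thesis by (simp add: n_def mult_left_mono)
qed

text \<open>The part of \<open>h\<close> below l / 2 raises the maximal function by at most l / 2,
  so the part above l / 2 must account for the other half. This truncated form is what matches the
  linear term of \<open>marcinkiewicz_weight\<close>.\<close>

lemma maximal_weak_type:
  fixes h :: "'a::euclidean_space \<Rightarrow> ennreal"
  assumes [measurable]: "h \<in> borel_measurable borel" and l: "l > 0"
  shows "ennreal l * emeasure lborel {x. maximal h x > ennreal l}
    \<le> ennreal (2 * 5 ^ DIM('a)) * (\<integral>\<^sup>+x. h x * indicator {x. h x > ennreal (l / 2)} x \<partial>lborel)"
proof -
  define h1 where "h1 = (\<lambda>x. h x * indicator {x. h x > ennreal (l / 2)} x)"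
  have [measurable]: "h1 \<in> borel_measurable borel" unfolding h1_def by measurable
  define V where "V = unit_ball_vol (real DIM('a))"
  have V: "V > 0" by (simp add: V_def)
  have le: "maximal h x \<le> maximal h1 x + ennreal (l / 2)" for x
    unfolding maximal_def[of h]
  proof (rule SUP_least, clarify)
    fix y :: 'a and r :: real assume r: "r > 0" "x \<in> ball y r"
    have "(\<integral>\<^sup>+z\<in>ball y r. h z \<partial>lborel) \<le> (\<integral>\<^sup>+z. h1 z * indicator (ball y r) z + ennreal (l / 2) * indicator (ball y r) z \<partial>lborel)"
      by (rule nn_integral_mono) (auto simp: h1_def indicator_def)
    also have "\<dots> = (\<integral>\<^sup>+z\<in>ball y r. h1 z \<partial>lborel) + ennreal (l / 2) * emeasure lborel (ball y r)"
      by (subst nn_integral_add) (auto simp: nn_integral_cmult_indicator intro!: borel_measurable_times_ennreal borel_measurable_indicator)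
    also have "\<dots> \<le> ennreal (V * r ^ DIM('a)) * maximal h1 x + ennreal (l / 2) * ennreal (V * r ^ DIM('a))"
      unfolding V_def using r ball_integral_le_maximal[OF r, of h1] by (intro add_mono mult_left_mono) (auto simp: emeasure_ball_eq)
    also have "\<dots> = ennreal (V * r ^ DIM('a)) * (maximal h1 x + ennreal (l / 2))"
      by (simp add: distrib_left mult.commute)
    finally show "(\<integral>\<^sup>+z\<in>ball y r. h z \<partial>lborel) / ennreal (unit_ball_vol (real DIM('a)) * r ^ DIM('a)) \<le> maximal h1 x + ennreal (l / 2)"
      using r V unfolding V_def by (subst ennreal_divide_le_iff) auto
  qed
  have sub: "{x. maximal h x > ennreal l} \<subseteq> {x. maximal h1 x > ennreal (l / 2)}"
  proof clarify
    fix x assume "ennreal l < maximal h x"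
    show "ennreal (l / 2) < maximal h1 x"
    proof (rule ccontr)
      assume "\<not> ennreal (l / 2) < maximal h1 x"
      then have "maximal h x \<le> ennreal (l / 2) + ennreal (l / 2)"
        using le[of x] by (meson add_right_mono not_less order_trans)
      also have "\<dots> = ennreal l" using l by (simp flip: ennreal_plus)
      finally show False using \<open>ennreal l < maximal h x\<close> by simp
    qed
  qed
  have "ennreal l * emeasure lborel {x. maximal h x > ennreal l} \<le> ennreal l * emeasure lborel {x. maximal h1 x > ennreal (l / 2)}"
    by (intro mult_left_mono emeasure_mono sub) (auto intro!: borel_open open_maximal_superlevel)
  also have "\<dots> = 2 * (ennreal (l / 2) * emeasure lborel {x. maximal h1 x > ennreal (l / 2)})"
  proof -
    have "ennreal l = 2 * ennreal (l / 2)"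
      using l ennreal_mult[of 2 "l / 2"] by simp
    then show ?thesis by (simp add: mult.assoc)
  qed
  also have "\<dots> \<le> 2 * (ennreal (5 ^ DIM('a)) * (\<integral>\<^sup>+x. h1 x \<partial>lborel))"
    using l by (intro mult_left_mono maximal_weak_type_aux) auto
  finally show ?thesis by (simp add: h1_def ennreal_mult mult.assoc)
qed

subsection \<open>Interpolation\<close>

lemma mono_ennreal_measurable:
  fixes F :: "real \<Rightarrow> ennreal"
  assumes "mono F"
  shows "F \<in> borel_measurable borel"
proof (rule borel_measurableI_greater)
  fix c
  have "is_interval {x. c < F x}"
    unfolding is_interval_1 using assms by (auto simp: mono_def intro: less_le_trans)
  then show "{x \<in> space borel. c < F x} \<in> sets borel"
    using real_interval_borel_measurable by simp
qed

lemma antimono_ennreal_measurable: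
  fixes F :: "real \<Rightarrow> ennreal"
  assumes "antimono F"
  shows "F \<in> borel_measurable borel"
proof (rule borel_measurableI_greater)
  fix c
  have "is_interval {x. c < F x}"
    unfolding is_interval_1 using assms by (auto simp: antimono_def intro: less_le_trans)
  then show "{x \<in> space borel. c < F x} \<in> sets borel"
    using real_interval_borel_measurable by simp
qed

text \<open>Nothing is known about \<Phi> at negative arguments; composition with max 0 is monotone
  on the whole line.\<close>

lemma mono_nonneg_measurable:
  fixes \<Phi> :: "real \<Rightarrow> ennreal"
  assumes mono: "\<And>a b. 0 \<le> a \<Longrightarrow> a \<le> b \<Longrightarrow> \<Phi> a \<le> \<Phi> b"
    and [measurable]: "u \<in> borel_measurable M" and u: "\<And>x. u x \<ge> 0"
  shows "(\<lambda>x. \<Phi> (u x)) \<in> borel_measurable M"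
proof -
  have "mono (\<lambda>x. \<Phi> (max 0 x))" by (auto simp: mono_def intro!: mono)
  then have [measurable]: "(\<lambda>x. \<Phi> (max 0 x)) \<in> borel_measurable borel" by (rule mono_ennreal_measurable)
  have "(\<lambda>x. \<Phi> (max 0 (u x))) \<in> borel_measurable M" by measurable
  then show ?thesis using u by (simp add: max_def)
qed

text \<open>What strong type q for the part of a function below l and weak type 1 for the large part
  contribute to a distribution function at height l. The linear term starts at l / 4 because the
  height is halved once for splitting into good and bad part and once in
  \<open>maximal_weak_type\<close>.\<close>

definition marcinkiewicz_weight :: "real \<Rightarrow> real \<Rightarrow> real \<Rightarrow> real" where
  "marcinkiewicz_weight q l s = (if s \<le> l then l powr (- q) * s powr q else 0) + (if l / 4 < s then s / l else 0)"

lemma marcinkiewicz_weight_nonneg: "l > 0 \<Longrightarrow> s \<ge> 0 \<Longrightarrow> marcinkiewicz_weight q l s \<ge> 0"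
  by (simp add: marcinkiewicz_weight_def)

lemma ennreal_mult_reassoc: "a \<ge> 0 \<Longrightarrow> ennreal a * c * ennreal b = c * ennreal (a * b)"
  by (simp add: ennreal_mult' mult_ac)

text \<open>For l \<ge> s the upper type gives \<Phi>(2 l) \<le> C1 (2 l / s)^p1 \<Phi>(s), and the
  remaining power l^(p1 - q - 1) is integrable at infinity as p1 < q. For l < 4 s the argument 2 l
  is the fraction l / (4 s) of 8 s, so the lower type gives the power l^(p0 - 2), integrable at 0 as
  p0 > 1, and the upper type returns from 8 s to s.\<close>

lemma nn_integral_marcinkiewicz_weight:
  fixes \<Phi> :: "real \<Rightarrow> ennreal"
  assumes mono: "\<And>a b. 0 \<le> a \<Longrightarrow> a \<le> b \<Longrightarrow> \<Phi> a \<le> \<Phi> b"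
    and low: "\<And>t s. t \<in> {0..1} \<Longrightarrow> s \<ge> 0 \<Longrightarrow> \<Phi> (s * t) \<le> ennreal (C0 * t powr p0) * \<Phi> s" and "C0 > 0"
    and up: "\<And>t s. t \<ge> 1 \<Longrightarrow> s \<ge> 0 \<Longrightarrow> \<Phi> (s * t) \<le> ennreal (C1 * t powr p1) * \<Phi> s" and "C1 > 0"
    and p: "1 < p0" "p1 < q" and s: "s \<ge> 0"
  shows "(\<integral>\<^sup>+l\<in>{0<..}. \<Phi> (2 * l) * ennreal (marcinkiewicz_weight q l s / l) \<partial>lborel)
    \<le> ennreal (C1 * 2 powr p1 / (q - p1) + C0 * C1 * 8 powr p1 / (4 * (p0 - 1))) * \<Phi> s"
proof (cases "s = 0")
  case True
  then have "(\<integral>\<^sup>+l\<in>{0<..}. \<Phi> (2 * l) * ennreal (marcinkiewicz_weight q l s / l) \<partial>lborel) = (\<integral>\<^sup>+l. 0 \<partial>(lborel::real measure))"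
    by (intro nn_integral_cong) (auto simp: marcinkiewicz_weight_def indicator_def)
  then show ?thesis by simp
next
  case False
  then have s: "s > 0" using s by simp
  define E1 where "E1 = C1 * 2 powr p1 * s powr (q - p1)"
  define E2 where "E2 = C0 * C1 * 8 powr p1 * s * (4 * s) powr (- p0)"
  have E: "E1 \<ge> 0" "E2 \<ge> 0" using assms s by (auto simp: E1_def E2_def)
  have "(\<integral>\<^sup>+l\<in>{0<..}. \<Phi> (2 * l) * ennreal (marcinkiewicz_weight q l s / l) \<partial>lborel)
     \<le> (\<integral>\<^sup>+l. \<Phi> s * (ennreal E1 * (ennreal (l powr (- (q - p1) - 1)) * indicator {s..} l) +
         ennreal E2 * (ennreal (l powr ((p0 - 1) - 1)) * indicator {0..4 * s} l)) \<partial>lborel)"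
  proof (rule nn_integral_mono)
    fix l :: real
    show "\<Phi> (2 * l) * ennreal (marcinkiewicz_weight q l s / l) * indicator {0<..} l
      \<le> \<Phi> s * (ennreal E1 * (ennreal (l powr (- (q - p1) - 1)) * indicator {s..} l) +
         ennreal E2 * (ennreal (l powr ((p0 - 1) - 1)) * indicator {0..4 * s} l))"
    proof (cases "l > 0")
      case False
      then show ?thesis by simp
    next
      case l: True
      have 1: "\<Phi> (2 * l) * ennreal ((if s \<le> l then l powr (- q) * s powr q else 0) / l)
         \<le> \<Phi> s * (ennreal E1 * (ennreal (l powr (- (q - p1) - 1)) * indicator {s..} l))"
      proof (cases "s \<le> l")
        case True
        have "\<Phi> (2 * l) \<le> ennreal (C1 * (2 * l / s) powr p1) * \<Phi> s"
          using up[of "2 * l / s" s] True s l by simp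
        then have "\<Phi> (2 * l) * ennreal (l powr (- q) * s powr q / l) \<le> ennreal (C1 * (2 * l / s) powr p1) * \<Phi> s * ennreal (l powr (- q) * s powr q / l)"
          by (rule mult_right_mono) simp
        also have "\<dots> = \<Phi> s * ennreal (C1 * (2 * l / s) powr p1 * (l powr (- q) * s powr q / l))"
          using \<open>C1 > 0\<close> by (simp only: ennreal_mult_reassoc mult_nonneg_nonneg less_imp_le powr_ge_zero)
        also have "C1 * (2 * l / s) powr p1 * (l powr (- q) * s powr q / l) = E1 * l powr (- (q - p1) - 1)"
          using l s by (simp add: E1_def powr_mult powr_divide powr_diff powr_minus powr_add field_simps)
        finally show ?thesis using True E by (simp add: ennreal_mult)
      qed simp
      have 2: "\<Phi> (2 * l) * ennreal ((if l / 4 < s then s / l else 0) / l)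
         \<le> \<Phi> s * (ennreal E2 * (ennreal (l powr ((p0 - 1) - 1)) * indicator {0..4 * s} l))"
      proof (cases "l / 4 < s")
        case True
        have "\<Phi> (2 * l) \<le> ennreal (C0 * (l / (4 * s)) powr p0) * \<Phi> (8 * s)"
          using low[of "l / (4 * s)" "8 * s"] True s l by (simp add: field_simps)
        also have "\<dots> \<le> ennreal (C0 * (l / (4 * s)) powr p0) * (ennreal (C1 * 8 powr p1) * \<Phi> s)"
          using up[of 8 s] s by (intro mult_left_mono) (auto simp: mult.commute)
        finally have "\<Phi> (2 * l) * ennreal (s / l / l) \<le> ennreal (C0 * (l / (4 * s)) powr p0) * (ennreal (C1 * 8 powr p1) * \<Phi> s) * ennreal (s / l / l)"
          by (rule mult_right_mono) simp
        also have "\<dots> = \<Phi> s * ennreal (C0 * (l / (4 * s)) powr p0 * (C1 * 8 powr p1) * (s / l / l))"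
          unfolding mult.assoc[of "ennreal (C0 * (l / (4 * s)) powr p0)" "ennreal (C1 * 8 powr p1)" "\<Phi> s", symmetric]
          using \<open>C1 > 0\<close> \<open>C0 > 0\<close>
          by (simp only: ennreal_mult[symmetric] ennreal_mult_reassoc mult_nonneg_nonneg less_imp_le powr_ge_zero)
        also have "C0 * (l / (4 * s)) powr p0 * (C1 * 8 powr p1) * (s / l / l) = E2 * l powr ((p0 - 1) - 1)"
          using l s by (simp add: E2_def powr_mult powr_divide powr_diff powr_minus powr_add power2_eq_square field_simps)
        finally show ?thesis using True E l by (simp add: ennreal_mult)
      qed simp
      have "ennreal (marcinkiewicz_weight q l s / l) = ennreal ((if s \<le> l then l powr (- q) * s powr q else 0) / l) + ennreal ((if l / 4 < s then s / l else 0) / l)"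
        using l s by (simp add: marcinkiewicz_weight_def add_divide_distrib)
      then show ?thesis using add_mono[OF 1 2] l by (simp add: distrib_left)
    qed
  qed
  also have "\<dots> = \<Phi> s * (ennreal E1 * ennreal (s powr (- (q - p1)) / (q - p1)) + ennreal E2 * ennreal ((4 * s) powr (p0 - 1) / (p0 - 1)))"
    using nn_integral_powr_atLeast[of "q - p1" s] nn_integral_powr_from_0[of "p0 - 1" "4 * s"] p s
    by (simp add: nn_integral_cmult nn_integral_add del: diff_minus_eq_add minus_diff_eq)
  also have "\<dots> = \<Phi> s * ennreal (E1 * (s powr (- (q - p1)) / (q - p1)) + E2 * ((4 * s) powr (p0 - 1) / (p0 - 1)))"
    using E p by (simp flip: ennreal_mult ennreal_plus)
  also have "E1 * (s powr (- (q - p1)) / (q - p1)) + E2 * ((4 * s) powr (p0 - 1) / (p0 - 1)) = C1 * 2 powr p1 / (q - p1) + C0 * C1 * 8 powr p1 / (4 * (p0 - 1))"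
  proof -
    have "E1 * s powr (- (q - p1)) = C1 * 2 powr p1" using s by (simp add: E1_def flip: powr_add)
    moreover have "E2 * (4 * s) powr (p0 - 1) = C0 * C1 * 8 powr p1 / 4"
      using s by (simp add: E2_def powr_minus powr_diff field_simps)
    ultimately show ?thesis unfolding times_divide_eq_right by (simp only: divide_divide_eq_left)
  qed
  finally show ?thesis by (simp add: mult.commute)
qed

text \<open>On the interval F l \<ge> c / l \<ge> c / u, and its length is u / 2.\<close>

lemma nn_integral_inverse_interval:
  assumes "u > 0" "\<And>l. u / 2 \<le> l \<Longrightarrow> l < u \<Longrightarrow> c \<le> F l * ennreal l"
  shows "c \<le> 2 * (\<integral>\<^sup>+l\<in>{u / 2..<u}. F l \<partial>lborel)"
proof -
  have "c = 2 * (\<integral>\<^sup>+l\<in>{u / 2..<u}. c * ennreal (1 / u) \<partial>lborel)"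
  proof -
    have "(\<integral>\<^sup>+l\<in>{u / 2..<u}. c * ennreal (1 / u) \<partial>lborel) = c * (ennreal (1 / u) * ennreal (u / 2))"
      using assms(1) by (subst nn_integral_cmult_indicator) (auto simp: mult.assoc)
    also have "ennreal (1 / u) * ennreal (u / 2) = ennreal (1 / 2)"
      using assms(1) by (simp flip: ennreal_mult)
    finally have "2 * (\<integral>\<^sup>+l\<in>{u / 2..<u}. c * ennreal (1 / u) \<partial>lborel) = c * (ennreal 2 * ennreal (1 / 2))"
      by (simp add: mult_ac)
    also have "ennreal 2 * ennreal (1 / 2) = ennreal (2 * (1 / 2))" by (rule ennreal_mult[symmetric]) auto
    finally show ?thesis by simp
  qed
  also have "\<dots> \<le> 2 * (\<integral>\<^sup>+l\<in>{u / 2..<u}. F l \<partial>lborel)"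
  proof (intro mult_left_mono nn_integral_mono)
    fix l :: real
    show "c * ennreal (1 / u) * indicator {u / 2..<u} l \<le> F l * indicator {u / 2..<u} l"
    proof (cases "l \<in> {u / 2..<u}")
      case True
      then have l: "l > 0" using assms(1) by auto
      have "c * ennreal (1 / u) \<le> F l * ennreal l * ennreal (1 / l)"
        using True l assms by (intro mult_mono ennreal_leI divide_left_mono) auto
      also have "\<dots> = F l" using l by (simp add: mult.assoc flip: ennreal_mult)
      finally show ?thesis using True by simp
    qed simp
  qed simp
  finally show ?thesis .
qed

text \<open>A layer-cake argument in which \<Phi>(2 l) dl / l takes the place of the derivative of
  \<Phi>: its integral over l < h x is at least \<Phi>(h x) / 2, already because of l between h x /
  2 and h x. The distribution inequality, Tonelli and
  \<open>nn_integral_marcinkiewicz_weight\<close> bound the integral over x. As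
  \<open>enn2real\<close> sends infinity to 0, finiteness of \<open>h\<close> almost everywhere is a
  conclusion of its own.\<close>

theorem marcinkiewicz_modular:
  fixes \<Phi> :: "real \<Rightarrow> ennreal"
  assumes mono: "\<And>a b. 0 \<le> a \<Longrightarrow> a \<le> b \<Longrightarrow> \<Phi> a \<le> \<Phi> b"
    and zero: "\<Phi> 0 = 0" and inf: "(\<Phi> \<longlongrightarrow> \<infinity>) at_top"
    and low: "lower_type p0 \<Phi>" and up: "upper_type p1 \<Phi>"
    and p: "1 < p0" "p1 < q" and B: "B \<ge> 0"
  obtains D where "D > 0"
    "\<And>(h :: 'a::euclidean_space \<Rightarrow> ennreal) (f :: 'a \<Rightarrow> real). h \<in> borel_measurable borel \<Longrightarrow> f \<in> borel_measurable borel \<Longrightarrow>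
      (\<And>x. f x \<ge> 0) \<Longrightarrow>
      (\<And>l. l > 0 \<Longrightarrow> emeasure lborel {x. h x > ennreal l} \<le> ennreal B * (\<integral>\<^sup>+x. ennreal (marcinkiewicz_weight q l (f x)) \<partial>lborel)) \<Longrightarrow>
      (\<integral>\<^sup>+x. \<Phi> (enn2real (h x)) \<partial>lborel) \<le> ennreal D * (\<integral>\<^sup>+x. \<Phi> (f x) \<partial>lborel) \<and>
      ((\<integral>\<^sup>+x. \<Phi> (f x) \<partial>lborel) < \<infinity> \<longrightarrow> (AE x in lborel. h x < \<infinity>))"
proof -
  obtain C0 where C0: "C0 > 0" "\<And>t s. t \<in> {0..1} \<Longrightarrow> s \<ge> 0 \<Longrightarrow> \<Phi> (s * t) \<le> ennreal (C0 * t powr p0) * \<Phi> s"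
    using low by (auto simp: lower_type_def)
  obtain C1 where C1: "C1 > 0" "\<And>t s. t \<ge> 1 \<Longrightarrow> s \<ge> 0 \<Longrightarrow> \<Phi> (s * t) \<le> ennreal (C1 * t powr p1) * \<Phi> s"
    using up by (auto simp: upper_type_def)
  define E where "E = C1 * 2 powr p1 / (q - p1) + C0 * C1 * 8 powr p1 / (4 * (p0 - 1))"
  have E: "E > 0" unfolding E_def using C0(1) C1(1) p by (intro add_pos_pos divide_pos_pos mult_pos_pos) auto
  \<comment> \<open>The summand 1 keeps \<open>D\<close> positive when B = 0.\<close>
  define D where "D = 2 * B * E + 1"
  show thesis
  proof (rule that[of D])
    show "D > 0" using B E by (simp add: D_def add_nonneg_pos)
    fix h :: "'a \<Rightarrow> ennreal" and f :: "'a \<Rightarrow> real"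
    assume hm[measurable]: "h \<in> borel_measurable borel" and fm[measurable]: "f \<in> borel_measurable borel"
      and f0: "\<And>x. f x \<ge> 0"
      and weak: "\<And>l. l > 0 \<Longrightarrow> emeasure lborel {x. h x > ennreal l} \<le> ennreal B * (\<integral>\<^sup>+x. ennreal (marcinkiewicz_weight q l (f x)) \<partial>lborel)"
    have Pm[measurable]: "(\<lambda>l. \<Phi> (2 * max 0 l)) \<in> borel_measurable borel"
      by (rule mono_nonneg_measurable) (auto intro: mono)
    define Q where "Q = (\<lambda>l. \<Phi> (2 * max 0 l) * ennreal (1 / l) * indicator {0<..} l)"
    have [measurable]: "Q \<in> borel_measurable borel" unfolding Q_def by measurable
    \<comment> \<open>The substitute for \<Phi>(h x), finite or infinite, in which the heights l can
      be integrated separately.\<close>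
    define T where "T = (\<lambda>x. \<integral>\<^sup>+l. Q l * indicator {l. h x > ennreal l} l \<partial>lborel)"
    have Tm: "(\<lambda>(x, l). Q l * indicator {l. h x > ennreal l} l) \<in> borel_measurable (borel \<Otimes>\<^sub>M borel)"
    proof -
      have "(\<lambda>(x, l). Q l * (if h x > ennreal l then 1 else 0)) \<in> borel_measurable (borel \<Otimes>\<^sub>M borel)" by measurable
      moreover have "(\<lambda>(x, l). Q l * (if h x > ennreal l then 1 else 0)) = (\<lambda>(x, l). Q l * indicator {l. h x > ennreal l} l)"
        by (auto simp: indicator_def fun_eq_iff)
      ultimately show ?thesis by simp
    qed
    have [measurable]: "T \<in> borel_measurable lborel"
      unfolding T_def using Tm by (intro lborel.borel_measurable_nn_integral) simp
    have "(\<integral>\<^sup>+x. T x \<partial>lborel) = (\<integral>\<^sup>+l. (\<integral>\<^sup>+x. Q l * indicator {l. h x > ennreal l} l \<partial>lborel) \<partial>lborel)"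
      unfolding T_def by (rule lborel_pair.Fubini') (use Tm in \<open>simp add: case_prod_beta'\<close>)
    also have "\<dots> = (\<integral>\<^sup>+l. Q l * emeasure lborel {x. h x > ennreal l} \<partial>lborel)"
    proof (rule nn_integral_cong)
      fix l
      have "(\<integral>\<^sup>+x. Q l * indicator {l. h x > ennreal l} l \<partial>lborel) = (\<integral>\<^sup>+x. Q l * indicator {x. h x > ennreal l} x \<partial>lborel)"
        by (intro nn_integral_cong) (auto simp: indicator_def)
      then show "(\<integral>\<^sup>+x. Q l * indicator {l. h x > ennreal l} l \<partial>lborel) = Q l * emeasure lborel {x. h x > ennreal l}"
        by (simp add: nn_integral_cmult_indicator)
    qed
    also have "\<dots> \<le> (\<integral>\<^sup>+l. Q l * (ennreal B * (\<integral>\<^sup>+x. ennreal (marcinkiewicz_weight q l (f x)) \<partial>lborel)) \<partial>lborel)"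
    proof (rule nn_integral_mono)
      fix l :: real
      show "Q l * emeasure lborel {x. h x > ennreal l} \<le> Q l * (ennreal B * (\<integral>\<^sup>+x. ennreal (marcinkiewicz_weight q l (f x)) \<partial>lborel))"
        using weak[of l] by (cases "l > 0") (auto intro!: mult_left_mono simp: Q_def)
    qed
    also have "\<dots> = (\<integral>\<^sup>+l. ennreal B * (\<integral>\<^sup>+x. Q l * ennreal (marcinkiewicz_weight q l (f x)) \<partial>lborel) \<partial>lborel)"
      unfolding marcinkiewicz_weight_def by (intro nn_integral_cong, subst nn_integral_cmult) (auto simp: mult_ac)
    also have "\<dots> = ennreal B * (\<integral>\<^sup>+l. (\<integral>\<^sup>+x. Q l * ennreal (marcinkiewicz_weight q l (f x)) \<partial>lborel) \<partial>lborel)"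
      unfolding marcinkiewicz_weight_def by (rule nn_integral_cmult) measurable
    also have "(\<integral>\<^sup>+l. (\<integral>\<^sup>+x. Q l * ennreal (marcinkiewicz_weight q l (f x)) \<partial>lborel) \<partial>lborel) =
      (\<integral>\<^sup>+x. (\<integral>\<^sup>+l. Q l * ennreal (marcinkiewicz_weight q l (f x)) \<partial>lborel) \<partial>lborel)"
      unfolding marcinkiewicz_weight_def by (rule lborel_pair.Fubini'[symmetric]) measurable
    also have "\<dots> \<le> (\<integral>\<^sup>+x. ennreal E * \<Phi> (f x) \<partial>lborel)"
    proof (rule nn_integral_mono)
      fix x
      have "(\<integral>\<^sup>+l. Q l * ennreal (marcinkiewicz_weight q l (f x)) \<partial>lborel) =
        (\<integral>\<^sup>+l\<in>{0<..}. \<Phi> (2 * l) * ennreal (marcinkiewicz_weight q l (f x) / l) \<partial>lborel)"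
      proof (rule nn_integral_cong)
        fix l :: real
        show "Q l * ennreal (marcinkiewicz_weight q l (f x)) = \<Phi> (2 * l) * ennreal (marcinkiewicz_weight q l (f x) / l) * indicator {0<..} l"
        proof (cases "l > 0")
          case True
          then show ?thesis using marcinkiewicz_weight_nonneg[OF True f0[of x], of q]
            by (simp add: Q_def mult.assoc flip: ennreal_mult)
        qed (simp add: Q_def)
      qed
      also have "\<dots> \<le> ennreal E * \<Phi> (f x)"
        unfolding E_def by (rule nn_integral_marcinkiewicz_weight[OF mono C0(2,1) C1(2,1) p f0])
      finally show "(\<integral>\<^sup>+l. Q l * ennreal (marcinkiewicz_weight q l (f x)) \<partial>lborel) \<le> ennreal E * \<Phi> (f x)" .
    qed
    also have "(\<integral>\<^sup>+x. ennreal E * \<Phi> (f x) \<partial>lborel) = ennreal E * (\<integral>\<^sup>+x. \<Phi> (f x) \<partial>lborel)"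
      by (rule nn_integral_cmult) (use mono_nonneg_measurable[OF mono fm f0] in simp)
    finally have T: "(\<integral>\<^sup>+x. T x \<partial>lborel) \<le> ennreal B * (ennreal E * (\<integral>\<^sup>+x. \<Phi> (f x) \<partial>lborel))"
      by (simp add: mult_left_mono)
    have T_low: "\<Phi> u \<le> 2 * T x" if u: "u > 0" "ennreal u \<le> h x" for u x
    proof -
      have "\<Phi> u \<le> 2 * (\<integral>\<^sup>+l\<in>{u / 2..<u}. Q l \<partial>lborel)"
      proof (rule nn_integral_inverse_interval[OF u(1)])
        fix l assume l: "u / 2 \<le> l" "l < u"
        have "Q l * ennreal l = \<Phi> (2 * l)" using l u by (simp add: Q_def mult.assoc flip: ennreal_mult)
        then show "\<Phi> u \<le> Q l * ennreal l" using mono[of u "2 * l"] l u by simp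
      qed
      also have "\<dots> \<le> 2 * T x"
        unfolding T_def
      proof (rule mult_left_mono, rule nn_integral_mono)
        fix l show "Q l * indicator {u / 2..<u} l \<le> Q l * indicator {l. h x > ennreal l} l"
        proof (cases "l \<in> {u / 2..<u}")
          case True
          then have "ennreal l < ennreal u" using u by (simp add: ennreal_less_iff)
          then show ?thesis using u(2) True by (simp add: less_le_trans)
        qed simp
      qed simp
      finally show ?thesis .
    qed
    have "(\<integral>\<^sup>+x. \<Phi> (enn2real (h x)) \<partial>lborel) \<le> (\<integral>\<^sup>+x. 2 * T x \<partial>lborel)"
    proof (rule nn_integral_mono)
      fix x
      show "\<Phi> (enn2real (h x)) \<le> 2 * T x"
      proof (cases "enn2real (h x) > 0")
        case True
        then have "ennreal (enn2real (h x)) \<le> h x" by (cases "h x") auto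
        then show ?thesis by (rule T_low[OF True])
      next
        case False
        then have "enn2real (h x) = 0" using enn2real_nonneg[of "h x"] by linarith
        then show ?thesis using zero by simp
      qed
    qed
    also have "\<dots> = 2 * (\<integral>\<^sup>+x. T x \<partial>lborel)"
      by (rule nn_integral_cmult) measurable
    also have "\<dots> \<le> 2 * (ennreal B * (ennreal E * (\<integral>\<^sup>+x. \<Phi> (f x) \<partial>lborel)))"
      using T by (intro mult_left_mono) auto
    also have "\<dots> = ennreal (2 * B * E) * (\<integral>\<^sup>+x. \<Phi> (f x) \<partial>lborel)"
      using B E by (simp add: ennreal_mult mult.assoc)
    also have "\<dots> \<le> ennreal D * (\<integral>\<^sup>+x. \<Phi> (f x) \<partial>lborel)"
      by (intro mult_right_mono ennreal_leI) (auto simp: D_def)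
    finally have main: "(\<integral>\<^sup>+x. \<Phi> (enn2real (h x)) \<partial>lborel) \<le> ennreal D * (\<integral>\<^sup>+x. \<Phi> (f x) \<partial>lborel)" .
    \<comment> \<open>Where h x is infinite, T x is at least \<Phi>(u) / 2 for every u, hence
      infinite because \<Phi> is unbounded; but T is integrable.\<close>
    have fin: "AE x in lborel. h x < \<infinity>" if "(\<integral>\<^sup>+x. \<Phi> (f x) \<partial>lborel) < \<infinity>"
    proof -
      have "(\<integral>\<^sup>+x. T x \<partial>lborel) \<noteq> \<infinity>"
        using T that by (auto simp: top_unique ennreal_mult_eq_top_iff)
      then have ae: "AE x in lborel. T x \<noteq> \<infinity>" by (intro nn_integral_noteq_infinite) auto
      have top: "T x = \<infinity>" if "h x = \<infinity>" for x
      proof (rule ccontr)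
        assume "T x \<noteq> \<infinity>"
        then have "2 * T x < \<infinity>" by (simp add: ennreal_mult_less_top top.not_eq_extremum)
        then have "eventually (\<lambda>u. 2 * T x < \<Phi> u) at_top" using inf by (rule order_tendstoD(1)[rotated])
        then have "eventually (\<lambda>u. 2 * T x < \<Phi> u \<and> u > 0) at_top"
          using eventually_gt_at_top[of "0::real"] by eventually_elim simp
        then obtain u where "2 * T x < \<Phi> u" "u > 0" using eventually_happens'[OF trivial_limit_at_top_linorder] by blast
        then show False using T_low[of u x] that by simp
      qed
      from ae show ?thesis unfolding infinity_ennreal_def top.not_eq_extremum[symmetric] by eventually_elim (use top in \<open>force simp only: infinity_ennreal_def\<close>)
    qed
    show "(\<integral>\<^sup>+x. \<Phi> (enn2real (h x)) \<partial>lborel) \<le> ennreal D * (\<integral>\<^sup>+x. \<Phi> (f x) \<partial>lborel) \<and>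
      ((\<integral>\<^sup>+x. \<Phi> (f x) \<partial>lborel) < \<infinity> \<longrightarrow> (AE x in lborel. h x < \<infinity>))"
      using main fin by blast
  qed
qed

subsection \<open>Large even exponents\<close>

lemma emeasure_chain_le:
  assumes "countable I" "\<And>i. i \<in> I \<Longrightarrow> X i \<in> sets M"
    and chain: "\<And>i j. i \<in> I \<Longrightarrow> j \<in> I \<Longrightarrow> X i \<subseteq> X j \<or> X j \<subseteq> X i"
    and le: "\<And>i. i \<in> I \<Longrightarrow> emeasure M (X i) \<le> c"
  shows "emeasure M (\<Union>i\<in>I. X i) \<le> c"
proof (cases "I = {}")
  case False
  define f where "f = from_nat_into I"
  have f: "range f = I" unfolding f_def using False assms(1) by (rule range_from_nat_into)
  define U where "U = (\<lambda>k::nat. \<Union>j\<le>k. X (f j))"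
  \<comment> \<open>A finite union of members of a chain is itself a member, so the bound holds
    along the increasing exhaustion.\<close>
  have ex: "\<exists>i\<in>I. U k = X i" for k
  proof (induction k)
    case 0
    then show ?case using f by (auto simp: U_def)
  next
    case (Suc k)
    then obtain i where i: "i \<in> I" "U k = X i" by auto
    have "U (Suc k) = U k \<union> X (f (Suc k))" by (auto simp: U_def atMost_Suc)
    moreover have "f (Suc k) \<in> I" using f by auto
    ultimately show ?case using chain[OF i(1), of "f (Suc k)"] i by (metis Un_absorb1 Un_absorb2)
  qed
  have "(\<Union>i\<in>I. X i) = (\<Union>k. U k)" unfolding f[symmetric] U_def by auto
  also have "emeasure M (\<Union>k. U k) = (SUP k. emeasure M (U k))"
  proof (rule SUP_emeasure_incseq[symmetric])
    show "range U \<subseteq> sets M" using ex assms(2) by (metis image_subsetI)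
    show "incseq U" unfolding incseq_def U_def by (intro allI impI UN_mono) auto
  qed
  also have "\<dots> \<le> c" by (rule SUP_least) (use ex le in metis)
  finally show ?thesis .
qed simp

text \<open>X is a half-line unbounded to the left. The rational points q of X give closed
  half-lines that exhaust it except perhaps for its right end, which has measure 0.\<close>

lemma emeasure_left_le:
  fixes X :: "real set"
  assumes M: "sets M = sets borel" "\<And>x. emeasure M {x} = 0" and X: "X \<in> sets borel"
    and le: "\<And>t. t \<in> X \<Longrightarrow> emeasure M {..t} \<le> c"
    and down: "\<And>s t. t \<in> X \<Longrightarrow> s \<le> t \<Longrightarrow> s \<in> X"
  shows "emeasure M X \<le> c"
proof -
  define U where "U = (\<Union>q\<in>\<rat> \<inter> X. {..q})"
  have U: "emeasure M U \<le> c" unfolding U_def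
  proof (rule emeasure_chain_le)
    show "countable (\<rat> \<inter> X)" using countable_rat by (rule countable_subset[rotated]) auto
  qed (use M le in auto)
  have Um: "U \<in> sets borel" unfolding U_def
    by (intro sets.countable_UN'' countable_subset[OF _ countable_rat]) auto
  \<comment> \<open>Between two points of X lies a rational point of X, whose half-line contains the
    smaller one; so at most one point can be missed.\<close>
  have "\<exists>x. X - U \<subseteq> {x}"
  proof (cases "X - U = {}")
    case False
    then obtain x where x: "x \<in> X" "x \<notin> U" by auto
    have "y = x" if y: "y \<in> X" "y \<notin> U" for y
    proof (rule ccontr)
      assume "y \<noteq> x"
      then obtain u v where uv: "u < v" "u \<in> X" "v \<in> X" "u \<notin> U" using x y by (metis linorder_neqE)
      then obtain q where "q \<in> \<rat>" "u < q" "q < v" using Rats_dense_in_real by blast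
      then have "q \<in> \<rat> \<inter> X" "u \<in> {..q}" using uv down[of v q] by auto
      then have "u \<in> U" unfolding U_def by blast
      then show False using uv by simp
    qed
    then show ?thesis by blast
  qed blast
  then obtain x where x: "X - U \<subseteq> {x}" by blast
  have "emeasure M X \<le> emeasure M (U \<union> {x})" using x Um M by (intro emeasure_mono) auto
  also have "\<dots> \<le> emeasure M U + emeasure M {x}" using Um M by (intro emeasure_subadditive) auto
  finally show ?thesis using U M by simp
qed

lemma emeasure_right_le:
  fixes X :: "real set"
  assumes M: "sets M = sets borel" "\<And>x. emeasure M {x} = 0" and X: "X \<in> sets borel"
    and le: "\<And>t. t \<in> X \<Longrightarrow> emeasure M {t..} \<le> c"
    and up: "\<And>s t. t \<in> X \<Longrightarrow> t \<le> s \<Longrightarrow> s \<in> X"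
  shows "emeasure M X \<le> c"
proof -
  define U where "U = (\<Union>q\<in>\<rat> \<inter> X. {q..})"
  have U: "emeasure M U \<le> c" unfolding U_def
  proof (rule emeasure_chain_le)
    show "countable (\<rat> \<inter> X)" using countable_rat by (rule countable_subset[rotated]) auto
  qed (use M le in auto)
  have Um: "U \<in> sets borel" unfolding U_def
    by (intro sets.countable_UN'' countable_subset[OF _ countable_rat]) auto
  have "\<exists>x. X - U \<subseteq> {x}"
  proof (cases "X - U = {}")
    case False
    then obtain x where x: "x \<in> X" "x \<notin> U" by auto
    have "y = x" if y: "y \<in> X" "y \<notin> U" for y
    proof (rule ccontr)
      assume "y \<noteq> x"
      then obtain u v where uv: "u > v" "u \<in> X" "v \<in> X" "u \<notin> U" using x y by (metis linorder_neqE)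
      then obtain q where "q \<in> \<rat>" "v < q" "q < u" using Rats_dense_in_real by blast
      then have "q \<in> \<rat> \<inter> X" "u \<in> {q..}" using uv up[of v q] by auto
      then have "u \<in> U" unfolding U_def by blast
      then show False using uv by simp
    qed
    then show ?thesis by blast
  qed blast
  then obtain x where x: "X - U \<subseteq> {x}" by blast
  have "emeasure M X \<le> emeasure M (U \<union> {x})" using x Um M by (intro emeasure_mono) auto
  also have "\<dots> \<le> emeasure M U + emeasure M {x}" using Um M by (intro emeasure_subadditive) auto
  finally show ?thesis using U M by simp
qed

lemma ennreal_add3: "0 \<le> a \<Longrightarrow> 0 \<le> b \<Longrightarrow> 0 \<le> c \<Longrightarrow> ennreal a + ennreal b + ennreal c = ennreal (a + b + c)"
  by simp

lemma ennreal_mult3: "0 \<le> a \<Longrightarrow> 0 \<le> b \<Longrightarrow> 0 \<le> c \<Longrightarrow> ennreal a * (ennreal b * m * ennreal c) = ennreal (a * b * c) * m"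
  by (simp add: ennreal_mult mult_ac)

text \<open>Let S be the total mass of a dt. The t with G t \<le> S / 3 carry at most a third of it,
  and so do the t with H t \<le> S / 3. On the remaining third both factors exceed S / 3. Formally
  the integral on the right is a beta integral in the variable G; this gives a lower bound for it
  without a change of variables. The inequality trades a power of an integral over scales for one
  scale t with everything else ordered relative to it.\<close>

lemma middle_third:
  fixes a :: "real \<Rightarrow> ennreal"
  assumes [measurable]: "a \<in> borel_measurable borel" and fin: "(\<integral>\<^sup>+t. a t \<partial>lborel) < \<infinity>"
  shows "(\<integral>\<^sup>+t. a t \<partial>lborel) ^ (k + 2)
    \<le> 3 ^ (k + 2) * (\<integral>\<^sup>+t. a t * (\<integral>\<^sup>+s\<in>{..t}. a s \<partial>lborel) * (\<integral>\<^sup>+s\<in>{t..}. a s \<partial>lborel) ^ k \<partial>lborel)"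
proof -
  define S where "S = (\<integral>\<^sup>+t. a t \<partial>lborel)"
  define G where "G = (\<lambda>t. \<integral>\<^sup>+s\<in>{..t}. a s \<partial>lborel)"
  define H where "H = (\<lambda>t. \<integral>\<^sup>+s\<in>{t..}. a s \<partial>lborel)"
  define M where "M = density lborel a"
  have M: "sets M = sets borel" by (simp add: M_def)
  have M0: "emeasure M {x} = 0" for x
    unfolding M_def by (subst emeasure_density) (auto simp: nn_integral_0_iff_AE intro!: AE_I[where N="{x}"])
  have GM: "G t = emeasure M {..t}" and HM: "H t = emeasure M {t..}" for t
    unfolding G_def H_def M_def by (simp_all add: emeasure_density)
  have SM: "S = emeasure M UNIV" by (simp add: S_def M_def emeasure_density)
  have Gmono: "mono G" unfolding mono_def GM by (auto intro!: emeasure_mono simp: M)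
  have Hmono: "antimono H" unfolding antimono_def HM by (auto intro!: emeasure_mono simp: M)
  have [measurable]: "G \<in> borel_measurable borel" "H \<in> borel_measurable borel"
    by (rule mono_ennreal_measurable[OF Gmono], rule antimono_ennreal_measurable[OF Hmono])
  define X1 where "X1 = {t. 3 * G t \<le> S}"
  define X2 where "X2 = {t. 3 * H t \<le> S}"
  have [measurable]: "X1 \<in> sets borel" "X2 \<in> sets borel" unfolding X1_def X2_def by measurable
  have third: "3 * (c / 3) = c" and third': "3 * b \<le> c \<Longrightarrow> b \<le> c / 3" for b c :: ennreal
  proof -
    show "3 * (c / 3) = c" using ennreal_times_divide[of 3 c 3] ennreal_mult_divide_eq[of 3 c] by (simp add: mult.commute)
    assume "3 * b \<le> c"
    then have "(b * 3) / 3 \<le> c / 3" by (intro divide_right_mono_ennreal) (simp add: mult.commute)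
    then show "b \<le> c / 3" by (subst (asm) ennreal_mult_divide_eq) auto
  qed
  have x1: "emeasure M X1 \<le> S / 3"
  proof (rule emeasure_left_le[OF M M0])
    show "s \<in> X1" if "t \<in> X1" "s \<le> t" for s t
      using that monoD[OF Gmono that(2)] unfolding X1_def by (auto intro: order_trans[OF mult_left_mono])
  qed (auto simp: X1_def GM[symmetric] third')
  have x2: "emeasure M X2 \<le> S / 3"
  proof (rule emeasure_right_le[OF M M0])
    show "s \<in> X2" if "t \<in> X2" "t \<le> s" for s t
      using that antimonoD[OF Hmono that(2)] unfolding X2_def by (auto intro: order_trans[OF mult_left_mono])
  qed (auto simp: X2_def HM[symmetric] third')
  define Y where "Y = - (X1 \<union> X2)"
  have [measurable]: "Y \<in> sets borel" unfolding Y_def by auto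
  have "S \<le> emeasure M (X1 \<union> X2) + emeasure M Y"
    unfolding SM by (rule order_trans[OF _ emeasure_subadditive]) (auto simp: Y_def M intro!: emeasure_mono)
  also have "emeasure M (X1 \<union> X2) \<le> S / 3 + S / 3"
    by (rule order_trans[OF emeasure_subadditive add_mono[OF x1 x2]]) (auto simp: M)
  finally have "S \<le> S / 3 + S / 3 + emeasure M Y" by (simp add: add_right_mono)
  then have Y: "S \<le> 3 * emeasure M Y"
  proof -
    assume *: "S \<le> S / 3 + S / 3 + emeasure M Y"
    obtain s where s: "s \<ge> 0" "S = ennreal s" using fin unfolding S_def[symmetric] by (cases S) auto
    show ?thesis
    proof (cases "emeasure M Y")
      case (real y)
      have "S / 3 = ennreal (s / 3)" using s divide_ennreal[of s 3] by simp
      then have "ennreal s \<le> ennreal (s / 3) + ennreal (s / 3) + ennreal y" using * s real by simp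
      also have "\<dots> = ennreal (s / 3 + s / 3 + y)" using s real by (intro ennreal_add3) auto
      finally have "ennreal s \<le> ennreal (s / 3 + s / 3 + y)" .
      then have "s \<le> 3 * y" using s real by (subst (asm) ennreal_le_iff) auto
      then have "ennreal s \<le> ennreal (3 * y)" by (rule ennreal_leI)
      then show ?thesis using s real by (simp add: ennreal_mult)
    next
      case top
      then show ?thesis by (simp add: ennreal_mult_eq_top_iff)
    qed
  qed
  have "S ^ (k + 2) = S * (S * S ^ k)" by simp
  also have "\<dots> \<le> 3 * emeasure M Y * (S * S ^ k)" using Y by (rule mult_right_mono) simp
  also have "\<dots> = 3 * (\<integral>\<^sup>+t. S * S ^ k * (a t * indicator Y t) \<partial>lborel)"
    unfolding M_def by (subst nn_integral_cmult) (auto simp: emeasure_density mult_ac)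
  also have "\<dots> \<le> 3 * (\<integral>\<^sup>+t. (3 * 3 ^ k) * (a t * G t * H t ^ k) \<partial>lborel)"
  proof (rule mult_left_mono, rule nn_integral_mono)
    fix t :: real
    show "S * S ^ k * (a t * indicator Y t) \<le> (3 * 3 ^ k) * (a t * G t * H t ^ k)"
    proof (cases "t \<in> Y")
      case True
      then have "S \<le> 3 * G t" "S \<le> 3 * H t" by (auto simp: Y_def X1_def X2_def)
      then have "S * S ^ k * a t \<le> (3 * G t) * (3 * H t) ^ k * a t"
        by (intro mult_mono power_mono) auto
      then show ?thesis using True by (simp add: power_mult_distrib mult_ac)
    qed simp
  qed simp
  also have "\<dots> = 3 * ((3 * 3 ^ k) * (\<integral>\<^sup>+t. a t * G t * H t ^ k \<partial>lborel))"
    by (subst nn_integral_cmult) auto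
  also have "\<dots> = 3 ^ (k + 2) * (\<integral>\<^sup>+t. a t * G t * H t ^ k \<partial>lborel)" by (simp add: mult_ac)
  finally show ?thesis unfolding S_def G_def H_def .
qed

lemma A_sup_cut_off:
  fixes f :: "'a::euclidean_space \<Rightarrow> 'b::{banach, second_countable_topology}"
  assumes a: "0 < \<alpha>" "\<alpha> \<le> 1" and s: "s > 0" and sub: "cball x s \<subseteq> B"
  shows "A_sup \<alpha> (cut_off B f) s x = A_sup \<alpha> f s x"
  unfolding A_sup_def
proof (rule SUP_cong[OF refl])
  fix \<psi> :: "'a \<Rightarrow> real" assume psi: "\<psi> \<in> C_class \<alpha>"
  have "dilate s \<psi> (x - z) *\<^sub>R cut_off B f z = dilate s \<psi> (x - z) *\<^sub>R f z" for z
  proof (cases "z \<in> B")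
    case False
    then have "norm (x - z) > s" using sub by (force simp: dist_norm)
    then show ?thesis using dilate_eq_0[OF psi a s] by simp
  qed (simp add: cut_off_def)
  then show "ennreal (norm (conv (cut_off B f) (dilate s \<psi>) x)) = ennreal (norm (conv f (dilate s \<psi>) x))"
    by (simp only: conv_def)
qed

text \<open>Cauchy-Schwarz on the closed ball of radius t, which lies in the open ball of radius 2 t
  about the same centre; hence 2^n. The bound takes care of the scales between N and 2 N in
  \<open>g_sq_even_power\<close>.\<close>

lemma A_sup_sq_le_maximal:
  fixes f :: "'a::euclidean_space \<Rightarrow> real"
  assumes a: "0 < \<alpha>" "\<alpha> \<le> 1" and t: "t > 0" and [measurable]: "f \<in> borel_measurable borel"
  shows "(A_sup \<alpha> f t x)\<^sup>2 \<le> ennreal (9 * (unit_ball_vol (real DIM('a)))\<^sup>2 * 2 ^ DIM('a)) * maximal (\<lambda>z. ennreal ((f z)\<^sup>2)) x"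
proof -
  define V where "V = unit_ball_vol (real DIM('a))"
  define n where "n = DIM('a)"
  have V: "V > 0" by (simp add: V_def)
  have cm[measurable]: "cball x t \<in> sets borel" by auto
  have "A_sup \<alpha> f t x \<le> (\<integral>\<^sup>+z. ennreal (3 * t powr (- real n)) * (ennreal (norm (f z)) * indicator (cball x t) z) \<partial>lborel)"
    unfolding n_def by (rule A_sup_le[OF a t])
  also have "\<dots> = ennreal (3 / t ^ n) * (\<integral>\<^sup>+z. ennreal (norm (f z)) * indicator (cball x t) z \<partial>lborel)"
    by (subst nn_integral_cmult) (auto simp: powr_minus_DIM[OF t] divide_inverse)
  finally have "(A_sup \<alpha> f t x)\<^sup>2 \<le> (ennreal (3 / t ^ n) * (\<integral>\<^sup>+z. ennreal (norm (f z)) * indicator (cball x t) z \<partial>lborel))\<^sup>2"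
    by (rule power_mono) simp
  \<comment> \<open>The indicator is doubled so that one copy becomes the second factor in
    Cauchy-Schwarz and produces the volume.\<close>
  also have "\<dots> = ennreal (9 / (t ^ n)\<^sup>2) * (\<integral>\<^sup>+z. (ennreal (norm (f z)) * indicator (cball x t) z) * indicator (cball x t) z \<partial>lborel)\<^sup>2"
  proof -
    have "(\<integral>\<^sup>+z. ennreal (norm (f z)) * indicator (cball x t) z \<partial>lborel) = (\<integral>\<^sup>+z. (ennreal (norm (f z)) * indicator (cball x t) z) * indicator (cball x t) z \<partial>lborel)"
      by (rule nn_integral_cong) (auto simp: indicator_def)
    then show ?thesis using t by (simp only: power_mult_distrib ennreal_power power_divide) (simp add: ennreal_power power_divide)
  qed
  also have "\<dots> \<le> ennreal (9 / (t ^ n)\<^sup>2) * ((\<integral>\<^sup>+z. (ennreal (norm (f z)) * indicator (cball x t) z)\<^sup>2 \<partial>lborel) * (\<integral>\<^sup>+z. (indicator (cball x t) z)\<^sup>2 \<partial>lborel))"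
    by (intro mult_left_mono Cauchy_Schwarz_nn_integral) auto
  also have "(\<integral>\<^sup>+z. (indicator (cball x t) z :: ennreal)\<^sup>2 \<partial>lborel) = ennreal (V * t ^ n)"
  proof -
    have "(\<integral>\<^sup>+z. (indicator (cball x t) z :: ennreal)\<^sup>2 \<partial>lborel) = (\<integral>\<^sup>+z. indicator (cball x t) z \<partial>lborel)"
      by (rule nn_integral_cong) (auto simp: indicator_def)
    then show ?thesis using t by (simp add: emeasure_cball_eq V_def n_def)
  qed
  also have "(\<integral>\<^sup>+z. (ennreal (norm (f z)) * indicator (cball x t) z)\<^sup>2 \<partial>lborel) \<le> (\<integral>\<^sup>+z\<in>ball x (2 * t). ennreal ((f z)\<^sup>2) \<partial>lborel)"
    using t by (intro nn_integral_mono) (auto simp: indicator_def ennreal_power)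
  also have "\<dots> \<le> ennreal (V * (2 * t) ^ n) * maximal (\<lambda>z. ennreal ((f z)\<^sup>2)) x"
    unfolding V_def n_def by (rule ball_integral_le_maximal) (use t in auto)
  also have "ennreal (9 / (t ^ n)\<^sup>2) * (ennreal (V * (2 * t) ^ n) * maximal (\<lambda>z. ennreal ((f z)\<^sup>2)) x * ennreal (V * t ^ n))
     = ennreal (9 / (t ^ n)\<^sup>2 * (V * (2 * t) ^ n) * (V * t ^ n)) * maximal (\<lambda>z. ennreal ((f z)\<^sup>2)) x"
    using t V by (intro ennreal_mult3) auto
  also have "9 / (t ^ n)\<^sup>2 * (V * (2 * t) ^ n) * (V * t ^ n) = 9 * V\<^sup>2 * 2 ^ n"
    using t by (simp add: power_mult_distrib power2_eq_square field_simps)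
  finally show ?thesis by (simp add: V_def n_def mult_left_mono mult_right_mono)
qed

lemma A_sup_measurable_fst:
  fixes f :: "'a::euclidean_space \<Rightarrow> 'b::{banach, second_countable_topology}"
  assumes f: "locally_integrable f" and a: "0 < \<alpha>" "\<alpha> \<le> 1"
  shows "(\<lambda>t. A_sup \<alpha> f t x * indicator {0<..} t) \<in> borel_measurable borel"
proof -
  have "(\<lambda>t. (t, x)) \<in> measurable borel (borel \<Otimes>\<^sub>M borel)" by measurable
  from measurable_compose[OF this A_sup_measurable[OF f a]] show ?thesis by simp
qed

text \<open>Invariance of dt / t under t -> 2 t; it undoes the doubling of scales caused by
  \<open>A_sup_shift\<close>.\<close>

lemma g_sq_scale:
  fixes f :: "'a::euclidean_space \<Rightarrow> 'b::{banach, second_countable_topology}"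
  assumes f: "locally_integrable f" and a: "0 < \<alpha>" "\<alpha> \<le> 1" and e: "0 < e"
  shows "(\<integral>\<^sup>+t\<in>{e..N}. (A_sup \<alpha> f (2 * t) x)\<^sup>2 * ennreal (1 / t) \<partial>lborel) = g_sq \<alpha> f {2 * e..2 * N} x"
proof -
  define F where "F = (\<lambda>t. (A_sup \<alpha> f t x * indicator {0<..} t)\<^sup>2 * ennreal (1 / t) * indicator {2 * e..2 * N} t)"
  have [measurable]: "F \<in> borel_measurable borel"
    unfolding F_def using A_sup_measurable_fst[OF f a, of x] by measurable
  have "g_sq \<alpha> f {2 * e..2 * N} x = (\<integral>\<^sup>+t. F t \<partial>lborel)"
    unfolding g_sq_def F_def using e by (intro nn_integral_cong) (auto simp: indicator_def)
  also have "\<dots> = ennreal \<bar>2\<bar> * (\<integral>\<^sup>+t. F (0 + 2 * t) \<partial>lborel)"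
    by (rule nn_integral_real_affine) auto
  also have "\<dots> = (\<integral>\<^sup>+t. ennreal \<bar>2\<bar> * F (0 + 2 * t) \<partial>lborel)"
    by (rule nn_integral_cmult[symmetric]) measurable
  also have "\<dots> = (\<integral>\<^sup>+t\<in>{e..N}. (A_sup \<alpha> f (2 * t) x)\<^sup>2 * ennreal (1 / t) \<partial>lborel)"
  proof (rule nn_integral_cong)
    fix t :: real
    show "ennreal \<bar>2\<bar> * F (0 + 2 * t) = (A_sup \<alpha> f (2 * t) x)\<^sup>2 * ennreal (1 / t) * indicator {e..N} t"
    proof (cases "t \<in> {e..N}")
      case True
      then have t: "t > 0" using e by auto
      have "ennreal \<bar>2\<bar> * ennreal (1 / (2 * t)) = ennreal (\<bar>2\<bar> * (1 / (2 * t)))"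
        using t by (intro ennreal_mult[symmetric]) auto
      also have "\<bar>2\<bar> * (1 / (2 * t)) = 1 / t" using t by simp
      finally have *: "ennreal \<bar>2\<bar> * ennreal (1 / (2 * t)) = ennreal (1 / t)" .
      have "ennreal \<bar>2\<bar> * F (0 + 2 * t) = (A_sup \<alpha> f (2 * t) x)\<^sup>2 * (ennreal \<bar>2\<bar> * ennreal (1 / (2 * t)))"
        using True t by (simp add: F_def mult_ac)
      then show ?thesis unfolding * using True by simp
    next
      case False
      then show ?thesis by (auto simp: F_def indicator_def)
    qed
  qed
  finally show ?thesis by simp
qed

lemma g_sq_measurable:
  fixes f :: "'a::euclidean_space \<Rightarrow> 'b::{banach, second_countable_topology}"
  assumes f: "locally_integrable f" and a: "0 < \<alpha>" "\<alpha> \<le> 1" and I: "I \<subseteq> {0<..}" and [measurable]: "I \<in> sets borel"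
  shows "g_sq \<alpha> f I \<in> borel_measurable borel"
proof -
  have m: "(\<lambda>(x, t). A_sup \<alpha> f t x * indicator {0<..} t) \<in> borel_measurable (borel \<Otimes>\<^sub>M borel)"
    using measurable_pair_swap[OF A_sup_measurable[OF f a]] by (simp add: case_prod_beta')
  have "(\<lambda>x. \<integral>\<^sup>+t. (A_sup \<alpha> f t x * indicator {0<..} t)\<^sup>2 * ennreal (1 / t) * indicator I t \<partial>lborel) \<in> borel_measurable borel"
    using m by measurable
  also have "(\<lambda>x. \<integral>\<^sup>+t. (A_sup \<alpha> f t x * indicator {0<..} t)\<^sup>2 * ennreal (1 / t) * indicator I t \<partial>lborel) = g_sq \<alpha> f I"
    unfolding g_sq_def fun_eq_iff using I by (auto intro!: nn_integral_cong simp: indicator_def)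
  finally show ?thesis .
qed

text \<open>
  In the kernel \<open>a G H\<^sup>k\<close> of \<open>middle_third\<close> the factors \<open>a\<close> and \<open>H\<close> only involve scales \<open>\<ge> t\<close>, so they
  may be moved from \<open>x\<close> to any \<open>x'\<close> at distance \<open>< t\<close> (\<open>A_sup_shift\<close>), whereas \<open>G\<close> only involves scales
  \<open>\<le> t\<close>, so its average over \<open>ball x' t\<close> is controlled by the quadratic estimate applied to
  the restriction of \<open>f\<close> to \<open>ball x' (2 t)\<close>.
\<close>

lemma g_sq_truncated_average:
  fixes f :: "'a::euclidean_space \<Rightarrow> real"
  assumes a: "0 < \<alpha>" "\<alpha> \<le> 1" and f: "bounded_support f" and t: "t > 0"
    and C: "C = 6 * (unit_ball_vol (real DIM('a)))\<^sup>2 * 2 ^ DIM('a) / \<alpha>"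
  shows "(\<integral>\<^sup>+x\<in>ball y t. g_sq \<alpha> f {0<..t} x \<partial>lborel)
    \<le> ennreal (C * 2 ^ DIM('a)) * (ennreal (unit_ball_vol (real DIM('a)) * t ^ DIM('a)) * maximal (\<lambda>z. ennreal ((f z)\<^sup>2)) y)"
proof -
  define V where "V = unit_ball_vol (real DIM('a))"
  define B where "B = ball y (2 * t)"
  have C0: "C \<ge> 0" using a unfolding C by simp
  have fB: "bounded_support (cut_off B f)"
  proof -
    have "bounded_support (\<lambda>x. f x * indicator B x)"
      by (rule bounded_support_mult[OF f, of _ 1]) (auto simp: B_def indicator_def intro!: borel_measurable_indicator)
    then show ?thesis by (simp add: cut_off_def[abs_def] mult.commute)
  qed
  have "(\<integral>\<^sup>+x\<in>ball y t. g_sq \<alpha> f {0<..t} x \<partial>lborel) \<le> (\<integral>\<^sup>+x. g_sq \<alpha> (cut_off B f) {0<..} x \<partial>lborel)"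
  proof (rule nn_integral_mono)
    fix x
    show "g_sq \<alpha> f {0<..t} x * indicator (ball y t) x \<le> g_sq \<alpha> (cut_off B f) {0<..} x"
    proof (cases "x \<in> ball y t")
      case True
      have "g_sq \<alpha> f {0<..t} x \<le> g_sq \<alpha> (cut_off B f) {0<..} x"
        unfolding g_sq_def
      proof (rule nn_integral_mono)
        fix s :: real
        show "(A_sup \<alpha> f s x)\<^sup>2 * ennreal (1 / s) * indicator {0<..t} s \<le> (A_sup \<alpha> (cut_off B f) s x)\<^sup>2 * ennreal (1 / s) * indicator {0<..} s"
        proof (cases "s \<in> {0<..t}")
          case s: True
          have "cball x s \<subseteq> B"
          proof
            fix z assume "z \<in> cball x s"
            then have "dist y z < 2 * t" using True s dist_triangle[of y z x] by (simp add: dist_commute)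
            then show "z \<in> B" by (simp add: B_def)
          qed
          then have "A_sup \<alpha> (cut_off B f) s x = A_sup \<alpha> f s x"
            using s by (intro A_sup_cut_off[OF a]) auto
          then show ?thesis using s by simp
        qed simp
      qed
      then show ?thesis using True by simp
    qed simp
  qed
  also have "\<dots> \<le> ennreal C * (\<integral>\<^sup>+z. ennreal ((cut_off B f z)\<^sup>2) \<partial>lborel)"
    unfolding C by (rule g_sq_L2[OF a fB])
  also have "(\<integral>\<^sup>+z. ennreal ((cut_off B f z)\<^sup>2) \<partial>lborel) = (\<integral>\<^sup>+z\<in>ball y (2 * t). ennreal ((f z)\<^sup>2) \<partial>lborel)"
    by (rule nn_integral_cong) (auto simp: cut_off_def B_def indicator_def)
  also have "\<dots> \<le> ennreal (V * (2 * t) ^ DIM('a)) * maximal (\<lambda>z. ennreal ((f z)\<^sup>2)) y"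
    unfolding V_def by (rule ball_integral_le_maximal) (use t in auto)
  also have "ennreal C * (ennreal (V * (2 * t) ^ DIM('a)) * maximal (\<lambda>z. ennreal ((f z)\<^sup>2)) y)
    = ennreal (C * 2 ^ DIM('a)) * (ennreal (V * t ^ DIM('a)) * maximal (\<lambda>z. ennreal ((f z)\<^sup>2)) y)"
    using t C0 by (simp add: V_def power_mult_distrib ennreal_mult mult_ac)
  finally show ?thesis by (simp add: V_def mult_left_mono)
qed

text \<open>\<open>middle_third\<close> is applied at each x, and its integrand is averaged over the
  x' in the ball of radius t about x. After moving the factors \<open>aa\<close> and
  \<open>H\<close> to x', only \<open>G\<close> depends on x. The doubled range of scales on the
  right is the price of the move.\<close>

lemma g_sq_truncated_power:
  fixes f :: "'a::euclidean_space \<Rightarrow> real"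
  assumes a: "0 < \<alpha>" "\<alpha> \<le> 1" and f: "bounded_support f" and e: "0 < e"
    and fin: "\<And>x. g_sq \<alpha> f {e..N} x < \<infinity>"
    and C: "C = 6 * (unit_ball_vol (real DIM('a)))\<^sup>2 * 2 ^ DIM('a) / \<alpha>"
  shows "(\<integral>\<^sup>+x. (g_sq \<alpha> f {e..N} x) ^ (k + 2) \<partial>lborel)
    \<le> ennreal (3 ^ (k + 2) * (4 ^ (DIM('a) + 1)) ^ (k + 1) * (C * 2 ^ DIM('a)))
      * (\<integral>\<^sup>+x. maximal (\<lambda>z. ennreal ((f z)\<^sup>2)) x * (g_sq \<alpha> f {2 * e..2 * N} x) ^ (k + 1) \<partial>lborel)"
proof -
  define V where "V = unit_ball_vol (real DIM('a))"
  define n where "n = DIM('a)"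
  have V: "V > 0" by (simp add: V_def)
  have C0: "C \<ge> 0" using a unfolding C by simp
  define v where "v = maximal (\<lambda>z. ennreal ((f z)\<^sup>2))"
  have [measurable]: "v \<in> borel_measurable borel" unfolding v_def by measurable
  note lif = bounded_support_locally_integrable[OF f]
  define A where "A = (\<lambda>t x. A_sup \<alpha> f t x * indicator {0<..} t)"
  have Am[measurable]: "case_prod A \<in> borel_measurable (borel \<Otimes>\<^sub>M borel)"
    unfolding A_def using A_sup_measurable[OF lif a] by simp
  define J where "J = {e..N}"
  have [measurable]: "J \<in> sets borel" by (simp add: J_def)
  define aa where "aa = (\<lambda>t x. (A t x)\<^sup>2 * ennreal (1 / t) * indicator J t)"
  define bb where "bb = (\<lambda>t x. (A (2 * t) x)\<^sup>2 * ennreal (1 / t) * indicator J t)"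
  have aam[measurable]: "case_prod aa \<in> borel_measurable (borel \<Otimes>\<^sub>M borel)" unfolding aa_def by measurable
  have bbm[measurable]: "case_prod bb \<in> borel_measurable (borel \<Otimes>\<^sub>M borel)" unfolding bb_def by measurable
  define G where "G = (\<lambda>t x. \<integral>\<^sup>+s\<in>{..t}. aa s x \<partial>lborel)"
  define H where "H = (\<lambda>t x. \<integral>\<^sup>+s\<in>{t..}. aa s x \<partial>lborel)"
  have Gm[measurable]: "case_prod G \<in> borel_measurable (borel \<Otimes>\<^sub>M borel)"
  proof -
    have "(\<lambda>(t, x). \<integral>\<^sup>+s. aa s x * (if s \<le> t then 1 else 0) \<partial>lborel) \<in> borel_measurable (borel \<Otimes>\<^sub>M borel)" by measurable
    also have "(\<lambda>(t, x). \<integral>\<^sup>+s. aa s x * (if s \<le> t then 1 else 0) \<partial>lborel) = case_prod G"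
      unfolding G_def fun_eq_iff by (auto intro!: nn_integral_cong simp: indicator_def)
    finally show ?thesis .
  qed
  have Hm[measurable]: "case_prod H \<in> borel_measurable (borel \<Otimes>\<^sub>M borel)"
  proof -
    have "(\<lambda>(t, x). \<integral>\<^sup>+s. aa s x * (if t \<le> s then 1 else 0) \<partial>lborel) \<in> borel_measurable (borel \<Otimes>\<^sub>M borel)" by measurable
    also have "(\<lambda>(t, x). \<integral>\<^sup>+s. aa s x * (if t \<le> s then 1 else 0) \<partial>lborel) = case_prod H"
      unfolding H_def fun_eq_iff by (auto intro!: nn_integral_cong simp: indicator_def)
    finally show ?thesis .
  qed
  define S where "S = g_sq \<alpha> f {e..N}"
  define S' where "S' = g_sq \<alpha> f {2 * e..2 * N}"
  have S: "S x = (\<integral>\<^sup>+t. aa t x \<partial>lborel)" for x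
    unfolding S_def g_sq_def aa_def A_def J_def using e by (intro nn_integral_cong) (auto simp: indicator_def)
  have S': "S' x = (\<integral>\<^sup>+t. bb t x \<partial>lborel)" for x
    unfolding S'_def g_sq_scale[OF lif a e, symmetric] bb_def A_def J_def
    using e by (intro nn_integral_cong) (auto simp: indicator_def)
  have [measurable]: "S' \<in> borel_measurable borel"
    unfolding S'_def using e by (intro g_sq_measurable[OF lif a]) auto
  \<comment> \<open>The square of the factor 2^(n + 1) from \<open>A_sup_shift\<close>.\<close>
  define c :: ennreal where "c = ennreal (4 ^ (n + 1))"
  have shift: "aa s x \<le> c * bb s x'" if "dist x x' \<le> s" for s x x'
  proof (cases "s \<in> J")
    case True
    then have s: "s > 0" using e by (auto simp: J_def)
    have "A_sup \<alpha> f s x \<le> ennreal (2 ^ (n + 1)) * A_sup \<alpha> f (2 * s) x'"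
      unfolding n_def by (rule A_sup_shift[OF a s that])
    then have "(A_sup \<alpha> f s x)\<^sup>2 \<le> (ennreal (2 ^ (n + 1)) * A_sup \<alpha> f (2 * s) x')\<^sup>2"
      by (rule power_mono) simp
    also have "\<dots> = c * (A_sup \<alpha> f (2 * s) x')\<^sup>2"
    proof -
      have "(2 ^ (n + 1))\<^sup>2 = (4::real) ^ (n + 1)"
        by (simp only: power2_eq_square power_mult_distrib[symmetric]) simp
      then show ?thesis by (simp only: power_mult_distrib ennreal_power c_def zero_le_power zero_le_numeral)
    qed
    finally have "(A_sup \<alpha> f s x)\<^sup>2 * ennreal (1 / s) \<le> c * (A_sup \<alpha> f (2 * s) x')\<^sup>2 * ennreal (1 / s)"
      by (rule mult_right_mono) simp
    then show ?thesis using True s by (simp add: aa_def bb_def A_def mult.assoc)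
  qed (simp add: aa_def)
  have Hshift: "H t x \<le> c * S' x'" if "dist x x' \<le> t" for t x x'
  proof -
    have "H t x \<le> (\<integral>\<^sup>+s. c * bb s x' \<partial>lborel)"
      unfolding H_def
    proof (rule nn_integral_mono)
      fix s show "aa s x * indicator {t..} s \<le> c * bb s x'"
        using shift[of x x' s] that by (cases "t \<le> s") auto
    qed
    also have "\<dots> = c * S' x'" unfolding S' by (rule nn_integral_cmult) measurable
    finally show ?thesis .
  qed
  \<comment> \<open>The reciprocal volume of a ball of radius t: it turns the integral over x' into
    a mean.\<close>
  define w where "w = (\<lambda>t. ennreal (1 / (V * t ^ n)))"
  have [measurable]: "w \<in> borel_measurable borel" unfolding w_def by measurable
  define F where "F = (\<lambda>x t x'. c ^ (k + 1) * (bb t x' * (S' x') ^ k) * w t * (G t x * (if dist x x' < t then 1 else 0)))"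
  have pw: "aa t x * G t x * H t x ^ k \<le> (\<integral>\<^sup>+x'. F x t x' \<partial>lborel)" for t x
  proof (cases "t \<in> J")
    case False
    then show ?thesis by (simp add: aa_def)
  next
    case True
    then have t: "t > 0" using e by (auto simp: J_def)
    have "aa t x * G t x * H t x ^ k = (\<integral>\<^sup>+x'\<in>ball x t. (aa t x * G t x * H t x ^ k) * w t \<partial>lborel)"
    proof -
      have "(\<integral>\<^sup>+x'\<in>ball x t. (aa t x * G t x * H t x ^ k) * w t \<partial>lborel) = (aa t x * G t x * H t x ^ k) * (w t * ennreal (V * t ^ n))"
        using t by (subst nn_integral_cmult_indicator) (auto simp: emeasure_ball_eq V_def n_def mult.assoc)
      also have "w t * ennreal (V * t ^ n) = ennreal (1 / (V * t ^ n) * (V * t ^ n))"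
        unfolding w_def using t V by (intro ennreal_mult[symmetric]) auto
      finally show ?thesis using t V by simp
    qed
    also have "\<dots> \<le> (\<integral>\<^sup>+x'. F x t x' \<partial>lborel)"
    proof (rule nn_integral_mono)
      fix x'
      show "aa t x * G t x * H t x ^ k * w t * indicator (ball x t) x' \<le> F x t x'"
      proof (cases "dist x x' < t")
        case True
        have "aa t x * G t x * H t x ^ k * w t \<le> (c * bb t x') * G t x * (c * S' x') ^ k * w t"
          using True by (intro mult_right_mono mult_mono power_mono shift Hshift) auto
        also have "\<dots> = F x t x'" using True by (simp add: F_def power_mult_distrib mult_ac)
        finally show ?thesis using True by simp
      qed simp
    qed
    finally show ?thesis .
  qed
  have "(\<integral>\<^sup>+x. (S x) ^ (k + 2) \<partial>lborel) \<le> (\<integral>\<^sup>+x. 3 ^ (k + 2) * (\<integral>\<^sup>+t. (\<integral>\<^sup>+x'. F x t x' \<partial>lborel) \<partial>lborel) \<partial>lborel)"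
  proof (rule nn_integral_mono)
    fix x
    have m: "(\<lambda>t. aa t x) \<in> borel_measurable borel" by measurable
    have "(S x) ^ (k + 2) \<le> 3 ^ (k + 2) * (\<integral>\<^sup>+t. aa t x * G t x * H t x ^ k \<partial>lborel)"
      unfolding S G_def H_def by (rule middle_third[OF m]) (use fin[of x] in \<open>simp add: S_def[symmetric] S\<close>)
    also have "\<dots> \<le> 3 ^ (k + 2) * (\<integral>\<^sup>+t. (\<integral>\<^sup>+x'. F x t x' \<partial>lborel) \<partial>lborel)"
      by (intro mult_left_mono nn_integral_mono pw) auto
    finally show "(S x) ^ (k + 2) \<le> 3 ^ (k + 2) * (\<integral>\<^sup>+t. (\<integral>\<^sup>+x'. F x t x' \<partial>lborel) \<partial>lborel)" .
  qed
  also have "\<dots> = 3 ^ (k + 2) * (\<integral>\<^sup>+x. (\<integral>\<^sup>+t. (\<integral>\<^sup>+x'. F x t x' \<partial>lborel) \<partial>lborel) \<partial>lborel)"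
    unfolding F_def by (rule nn_integral_cmult) measurable
  also have "(\<integral>\<^sup>+x. (\<integral>\<^sup>+t. (\<integral>\<^sup>+x'. F x t x' \<partial>lborel) \<partial>lborel) \<partial>lborel) = (\<integral>\<^sup>+x. (\<integral>\<^sup>+x'. (\<integral>\<^sup>+t. F x t x' \<partial>lborel) \<partial>lborel) \<partial>lborel)"
    unfolding F_def by (intro nn_integral_cong lborel_pair.Fubini') measurable
  also have "\<dots> = (\<integral>\<^sup>+x'. (\<integral>\<^sup>+x. (\<integral>\<^sup>+t. F x t x' \<partial>lborel) \<partial>lborel) \<partial>lborel)"
    unfolding F_def by (rule lborel_pair.Fubini') measurable
  also have "\<dots> = (\<integral>\<^sup>+x'. (\<integral>\<^sup>+t. (\<integral>\<^sup>+x. F x t x' \<partial>lborel) \<partial>lborel) \<partial>lborel)"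
    unfolding F_def by (intro nn_integral_cong lborel_pair.Fubini') measurable
  \<comment> \<open>The interchanges have brought the integral in x to the inside, where it runs
    over the ball of radius t about x' and meets only \<open>G\<close>;
    \<open>g_sq_truncated_average\<close> then cancels the normalisation \<open>w\<close>.\<close>
  also have "\<dots> \<le> (\<integral>\<^sup>+x'. (\<integral>\<^sup>+t. c ^ (k + 1) * ennreal (C * 2 ^ n) * v x' * (S' x') ^ k * bb t x' \<partial>lborel) \<partial>lborel)"
  proof (intro nn_integral_mono)
    fix t x'
    show "(\<integral>\<^sup>+x. F x t x' \<partial>lborel) \<le> c ^ (k + 1) * ennreal (C * 2 ^ n) * v x' * (S' x') ^ k * bb t x'"
    proof (cases "t \<in> J")
      case False
      then show ?thesis by (simp add: F_def bb_def)
    next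
      case True
      then have t: "t > 0" using e by (auto simp: J_def)
      have "(\<integral>\<^sup>+x. F x t x' \<partial>lborel) = c ^ (k + 1) * (bb t x' * (S' x') ^ k) * w t * (\<integral>\<^sup>+x. G t x * (if dist x x' < t then 1 else 0) \<partial>lborel)"
        unfolding F_def by (rule nn_integral_cmult) measurable
      also have "(\<integral>\<^sup>+x. G t x * (if dist x x' < t then 1 else 0) \<partial>lborel) \<le> (\<integral>\<^sup>+x\<in>ball x' t. g_sq \<alpha> f {0<..t} x \<partial>lborel)"
      proof (rule nn_integral_mono)
        fix x
        have "G t x \<le> g_sq \<alpha> f {0<..t} x"
          unfolding G_def g_sq_def aa_def A_def J_def using e
          by (intro nn_integral_mono) (auto simp: indicator_def)
        then show "G t x * (if dist x x' < t then 1 else 0) \<le> g_sq \<alpha> f {0<..t} x * indicator (ball x' t) x"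
          by (auto simp: indicator_def dist_commute)
      qed
      also have "\<dots> \<le> ennreal (C * 2 ^ n) * (ennreal (V * t ^ n) * v x')"
        unfolding n_def V_def v_def by (rule g_sq_truncated_average[OF a f t C])
      also have "c ^ (k + 1) * (bb t x' * (S' x') ^ k) * w t * (ennreal (C * 2 ^ n) * (ennreal (V * t ^ n) * v x'))
        = c ^ (k + 1) * ennreal (C * 2 ^ n) * v x' * (S' x') ^ k * bb t x' * (w t * ennreal (V * t ^ n))"
        by (simp only: mult_ac)
      also have "w t * ennreal (V * t ^ n) = ennreal (1 / (V * t ^ n) * (V * t ^ n))"
        unfolding w_def using t V by (intro ennreal_mult[symmetric]) auto
      also have "\<dots> = 1" using t V by simp
      finally show ?thesis by (simp add: mult_left_mono)
    qed
  qed
  also have "\<dots> = (\<integral>\<^sup>+x'. c ^ (k + 1) * ennreal (C * 2 ^ n) * (v x' * (S' x') ^ (k + 1)) \<partial>lborel)"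
  proof (rule nn_integral_cong)
    fix x'
    show "(\<integral>\<^sup>+t. c ^ (k + 1) * ennreal (C * 2 ^ n) * v x' * (S' x') ^ k * bb t x' \<partial>lborel) = c ^ (k + 1) * ennreal (C * 2 ^ n) * (v x' * (S' x') ^ (k + 1))"
      by (subst nn_integral_cmult) (auto simp: S'[symmetric] mult_ac)
  qed
  also have "\<dots> = c ^ (k + 1) * ennreal (C * 2 ^ n) * (\<integral>\<^sup>+x'. v x' * (S' x') ^ (k + 1) \<partial>lborel)"
    by (rule nn_integral_cmult) measurable
  also have "3 ^ (k + 2) * (c ^ (k + 1) * ennreal (C * 2 ^ n) * (\<integral>\<^sup>+x'. v x' * (S' x') ^ (k + 1) \<partial>lborel))
    = ennreal (3 ^ (k + 2) * (4 ^ (n + 1)) ^ (k + 1) * (C * 2 ^ n)) * (\<integral>\<^sup>+x'. v x' * (S' x') ^ (k + 1) \<partial>lborel)"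
  proof -
    have "ennreal (3 ^ (k + 2) * (4 ^ (n + 1)) ^ (k + 1) * (C * 2 ^ n)) = ennreal 3 ^ (k + 2) * ennreal (4 ^ (n + 1)) ^ (k + 1) * ennreal (C * 2 ^ n)"
      using C0 by (simp only: ennreal_mult ennreal_power[symmetric] mult_nonneg_nonneg zero_le_power zero_le_numeral)
    then show ?thesis by (simp add: c_def mult.assoc)
  qed
  finally show ?thesis by (simp add: S_def S'_def v_def n_def mult_left_mono)
qed

lemma indicator_mono_ennreal: "A \<subseteq> B \<Longrightarrow> indicator A x \<le> (indicator B x :: ennreal)"
  by (auto simp: indicator_def)

text \<open>A crude bound in place of the logarithm; for b = 2 a it equals 1.\<close>

lemma nn_integral_inverse_le:
  assumes "0 < a" "a \<le> b"
  shows "(\<integral>\<^sup>+t\<in>{a..b}. ennreal (1 / t) \<partial>lborel) \<le> ennreal ((b - a) / a)"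
proof -
  have "(\<integral>\<^sup>+t\<in>{a..b}. ennreal (1 / t) \<partial>lborel) \<le> (\<integral>\<^sup>+t. ennreal (1 / a) * indicator {a..b} t \<partial>lborel)"
    using assms by (intro nn_integral_mono) (auto simp: indicator_def intro!: ennreal_leI divide_left_mono)
  also have "\<dots> = ennreal (1 / a) * ennreal (b - a)"
    using assms by (subst nn_integral_cmult_indicator) auto
  also have "\<dots> = ennreal ((b - a) / a)" using assms by (simp flip: ennreal_mult)
  finally show ?thesis .
qed

text \<open>Supplies the finiteness without which half of the left side could not be absorbed in
  \<open>g_sq_even_power\<close>.\<close>

lemma g_sq_truncated_bounded:
  fixes f :: "'a::euclidean_space \<Rightarrow> real"
  assumes a: "0 < \<alpha>" "\<alpha> \<le> 1" and f: "bounded_support f" and e: "0 < e" "e \<le> N"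
  obtains Q where "Q \<ge> 0" "\<And>x. g_sq \<alpha> f {e..N} x \<le> ennreal Q * indicator (cball 0 Q) x"
proof -
  obtain M where M: "f \<in> borel_measurable borel" "M > 0" "\<And>x. \<bar>f x\<bar> \<le> M" "\<And>x. norm x > M \<Longrightarrow> f x = 0"
    using bounded_supportE[OF f] by blast
  define V where "V = unit_ball_vol (real DIM('a))"
  have V: "V > 0" by (simp add: V_def)
  define Q1 where "Q1 = 9 * V\<^sup>2 * M\<^sup>2 * ((N - e) / e)"
  have Q1: "Q1 \<ge> 0" using e by (simp add: Q1_def)
  \<comment> \<open>\<open>Q1\<close> bounds the values; kernels of scale at most N see
    \<open>f\<close> only from points within distance N of its support, hence M + N for the
    radius.\<close>
  define Q where "Q = Q1 + M + N"
  have Q0: "Q \<ge> 0" using Q1 M(2) e by (simp add: Q_def)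
  have A: "A_sup \<alpha> f t x \<le> ennreal (3 * V * M)" if t: "t > 0" for t x
  proof -
    have "A_sup \<alpha> f t x \<le> (\<integral>\<^sup>+z. ennreal (3 * t powr (- real DIM('a))) * (ennreal (norm (f z)) * indicator (cball x t) z) \<partial>lborel)"
      by (rule A_sup_le[OF a t])
    also have "\<dots> \<le> (\<integral>\<^sup>+z. ennreal (3 / t ^ DIM('a) * M) * indicator (cball x t) z \<partial>lborel)"
      using M(2,3) t by (intro nn_integral_mono)
        (auto simp: indicator_def powr_minus_DIM[OF t] divide_inverse mult.assoc simp flip: ennreal_mult intro!: ennreal_leI mult_left_mono)
    also have "\<dots> = ennreal (3 / t ^ DIM('a) * M) * ennreal (V * t ^ DIM('a))"
      using t by (subst nn_integral_cmult_indicator) (auto simp: emeasure_cball_eq V_def)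
    also have "\<dots> = ennreal (3 * V * M)" using t V M(2) by (simp flip: ennreal_mult)
    finally show ?thesis .
  qed
  have A0: "A_sup \<alpha> f t x = 0" if t: "0 < t" "t \<le> N" and x: "norm x > Q" for t x
  proof -
    have "A_sup \<alpha> f t x \<le> (\<integral>\<^sup>+z. ennreal (3 * t powr (- real DIM('a))) * (ennreal (norm (f z)) * indicator (cball x t) z) \<partial>lborel)"
      by (rule A_sup_le[OF a t(1)])
    also have "\<dots> = (\<integral>\<^sup>+z. 0 \<partial>(lborel :: 'a measure))"
    proof (rule nn_integral_cong)
      fix z
      show "ennreal (3 * t powr (- real DIM('a))) * (ennreal (norm (f z)) * indicator (cball x t) z) = 0"
      proof (cases "dist x z \<le> t")
        case True
        then have "norm z > M" using x t norm_triangle_ineq2[of x z] Q1 by (simp add: Q_def dist_norm)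
        then show ?thesis by (simp add: M(4))
      qed simp
    qed
    finally show ?thesis by simp
  qed
  have "g_sq \<alpha> f {e..N} x \<le> ennreal Q * indicator (cball 0 Q) x" for x
  proof (cases "norm x \<le> Q")
    case True
    have "g_sq \<alpha> f {e..N} x \<le> (\<integral>\<^sup>+t. ennreal (9 * V\<^sup>2 * M\<^sup>2) * (ennreal (1 / t) * indicator {e..N} t) \<partial>lborel)"
      unfolding g_sq_def
    proof (rule nn_integral_mono)
      fix t :: real
      show "(A_sup \<alpha> f t x)\<^sup>2 * ennreal (1 / t) * indicator {e..N} t \<le> ennreal (9 * V\<^sup>2 * M\<^sup>2) * (ennreal (1 / t) * indicator {e..N} t)"
      proof (cases "t \<in> {e..N}")
        case True
        then have "(A_sup \<alpha> f t x)\<^sup>2 \<le> (ennreal (3 * V * M))\<^sup>2" using e by (intro power_mono A) auto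
        also have "\<dots> = ennreal (9 * V\<^sup>2 * M\<^sup>2)" using V M(2) by (simp add: ennreal_power power_mult_distrib)
        finally show ?thesis using True by (simp add: mult_right_mono)
      qed simp
    qed
    also have "\<dots> = ennreal (9 * V\<^sup>2 * M\<^sup>2) * (\<integral>\<^sup>+t\<in>{e..N}. ennreal (1 / t) \<partial>lborel)"
      by (rule nn_integral_cmult) auto
    also have "\<dots> \<le> ennreal (9 * V\<^sup>2 * M\<^sup>2) * ennreal ((N - e) / e)"
      by (intro mult_left_mono nn_integral_inverse_le e) auto
    also have "\<dots> = ennreal Q1" using e unfolding Q1_def by (intro ennreal_mult[symmetric]) auto
    also have "\<dots> \<le> ennreal Q" using M(2) e by (intro ennreal_leI) (simp add: Q_def)
    finally show ?thesis using True by simp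
  next
    case False
    have "g_sq \<alpha> f {e..N} x = (\<integral>\<^sup>+t. 0 \<partial>(lborel :: real measure))"
      unfolding g_sq_def using A0[of _ x] e False by (intro nn_integral_cong) (auto simp: indicator_def)
    then show ?thesis by simp
  qed
  then show thesis using Q0 that by blast
qed

text \<open>A form of Young's inequality by two cases. If S \<ge> L v, replacing v by S / L makes
  the product a small multiple of the power of S; otherwise S + c v is at most (L + c) v, and only a
  power of v remains.\<close>

lemma absorb_power:
  assumes K: "K > 0" and c: "c \<ge> 0"
  obtains K' :: real where "K' > 0"
    "\<And>S v. S < \<infinity> \<Longrightarrow> ennreal K * (v * (S + ennreal c * v) ^ (k + 1)) \<le> S ^ (k + 2) / 2 + ennreal K' * v ^ (k + 2)"
proof -
  \<comment> \<open>L \<ge> c gives S + c v \<le> 2 S in the first case, and L \<ge> 2 K 2^(k + 1)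
    makes the resulting coefficient K 2^(k + 1) / L at most 1 / 2; the 1 makes L positive.\<close>
  define L where "L = max 1 (max c (2 * K * 2 ^ (k + 1)))"
  have L: "L \<ge> 1" "L \<ge> c" "L \<ge> 2 * K * 2 ^ (k + 1)" by (auto simp: L_def)
  define K' where "K' = K * (L + c) ^ (k + 1)"
  have K': "K' > 0" using K c L(1) by (simp add: K'_def)
  have real: "K * (b * (a + c * b) ^ (k + 1)) \<le> a ^ (k + 2) / 2 + K' * b ^ (k + 2)" if ab: "a \<ge> 0" "b \<ge> 0" for a b :: real
  proof (cases "a \<ge> L * b")
    case True
    have b: "b \<le> a / L" using True L by (simp add: field_simps)
    have "c * b \<le> L * b" using L(2) ab by (intro mult_right_mono)
    then have "a + c * b \<le> 2 * a" using True by simp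
    then have "b * (a + c * b) ^ (k + 1) \<le> (a / L) * (2 * a) ^ (k + 1)"
      using b ab c by (intro mult_mono power_mono) auto
    then have "K * (b * (a + c * b) ^ (k + 1)) \<le> K * ((a / L) * (2 * a) ^ (k + 1))"
      using K by (intro mult_left_mono) auto
    also have "\<dots> = K * 2 ^ (k + 1) / L * a ^ (k + 2)" using L by (simp add: power_mult_distrib field_simps)
    also have "\<dots> \<le> 1 / 2 * a ^ (k + 2)"
      using L K ab by (intro mult_right_mono) (auto simp: field_simps)
    also have "\<dots> \<le> a ^ (k + 2) / 2 + K' * b ^ (k + 2)" using K' ab by simp
    finally show ?thesis .
  next
    case False
    then have "a + c * b \<le> (L + c) * b" by (simp add: distrib_right)
    then have "K * (b * (a + c * b) ^ (k + 1)) \<le> K * (b * ((L + c) * b) ^ (k + 1))"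
      using ab c K by (intro mult_left_mono power_mono) auto
    also have "\<dots> = K' * b ^ (k + 2)" by (simp add: K'_def power_mult_distrib mult_ac)
    also have "\<dots> \<le> a ^ (k + 2) / 2 + K' * b ^ (k + 2)" using ab by simp
    finally show ?thesis .
  qed
  have "ennreal K * (v * (S + ennreal c * v) ^ (k + 1)) \<le> S ^ (k + 2) / 2 + ennreal K' * v ^ (k + 2)" if finS: "S < \<infinity>" for S v
  proof (cases v)
    case (real b)
    obtain a where a: "S = ennreal a" "a \<ge> 0" using finS by (cases S) auto
    have "ennreal K * (v * (S + ennreal c * v) ^ (k + 1)) = ennreal (K * (b * (a + c * b) ^ (k + 1)))"
    proof -
      have "S + ennreal c * v = ennreal (a + c * b)"
        using real a c by (simp add: ennreal_mult)
      then show ?thesis using real a c K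
        by (simp only: ennreal_mult ennreal_power mult_nonneg_nonneg add_nonneg_nonneg zero_le_power less_imp_le)
    qed
    also have "\<dots> \<le> ennreal (a ^ (k + 2) / 2 + K' * b ^ (k + 2))"
      using real a by (intro ennreal_leI \<open>\<And>a b. 0 \<le> a \<Longrightarrow> 0 \<le> b \<Longrightarrow> _\<close>) auto
    also have "\<dots> = S ^ (k + 2) / 2 + ennreal K' * v ^ (k + 2)"
    proof -
      have "S ^ (k + 2) / 2 = ennreal (a ^ (k + 2) / 2)"
        using a divide_ennreal[of "a ^ (k + 2)" 2] ennreal_power[of a "k + 2"] by simp
      moreover have "ennreal K' * v ^ (k + 2) = ennreal (K' * b ^ (k + 2))"
        using real K' ennreal_power[of b "k + 2"] by (simp only: ennreal_mult less_imp_le zero_le_power)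
      ultimately show ?thesis using a real K' by (simp only: ennreal_plus mult_nonneg_nonneg less_imp_le zero_le_power divide_nonneg_nonneg zero_le_numeral)
    qed
    finally show ?thesis .
  next
    case top
    then show ?thesis using K' by (simp add: ennreal_mult_eq_top_iff)
  qed
  then show thesis using K' that by blast
qed

text \<open>The maximal theorem on L^(k + 2), applied to the square of \<open>f\<close>, as the case
  \<Phi>(s) = s^(k + 2) of the modular interpolation. The weak type inequality feeds the linear term
  of the weight, and k + 3 stands for any exponent above k + 2.\<close>

lemma maximal_power_bound:
  fixes k :: nat
  obtains D where "D > 0"
    "\<And>f :: 'a::euclidean_space \<Rightarrow> real. bounded_support f \<Longrightarrow>
      (\<integral>\<^sup>+x. (maximal (\<lambda>z. ennreal ((f z)\<^sup>2)) x) ^ (k + 2) \<partial>lborel) \<le> ennreal D * (\<integral>\<^sup>+x. ennreal ((f x)\<^sup>2) ^ (k + 2) \<partial>lborel)"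
proof -
  define \<Phi> where "\<Phi> = (\<lambda>s::real. ennreal (max 0 s ^ (k + 2)))"
  define B :: real where "B = 2 * 5 ^ DIM('a)"
  have pw: "t powr real (k + 2) = t ^ (k + 2)" if "t \<ge> 0" for t :: real
    using that powr_realpow[of t "k + 2"] by (cases "t = 0") (auto simp del: of_nat_add power_Suc)
  have mult: "\<Phi> (s * t) \<le> ennreal (1 * t powr real (k + 2)) * \<Phi> s" if "s \<ge> 0" "t \<ge> 0" for s t
    unfolding \<Phi>_def pw[OF that(2)] using that by (simp add: power_mult_distrib mult_ac flip: ennreal_mult del: power_Suc)
  obtain D where D: "D > 0"
    "\<And>(h :: 'a \<Rightarrow> ennreal) (f :: 'a \<Rightarrow> real). h \<in> borel_measurable borel \<Longrightarrow> f \<in> borel_measurable borel \<Longrightarrow>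
      (\<And>x. f x \<ge> 0) \<Longrightarrow>
      (\<And>l. l > 0 \<Longrightarrow> emeasure lborel {x. h x > ennreal l} \<le> ennreal B * (\<integral>\<^sup>+x. ennreal (marcinkiewicz_weight (real (k + 3)) l (f x)) \<partial>lborel)) \<Longrightarrow>
      (\<integral>\<^sup>+x. \<Phi> (enn2real (h x)) \<partial>lborel) \<le> ennreal D * (\<integral>\<^sup>+x. \<Phi> (f x) \<partial>lborel) \<and>
      ((\<integral>\<^sup>+x. \<Phi> (f x) \<partial>lborel) < \<infinity> \<longrightarrow> (AE x in lborel. h x < \<infinity>))"
  proof (rule marcinkiewicz_modular[of \<Phi> "real (k + 2)" "real (k + 2)" "real (k + 3)" B])
    show "\<Phi> a \<le> \<Phi> b" if "0 \<le> a" "a \<le> b" for a b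
      unfolding \<Phi>_def using that by (intro ennreal_leI power_mono) auto
    show "\<Phi> 0 = 0" by (simp add: \<Phi>_def)
    show "(\<Phi> \<longlongrightarrow> \<infinity>) at_top"
    proof -
      have "filterlim (\<lambda>s::real. max 0 s ^ (k + 2)) at_top at_top"
      proof (rule filterlim_at_top_mono[OF filterlim_ident])
        show "\<forall>\<^sub>F s in at_top. (s::real) \<le> max 0 s ^ (k + 2)"
          using eventually_ge_at_top[of "1::real"]
        proof eventually_elim
          case (elim s)
          then show ?case using self_le_power[of s "k + 2"] by simp
        qed
      qed
      then show ?thesis unfolding \<Phi>_def infinity_ennreal_def by (rule ennreal_tendsto_top_eq_at_top[THEN iffD2])
    qed
    show "lower_type (real (k + 2)) \<Phi>" unfolding lower_type_def using mult by (intro exI[of _ 1]) auto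
    show "upper_type (real (k + 2)) \<Phi>" unfolding upper_type_def using mult by (intro exI[of _ 1]) auto
  qed (auto simp: B_def)
  have "(\<integral>\<^sup>+x. (maximal (\<lambda>z. ennreal ((f z)\<^sup>2)) x) ^ (k + 2) \<partial>lborel) \<le> ennreal D * (\<integral>\<^sup>+x. ennreal ((f x)\<^sup>2) ^ (k + 2) \<partial>lborel)"
    if f: "bounded_support f" for f :: "'a \<Rightarrow> real"
  proof -
    define v where "v = maximal (\<lambda>z. ennreal ((f z)\<^sup>2))"
    have fm[measurable]: "f \<in> borel_measurable borel" using f by (simp add: bounded_support_def)
    have weak: "emeasure lborel {x. v x > ennreal l} \<le> ennreal B * (\<integral>\<^sup>+x. ennreal (marcinkiewicz_weight (real (k + 3)) l ((f x)\<^sup>2)) \<partial>lborel)" if l: "l > 0" for l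
    proof -
      have "ennreal l * emeasure lborel {x. v x > ennreal l} \<le> ennreal B * (\<integral>\<^sup>+x. ennreal ((f x)\<^sup>2) * indicator {x. ennreal ((f x)\<^sup>2) > ennreal (l / 2)} x \<partial>lborel)"
        unfolding v_def B_def by (rule maximal_weak_type) (use l in auto)
      also have "\<dots> \<le> ennreal B * (\<integral>\<^sup>+x. ennreal l * ennreal (marcinkiewicz_weight (real (k + 3)) l ((f x)\<^sup>2)) \<partial>lborel)"
      proof (rule mult_left_mono, rule nn_integral_mono)
        fix x
        show "ennreal ((f x)\<^sup>2) * indicator {x. ennreal ((f x)\<^sup>2) > ennreal (l / 2)} x \<le> ennreal l * ennreal (marcinkiewicz_weight (real (k + 3)) l ((f x)\<^sup>2))"
        proof (cases "(f x)\<^sup>2 > l / 2")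
          case True
          then have "(f x)\<^sup>2 / l \<le> marcinkiewicz_weight (real (k + 3)) l ((f x)\<^sup>2)"
            using l by (auto simp: marcinkiewicz_weight_def)
          then have "(f x)\<^sup>2 \<le> l * marcinkiewicz_weight (real (k + 3)) l ((f x)\<^sup>2)" using l by (simp add: field_simps)
          then have "ennreal ((f x)\<^sup>2) \<le> ennreal (l * marcinkiewicz_weight (real (k + 3)) l ((f x)\<^sup>2))" by (rule ennreal_leI)
          then have "ennreal ((f x)\<^sup>2) \<le> ennreal l * ennreal (marcinkiewicz_weight (real (k + 3)) l ((f x)\<^sup>2))"
            using l by (simp only: ennreal_mult' less_imp_le)
          then show ?thesis by (auto simp only: indicator_def of_bool_def mult_1_right mult_zero_right zero_le split: if_split)
        qed (use l in \<open>simp add: ennreal_less_iff\<close>)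
      qed simp
      also have "\<dots> = ennreal l * (ennreal B * (\<integral>\<^sup>+x. ennreal (marcinkiewicz_weight (real (k + 3)) l ((f x)\<^sup>2)) \<partial>lborel))"
        unfolding marcinkiewicz_weight_def by (subst nn_integral_cmult) (auto simp: mult_ac)
      finally show ?thesis using l by (simp add: ennreal_mult_le_mult_iff)
    qed
    have main: "(\<integral>\<^sup>+x. \<Phi> (enn2real (v x)) \<partial>lborel) \<le> ennreal D * (\<integral>\<^sup>+x. \<Phi> ((f x)\<^sup>2) \<partial>lborel)"
      "(\<integral>\<^sup>+x. \<Phi> ((f x)\<^sup>2) \<partial>lborel) < \<infinity> \<Longrightarrow> (AE x in lborel. v x < \<infinity>)"
      using D(2)[of v "\<lambda>x. (f x)\<^sup>2"] weak by (auto simp: v_def)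
    have eq: "(\<integral>\<^sup>+x. \<Phi> ((f x)\<^sup>2) \<partial>lborel) = (\<integral>\<^sup>+x. ennreal ((f x)\<^sup>2) ^ (k + 2) \<partial>lborel)"
      by (simp add: \<Phi>_def ennreal_power del: power_Suc)
    \<comment> \<open>A finite modular makes \<open>v\<close> finite almost everywhere, so that
      \<open>enn2real\<close> loses nothing.\<close>
    have fin: "(\<integral>\<^sup>+x. \<Phi> ((f x)\<^sup>2) \<partial>lborel) < \<infinity>"
    proof -
      obtain M where M: "M > 0" "\<And>x. \<bar>f x\<bar> \<le> M" "\<And>x. norm x > M \<Longrightarrow> f x = 0"
        using bounded_supportE[OF f] by metis
      have "(\<integral>\<^sup>+x. \<Phi> ((f x)\<^sup>2) \<partial>lborel) \<le> (\<integral>\<^sup>+x. ennreal ((M\<^sup>2) ^ (k + 2)) * indicator (cball (0::'a) M) x \<partial>lborel)"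
      proof (rule nn_integral_mono)
        fix x
        show "\<Phi> ((f x)\<^sup>2) \<le> ennreal ((M\<^sup>2) ^ (k + 2)) * indicator (cball 0 M) x"
        proof (cases "norm x \<le> M")
          case True
          have "(f x)\<^sup>2 \<le> M\<^sup>2" using M(1) M(2)[of x] by (metis abs_le_square_iff abs_of_pos)
          then have "\<Phi> ((f x)\<^sup>2) \<le> ennreal ((M\<^sup>2) ^ (k + 2))" unfolding \<Phi>_def by (intro ennreal_leI power_mono) auto
          then show ?thesis using True by simp
        next
          case False
          then show ?thesis using M(3)[of x] by (simp add: \<Phi>_def)
        qed
      qed
      also have "\<dots> < \<infinity>" using M(1) by (subst nn_integral_cmult_indicator) (auto simp: emeasure_cball_eq ennreal_mult_less_top)
      finally show ?thesis .
    qed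
    have "(\<integral>\<^sup>+x. v x ^ (k + 2) \<partial>lborel) = (\<integral>\<^sup>+x. \<Phi> (enn2real (v x)) \<partial>lborel)"
    proof (rule nn_integral_cong_AE)
      show "AE x in lborel. v x ^ (k + 2) = \<Phi> (enn2real (v x))"
        using main(2)[OF fin]
      proof eventually_elim
        case (elim x)
        then obtain r where "v x = ennreal r" "r \<ge> 0" by (cases "v x") auto
        then show ?case by (simp add: \<Phi>_def ennreal_power del: power_Suc)
      qed
    qed
    then show ?thesis using main(1) unfolding eq v_def by simp
  qed
  then show thesis using D(1) that by blast
qed

text \<open>For a truncated range of scales, \<open>g_sq_truncated_power\<close> and
  \<open>absorb_power\<close> give Y \<le> Y / 2 plus a multiple of the integral of v^(k + 2), where
  \<open>v\<close> is the maximal function of the square of f; as Y is finite, half of it can be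
  subtracted. The resulting constant does not depend on the truncation, so monotone convergence
  restores all scales.\<close>

theorem g_sq_even_power:
  fixes k :: nat
  assumes a: "0 < \<alpha>" "\<alpha> \<le> 1"
  obtains D where "D > 0"
    "\<And>f :: 'a::euclidean_space \<Rightarrow> real. bounded_support f \<Longrightarrow>
      (\<integral>\<^sup>+x. (g_sq \<alpha> f {0<..} x) ^ (k + 2) \<partial>lborel) \<le> ennreal D * (\<integral>\<^sup>+x. ennreal ((f x)\<^sup>2) ^ (k + 2) \<partial>lborel)"
proof -
  define V where "V = unit_ball_vol (real DIM('a))"
  have V: "V > 0" by (simp add: V_def)
  define C where "C = 6 * V\<^sup>2 * 2 ^ DIM('a) / \<alpha>"
  have C: "C > 0" using V a by (simp add: C_def)
  define K where "K = 3 ^ (k + 2) * (4 ^ (DIM('a) + 1)) ^ (k + 1) * (C * 2 ^ DIM('a))"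
  have K: "K > 0" using C by (simp add: K_def)
  define c where "c = 9 * V\<^sup>2 * 2 ^ DIM('a)"
  have c: "c \<ge> 0" by (simp add: c_def)
  obtain K' where K': "K' > 0"
    "\<And>S v. S < \<infinity> \<Longrightarrow> ennreal K * (v * (S + ennreal c * v) ^ (k + 1)) \<le> S ^ (k + 2) / 2 + ennreal K' * v ^ (k + 2)"
    using absorb_power[OF K c, of k] by blast
  obtain D where D: "D > 0" "\<And>f :: 'a \<Rightarrow> real. bounded_support f \<Longrightarrow>
      (\<integral>\<^sup>+x. (maximal (\<lambda>z. ennreal ((f z)\<^sup>2)) x) ^ (k + 2) \<partial>lborel) \<le> ennreal D * (\<integral>\<^sup>+x. ennreal ((f x)\<^sup>2) ^ (k + 2) \<partial>lborel)"
    using maximal_power_bound[of k, where 'a='a] by blast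
  have bound: "(\<integral>\<^sup>+x. (g_sq \<alpha> f {0<..} x) ^ (k + 2) \<partial>lborel) \<le> ennreal (2 * K' * D) * (\<integral>\<^sup>+x. ennreal ((f x)\<^sup>2) ^ (k + 2) \<partial>lborel)"
    if f: "bounded_support f" for f :: "'a \<Rightarrow> real"
  proof -
    define v where "v = maximal (\<lambda>z. ennreal ((f z)\<^sup>2))"
    have [measurable]: "v \<in> borel_measurable borel" unfolding v_def by measurable
    have fm[measurable]: "f \<in> borel_measurable borel" using f by (simp add: bounded_support_def)
    note lif = bounded_support_locally_integrable[OF f]
    have trunc: "(\<integral>\<^sup>+x. (g_sq \<alpha> f {e..N} x) ^ (k + 2) \<partial>lborel) \<le> ennreal (2 * K') * (\<integral>\<^sup>+x. v x ^ (k + 2) \<partial>lborel)"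
      if e: "0 < e" "e \<le> N" for e N
    proof -
      obtain Q where Q: "Q \<ge> 0" "\<And>x. g_sq \<alpha> f {e..N} x \<le> ennreal Q * indicator (cball 0 Q) x"
        using g_sq_truncated_bounded[OF a f e] by blast
      have fin: "g_sq \<alpha> f {e..N} x < \<infinity>" for x
        using Q(2)[of x] by (rule le_less_trans) (auto simp: indicator_def)
      have [measurable]: "g_sq \<alpha> f {e..N} \<in> borel_measurable borel"
        using e by (intro g_sq_measurable[OF lif a]) auto
      define Y where "Y = (\<integral>\<^sup>+x. (g_sq \<alpha> f {e..N} x) ^ (k + 2) \<partial>lborel)"
      have "Y \<le> (\<integral>\<^sup>+x. ennreal Q ^ (k + 2) * indicator (cball (0::'a) Q) x \<partial>lborel)"
        unfolding Y_def
      proof (rule nn_integral_mono)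
        fix x
        show "(g_sq \<alpha> f {e..N} x) ^ (k + 2) \<le> ennreal Q ^ (k + 2) * indicator (cball 0 Q) x"
          using power_mono[OF Q(2)[of x], of "k + 2"] by (auto simp: indicator_def)
      qed
      also have "\<dots> < \<infinity>"
        using Q(1) by (subst nn_integral_cmult_indicator) (auto simp: emeasure_cball_eq ennreal_mult_less_top ennreal_power simp del: power_Suc)
      finally have Y: "Y < \<infinity>" .
      \<comment> \<open>The doubled range [2 e, 2 N] exceeds [e, N] only by scales in [N, 2 N].
        Their integrand is at most c v / t, and dt / t has mass at most 1 there.\<close>
      have S': "g_sq \<alpha> f {2 * e..2 * N} x \<le> g_sq \<alpha> f {e..N} x + ennreal c * v x" for x
      proof -
        define At where "At = (\<lambda>t. (A_sup \<alpha> f t x * indicator {0<..} t)\<^sup>2)"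
        have [measurable]: "At \<in> borel_measurable borel" unfolding At_def using A_sup_measurable_fst[OF lif a, of x] by measurable
        have "g_sq \<alpha> f {2 * e..2 * N} x \<le> (\<integral>\<^sup>+t. At t * ennreal (1 / t) * indicator {e..N} t + ennreal c * v x * (ennreal (1 / t) * indicator {N..2 * N} t) \<partial>lborel)"
          unfolding g_sq_def
        proof (rule nn_integral_mono)
          fix t :: real
          show "(A_sup \<alpha> f t x)\<^sup>2 * ennreal (1 / t) * indicator {2 * e..2 * N} t \<le> At t * ennreal (1 / t) * indicator {e..N} t + ennreal c * v x * (ennreal (1 / t) * indicator {N..2 * N} t)"
          proof (cases "t \<in> {2 * e..2 * N}")
            case True
            then have t: "t > 0" "e \<le> t" using e by auto
            show ?thesis
            proof (cases "t \<le> N")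
              case True
              then show ?thesis using t by (auto simp: At_def indicator_def)
            next
              case False
              have "(A_sup \<alpha> f t x)\<^sup>2 * ennreal (1 / t) \<le> ennreal c * v x * ennreal (1 / t)"
                unfolding c_def V_def v_def by (intro mult_right_mono A_sup_sq_le_maximal[OF a t(1)]) auto
              then show ?thesis using False True by (auto simp: indicator_def)
            qed
          qed simp
        qed
        also have "\<dots> = (\<integral>\<^sup>+t. At t * ennreal (1 / t) * indicator {e..N} t \<partial>lborel) + ennreal c * v x * (\<integral>\<^sup>+t\<in>{N..2 * N}. ennreal (1 / t) \<partial>lborel)"
          by (subst nn_integral_add) (auto simp: nn_integral_cmult)
        also have "\<dots> \<le> g_sq \<alpha> f {e..N} x + ennreal c * v x * 1"
        proof (intro add_mono mult_left_mono)
          show "(\<integral>\<^sup>+t. At t * ennreal (1 / t) * indicator {e..N} t \<partial>lborel) \<le> g_sq \<alpha> f {e..N} x"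
            unfolding g_sq_def by (intro nn_integral_mono) (auto simp: At_def indicator_def)
          have "(\<integral>\<^sup>+t\<in>{N..2 * N}. ennreal (1 / t) \<partial>lborel) \<le> ennreal ((2 * N - N) / N)"
            using e by (intro nn_integral_inverse_le) auto
          also have "(2 * N - N) / N = 1" using e by simp
          finally show "(\<integral>\<^sup>+t\<in>{N..2 * N}. ennreal (1 / t) \<partial>lborel) \<le> 1" by simp
        qed auto
        finally show ?thesis by simp
      qed
      have "Y \<le> ennreal K * (\<integral>\<^sup>+x. v x * (g_sq \<alpha> f {2 * e..2 * N} x) ^ (k + 1) \<partial>lborel)"
        unfolding Y_def K_def v_def by (rule g_sq_truncated_power[OF a f e(1) fin]) (simp add: C_def V_def)
      also have "\<dots> = (\<integral>\<^sup>+x. ennreal K * (v x * (g_sq \<alpha> f {2 * e..2 * N} x) ^ (k + 1)) \<partial>lborel)"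
      proof -
        have [measurable]: "g_sq \<alpha> f {2 * e..2 * N} \<in> borel_measurable borel"
          using e by (intro g_sq_measurable[OF lif a]) auto
        show ?thesis by (rule nn_integral_cmult[symmetric]) measurable
      qed
      also have "\<dots> \<le> (\<integral>\<^sup>+x. (g_sq \<alpha> f {e..N} x) ^ (k + 2) / 2 + ennreal K' * v x ^ (k + 2) \<partial>lborel)"
      proof (rule nn_integral_mono)
        fix x
        have "ennreal K * (v x * (g_sq \<alpha> f {2 * e..2 * N} x) ^ (k + 1)) \<le> ennreal K * (v x * (g_sq \<alpha> f {e..N} x + ennreal c * v x) ^ (k + 1))"
          by (intro mult_left_mono power_mono S') auto
        also have "\<dots> \<le> (g_sq \<alpha> f {e..N} x) ^ (k + 2) / 2 + ennreal K' * v x ^ (k + 2)"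
          by (rule K'(2)[OF fin])
        finally show "ennreal K * (v x * (g_sq \<alpha> f {2 * e..2 * N} x) ^ (k + 1)) \<le> \<dots>" .
      qed
      also have "\<dots> = Y / 2 + ennreal K' * (\<integral>\<^sup>+x. v x ^ (k + 2) \<partial>lborel)"
        unfolding Y_def by (subst nn_integral_add) (auto simp: nn_integral_cmult nn_integral_divide)
      finally have le: "Y \<le> Y / 2 + ennreal K' * (\<integral>\<^sup>+x. v x ^ (k + 2) \<partial>lborel)" .
      show ?thesis
      proof (cases "(\<integral>\<^sup>+x. v x ^ (k + 2) \<partial>lborel)")
        case (real r)
        obtain y where y: "Y = ennreal y" "y \<ge> 0" using Y by (cases Y) auto
        have "Y / 2 = ennreal (y / 2)" using y divide_ennreal[of y 2] by simp
        then have "ennreal y \<le> ennreal (y / 2) + ennreal (K' * r)" using le y real K' by (simp add: ennreal_mult)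
        also have "\<dots> = ennreal (y / 2 + K' * r)" using y real K' by (intro ennreal_plus[symmetric]) auto
        finally have "y \<le> y / 2 + K' * r" using y real K' by (subst (asm) ennreal_le_iff) auto
        then have "y \<le> 2 * K' * r" by simp
        then have "Y \<le> ennreal (2 * K' * r)" unfolding y by (rule ennreal_leI)
        also have "\<dots> = ennreal (2 * K') * ennreal r" using K' real by (intro ennreal_mult) auto
        finally show ?thesis unfolding Y_def real .
      next
        case top
        then show ?thesis using K' by (simp add: ennreal_mult_eq_top_iff)
      qed
    qed
    \<comment> \<open>An increasing exhaustion of the positive scales by ranges to which the
      truncated bound applies.\<close>
    define S where "S = (\<lambda>(j::nat) x. g_sq \<alpha> f {1 / real (Suc j)..real (Suc j)} x)"
    have Sm[measurable]: "S j \<in> borel_measurable borel" for j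
      unfolding S_def by (intro g_sq_measurable[OF lif a]) (auto intro: less_le_trans[rotated])
    have sub: "{1 / real (Suc i)..real (Suc i)} \<subseteq> {1 / real (Suc j)..real (Suc j)}" if "i \<le> j" for i j
    proof -
      have "1 / real (Suc j) \<le> 1 / real (Suc i)" using that by (intro divide_left_mono) auto
      then show ?thesis using that by auto
    qed
    have incS: "S i x \<le> S j x" if "i \<le> j" for i j x
      unfolding S_def g_sq_def using sub[OF that]
      by (intro nn_integral_mono mult_left_mono indicator_mono_ennreal) auto
    have SUP: "g_sq \<alpha> f {0<..} x = (SUP j. S j x)" for x
    proof -
      define F where "F = (\<lambda>j t. (A_sup \<alpha> f t x * indicator {0<..} t)\<^sup>2 * ennreal (1 / t) * indicator {1 / real (Suc j)..real (Suc j)} t)"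
      have [measurable]: "F j \<in> borel_measurable borel" for j
        unfolding F_def using A_sup_measurable_fst[OF lif a, of x] by measurable
      have pos: "t > 0" if "t \<in> {1 / real (Suc j)..real (Suc j)}" for t j
        using that by (auto intro: less_le_trans[rotated])
      have "g_sq \<alpha> f {0<..} x \<le> (\<integral>\<^sup>+t. (SUP j. F j t) \<partial>lborel)"
        unfolding g_sq_def
      proof (rule nn_integral_mono)
        fix t :: real
        show "(A_sup \<alpha> f t x)\<^sup>2 * ennreal (1 / t) * indicator {0<..} t \<le> (SUP j. F j t)"
        proof (cases "t > 0")
          case True
          obtain j :: nat where j: "max t (1 / t) < real j" using reals_Archimedean2 by blast
          then have "max t (1 / t) < real (Suc j)" by simp
          then have "t \<in> {1 / real (Suc j)..real (Suc j)}" using True by (auto simp: field_simps)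
          then show ?thesis using True by (intro SUP_upper2[of j]) (auto simp: F_def)
        qed simp
      qed
      also have "\<dots> = (SUP j. (\<integral>\<^sup>+t. F j t \<partial>lborel))"
      proof (rule nn_integral_monotone_convergence_SUP)
        show "incseq F" unfolding incseq_def le_fun_def F_def
          using sub by (intro allI impI mult_left_mono indicator_mono_ennreal) auto
      qed auto
      also have "\<dots> = (SUP j. S j x)"
        unfolding S_def g_sq_def F_def using pos
        by (intro SUP_cong refl nn_integral_cong) (auto simp: indicator_def)
      finally have "g_sq \<alpha> f {0<..} x \<le> (SUP j. S j x)" .
      moreover have "S j x \<le> g_sq \<alpha> f {0<..} x" for j
        unfolding S_def g_sq_def using pos
        by (intro nn_integral_mono mult_left_mono indicator_mono_ennreal subsetI) auto
      ultimately show ?thesis by (intro antisym SUP_least) auto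
    qed
    have "(\<integral>\<^sup>+x. (g_sq \<alpha> f {0<..} x) ^ (k + 2) \<partial>lborel) = (\<integral>\<^sup>+x. (SUP j. S j x ^ (k + 2)) \<partial>lborel)"
      unfolding SUP by (intro nn_integral_cong SUP_power_incseq) (auto simp: incseq_def incS)
    also have "\<dots> = (SUP j. \<integral>\<^sup>+x. S j x ^ (k + 2) \<partial>lborel)"
      by (rule nn_integral_monotone_convergence_SUP) (auto simp: incseq_def le_fun_def intro!: power_mono incS simp del: power_Suc)
    also have "\<dots> \<le> ennreal (2 * K') * (\<integral>\<^sup>+x. v x ^ (k + 2) \<partial>lborel)"
      unfolding S_def by (intro SUP_least trunc) (auto simp: field_simps)
    also have "\<dots> \<le> ennreal (2 * K') * (ennreal D * (\<integral>\<^sup>+x. ennreal ((f x)\<^sup>2) ^ (k + 2) \<partial>lborel))"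
      unfolding v_def by (intro mult_left_mono D(2) f) auto
    also have "\<dots> = ennreal (2 * K' * D) * (\<integral>\<^sup>+x. ennreal ((f x)\<^sup>2) ^ (k + 2) \<partial>lborel)"
      using K' D by (simp add: ennreal_mult mult.assoc)
    finally show ?thesis .
  qed
  show thesis by (rule that[of "2 * K' * D"]) (use K' D bound in auto)
qed

subsection \<open>Calderon-Zygmund decomposition\<close>

text \<open>The consequence of Lebesgue's differentiation theorem that the decomposition needs, from
  Vitali's covering theorem. For a < b let E be the set where h > b but the maximal function is at
  most a, and U an open set around E with |U - E| < e. Disjoint balls inside U with centres in E
  cover almost all of E, and each has average at most a, so b |E| \<le> a (|E| + e). Letting e tend
  to 0 gives |E| = 0; rational a and b are enough.\<close>

lemma AE_le_maximal:
  fixes h :: "'a::euclidean_space \<Rightarrow> ennreal"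
  assumes hm[measurable]: "h \<in> borel_measurable borel" and fin: "(\<integral>\<^sup>+x. h x \<partial>lborel) < \<infinity>"
  shows "AE x in lborel. h x \<le> maximal h x"
proof -
  have null: "emeasure lborel {x. ennreal b < h x \<and> maximal h x \<le> ennreal a} = 0" if ab: "0 \<le> a" "a < b" for a b
  proof -
    define E where "E = {x. ennreal b < h x \<and> maximal h x \<le> ennreal a}"
    have Em[measurable]: "E \<in> sets borel" unfolding E_def by measurable
    have bE: "ennreal b * emeasure lborel E \<le> (\<integral>\<^sup>+x\<in>E. h x \<partial>lborel)"
    proof -
      have "ennreal b * emeasure lborel E = (\<integral>\<^sup>+x\<in>E. ennreal b \<partial>lborel)"
        by (subst nn_integral_cmult_indicator) auto
      also have "\<dots> \<le> (\<integral>\<^sup>+x\<in>E. h x \<partial>lborel)"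
        by (intro nn_integral_mono) (auto simp: E_def indicator_def)
      finally show ?thesis .
    qed
    also have "\<dots> \<le> (\<integral>\<^sup>+x. h x \<partial>lborel)" by (intro nn_integral_mono) (auto simp: indicator_def)
    finally have "ennreal b * emeasure lborel E < \<infinity>" using fin by (rule le_less_trans)
    then have "emeasure lborel E < \<infinity>" using ab by (auto simp: ennreal_mult_less_top)
    then obtain m where m: "emeasure lborel E = ennreal m" "m \<ge> 0" by (cases "emeasure lborel E") auto
    have le: "b * m \<le> a * (m + e)" if e: "e > 0" for e
    proof -
      obtain U where U: "open U" "E \<subseteq> U" "emeasure lborel (U - E) < ennreal e"
        using outer_regular_lborel[OF Em e] by blast
      define K where "K = {(y, r). y \<in> E \<and> r > 0 \<and> ball y r \<subseteq> U}"
      obtain C where C: "countable C" "C \<subseteq> K"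
        "pairwise (\<lambda>i j. disjnt (ball (fst i) (snd i)) (ball (fst j) (snd j))) C"
        "negligible (E - (\<Union>i\<in>C. ball (fst i) (snd i)))"
      proof (rule Vitali_covering_theorem_balls[of E K fst snd])
        fix x :: 'a and d :: real assume x: "x \<in> E" and d: "0 < d"
        then obtain r where r: "r > 0" "ball x r \<subseteq> U" using U(1,2) open_contains_ball by (metis subsetD)
        have "(x, min r (d / 2)) \<in> K" using r d x by (auto simp: K_def)
        then show "\<exists>i. i \<in> K \<and> x \<in> ball (fst i) (snd i) \<and> snd i < d"
          using r d by (intro exI[of _ "(x, min r (d / 2))"]) auto
      qed auto
      define W where "W = (\<Union>i\<in>C. ball (fst i) (snd i))"
      have Wm[measurable]: "W \<in> sets borel" unfolding W_def by (intro borel_open open_UN) auto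
      have WU: "W \<subseteq> U" unfolding W_def
      proof (rule UN_least)
        fix i assume "i \<in> C"
        then have "i \<in> K" using C(2) by auto
        then show "ball (fst i) (snd i) \<subseteq> U" by (simp add: K_def case_prod_beta)
      qed
      have disj: "disjoint_family_on (\<lambda>i. ball (fst i) (snd i)) C"
        using C(3) by (auto simp: disjoint_family_on_def pairwise_def disjnt_def)
      have "E - W \<in> null_sets lborel"
        using C(4) unfolding negligible_iff_null_sets W_def[symmetric] by (subst (asm) null_sets_completion_iff) auto
      then have ae: "AE x in lborel. x \<notin> E - W" by (rule AE_not_in)
      have "(\<integral>\<^sup>+x\<in>E. h x \<partial>lborel) \<le> (\<integral>\<^sup>+x\<in>W. h x \<partial>lborel)"
        by (rule nn_integral_mono_AE) (use ae in eventually_elim, auto simp: indicator_def)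
      also have "\<dots> = emeasure (density lborel h) W" by (simp add: emeasure_density)
      also have "\<dots> = (\<integral>\<^sup>+i. emeasure (density lborel h) (ball (fst i) (snd i)) \<partial>count_space C)"
        unfolding W_def by (rule emeasure_UN_countable) (use C disj in auto)
      also have "\<dots> \<le> (\<integral>\<^sup>+i. ennreal a * emeasure lborel (ball (fst i) (snd i)) \<partial>count_space C)"
      proof (rule nn_integral_mono)
        fix i assume "i \<in> space (count_space C)"
        then obtain y r where i: "i = (y, r)" "y \<in> E" "r > 0" using C(2) by (auto simp: K_def)
        have "emeasure (density lborel h) (ball y r) = (\<integral>\<^sup>+z\<in>ball y r. h z \<partial>lborel)"
          by (simp add: emeasure_density)
        also have "\<dots> \<le> ennreal (unit_ball_vol (real DIM('a)) * r ^ DIM('a)) * maximal h y"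
          by (rule ball_integral_le_maximal) (use i in auto)
        also have "\<dots> \<le> ennreal (unit_ball_vol (real DIM('a)) * r ^ DIM('a)) * ennreal a"
          using i by (intro mult_left_mono) (auto simp: E_def)
        also have "\<dots> = ennreal a * emeasure lborel (ball y r)" using i by (simp add: emeasure_ball_eq mult.commute)
        finally show "emeasure (density lborel h) (ball (fst i) (snd i)) \<le> ennreal a * emeasure lborel (ball (fst i) (snd i))"
          by (simp add: i)
      qed
      also have "\<dots> = ennreal a * (\<integral>\<^sup>+i. emeasure lborel (ball (fst i) (snd i)) \<partial>count_space C)"
        by (rule nn_integral_cmult) auto
      also have "(\<integral>\<^sup>+i. emeasure lborel (ball (fst i) (snd i)) \<partial>count_space C) = emeasure lborel W"
        unfolding W_def by (rule emeasure_UN_countable[symmetric]) (use C disj in auto)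
      also have "\<dots> \<le> emeasure lborel U" using WU U(1) by (intro emeasure_mono) auto
      also have "emeasure lborel U \<le> emeasure lborel E + emeasure lborel (U - E)"
        using U(1,2) by (subst plus_emeasure) (auto simp: Un_absorb1)
      also have "\<dots> \<le> ennreal m + ennreal e" using U(3) m by (intro add_mono) auto
      finally have "(\<integral>\<^sup>+x\<in>E. h x \<partial>lborel) \<le> ennreal a * (ennreal m + ennreal e)"
        by (simp add: mult_left_mono)
      with bE have "ennreal b * ennreal m \<le> ennreal a * (ennreal m + ennreal e)"
        unfolding m(1) by (rule order_trans)
      also have "\<dots> = ennreal (a * (m + e))"
        using m e ab ennreal_mult[of a "m + e"] by simp
      finally have "ennreal (b * m) \<le> ennreal (a * (m + e))" using m ab by (simp add: ennreal_mult)
      then show ?thesis using ab m e by (subst (asm) ennreal_le_iff) auto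
    qed
    have "m = 0"
    proof (rule ccontr)
      assume "m \<noteq> 0"
      then have m0: "m > 0" using m by simp
      \<comment> \<open>Chosen so that a e is at most (b - a) m / 2; the a + 1 in the denominator
        covers the case a = 0.\<close>
      define e where "e = (b - a) * m / (2 * (a + 1))"
      have e: "e > 0" using m0 ab by (simp add: e_def)
      have "a * e \<le> (a + 1) * e" using e by simp
      also have "\<dots> = (b - a) * m / 2" using ab by (simp add: e_def field_simps)
      finally have "a * e \<le> (b - a) * m / 2" .
      moreover have "(b - a) * m > 0" using m0 ab by simp
      ultimately show False using le[OF e] by (simp add: algebra_simps)
    qed
    then show ?thesis using m unfolding E_def by simp
  qed
  have "AE x in lborel. \<forall>a\<in>\<rat>. \<forall>b\<in>\<rat>. 0 \<le> a \<and> a < b \<longrightarrow> \<not> (ennreal b < h x \<and> maximal h x \<le> ennreal a)"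
  proof (intro AE_ball_countable[THEN iffD2] countable_rat ballI)
    fix a b :: real
    show "AE x in lborel. 0 \<le> a \<and> a < b \<longrightarrow> \<not> (ennreal b < h x \<and> maximal h x \<le> ennreal a)"
    proof (cases "0 \<le> a \<and> a < b")
      case True
      have "{x. ennreal b < h x \<and> maximal h x \<le> ennreal a} \<in> null_sets lborel"
        using null[of a b] True by (intro null_setsI) auto
      from AE_not_in[OF this] show ?thesis by eventually_elim auto
    qed auto
  qed
  then show ?thesis
  proof eventually_elim
    case (elim x)
    show ?case
    proof (rule ccontr)
      assume "\<not> h x \<le> maximal h x"
      then have lt: "maximal h x < h x" by simp
      then obtain u where u: "u \<ge> 0" "maximal h x = ennreal u" by (cases "maximal h x") auto
      obtain v where v: "u < v" "ennreal v < h x"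
      proof (cases "h x")
        case (real r)
        then have "u < r" using lt u by (simp add: ennreal_less_iff)
        then obtain v where "u < v" "v < r" using dense by blast
        then show thesis using that[of v] real u by (simp add: ennreal_less_iff)
      next
        case top
        then show thesis using that[of "u + 1"] by simp
      qed
      obtain a where a: "a \<in> \<rat>" "u < a" "a < v" using Rats_dense_in_real[OF v(1)] by blast
      obtain b where b: "b \<in> \<rat>" "a < b" "b < v" using Rats_dense_in_real[OF a(3)] by blast
      have "ennreal b < h x" using b v u a by (metis ennreal_less_iff order_less_trans less_imp_le order_le_less_trans)
      moreover have "maximal h x \<le> ennreal a" using a u by (simp add: ennreal_leI)
      ultimately show False using elim a b u by auto
    qed
  qed
qed

text \<open>Let J be the integral that is squared on the right. As U increases, t^(-\<beta>) U t,
  which is \<beta> U t times the integral of s^(-\<beta> - 1) over s \<ge> t, is at most \<beta> J.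
  So one factor of the square is bounded by \<beta> J and the other one integrates to J. This
  replaces a quadratic integral over scales by a linear one, to which Tonelli applies; it serves
  both the bad part and the far part of f.\<close>

lemma square_integral_monotone_kernel:
  fixes U :: "real \<Rightarrow> ennreal"
  assumes U: "mono U" and b: "\<beta> > 0" and r: "r \<ge> 0"
  shows "(\<integral>\<^sup>+t\<in>{r<..}. (ennreal (t powr (- \<beta>)) * U t)\<^sup>2 * ennreal (1 / t) \<partial>lborel)
    \<le> ennreal \<beta> * (\<integral>\<^sup>+t\<in>{r<..}. ennreal (t powr (- \<beta> - 1)) * U t \<partial>lborel)\<^sup>2"
proof -
  have [measurable]: "U \<in> borel_measurable borel" by (rule mono_ennreal_measurable[OF U])
  define J where "J = (\<integral>\<^sup>+t\<in>{r<..}. ennreal (t powr (- \<beta> - 1)) * U t \<partial>lborel)"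
  have pw: "ennreal (t powr (- \<beta>)) * U t \<le> ennreal \<beta> * J" if t: "t > r" for t
  proof -
    have t0: "t > 0" using t r by simp
    have "ennreal (t powr (- \<beta>)) * U t = ennreal \<beta> * (ennreal (t powr (- \<beta>) / \<beta>) * U t)"
    proof -
      have "ennreal \<beta> * ennreal (t powr (- \<beta>) / \<beta>) = ennreal (\<beta> * (t powr (- \<beta>) / \<beta>))"
        using b by (intro ennreal_mult[symmetric]) auto
      then show ?thesis using b by (simp flip: mult.assoc)
    qed
    also have "ennreal (t powr (- \<beta>) / \<beta>) * U t = (\<integral>\<^sup>+s\<in>{t..}. ennreal (s powr (- \<beta> - 1)) \<partial>lborel) * U t"
      using nn_integral_powr_atLeast[OF b t0] by simp
    also have "\<dots> = (\<integral>\<^sup>+s. ennreal (s powr (- \<beta> - 1)) * indicator {t..} s * U t \<partial>lborel)"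
      by (rule nn_integral_multc[symmetric]) auto
    also have "\<dots> \<le> J" unfolding J_def
    proof (rule nn_integral_mono)
      fix s
      show "ennreal (s powr (- \<beta> - 1)) * indicator {t..} s * U t \<le> ennreal (s powr (- \<beta> - 1)) * U s * indicator {r<..} s"
        using t monoD[OF U, of t s] by (cases "t \<le> s") (auto intro: mult_left_mono)
    qed
    finally show ?thesis by (simp add: mult_left_mono)
  qed
  have "(\<integral>\<^sup>+t\<in>{r<..}. (ennreal (t powr (- \<beta>)) * U t)\<^sup>2 * ennreal (1 / t) \<partial>lborel)
    \<le> (\<integral>\<^sup>+t. ennreal \<beta> * J * (ennreal (t powr (- \<beta> - 1)) * U t * indicator {r<..} t) \<partial>lborel)"
  proof (rule nn_integral_mono)
    fix t :: real
    show "(ennreal (t powr (- \<beta>)) * U t)\<^sup>2 * ennreal (1 / t) * indicator {r<..} t \<le> ennreal \<beta> * J * (ennreal (t powr (- \<beta> - 1)) * U t * indicator {r<..} t)"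
    proof (cases "t > r")
      case True
      then have t0: "t > 0" using r by simp
      have "ennreal (t powr (- \<beta>)) * ennreal (1 / t) = ennreal (t powr (- \<beta>) * (1 / t))"
        using t0 by (intro ennreal_mult[symmetric]) auto
      also have "t powr (- \<beta>) * (1 / t) = t powr (- \<beta> - 1)" using t0 by (simp add: powr_diff)
      finally have *: "ennreal (t powr (- \<beta>)) * ennreal (1 / t) = ennreal (t powr (- \<beta> - 1))" .
      have "(ennreal (t powr (- \<beta>)) * U t)\<^sup>2 * ennreal (1 / t) = (ennreal (t powr (- \<beta>)) * U t) * ((ennreal (t powr (- \<beta>)) * ennreal (1 / t)) * U t)"
        by (simp add: power2_eq_square mult_ac)
      also have "\<dots> \<le> ennreal \<beta> * J * ((ennreal (t powr (- \<beta>)) * ennreal (1 / t)) * U t)"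
        by (rule mult_right_mono[OF pw[OF True]]) simp
      finally show ?thesis using True by (simp add: *)
    qed simp
  qed
  also have "\<dots> = ennreal \<beta> * J * J" unfolding J_def by (rule nn_integral_cmult) measurable
  finally show ?thesis by (simp add: J_def power2_eq_square mult.assoc)
qed

text \<open>
  No cubes are needed: the mass of \<open>f\<close> at a point \<open>y\<close> of the exceptional set is spread over the ball
  around \<open>y\<close> whose radius is a quarter of the distance of \<open>y\<close> to the complement.
\<close>

locale calderon_zygmund =
  fixes f :: "'a::euclidean_space \<Rightarrow> real" and l :: real
  assumes f: "bounded_support f" and l: "l > 0"
begin

definition "Mf = maximal (\<lambda>z. ennreal \<bar>f z\<bar>)"
definition "\<Omega> = {x. Mf x > ennreal l}"
definition "\<delta> y = infdist y (- \<Omega>)"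
definition "V = unit_ball_vol (real DIM('a))"
definition "\<kappa> y w = (if y \<in> \<Omega> \<and> dist y w < \<delta> y / 4 then 1 / (V * (\<delta> y / 4) ^ DIM('a)) else 0)"
definition "P w = (\<integral>y. f y * \<kappa> y w \<partial>lborel)"
definition "good w = f w * indicator (- \<Omega>) w + P w"
text \<open>The superposition over y in \<Omega> of the pieces f(y) times (unit mass at y minus
  \<kappa> y), each of total mass zero and concentrated within distance \<delta> y / 4 of y.\<close>

definition "bad w = f w * indicator \<Omega> w - P w"

lemma fm[measurable]: "f \<in> borel_measurable borel"
  using f by (simp add: bounded_support_def)

lemma V_pos: "V > 0"
  by (simp add: V_def)

lemma open_Omega: "open \<Omega>"
  unfolding \<Omega>_def Mf_def by (rule open_maximal_superlevel)

lemma Omega_measurable[measurable]: "\<Omega> \<in> sets borel"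
  using open_Omega by simp

lemma f_integral_finite: "(\<integral>\<^sup>+x. ennreal \<bar>f x\<bar> \<partial>lborel) < \<infinity>"
  using bounded_support_integrable[OF f] by (simp add: integrable_iff_bounded)

text \<open>A ball over which the average of |f| exceeds l has bounded radius, because f is
  integrable, and must meet the bounded support of f. In particular \<Omega> is not the whole space,
  so the distance to its complement is positive inside and attained.\<close>

lemma bounded_Omega: obtains R where "R > 0" "\<Omega> \<subseteq> ball 0 R"
proof -
  obtain M where M: "M > 0" "\<And>x. norm x > M \<Longrightarrow> f x = 0"
    using bounded_supportE[OF f] by metis
  obtain I where I: "I \<ge> 0" "(\<integral>\<^sup>+x. ennreal \<bar>f x\<bar> \<partial>lborel) = ennreal I"
    using f_integral_finite by (cases "(\<integral>\<^sup>+x. ennreal \<bar>f x\<bar> \<partial>lborel)") auto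
  define R where "R = max 1 (I / (V * l))"
  have "norm x < M + 2 * R + 1" if x: "x \<in> \<Omega>" for x
  proof -
    obtain y r where yr: "r > 0" "x \<in> ball y r" "(\<integral>\<^sup>+z\<in>ball y r. ennreal \<bar>f z\<bar> \<partial>lborel) > ennreal (V * r ^ DIM('a)) * ennreal l"
      using x unfolding \<Omega>_def Mf_def maximal_superlevel V_def by auto
    have "(\<integral>\<^sup>+z\<in>ball y r. ennreal \<bar>f z\<bar> \<partial>lborel) \<le> (\<integral>\<^sup>+z. ennreal \<bar>f z\<bar> \<partial>lborel)"
      by (rule nn_integral_mono) (auto simp: indicator_def)
    then have "ennreal (V * r ^ DIM('a)) * ennreal l < ennreal I" using yr(3) I by (simp add: less_le_trans)
    then have "ennreal (V * r ^ DIM('a) * l) < ennreal I" using yr(1) V_pos l by (simp add: ennreal_mult)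
    then have *: "V * r ^ DIM('a) * l < I" using yr(1) V_pos l by (subst (asm) ennreal_less_iff) auto
    have rR: "r \<le> R"
    proof (cases "r \<le> 1")
      case False
      then have "r \<le> r ^ DIM('a)" using self_le_power[of r "DIM('a)"] by simp
      also have "\<dots> \<le> I / (V * l)" using * V_pos l by (simp add: field_simps)
      finally show ?thesis by (simp add: R_def)
    qed (simp add: R_def)
    have "\<exists>z\<in>ball y r. norm z \<le> M"
    proof (rule ccontr)
      assume "\<not> ?thesis"
      then have "(\<integral>\<^sup>+z\<in>ball y r. ennreal \<bar>f z\<bar> \<partial>lborel) = (\<integral>\<^sup>+z. 0 \<partial>(lborel :: 'a measure))"
        using M by (intro nn_integral_cong) (force simp: indicator_def)
      then show False using yr(3) by simp
    qed
    then obtain z where z: "dist y z < r" "norm z \<le> M" by auto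
    have "norm x \<le> norm z + dist y z + dist y x"
      using norm_triangle_sub[of x z] dist_triangle3[of x z y] by (simp add: dist_norm)
    also have "\<dots> < M + r + r" using z yr(2) by auto
    finally show ?thesis using rR by simp
  qed
  then show thesis using M(1) by (intro that[of "M + 2 * R + 1"]) (auto simp: R_def)
qed

lemma Omega_compl_nonempty: "- \<Omega> \<noteq> {}"
proof -
  obtain R where R: "R > 0" "\<Omega> \<subseteq> ball 0 R" using bounded_Omega .
  obtain u :: 'a where "norm u = R" using vector_choose_size[of R] R by auto
  then have "u \<notin> \<Omega>" using R by auto
  then show ?thesis by auto
qed

lemma closed_compl: "closed (- \<Omega>)"
  using open_Omega by (simp add: closed_Compl)

lemma delta_pos: "y \<in> \<Omega> \<Longrightarrow> \<delta> y > 0"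
  unfolding \<delta>_def using infdist_pos_not_in_closed[OF closed_compl Omega_compl_nonempty, of y] by simp

lemma delta_le: "x \<notin> \<Omega> \<Longrightarrow> \<delta> y \<le> dist y x"
  unfolding \<delta>_def by (rule infdist_le) simp

lemma delta_lipschitz: "\<delta> y \<le> \<delta> w + dist y w"
  unfolding \<delta>_def by (rule infdist_triangle)

lemma delta_measurable[measurable]: "\<delta> \<in> borel_measurable borel"
  unfolding \<delta>_def by (intro borel_measurable_continuous_onI continuous_intros)

lemma delta_nonneg: "\<delta> y \<ge> 0"
  unfolding \<delta>_def by (rule infdist_nonneg)

lemma kappa_measurable[measurable]: "(\<lambda>(y, w). \<kappa> y w) \<in> borel_measurable (borel \<Otimes>\<^sub>M borel)"
  unfolding \<kappa>_def by measurable

lemma kappa_nonneg: "\<kappa> y w \<ge> 0"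
  using V_pos delta_nonneg[of y] by (simp add: \<kappa>_def)

lemma kappa_integral: "(\<integral>\<^sup>+w. ennreal (\<kappa> y w) \<partial>lborel) = indicator \<Omega> y"
proof (cases "y \<in> \<Omega>")
  case True
  have d: "\<delta> y / 4 > 0" using delta_pos[OF True] by simp
  have "(\<integral>\<^sup>+w. ennreal (\<kappa> y w) \<partial>lborel) = (\<integral>\<^sup>+w. ennreal (1 / (V * (\<delta> y / 4) ^ DIM('a))) * indicator (ball y (\<delta> y / 4)) w \<partial>lborel)"
    using True by (intro nn_integral_cong) (auto simp: \<kappa>_def indicator_def)
  also have "\<dots> = ennreal (1 / (V * (\<delta> y / 4) ^ DIM('a))) * ennreal (V * (\<delta> y / 4) ^ DIM('a))"
    using d emeasure_ball_eq[of "\<delta> y / 4" y] by (subst nn_integral_cmult_indicator) (auto simp: V_def)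
  also have "\<dots> = ennreal (1 / (V * (\<delta> y / 4) ^ DIM('a)) * (V * (\<delta> y / 4) ^ DIM('a)))"
    using d V_pos by (intro ennreal_mult[symmetric]) auto
  also have "\<dots> = 1" using d V_pos by simp
  finally show ?thesis using True by simp
qed (simp add: \<kappa>_def)

text \<open>\<delta> is 1-Lipschitz, so it is comparable at y and w when their distance is below
  \<delta> y / 4: \<delta> w > 3 dist y w from one side, \<delta> w \<le> 5 / 4 \<delta> y from the
  other.\<close>

lemma kappa_support:
  assumes "\<kappa> y w \<noteq> 0"
  shows "y \<in> \<Omega>" "w \<in> \<Omega>" "dist y w < \<delta> y / 4" "dist y w < \<delta> w / 3" "\<delta> w \<le> 5 / 4 * \<delta> y"
proof -
  show y: "y \<in> \<Omega>" and d: "dist y w < \<delta> y / 4" using assms by (auto simp: \<kappa>_def split: if_splits)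
  show "w \<in> \<Omega>" using delta_le[of w y] d delta_pos[OF y] by force
  show "dist y w < \<delta> w / 3" using delta_lipschitz[of y w] d by simp
  show "\<delta> w \<le> 5 / 4 * \<delta> y" using delta_lipschitz[of w y] d by (simp add: dist_commute)
qed

text \<open>All y that send mass to w lie in the ball of radius 2 \<delta> w about w, with \<kappa>
  y w at most 5^n / (V \<delta>(w)^n). That ball contains a nearest point z of the complement of
  \<Omega>, where the maximal function is at most l; volume times density gives (2 * 5)^n l.\<close>

lemma P_bound: "\<bar>P w\<bar> \<le> 10 ^ DIM('a) * l * indicator \<Omega> w"
proof (cases "w \<in> \<Omega>")
  case False
  then have "\<kappa> y w = 0" for y using kappa_support(2) by blast
  then show ?thesis using False by (simp add: P_def)
next
  case True
  define n where "n = DIM('a)"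
  have d: "\<delta> w > 0" by (rule delta_pos[OF True])
  obtain z where z: "z \<notin> \<Omega>" "\<delta> w = dist w z"
    using infdist_attains_inf[OF closed_compl Omega_compl_nonempty, of w] unfolding \<delta>_def by auto
  have kap: "\<kappa> y w \<le> 5 ^ n / (V * \<delta> w ^ n) * indicator (ball w (2 * \<delta> w)) y" for y
  proof (cases "\<kappa> y w = 0")
    case True
    then show ?thesis using V_pos d by simp
  next
    case False
    have k: "\<kappa> y w = 1 / (V * (\<delta> y / 4) ^ n)" using False by (auto simp: \<kappa>_def n_def split: if_splits)
    have "\<delta> w / 5 \<le> \<delta> y / 4" using kappa_support(5)[OF False] by simp
    then have "(\<delta> w / 5) ^ n \<le> (\<delta> y / 4) ^ n" using d by (intro power_mono) auto
    then have "\<kappa> y w \<le> 1 / (V * (\<delta> w / 5) ^ n)"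
      unfolding k using d V_pos by (intro divide_left_mono mult_left_mono mult_pos_pos) (auto intro: less_le_trans[rotated])
    also have "\<dots> = 5 ^ n / (V * \<delta> w ^ n)" by (simp add: power_divide)
    finally have "\<kappa> y w \<le> 5 ^ n / (V * \<delta> w ^ n)" .
    moreover have "y \<in> ball w (2 * \<delta> w)" using kappa_support(4)[OF False] d by (simp add: dist_commute)
    ultimately show ?thesis by simp
  qed
  have "ennreal \<bar>P w\<bar> \<le> (\<integral>\<^sup>+y. ennreal (norm (f y * \<kappa> y w)) \<partial>lborel)"
    unfolding P_def by (cases "integrable lborel (\<lambda>y. f y * \<kappa> y w)")
      (use integral_norm_bound_ennreal[of lborel "\<lambda>y. f y * \<kappa> y w"] in \<open>auto simp: not_integrable_integral_eq\<close>)
  also have "\<dots> \<le> (\<integral>\<^sup>+y. ennreal (5 ^ n / (V * \<delta> w ^ n)) * (ennreal \<bar>f y\<bar> * indicator (ball w (2 * \<delta> w)) y) \<partial>lborel)"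
  proof (rule nn_integral_mono)
    fix y
    have "norm (f y * \<kappa> y w) = \<bar>f y\<bar> * \<kappa> y w" using kappa_nonneg[of y w] by (simp add: abs_mult)
    also have "\<dots> \<le> \<bar>f y\<bar> * (5 ^ n / (V * \<delta> w ^ n) * indicator (ball w (2 * \<delta> w)) y)"
      by (rule mult_left_mono[OF kap]) simp
    finally have "ennreal (norm (f y * \<kappa> y w)) \<le> ennreal (\<bar>f y\<bar> * (5 ^ n / (V * \<delta> w ^ n) * indicator (ball w (2 * \<delta> w)) y))"
      by (rule ennreal_leI)
    also have "\<dots> = ennreal (5 ^ n / (V * \<delta> w ^ n)) * (ennreal \<bar>f y\<bar> * indicator (ball w (2 * \<delta> w)) y)"
      using V_pos d by (cases "y \<in> ball w (2 * \<delta> w)") (auto simp: ennreal_mult[symmetric] mult.commute)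
    finally show "ennreal (norm (f y * \<kappa> y w)) \<le> \<dots>" .
  qed
  also have "\<dots> = ennreal (5 ^ n / (V * \<delta> w ^ n)) * (\<integral>\<^sup>+y\<in>ball w (2 * \<delta> w). ennreal \<bar>f y\<bar> \<partial>lborel)"
    by (rule nn_integral_cmult) (auto intro!: borel_measurable_times_ennreal borel_measurable_indicator)
  also have "\<dots> \<le> ennreal (5 ^ n / (V * \<delta> w ^ n)) * (ennreal (V * (2 * \<delta> w) ^ n) * Mf z)"
    unfolding V_def n_def Mf_def by (intro mult_left_mono ball_integral_le_maximal) (use z d in auto)
  also have "\<dots> \<le> ennreal (5 ^ n / (V * \<delta> w ^ n)) * (ennreal (V * (2 * \<delta> w) ^ n) * ennreal l)"
    using z(1) by (intro mult_left_mono) (auto simp: \<Omega>_def)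
  also have "\<dots> = ennreal (5 ^ n / (V * \<delta> w ^ n) * (V * (2 * \<delta> w) ^ n * l))"
    using V_pos d l by (simp only: ennreal_mult divide_nonneg_nonneg mult_nonneg_nonneg zero_le_power less_imp_le zero_le_numeral)
  also have "5 ^ n / (V * \<delta> w ^ n) * (V * (2 * \<delta> w) ^ n * l) = (5 * 2) ^ n * l"
    using V_pos d unfolding power_mult_distrib by (simp add: field_simps)
  finally have "\<bar>P w\<bar> \<le> 10 ^ n * l" using l by (subst (asm) ennreal_le_iff) auto
  then show ?thesis using True by (simp add: n_def)
qed

lemma P_measurable[measurable]: "P \<in> borel_measurable borel"
  unfolding P_def by measurable

lemma good_bounded_support: "bounded_support good"
proof -
  obtain M where M: "M > 0" "\<And>x. \<bar>f x\<bar> \<le> M" "\<And>x. norm x > M \<Longrightarrow> f x = 0"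
    using bounded_supportE[OF f] by metis
  obtain R where R: "R > 0" "\<Omega> \<subseteq> ball 0 R" using bounded_Omega .
  define Q where "Q = M + 10 ^ DIM('a) * l + R"
  have pos: "10 ^ DIM('a) * l > 0" using l by simp
  show ?thesis
  proof (rule bounded_supportI[of _ Q])
    show "good \<in> borel_measurable borel" unfolding good_def by measurable
    have Pb: "\<bar>P x\<bar> \<le> 10 ^ DIM('a) * l" for x using P_bound[of x] pos by (cases "x \<in> \<Omega>") auto
    show "\<bar>good x\<bar> \<le> Q" for x
    proof -
      have "\<bar>good x\<bar> \<le> \<bar>f x\<bar> + \<bar>P x\<bar>" by (auto simp: good_def indicator_def)
      then show ?thesis using M(2)[of x] Pb[of x] R by (simp add: Q_def)
    qed
    show "good x = 0" if "Q < norm x" for x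
    proof -
      have "f x = 0" using that M R pos by (intro M(3)) (simp add: Q_def)
      moreover have "x \<notin> \<Omega>" using that M R pos by (auto simp: Q_def)
      then have "P x = 0" using P_bound[of x] by simp
      ultimately show ?thesis by (simp add: good_def)
    qed
  qed
qed

text \<open>Outside \<Omega>, where \<open>P\<close> vanishes, |f| is almost everywhere below its
  maximal function and so at most l.\<close>

lemma good_bound_AE: "AE x in lborel. \<bar>good x\<bar> \<le> \<bar>f x\<bar> * indicator {x. \<bar>f x\<bar> \<le> l} x + 10 ^ DIM('a) * l * indicator \<Omega> x"
proof -
  have "AE x in lborel. ennreal \<bar>f x\<bar> \<le> Mf x"
    unfolding Mf_def by (rule AE_le_maximal) (use f_integral_finite in auto)
  then show ?thesis
  proof eventually_elim
    case (elim x)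
    show ?case
    proof (cases "x \<in> \<Omega>")
      case True
      then show ?thesis using P_bound[of x] by (simp add: good_def add_increasing)
    next
      case False
      then have "ennreal \<bar>f x\<bar> \<le> ennreal l" using elim by (auto simp: \<Omega>_def)
      then have "\<bar>f x\<bar> \<le> l" using l by (subst (asm) ennreal_le_iff) auto
      moreover have "P x = 0" using P_bound[of x] False by simp
      ultimately show ?thesis using False by (simp add: good_def)
    qed
  qed
qed

end

section \<open>Subadditivity of the square function\<close>

lemma integrable_locally_integrable:
  fixes f :: "'a::euclidean_space \<Rightarrow> 'b::{banach, second_countable_topology}"
  assumes "integrable lebesgue f"
  shows "locally_integrable f"
  unfolding locally_integrable_def set_integrable_def using assms
  by (intro allI integrable_mult_indicator) (auto simp: sets_completionI_sets)

lemma A_sup_add: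
  fixes f g :: "'a::euclidean_space \<Rightarrow> 'b::{banach, second_countable_topology}"
  assumes a: "0 < \<alpha>" "\<alpha> \<le> 1" and t: "t > 0" and f: "locally_integrable f" and g: "locally_integrable g"
  shows "A_sup \<alpha> (\<lambda>x. f x + g x) t y \<le> A_sup \<alpha> f t y + A_sup \<alpha> g t y"
  unfolding A_sup_def[of _ "\<lambda>x. f x + g x"]
proof (rule SUP_least)
  fix \<psi> :: "'a \<Rightarrow> real" assume psi: "\<psi> \<in> C_class \<alpha>"
  have "conv (\<lambda>x. f x + g x) (dilate t \<psi>) y = conv f (dilate t \<psi>) y + conv g (dilate t \<psi>) y"
    unfolding conv_def scaleR_add_right
    by (rule Bochner_Integration.integral_add[OF conv_integrable[OF f psi a t] conv_integrable[OF g psi a t]])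
  then have "ennreal (norm (conv (\<lambda>x. f x + g x) (dilate t \<psi>) y)) \<le> ennreal (norm (conv f (dilate t \<psi>) y) + norm (conv g (dilate t \<psi>) y))"
    by (intro ennreal_leI) (simp add: norm_triangle_ineq)
  also have "\<dots> = ennreal (norm (conv f (dilate t \<psi>) y)) + ennreal (norm (conv g (dilate t \<psi>) y))" by simp
  also have "\<dots> \<le> A_sup \<alpha> f t y + A_sup \<alpha> g t y"
    unfolding A_sup_def by (intro add_mono SUP_upper psi)
  finally show "ennreal (norm (conv (\<lambda>x. f x + g x) (dilate t \<psi>) y)) \<le> A_sup \<alpha> f t y + A_sup \<alpha> g t y" .
qed

lemma ennreal_square_add_le:
  fixes a b :: ennreal
  shows "(a + b)\<^sup>2 \<le> 2 * a\<^sup>2 + 2 * b\<^sup>2"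
proof (cases a; cases b)
  fix r s assume *: "a = ennreal r" "0 \<le> r" "b = ennreal s" "0 \<le> s"
  have "(r + s)\<^sup>2 \<le> 2 * r\<^sup>2 + 2 * s\<^sup>2" using sum_squares_bound[of r s] by (simp add: power2_sum)
  then have "ennreal ((r + s)\<^sup>2) \<le> ennreal (2 * r\<^sup>2 + 2 * s\<^sup>2)" by (rule ennreal_leI)
  then show ?thesis using * by (simp add: ennreal_mult ennreal_power[symmetric])
qed (auto simp: power2_eq_square ennreal_mult_eq_top_iff)

lemma g_sq_add:
  fixes f g :: "'a::euclidean_space \<Rightarrow> 'b::{banach, second_countable_topology}"
  assumes a: "0 < \<alpha>" "\<alpha> \<le> 1" and f: "locally_integrable f" and g: "locally_integrable g"
  shows "g_sq \<alpha> (\<lambda>x. f x + g x) {0<..} x \<le> 2 * g_sq \<alpha> f {0<..} x + 2 * g_sq \<alpha> g {0<..} x"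
proof -
  define F where "F = (\<lambda>t. (A_sup \<alpha> f t x * indicator {0<..} t)\<^sup>2 * ennreal (1 / t))"
  define G where "G = (\<lambda>t. (A_sup \<alpha> g t x * indicator {0<..} t)\<^sup>2 * ennreal (1 / t))"
  have [measurable]: "F \<in> borel_measurable borel" "G \<in> borel_measurable borel"
    unfolding F_def G_def using A_sup_measurable_fst[OF f a, of x] A_sup_measurable_fst[OF g a, of x] by measurable
  have "g_sq \<alpha> (\<lambda>x. f x + g x) {0<..} x \<le> (\<integral>\<^sup>+t. 2 * F t + 2 * G t \<partial>lborel)"
    unfolding g_sq_def
  proof (rule nn_integral_mono)
    fix t :: real
    show "(A_sup \<alpha> (\<lambda>x. f x + g x) t x)\<^sup>2 * ennreal (1 / t) * indicator {0<..} t \<le> 2 * F t + 2 * G t"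
    proof (cases "t > 0")
      case True
      have "(A_sup \<alpha> (\<lambda>x. f x + g x) t x)\<^sup>2 \<le> (A_sup \<alpha> f t x + A_sup \<alpha> g t x)\<^sup>2"
        by (intro power_mono A_sup_add[OF a True f g]) simp
      also have "\<dots> \<le> 2 * (A_sup \<alpha> f t x)\<^sup>2 + 2 * (A_sup \<alpha> g t x)\<^sup>2" by (rule ennreal_square_add_le)
      finally have "(A_sup \<alpha> (\<lambda>x. f x + g x) t x)\<^sup>2 * ennreal (1 / t) \<le> (2 * (A_sup \<alpha> f t x)\<^sup>2 + 2 * (A_sup \<alpha> g t x)\<^sup>2) * ennreal (1 / t)"
        by (rule mult_right_mono) simp
      then show ?thesis using True by (simp add: F_def G_def distrib_right mult.assoc)
    qed simp
  qed
  also have "\<dots> = 2 * (\<integral>\<^sup>+t. F t \<partial>lborel) + 2 * (\<integral>\<^sup>+t. G t \<partial>lborel)"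
    by (simp add: nn_integral_add nn_integral_cmult)
  also have "(\<integral>\<^sup>+t. F t \<partial>lborel) = g_sq \<alpha> f {0<..} x"
    unfolding g_sq_def F_def by (intro nn_integral_cong) (auto simp: indicator_def)
  also have "(\<integral>\<^sup>+t. G t \<partial>lborel) = g_sq \<alpha> g {0<..} x"
    unfolding g_sq_def G_def by (intro nn_integral_cong) (auto simp: indicator_def)
  finally show ?thesis .
qed

section \<open>Weak type estimate for the bad part\<close>

context calderon_zygmund
begin

text \<open>The mass of f on \<Omega> that kernels of scale t at x can feel, weighted by
  \<delta>^\<alpha>. The radius is 2 t rather than t because the mass at y is spread over a ball, of
  radius at most a quarter of the distance from y to a point x outside \<Omega>.\<close>

definition "U \<alpha> x t = (\<integral>\<^sup>+y. ennreal (\<bar>f y\<bar> * \<delta> y powr \<alpha>) * indicator \<Omega> y * (if dist x y \<le> 2 * t then 1 else 0) \<partial>lborel)"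

lemma U_mono: "mono (U \<alpha> x)"
  unfolding mono_def U_def by (auto intro!: nn_integral_mono mult_left_mono)

lemma U_measurable[measurable]: "(\<lambda>(x, t). U \<alpha> x t) \<in> borel_measurable (borel \<Otimes>\<^sub>M borel)"
  unfolding U_def by measurable

lemma f_Omega_bounded_support: "bounded_support (\<lambda>w. f w * indicator \<Omega> w)"
  by (rule bounded_support_mult[OF f, of _ 1]) (auto simp: indicator_def)

lemma P_bound': "\<bar>P x\<bar> \<le> 10 ^ DIM('a) * l"
  using P_bound[of x] l by (cases "x \<in> \<Omega>") auto

lemma bad_locally_integrable: "locally_integrable bad"
proof (rule integrable_locally_integrable)
  have "integrable lborel (\<lambda>x. f x - good x)"
    using bounded_support_integrable[OF f] bounded_support_integrable[OF good_bounded_support] by simp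
  moreover have "(\<lambda>x. f x - good x) = bad" by (auto simp: good_def bad_def indicator_def fun_eq_iff)
  ultimately show "integrable lebesgue bad" by (simp add: integrable_completion)
qed

lemma bad_measurable[measurable]: "bad \<in> borel_measurable borel"
  unfolding bad_def by measurable

text \<open>By Fubini the convolution is the integral over y of f(y) times the mean of d y - d w
  over the w that receive mass from y, where d is the reflected kernel. Hoelder continuity in the
  integration variable bounds the difference by t^(-n) (\<delta> y / t)^\<alpha>. The bound is
  uniform in \<psi>, so it passes to the supremum.\<close>

lemma conv_bad_le:
  assumes psi: "\<psi> \<in> C_class \<alpha>" and a: "0 < \<alpha>" "\<alpha> \<le> 1" and t: "t > 0" and x: "x \<notin> \<Omega>"
  shows "ennreal (norm (conv bad (dilate t \<psi>) x)) \<le> ennreal (t powr (- (real DIM('a) + \<alpha>))) * U \<alpha> x t"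
proof -
  define d where "d = (\<lambda>w. dilate t \<psi> (x - w))"
  have d: "bounded_support d" unfolding d_def by (rule dilate_bounded_support[OF psi a t])
  then have [measurable]: "d \<in> borel_measurable borel" by (simp add: bounded_support_def)
  obtain Bd where Bd: "\<And>w. \<bar>d w\<bar> \<le> Bd" using bounded_support_bound[OF d] by blast
  have Bd0: "Bd \<ge> 0" using Bd[of 0] by simp
  have i1: "integrable lborel (\<lambda>w. (f w * indicator \<Omega> w) * d w)"
    by (rule bounded_support_integrable[OF bounded_support_mult[OF f_Omega_bounded_support _ Bd]]) measurable
  have i2: "integrable lborel (\<lambda>w. d w * P w)"
    by (rule bounded_support_integrable[OF bounded_support_mult[OF d _ P_bound']]) measurable
  define F where "F = (\<lambda>y w. f y * \<kappa> y w * d w)"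
  have Fm[measurable]: "case_prod F \<in> borel_measurable (borel \<Otimes>\<^sub>M borel)" unfolding F_def by measurable
  have kint: "integrable lborel (\<lambda>w. \<kappa> y w)" "(\<integral>w. \<kappa> y w \<partial>lborel) = indicator \<Omega> y" for y
  proof -
    have *: "(\<integral>\<^sup>+w. ennreal (\<kappa> y w) \<partial>lborel) = ennreal (indicator \<Omega> y)" by (simp add: kappa_integral ennreal_indicator)
    show "integrable lborel (\<lambda>w. \<kappa> y w)"
      by (rule integrableI_nn_integral_finite[OF _ _ *]) (auto simp: kappa_nonneg)
    show "(\<integral>w. \<kappa> y w \<partial>lborel) = indicator \<Omega> y"
      by (rule integral_eq_nn_integral[THEN trans]) (auto simp: kappa_nonneg *)
  qed
  have Fint: "integrable (lborel \<Otimes>\<^sub>M lborel) (case_prod F)"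
  proof (rule integrableI_bounded)
    have "(\<integral>\<^sup>+p. ennreal (norm (case_prod F p)) \<partial>(lborel \<Otimes>\<^sub>M lborel)) = (\<integral>\<^sup>+y. (\<integral>\<^sup>+w. ennreal (norm (F y w)) \<partial>lborel) \<partial>lborel)"
      by (subst lborel.nn_integral_fst[symmetric]) auto
    also have "\<dots> \<le> (\<integral>\<^sup>+y. ennreal Bd * ennreal \<bar>f y\<bar> \<partial>lborel)"
    proof (rule nn_integral_mono)
      fix y
      have "(\<integral>\<^sup>+w. ennreal (norm (F y w)) \<partial>lborel) \<le> (\<integral>\<^sup>+w. ennreal (Bd * \<bar>f y\<bar>) * ennreal (\<kappa> y w) \<partial>lborel)"
      proof (rule nn_integral_mono)
        fix w
        have "norm (F y w) = \<bar>d w\<bar> * \<bar>f y\<bar> * \<kappa> y w" using kappa_nonneg[of y w] by (simp add: F_def abs_mult mult_ac)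
        also have "\<dots> \<le> Bd * \<bar>f y\<bar> * \<kappa> y w" using Bd[of w] kappa_nonneg[of y w] by (intro mult_right_mono) auto
        finally show "ennreal (norm (F y w)) \<le> ennreal (Bd * \<bar>f y\<bar>) * ennreal (\<kappa> y w)"
          using Bd0 kappa_nonneg[of y w] by (simp flip: ennreal_mult add: ennreal_leI)
      qed
      also have "\<dots> = ennreal (Bd * \<bar>f y\<bar>) * indicator \<Omega> y" by (simp add: nn_integral_cmult kappa_integral)
      also have "\<dots> \<le> ennreal Bd * ennreal \<bar>f y\<bar>" using Bd0 by (auto simp: ennreal_mult indicator_def)
      finally show "(\<integral>\<^sup>+w. ennreal (norm (F y w)) \<partial>lborel) \<le> ennreal Bd * ennreal \<bar>f y\<bar>" .
    qed
    also have "\<dots> = ennreal Bd * (\<integral>\<^sup>+y. ennreal \<bar>f y\<bar> \<partial>lborel)" by (rule nn_integral_cmult) auto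
    also have "\<dots> < \<infinity>" using f_integral_finite by (simp add: ennreal_mult_less_top)
    finally show "(\<integral>\<^sup>+p. ennreal (norm (case_prod F p)) \<partial>(lborel \<Otimes>\<^sub>M lborel)) < \<infinity>" .
  qed simp
  have iF: "integrable lborel (\<lambda>y. \<integral>w. F y w \<partial>lborel)" using lborel_pair.integrable_fst[OF Fint] .
  have dP: "(\<integral>w. d w * P w \<partial>lborel) = (\<integral>y. (\<integral>w. F y w \<partial>lborel) \<partial>lborel)"
  proof -
    have "(\<integral>w. d w * P w \<partial>lborel) = (\<integral>w. (\<integral>y. F y w \<partial>lborel) \<partial>lborel)"
      unfolding P_def F_def integral_mult_right_zero[symmetric] by (simp add: mult_ac)
    also have "\<dots> = (\<integral>y. (\<integral>w. F y w \<partial>lborel) \<partial>lborel)"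
      by (rule lborel_pair.Fubini_integral) (use Fint in simp)
    finally show ?thesis .
  qed
  have "conv bad (dilate t \<psi>) x = (\<integral>w. d w * bad w \<partial>lborel)"
    unfolding d_def by (rule conv_lborel[OF bad_measurable psi a(1)])
  also have "\<dots> = (\<integral>w. (f w * indicator \<Omega> w) * d w - d w * P w \<partial>lborel)"
    by (intro Bochner_Integration.integral_cong) (auto simp: bad_def algebra_simps)
  also have "\<dots> = (\<integral>w. (f w * indicator \<Omega> w) * d w \<partial>lborel) - (\<integral>w. d w * P w \<partial>lborel)"
    by (rule Bochner_Integration.integral_diff[OF i1 i2])
  also have "\<dots> = (\<integral>y. (f y * indicator \<Omega> y) * d y - (\<integral>w. F y w \<partial>lborel) \<partial>lborel)"
    unfolding dP by (rule Bochner_Integration.integral_diff[OF i1 iF, symmetric])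
  finally have conv: "conv bad (dilate t \<psi>) x = (\<integral>y. (f y * indicator \<Omega> y) * d y - (\<integral>w. F y w \<partial>lborel) \<partial>lborel)" .
  have "ennreal (norm (conv bad (dilate t \<psi>) x)) \<le> (\<integral>\<^sup>+y. ennreal (norm ((f y * indicator \<Omega> y) * d y - (\<integral>w. F y w \<partial>lborel))) \<partial>lborel)"
    unfolding conv by (rule integral_norm_bound_ennreal) (use i1 iF in simp)
  also have "\<dots> \<le> (\<integral>\<^sup>+y. ennreal (t powr (- (real DIM('a) + \<alpha>))) * (ennreal (\<bar>f y\<bar> * \<delta> y powr \<alpha>) * indicator \<Omega> y * (if dist x y \<le> 2 * t then 1 else 0)) \<partial>lborel)"
  proof (rule nn_integral_mono)
    fix y
    define c where "c = \<delta> y powr \<alpha> * t powr (- (real DIM('a) + \<alpha>)) * (if dist x y \<le> 2 * t then 1 else 0)"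
    have c0: "c \<ge> 0" by (simp add: c_def)
    have id: "integrable lborel (\<lambda>w. \<kappa> y w * d w)"
    proof (rule Bochner_Integration.integrable_bound)
      show "integrable lborel (\<lambda>w. Bd * \<kappa> y w)" using kint by simp
      show "AE w in lborel. norm (\<kappa> y w * d w) \<le> norm (Bd * \<kappa> y w)"
      proof (rule AE_I2)
        fix w
        show "norm (\<kappa> y w * d w) \<le> norm (Bd * \<kappa> y w)"
          using mult_right_mono[OF Bd[of w], of "\<kappa> y w"] kappa_nonneg[of y w] Bd0 by (simp add: abs_mult mult.commute)
      qed
    qed simp
    have "(f y * indicator \<Omega> y) * d y - (\<integral>w. F y w \<partial>lborel) = f y * (\<integral>w. \<kappa> y w * (d y - d w) \<partial>lborel)"
    proof -
      have "(\<integral>w. \<kappa> y w * (d y - d w) \<partial>lborel) = (\<integral>w. \<kappa> y w * d y \<partial>lborel) - (\<integral>w. \<kappa> y w * d w \<partial>lborel)"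
        unfolding right_diff_distrib by (rule Bochner_Integration.integral_diff) (use kint id in simp_all)
      also have "(\<integral>w. \<kappa> y w * d y \<partial>lborel) = indicator \<Omega> y * d y" by (simp add: kint)
      finally have "f y * (\<integral>w. \<kappa> y w * (d y - d w) \<partial>lborel) = f y * indicator \<Omega> y * d y - f y * (\<integral>w. \<kappa> y w * d w \<partial>lborel)"
        by (simp add: right_diff_distrib mult.assoc)
      then show ?thesis by (simp add: F_def mult.assoc)
    qed
    moreover have "\<bar>\<integral>w. \<kappa> y w * (d y - d w) \<partial>lborel\<bar> \<le> (\<integral>w. c * \<kappa> y w \<partial>lborel)"
    proof (rule Bochner_Integration.integral_abs_bound_integral)
      show "integrable lborel (\<lambda>w. \<kappa> y w * (d y - d w))"
        unfolding right_diff_distrib using kint id by simp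
      show "integrable lborel (\<lambda>w. c * \<kappa> y w)" using kint by simp
      fix w
      show "\<bar>\<kappa> y w * (d y - d w)\<bar> \<le> c * \<kappa> y w"
      proof (cases "\<kappa> y w = 0")
        case False
        have yw: "y \<in> \<Omega>" "dist y w < \<delta> y / 4" using kappa_support[OF False] by auto
        have dy: "\<delta> y > 0" by (rule delta_pos[OF yw(1)])
        have dx: "\<delta> y \<le> dist x y" using delta_le[OF x, of y] by (simp add: dist_commute)
        have "\<bar>d y - d w\<bar> \<le> c"
        proof (cases "dist x y \<le> 2 * t")
          case True
          have "\<bar>d y - d w\<bar> \<le> t powr (- real DIM('a)) * (norm ((x - y) - (x - w)) / t) powr \<alpha>"
            unfolding d_def by (rule dilate_holder[OF psi t])
          also have "\<dots> \<le> t powr (- real DIM('a)) * (\<delta> y / t) powr \<alpha>"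
            using yw(2) dy t a by (intro mult_left_mono powr_mono2 divide_right_mono) (auto simp: dist_norm norm_minus_commute)
          also have "\<dots> = c"
          proof -
            have "t powr (- (real DIM('a) + \<alpha>)) = t powr (- real DIM('a)) * t powr (- \<alpha>)" by (simp flip: powr_add)
            then show ?thesis using True dy t by (simp add: c_def powr_divide powr_minus field_simps)
          qed
          finally show ?thesis .
        next
          case False
          \<comment> \<open>Beyond distance 2 t both kernel values vanish: w is within dist x y / 4
            of y, hence still farther than t from x.\<close>
          have "d y = 0" unfolding d_def by (rule dilate_eq_0[OF psi a t]) (use False t in \<open>simp add: dist_norm\<close>)
          moreover have "dist x w > t"
            using dist_triangle[of x y w] yw(2) dx False t by (simp add: dist_commute[of w y])
          then have "norm (x - w) > t" by (simp add: dist_norm)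
          then have "d w = 0" unfolding d_def by (rule dilate_eq_0[OF psi a t])
          ultimately show ?thesis using c0 by simp
        qed
        then show ?thesis using mult_right_mono[of "\<bar>d y - d w\<bar>" c "\<kappa> y w"] kappa_nonneg[of y w] by (simp add: abs_mult mult.commute)
      qed simp
    qed
    ultimately have "norm ((f y * indicator \<Omega> y) * d y - (\<integral>w. F y w \<partial>lborel)) \<le> \<bar>f y\<bar> * (c * indicator \<Omega> y)"
      by (simp add: abs_mult kint mult_left_mono)
    then have "ennreal (norm ((f y * indicator \<Omega> y) * d y - (\<integral>w. F y w \<partial>lborel))) \<le> ennreal (\<bar>f y\<bar> * (c * indicator \<Omega> y))"
      by (rule ennreal_leI)
    also have "\<dots> = ennreal (t powr (- (real DIM('a) + \<alpha>))) * (ennreal (\<bar>f y\<bar> * \<delta> y powr \<alpha>) * indicator \<Omega> y * (if dist x y \<le> 2 * t then 1 else 0))"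
      by (auto simp: c_def indicator_def mult_ac simp flip: ennreal_mult)
    finally show "ennreal (norm ((f y * indicator \<Omega> y) * d y - (\<integral>w. F y w \<partial>lborel))) \<le> \<dots>" .
  qed
  also have "\<dots> = ennreal (t powr (- (real DIM('a) + \<alpha>))) * U \<alpha> x t"
    unfolding U_def by (rule nn_integral_cmult) measurable
  finally show ?thesis .
qed

text \<open>The linear integral over scales that \<open>square_integral_monotone_kernel\<close>
  leaves, with exponent n + \<alpha>.\<close>

definition "L \<alpha> x = (\<integral>\<^sup>+t\<in>{0<..}. ennreal (t powr (- (real DIM('a) + \<alpha>) - 1)) * U \<alpha> x t \<partial>lborel)"

lemma g_sq_bad_le:
  assumes a: "0 < \<alpha>" "\<alpha> \<le> 1" and x: "x \<notin> \<Omega>"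
  shows "g_sq \<alpha> bad {0<..} x \<le> ennreal (real DIM('a) + \<alpha>) * (L \<alpha> x)\<^sup>2"
proof -
  have "g_sq \<alpha> bad {0<..} x \<le> (\<integral>\<^sup>+t\<in>{0<..}. (ennreal (t powr (- (real DIM('a) + \<alpha>))) * U \<alpha> x t)\<^sup>2 * ennreal (1 / t) \<partial>lborel)"
    unfolding g_sq_def
  proof (rule nn_integral_mono)
    fix t :: real
    show "(A_sup \<alpha> bad t x)\<^sup>2 * ennreal (1 / t) * indicator {0<..} t \<le> (ennreal (t powr (- (real DIM('a) + \<alpha>))) * U \<alpha> x t)\<^sup>2 * ennreal (1 / t) * indicator {0<..} t"
    proof (cases "t > 0")
      case True
      have "A_sup \<alpha> bad t x \<le> ennreal (t powr (- (real DIM('a) + \<alpha>))) * U \<alpha> x t"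
        unfolding A_sup_def by (intro SUP_least conv_bad_le[OF _ a True x])
      then show ?thesis by (intro mult_right_mono power_mono) auto
    qed simp
  qed
  also have "\<dots> \<le> ennreal (real DIM('a) + \<alpha>) * (L \<alpha> x)\<^sup>2"
    unfolding L_def by (rule square_integral_monotone_kernel[OF U_mono]) (use a in auto)
  finally show ?thesis .
qed

text \<open>With y fixed, points x outside \<Omega> are at distance at least \<delta> y, so only t
  \<ge> \<delta> y / 2 contribute. The volume of the ball of radius 2 t cancels t^(-n), and
  integrating t^(-\<alpha> - 1) gives (\<delta> y / 2)^(-\<alpha>) / \<alpha>, which cancels the
  weight \<delta>^\<alpha> up to 2^\<alpha>.\<close>

lemma L_integral:
  assumes a: "0 < \<alpha>"
  shows "(\<integral>\<^sup>+x\<in>- \<Omega>. L \<alpha> x \<partial>lborel) \<le> ennreal (V * 2 ^ DIM('a) * 2 powr \<alpha> / \<alpha>) * (\<integral>\<^sup>+y\<in>\<Omega>. ennreal \<bar>f y\<bar> \<partial>lborel)"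
proof -
  define n where "n = DIM('a)"
  define c where "c = (\<lambda>t::real. ennreal (t powr (- (real n + \<alpha>) - 1)) * indicator {0<..} t)"
  define p where "p = (\<lambda>y. ennreal (\<bar>f y\<bar> * \<delta> y powr \<alpha>) * indicator \<Omega> y)"
  define ind where "ind = (\<lambda>(x::'a) y t. if dist x y \<le> 2 * t then 1 else 0 :: ennreal)"
  have [measurable]: "c \<in> borel_measurable borel" "p \<in> borel_measurable borel" unfolding c_def p_def by measurable
  have "(\<integral>\<^sup>+x\<in>- \<Omega>. L \<alpha> x \<partial>lborel) = (\<integral>\<^sup>+x. (\<integral>\<^sup>+t. (\<integral>\<^sup>+y. c t * indicator (- \<Omega>) x * p y * ind x y t \<partial>lborel) \<partial>lborel) \<partial>lborel)"
  proof (rule nn_integral_cong)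
    fix x
    have "L \<alpha> x * indicator (- \<Omega>) x = (\<integral>\<^sup>+t. c t * U \<alpha> x t * indicator (- \<Omega>) x \<partial>lborel)"
      unfolding L_def c_def n_def by (subst nn_integral_multc[symmetric]) (auto simp: mult_ac)
    also have "\<dots> = (\<integral>\<^sup>+t. (\<integral>\<^sup>+y. c t * indicator (- \<Omega>) x * p y * ind x y t \<partial>lborel) \<partial>lborel)"
    proof (rule nn_integral_cong)
      fix t
      show "c t * U \<alpha> x t * indicator (- \<Omega>) x = (\<integral>\<^sup>+y. c t * indicator (- \<Omega>) x * p y * ind x y t \<partial>lborel)"
      proof -
        have [measurable]: "(\<lambda>y. p y * ind x y t) \<in> borel_measurable lborel" unfolding ind_def by measurable
        have "U \<alpha> x t = (\<integral>\<^sup>+y. p y * ind x y t \<partial>lborel)" by (simp add: U_def p_def ind_def)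
        then have "c t * U \<alpha> x t * indicator (- \<Omega>) x = (c t * indicator (- \<Omega>) x) * (\<integral>\<^sup>+y. p y * ind x y t \<partial>lborel)"
          by (simp only: mult_ac)
        also have "\<dots> = (\<integral>\<^sup>+y. (c t * indicator (- \<Omega>) x) * (p y * ind x y t) \<partial>lborel)"
          by (rule nn_integral_cmult[symmetric]) measurable
        finally show ?thesis by (simp only: mult.assoc)
      qed
    qed
    finally show "L \<alpha> x * indicator (- \<Omega>) x = \<dots>" .
  qed
  also have "\<dots> = (\<integral>\<^sup>+x. (\<integral>\<^sup>+y. (\<integral>\<^sup>+t. c t * indicator (- \<Omega>) x * p y * ind x y t \<partial>lborel) \<partial>lborel) \<partial>lborel)"
    unfolding ind_def by (intro nn_integral_cong lborel_pair.Fubini') measurable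
  also have "\<dots> = (\<integral>\<^sup>+y. (\<integral>\<^sup>+x. (\<integral>\<^sup>+t. c t * indicator (- \<Omega>) x * p y * ind x y t \<partial>lborel) \<partial>lborel) \<partial>lborel)"
    unfolding ind_def by (rule lborel_pair.Fubini') measurable
  also have "\<dots> = (\<integral>\<^sup>+y. (\<integral>\<^sup>+t. (\<integral>\<^sup>+x. c t * indicator (- \<Omega>) x * p y * ind x y t \<partial>lborel) \<partial>lborel) \<partial>lborel)"
    unfolding ind_def by (intro nn_integral_cong lborel_pair.Fubini') measurable
  also have "\<dots> \<le> (\<integral>\<^sup>+y. ennreal (V * 2 ^ n * 2 powr \<alpha> / \<alpha>) * (ennreal \<bar>f y\<bar> * indicator \<Omega> y) \<partial>lborel)"
  proof (rule nn_integral_mono)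
    fix y
    show "(\<integral>\<^sup>+t. (\<integral>\<^sup>+x. c t * indicator (- \<Omega>) x * p y * ind x y t \<partial>lborel) \<partial>lborel) \<le> ennreal (V * 2 ^ n * 2 powr \<alpha> / \<alpha>) * (ennreal \<bar>f y\<bar> * indicator \<Omega> y)"
    proof (cases "y \<in> \<Omega>")
      case False
      then show ?thesis by (simp add: p_def)
    next
      case True
      have dy: "\<delta> y > 0" by (rule delta_pos[OF True])
      have "(\<integral>\<^sup>+t. (\<integral>\<^sup>+x. c t * indicator (- \<Omega>) x * p y * ind x y t \<partial>lborel) \<partial>lborel) \<le> (\<integral>\<^sup>+t. (p y * ennreal (V * 2 ^ n)) * (ennreal (t powr (- \<alpha> - 1)) * indicator {\<delta> y / 2..} t) \<partial>lborel)"
      proof (rule nn_integral_mono)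
        fix t :: real
        show "(\<integral>\<^sup>+x. c t * indicator (- \<Omega>) x * p y * ind x y t \<partial>lborel) \<le> (p y * ennreal (V * 2 ^ n)) * (ennreal (t powr (- \<alpha> - 1)) * indicator {\<delta> y / 2..} t)"
        proof (cases "t \<ge> \<delta> y / 2")
          case False
          have "(\<integral>\<^sup>+x. c t * indicator (- \<Omega>) x * p y * ind x y t \<partial>lborel) = (\<integral>\<^sup>+x. 0 \<partial>(lborel :: 'a measure))"
          proof (rule nn_integral_cong)
            fix x show "c t * indicator (- \<Omega>) x * p y * ind x y t = 0"
              using False delta_le[of x y] by (cases "x \<in> \<Omega>") (auto simp: ind_def dist_commute)
          qed
          then show ?thesis by simp
        next
          case t: True
          then have t0: "t > 0" using dy by simp
          have "(\<integral>\<^sup>+x. c t * indicator (- \<Omega>) x * p y * ind x y t \<partial>lborel) \<le> (\<integral>\<^sup>+x. (c t * p y) * indicator (cball y (2 * t)) x \<partial>lborel)"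
            by (rule nn_integral_mono) (auto simp: ind_def indicator_def dist_commute)
          also have "\<dots> = c t * p y * ennreal (V * (2 * t) ^ n)"
            using t0 by (subst nn_integral_cmult_indicator) (auto simp: emeasure_cball_eq V_def n_def)
          also have "\<dots> = p y * (ennreal (t powr (- (real n + \<alpha>) - 1)) * ennreal (V * (2 * t) ^ n))"
            using t0 by (simp add: c_def mult_ac)
          also have "ennreal (t powr (- (real n + \<alpha>) - 1)) * ennreal (V * (2 * t) ^ n) = ennreal (t powr (- (real n + \<alpha>) - 1) * (V * (2 * t) ^ n))"
            using t0 V_pos by (intro ennreal_mult[symmetric]) auto
          also have "t powr (- (real n + \<alpha>) - 1) * (V * (2 * t) ^ n) = V * 2 ^ n * t powr (- \<alpha> - 1)"
            using t0 by (simp add: powr_diff powr_minus powr_add powr_realpow power_mult_distrib field_simps)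
          also have "ennreal (V * 2 ^ n * t powr (- \<alpha> - 1)) = ennreal (V * 2 ^ n) * ennreal (t powr (- \<alpha> - 1))"
            using V_pos by (intro ennreal_mult) auto
          finally show ?thesis using t by (simp add: mult.assoc)
        qed
      qed
      also have "\<dots> = (p y * ennreal (V * 2 ^ n)) * ennreal ((\<delta> y / 2) powr (- \<alpha>) / \<alpha>)"
        using nn_integral_powr_atLeast[OF a, of "\<delta> y / 2"] dy by (subst nn_integral_cmult) auto
      also have "\<dots> = ennreal (\<bar>f y\<bar> * \<delta> y powr \<alpha> * (V * 2 ^ n) * ((\<delta> y / 2) powr (- \<alpha>) / \<alpha>))"
      proof -
        have "ennreal u * ennreal v * ennreal w = ennreal (u * v * w)" if "u \<ge> 0" "v \<ge> 0" "w \<ge> 0" for u v w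
          using that by (simp add: ennreal_mult)
        moreover have "p y = ennreal (\<bar>f y\<bar> * \<delta> y powr \<alpha>)" using True by (simp add: p_def)
        ultimately show ?thesis using V_pos a by simp
      qed
      also have "\<bar>f y\<bar> * \<delta> y powr \<alpha> * (V * 2 ^ n) * ((\<delta> y / 2) powr (- \<alpha>) / \<alpha>) = V * 2 ^ n * 2 powr \<alpha> / \<alpha> * \<bar>f y\<bar>"
        using dy by (simp add: powr_divide powr_minus field_simps)
      also have "ennreal (V * 2 ^ n * 2 powr \<alpha> / \<alpha> * \<bar>f y\<bar>) = ennreal (V * 2 ^ n * 2 powr \<alpha> / \<alpha>) * (ennreal \<bar>f y\<bar> * indicator \<Omega> y)"
      proof -
        have "ennreal (V * 2 ^ n * 2 powr \<alpha> / \<alpha> * \<bar>f y\<bar>) = ennreal (V * 2 ^ n * 2 powr \<alpha> / \<alpha>) * ennreal \<bar>f y\<bar>"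
          by (rule ennreal_mult) (use V_pos a in auto)
        then show ?thesis using True by (simp only: indicator_simps mult_1_right)
      qed
      finally show ?thesis .
    qed
  qed
  also have "\<dots> = ennreal (V * 2 ^ n * 2 powr \<alpha> / \<alpha>) * (\<integral>\<^sup>+y\<in>\<Omega>. ennreal \<bar>f y\<bar> \<partial>lborel)"
    by (rule nn_integral_cmult) measurable
  finally show ?thesis unfolding n_def .
qed

text \<open>Chebyshev's inequality for L rather than for the square function: outside \<Omega>,
  exceeding l^2 forces sqrt(n + \<alpha>) L to be at least l.\<close>

lemma bad_weak_type:
  assumes a: "0 < \<alpha>" "\<alpha> \<le> 1"
  shows "emeasure lborel {x. x \<notin> \<Omega> \<and> g_sq \<alpha> bad {0<..} x > ennreal (l\<^sup>2)}
    \<le> ennreal (sqrt (real DIM('a) + \<alpha>) * (V * 2 ^ DIM('a) * 2 powr \<alpha> / \<alpha>)) * (\<integral>\<^sup>+y\<in>\<Omega>. ennreal (\<bar>f y\<bar> / l) \<partial>lborel)"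
proof -
  define b where "b = real DIM('a) + \<alpha>"
  have b: "b > 0" using a by (simp add: b_def)
  define S where "S = {x. x \<notin> \<Omega> \<and> g_sq \<alpha> bad {0<..} x > ennreal (l\<^sup>2)}"
  have [measurable]: "g_sq \<alpha> bad {0<..} \<in> borel_measurable borel"
    by (rule g_sq_measurable[OF bad_locally_integrable a]) auto
  have Sm[measurable]: "S \<in> sets borel" unfolding S_def by measurable
  have Lm[measurable]: "L \<alpha> \<in> borel_measurable borel" unfolding L_def by measurable
  have "ennreal l * emeasure lborel S = (\<integral>\<^sup>+x. ennreal l * indicator S x \<partial>lborel)"
    by (rule nn_integral_cmult_indicator[symmetric]) simp
  also have "\<dots> \<le> (\<integral>\<^sup>+x. ennreal (sqrt b) * (L \<alpha> x * indicator (- \<Omega>) x) \<partial>lborel)"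
  proof (rule nn_integral_mono)
    fix x
    show "ennreal l * indicator S x \<le> ennreal (sqrt b) * (L \<alpha> x * indicator (- \<Omega>) x)"
    proof (cases "x \<in> S")
      case True
      then have x: "x \<notin> \<Omega>" "ennreal (l\<^sup>2) < g_sq \<alpha> bad {0<..} x" by (auto simp: S_def)
      have less: "ennreal (l\<^sup>2) < ennreal b * (L \<alpha> x)\<^sup>2"
        using x(2) g_sq_bad_le[OF a x(1)] unfolding b_def by (rule less_le_trans)
      have "ennreal l \<le> ennreal (sqrt b) * L \<alpha> x"
      proof (rule ccontr)
        assume "\<not> ?thesis"
        then have "(ennreal (sqrt b) * L \<alpha> x)\<^sup>2 \<le> (ennreal l)\<^sup>2" by (intro power_mono) auto
        also have "(ennreal l)\<^sup>2 = ennreal (l\<^sup>2)" using l by (simp add: ennreal_power)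
        also have "(ennreal (sqrt b) * L \<alpha> x)\<^sup>2 = ennreal b * (L \<alpha> x)\<^sup>2" using b by (simp add: power_mult_distrib ennreal_power)
        finally show False using less by simp
      qed
      then show ?thesis using True x by simp
    qed simp
  qed
  also have "\<dots> = ennreal (sqrt b) * (\<integral>\<^sup>+x\<in>- \<Omega>. L \<alpha> x \<partial>lborel)"
    by (rule nn_integral_cmult) measurable
  also have "\<dots> \<le> ennreal (sqrt b) * (ennreal (V * 2 ^ DIM('a) * 2 powr \<alpha> / \<alpha>) * (\<integral>\<^sup>+y\<in>\<Omega>. ennreal \<bar>f y\<bar> \<partial>lborel))"
    by (intro mult_left_mono L_integral a) auto
  also have "(\<integral>\<^sup>+y\<in>\<Omega>. ennreal \<bar>f y\<bar> \<partial>lborel) = ennreal l * (\<integral>\<^sup>+y\<in>\<Omega>. ennreal (\<bar>f y\<bar> / l) \<partial>lborel)"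
    by (subst nn_integral_cmult[symmetric]) (use l in \<open>auto simp: mult.assoc[symmetric] simp flip: ennreal_mult\<close>)
  also have "ennreal (sqrt b) * (ennreal (V * 2 ^ DIM('a) * 2 powr \<alpha> / \<alpha>) * (ennreal l * (\<integral>\<^sup>+y\<in>\<Omega>. ennreal (\<bar>f y\<bar> / l) \<partial>lborel)))
    = ennreal l * (ennreal (sqrt b * (V * 2 ^ DIM('a) * 2 powr \<alpha> / \<alpha>)) * (\<integral>\<^sup>+y\<in>\<Omega>. ennreal (\<bar>f y\<bar> / l) \<partial>lborel))"
  proof -
    have "ennreal (sqrt b * (V * 2 ^ DIM('a) * 2 powr \<alpha> / \<alpha>)) = ennreal (sqrt b) * ennreal (V * 2 ^ DIM('a) * 2 powr \<alpha> / \<alpha>)"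
      using b V_pos a by (intro ennreal_mult) auto
    then show ?thesis by (simp only: mult_ac)
  qed
  finally show ?thesis using l unfolding S_def b_def by (simp add: ennreal_mult_le_mult_iff)
qed

end

text \<open>The superlevel set is covered by \<Omega>, which the weak type of the maximal function
  controls, the set where the bad part is large outside \<Omega>, and the set where the good part is
  large. For the last, Chebyshev is used with the power m of the square function, and the good part
  is at most |f| below l plus a multiple of l on \<Omega>.\<close>

theorem g_sq_distribution:
  fixes k :: nat
  assumes a: "0 < \<alpha>" "\<alpha> \<le> 1"
  obtains B where "B \<ge> 0"
    "\<And>(f :: 'a::euclidean_space \<Rightarrow> real) l. bounded_support f \<Longrightarrow> l > 0 \<Longrightarrow>
      emeasure lborel {x. g_sq \<alpha> f {0<..} x > ennreal (l\<^sup>2)}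
      \<le> ennreal B * (\<integral>\<^sup>+x. ennreal (marcinkiewicz_weight (real (2 * (k + 2))) l \<bar>f x\<bar>) \<partial>lborel)"
proof -
  define m where "m = k + 2"
  define n where "n = DIM('a)"
  define V where "V = unit_ball_vol (real DIM('a))"
  have V: "V > 0" by (simp add: V_def)
  obtain D where D: "D > 0" "\<And>f :: 'a::euclidean_space \<Rightarrow> real. bounded_support f \<Longrightarrow>
      (\<integral>\<^sup>+x. (g_sq \<alpha> f {0<..} x) ^ m \<partial>lborel) \<le> ennreal D * (\<integral>\<^sup>+x. ennreal ((f x)\<^sup>2) ^ m \<partial>lborel)"
    using g_sq_even_power[OF a, of k, where 'a='a] unfolding m_def by blast
  define Bb where "Bb = sqrt (real n + \<alpha>) * (V * 2 ^ n * 2 powr \<alpha> / \<alpha>)"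
  have Bb: "Bb \<ge> 0" using V a by (simp add: Bb_def)
  define c1 :: real where "c1 = D * 4 ^ m"
  \<comment> \<open>\<open>c2\<close> collects three multiples of the measure of \<Omega>: from the
    good part, from \<Omega> itself, and from the values of f below l / 2 in the estimate of the bad
    part. \<open>c3\<close> is the constant of the maximal theorem.\<close>
  define c2 :: real where "c2 = D * 4 ^ m * (10 ^ n) ^ (2 * m) + 1 + Bb / 2"
  define c3 :: real where "c3 = 2 * 5 ^ n"
  have c: "c1 \<ge> 0" "c2 \<ge> 0" "c3 \<ge> 0" using D(1) Bb by (auto simp: c1_def c2_def c3_def)
  define B where "B = (c1 + (Bb + c2 * c3)) * 4 ^ m"
  have B0: "B \<ge> 0" using c Bb by (simp add: B_def)
  have "emeasure lborel {x. g_sq \<alpha> f {0<..} x > ennreal (l0\<^sup>2)} \<le> ennreal B * (\<integral>\<^sup>+x. ennreal (marcinkiewicz_weight (real (2 * m)) l0 \<bar>f x\<bar>) \<partial>lborel)"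
    if f: "bounded_support f" and l0: "l0 > 0" for f :: "'a \<Rightarrow> real" and l0
  proof -
    \<comment> \<open>The square function of a sum is at most twice the sum of the two square
      functions, and 2 l^2 + 2 l^2 = l0^2.\<close>
    define l where "l = l0 / 2"
    have l: "l > 0" using l0 by (simp add: l_def)
    interpret cz: calderon_zygmund f l by standard (use f l in auto)
    have fm[measurable]: "f \<in> borel_measurable borel" by (rule cz.fm)
    note lif = bounded_support_locally_integrable[OF f]
    note lgood = bounded_support_locally_integrable[OF cz.good_bounded_support]
    note [measurable] = cz.Omega_measurable
    define E1 where "E1 = (\<integral>\<^sup>+x. ennreal (l powr (- real (2 * m)) * \<bar>f x\<bar> ^ (2 * m)) * indicator {x. \<bar>f x\<bar> \<le> l} x \<partial>lborel)"
    define E2 where "E2 = (\<integral>\<^sup>+x. ennreal (\<bar>f x\<bar> / l) * indicator {x. \<bar>f x\<bar> > l / 2} x \<partial>lborel)"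
    have lm: "l powr (- real (2 * m)) = 1 / l ^ (2 * m)"
      using l by (simp only: powr_minus powr_realpow inverse_eq_divide)
    have Om: "emeasure lborel cz.\<Omega> \<le> ennreal c3 * E2"
    proof -
      have "ennreal l * emeasure lborel cz.\<Omega> \<le> ennreal c3 * (\<integral>\<^sup>+x. ennreal \<bar>f x\<bar> * indicator {x. ennreal \<bar>f x\<bar> > ennreal (l / 2)} x \<partial>lborel)"
        unfolding cz.\<Omega>_def cz.Mf_def c3_def n_def by (rule maximal_weak_type) (use l in auto)
      also have "(\<integral>\<^sup>+x. ennreal \<bar>f x\<bar> * indicator {x. ennreal \<bar>f x\<bar> > ennreal (l / 2)} x \<partial>lborel) = ennreal l * E2"
        unfolding E2_def by (subst nn_integral_cmult[symmetric])
          (use l in \<open>auto simp: mult.assoc[symmetric] ennreal_less_iff indicator_def simp flip: ennreal_mult intro!: nn_integral_cong\<close>)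
      finally have "ennreal l * emeasure lborel cz.\<Omega> \<le> ennreal l * (ennreal c3 * E2)" by (simp add: mult_ac)
      then show ?thesis using l by (simp add: ennreal_mult_le_mult_iff)
    qed
    \<comment> \<open>On \<Omega> the values |f| \<le> l / 2 contribute at most half the measure of
      \<Omega>; the others are in \<open>E2\<close>.\<close>
    have fO: "(\<integral>\<^sup>+y\<in>cz.\<Omega>. ennreal (\<bar>f y\<bar> / l) \<partial>lborel) \<le> E2 + ennreal (1 / 2) * emeasure lborel cz.\<Omega>"
    proof -
      have "(\<integral>\<^sup>+y\<in>cz.\<Omega>. ennreal (\<bar>f y\<bar> / l) \<partial>lborel) \<le> (\<integral>\<^sup>+y. ennreal (\<bar>f y\<bar> / l) * indicator {x. \<bar>f x\<bar> > l / 2} y + ennreal (1 / 2) * indicator cz.\<Omega> y \<partial>lborel)"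
      proof (rule nn_integral_mono)
        fix y
        show "ennreal (\<bar>f y\<bar> / l) * indicator cz.\<Omega> y \<le> ennreal (\<bar>f y\<bar> / l) * indicator {x. \<bar>f x\<bar> > l / 2} y + ennreal (1 / 2) * indicator cz.\<Omega> y"
        proof (cases "\<bar>f y\<bar> > l / 2")
          case False
          then have "ennreal (\<bar>f y\<bar> / l) \<le> ennreal (1 / 2)" using l by (intro ennreal_leI) (simp add: field_simps)
          then have "ennreal (\<bar>f y\<bar> / l) * indicator cz.\<Omega> y \<le> ennreal (1 / 2) * indicator cz.\<Omega> y" by (rule mult_right_mono) simp
          then show ?thesis by (rule add_increasing[rotated]) simp
        qed (simp add: indicator_def)
      qed
      also have "\<dots> = E2 + ennreal (1 / 2) * emeasure lborel cz.\<Omega>"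
        unfolding E2_def by (subst nn_integral_add) (auto simp: nn_integral_cmult_indicator)
      finally show ?thesis .
    qed
    define S1 where "S1 = {x. g_sq \<alpha> cz.good {0<..} x > ennreal (l\<^sup>2)}"
    define S2 where "S2 = {x. x \<notin> cz.\<Omega> \<and> g_sq \<alpha> cz.bad {0<..} x > ennreal (l\<^sup>2)}"
    have [measurable]: "g_sq \<alpha> cz.good {0<..} \<in> borel_measurable borel" "g_sq \<alpha> cz.bad {0<..} \<in> borel_measurable borel"
      by (rule g_sq_measurable[OF lgood a] g_sq_measurable[OF cz.bad_locally_integrable a]; simp)+
    have [measurable]: "S1 \<in> sets borel" "S2 \<in> sets borel" unfolding S1_def S2_def by measurable
    have S1: "emeasure lborel S1 \<le> ennreal c1 * E1 + ennreal (D * 4 ^ m * (10 ^ n) ^ (2 * m)) * emeasure lborel cz.\<Omega>"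
    proof -
      have "emeasure lborel S1 = (\<integral>\<^sup>+x. indicator S1 x \<partial>lborel)" by simp
      also have "\<dots> \<le> (\<integral>\<^sup>+x. ennreal (l powr (- real (2 * m))) * (g_sq \<alpha> cz.good {0<..} x) ^ m \<partial>lborel)"
      proof (rule nn_integral_mono)
        fix x
        show "indicator S1 x \<le> ennreal (l powr (- real (2 * m))) * (g_sq \<alpha> cz.good {0<..} x) ^ m"
        proof (cases "x \<in> S1")
          case True
          then have "ennreal (l\<^sup>2) ^ m \<le> (g_sq \<alpha> cz.good {0<..} x) ^ m" by (intro power_mono) (auto simp: S1_def)
          then have "ennreal (l powr (- real (2 * m))) * ennreal (l\<^sup>2) ^ m \<le> ennreal (l powr (- real (2 * m))) * (g_sq \<alpha> cz.good {0<..} x) ^ m"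
            by (rule mult_left_mono) simp
          also have "ennreal (l powr (- real (2 * m))) * ennreal (l\<^sup>2) ^ m = ennreal (l powr (- real (2 * m)) * (l\<^sup>2) ^ m)"
            using l by (simp only: ennreal_power ennreal_mult zero_le_power less_imp_le powr_ge_zero)
          also have "l powr (- real (2 * m)) * (l\<^sup>2) ^ m = 1" using l unfolding lm by (simp add: power_mult)
          finally show ?thesis using True by simp
        qed simp
      qed
      also have "\<dots> = ennreal (l powr (- real (2 * m))) * (\<integral>\<^sup>+x. (g_sq \<alpha> cz.good {0<..} x) ^ m \<partial>lborel)"
        by (rule nn_integral_cmult) measurable
      also have "\<dots> \<le> ennreal (l powr (- real (2 * m))) * (ennreal D * (\<integral>\<^sup>+x. ennreal ((cz.good x)\<^sup>2) ^ m \<partial>lborel))"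
        by (intro mult_left_mono D(2) cz.good_bounded_support) auto
      also have "\<dots> = ennreal D * (\<integral>\<^sup>+x. ennreal (l powr (- real (2 * m))) * ennreal ((cz.good x)\<^sup>2) ^ m \<partial>lborel)"
      proof -
        have [measurable]: "cz.good \<in> borel_measurable borel" using cz.good_bounded_support by (simp add: bounded_support_def)
        show ?thesis by (subst nn_integral_cmult) (auto simp: mult_ac)
      qed
      also have "\<dots> \<le> ennreal D * (\<integral>\<^sup>+x. ennreal (4 ^ m) * (ennreal (l powr (- real (2 * m)) * \<bar>f x\<bar> ^ (2 * m)) * indicator {x. \<bar>f x\<bar> \<le> l} x) + ennreal (4 ^ m * (10 ^ n) ^ (2 * m)) * indicator cz.\<Omega> x \<partial>lborel)"
      proof (rule mult_left_mono, rule nn_integral_mono_AE)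
        show "AE x in lborel. ennreal (l powr (- real (2 * m))) * ennreal ((cz.good x)\<^sup>2) ^ m
          \<le> ennreal (4 ^ m) * (ennreal (l powr (- real (2 * m)) * \<bar>f x\<bar> ^ (2 * m)) * indicator {x. \<bar>f x\<bar> \<le> l} x) + ennreal (4 ^ m * (10 ^ n) ^ (2 * m)) * indicator cz.\<Omega> x"
          using cz.good_bound_AE
        proof eventually_elim
          case (elim x)
          define u where "u = \<bar>f x\<bar> * indicator {x. \<bar>f x\<bar> \<le> l} x"
          define v where "v = 10 ^ n * l * indicator cz.\<Omega> x"
          have uv: "u \<ge> 0" "v \<ge> 0" using l by (auto simp: u_def v_def)
          have "((cz.good x)\<^sup>2) ^ m = \<bar>cz.good x\<bar> ^ (2 * m)" by (simp add: power_mult)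
          also have "\<dots> \<le> (u + v) ^ (2 * m)" using elim by (intro power_mono) (auto simp: u_def v_def n_def)
          also have "\<dots> \<le> (2 * max u v) ^ (2 * m)" using uv by (intro power_mono) auto
          also have "\<dots> = 4 ^ m * max u v ^ (2 * m)" by (simp add: power_mult power_mult_distrib)
          also have "\<dots> \<le> 4 ^ m * (u ^ (2 * m) + v ^ (2 * m))" using uv by (intro mult_left_mono) (auto simp: max_def)
          finally have "l powr (- real (2 * m)) * ((cz.good x)\<^sup>2) ^ m \<le> l powr (- real (2 * m)) * (4 ^ m * (u ^ (2 * m) + v ^ (2 * m)))"
            by (rule mult_left_mono) simp
          also have "\<dots> = 4 ^ m * (l powr (- real (2 * m)) * u ^ (2 * m)) + 4 ^ m * (l powr (- real (2 * m)) * v ^ (2 * m))"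
            by (simp add: algebra_simps)
          finally have le: "l powr (- real (2 * m)) * ((cz.good x)\<^sup>2) ^ m \<le> 4 ^ m * (l powr (- real (2 * m)) * u ^ (2 * m)) + 4 ^ m * (l powr (- real (2 * m)) * v ^ (2 * m))" .
          have m0: "m > 0" by (simp add: m_def)
          have v: "l powr (- real (2 * m)) * v ^ (2 * m) = (10 ^ n) ^ (2 * m) * indicator cz.\<Omega> x"
            using l m0 unfolding lm v_def by (auto simp: power_mult_distrib indicator_def)
          have u: "ennreal (l powr (- real (2 * m)) * u ^ (2 * m)) = ennreal (l powr (- real (2 * m)) * \<bar>f x\<bar> ^ (2 * m)) * indicator {x. \<bar>f x\<bar> \<le> l} x"
            using m0 unfolding u_def by (auto simp: indicator_def)
          have "ennreal (l powr (- real (2 * m))) * ennreal ((cz.good x)\<^sup>2) ^ m = ennreal (l powr (- real (2 * m)) * ((cz.good x)\<^sup>2) ^ m)"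
            by (simp only: ennreal_power ennreal_mult zero_le_power zero_le_power2 powr_ge_zero)
          also have "\<dots> \<le> ennreal (4 ^ m * (l powr (- real (2 * m)) * u ^ (2 * m)) + 4 ^ m * (l powr (- real (2 * m)) * v ^ (2 * m)))"
            using le by (rule ennreal_leI)
          also have "\<dots> = ennreal (4 ^ m) * ennreal (l powr (- real (2 * m)) * u ^ (2 * m)) + ennreal (4 ^ m * (l powr (- real (2 * m)) * v ^ (2 * m)))"
            using uv by (simp only: ennreal_plus ennreal_mult mult_nonneg_nonneg zero_le_power zero_le_numeral powr_ge_zero)
          also have "ennreal (4 ^ m * (l powr (- real (2 * m)) * v ^ (2 * m))) = ennreal (4 ^ m * (10 ^ n) ^ (2 * m)) * indicator cz.\<Omega> x"
            unfolding v by (auto simp: indicator_def)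
          finally show ?case unfolding u .
        qed
      qed simp
      also have "\<dots> = ennreal D * (ennreal (4 ^ m) * E1 + ennreal (4 ^ m * (10 ^ n) ^ (2 * m)) * emeasure lborel cz.\<Omega>)"
        unfolding E1_def by (subst nn_integral_add) (auto simp: nn_integral_cmult nn_integral_cmult_indicator)
      also have "\<dots> = ennreal c1 * E1 + ennreal (D * 4 ^ m * (10 ^ n) ^ (2 * m)) * emeasure lborel cz.\<Omega>"
      proof -
        have "ennreal c1 = ennreal D * ennreal (4 ^ m)" unfolding c1_def using D(1) by (intro ennreal_mult) auto
        moreover have "ennreal (D * 4 ^ m * (10 ^ n) ^ (2 * m)) = ennreal D * ennreal (4 ^ m * (10 ^ n) ^ (2 * m))"
          unfolding mult.assoc using D(1) by (intro ennreal_mult) auto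
        ultimately show ?thesis by (simp only: distrib_left mult.assoc)
      qed
      finally show ?thesis .
    qed
    have S2: "emeasure lborel S2 \<le> ennreal Bb * E2 + ennreal (Bb / 2) * emeasure lborel cz.\<Omega>"
    proof -
      have "emeasure lborel S2 \<le> ennreal Bb * (\<integral>\<^sup>+y\<in>cz.\<Omega>. ennreal (\<bar>f y\<bar> / l) \<partial>lborel)"
        unfolding S2_def Bb_def n_def V_def cz.V_def[symmetric] by (rule cz.bad_weak_type[OF a])
      also have "\<dots> \<le> ennreal Bb * (E2 + ennreal (1 / 2) * emeasure lborel cz.\<Omega>)"
        by (rule mult_left_mono[OF fO]) simp
      also have "\<dots> = ennreal Bb * E2 + ennreal (Bb / 2) * emeasure lborel cz.\<Omega>"
        using Bb ennreal_mult[of Bb "1 / 2"] by (simp add: distrib_left mult.assoc)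
      finally show ?thesis .
    qed
    have sub: "{x. g_sq \<alpha> f {0<..} x > ennreal (l0\<^sup>2)} \<subseteq> S1 \<union> (cz.\<Omega> \<union> S2)"
    proof (rule subsetI, rule ccontr)
      fix x assume x: "x \<in> {x. g_sq \<alpha> f {0<..} x > ennreal (l0\<^sup>2)}" and nx: "x \<notin> S1 \<union> (cz.\<Omega> \<union> S2)"
      have "g_sq \<alpha> f {0<..} x = g_sq \<alpha> (\<lambda>x. cz.good x + cz.bad x) {0<..} x"
      proof -
        have "(\<lambda>x. cz.good x + cz.bad x) = f" by (auto simp: cz.good_def cz.bad_def indicator_def fun_eq_iff)
        then show ?thesis by simp
      qed
      also have "\<dots> \<le> 2 * g_sq \<alpha> cz.good {0<..} x + 2 * g_sq \<alpha> cz.bad {0<..} x"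
        by (rule g_sq_add[OF a lgood cz.bad_locally_integrable])
      also have "\<dots> \<le> 2 * ennreal (l\<^sup>2) + 2 * ennreal (l\<^sup>2)"
        using nx by (intro add_mono mult_left_mono) (auto simp: S1_def S2_def not_less)
      also have "\<dots> = ennreal (2 * l\<^sup>2 + 2 * l\<^sup>2)"
        by (simp add: ennreal_mult flip: distrib_right)
      also have "2 * l\<^sup>2 + 2 * l\<^sup>2 = l0\<^sup>2" by (simp add: l_def power2_eq_square)
      finally show False using x by auto
    qed
    have "emeasure lborel {x. g_sq \<alpha> f {0<..} x > ennreal (l0\<^sup>2)} \<le> emeasure lborel (S1 \<union> (cz.\<Omega> \<union> S2))"
      by (rule emeasure_mono[OF sub]) simp
    also have "\<dots> \<le> emeasure lborel S1 + (emeasure lborel cz.\<Omega> + emeasure lborel S2)"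
      by (rule order_trans[OF emeasure_subadditive add_left_mono[OF emeasure_subadditive]]) auto
    also have "\<dots> \<le> (ennreal c1 * E1 + ennreal (D * 4 ^ m * (10 ^ n) ^ (2 * m)) * emeasure lborel cz.\<Omega>) + (emeasure lborel cz.\<Omega> + (ennreal Bb * E2 + ennreal (Bb / 2) * emeasure lborel cz.\<Omega>))"
      by (intro add_mono S1 S2 order_refl)
    also have "\<dots> = ennreal c1 * E1 + (ennreal Bb * E2 + ennreal c2 * emeasure lborel cz.\<Omega>)"
    proof -
      have c2: "ennreal c2 = ennreal (D * 4 ^ m * (10 ^ n) ^ (2 * m)) + 1 + ennreal (Bb / 2)"
        unfolding c2_def using D(1) Bb by (subst ennreal_plus) auto
      show ?thesis unfolding c2 by (simp only: distrib_right mult_1_left add_ac)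
    qed
    also have "\<dots> \<le> ennreal c1 * E1 + (ennreal Bb * E2 + ennreal c2 * (ennreal c3 * E2))"
      by (intro add_left_mono mult_left_mono Om) auto
    also have "\<dots> = ennreal c1 * E1 + ennreal (Bb + c2 * c3) * E2"
    proof -
      have "ennreal (Bb + c2 * c3) = ennreal Bb + ennreal c2 * ennreal c3"
        using Bb c ennreal_mult[of c2 c3] by (subst ennreal_plus) auto
      then show ?thesis by (simp only: distrib_right mult.assoc)
    qed
    also have "\<dots> \<le> ennreal (c1 + (Bb + c2 * c3)) * E1 + ennreal (c1 + (Bb + c2 * c3)) * E2"
      by (rule add_mono[OF mult_right_mono[OF ennreal_leI] mult_right_mono[OF ennreal_leI]]) (use c Bb in auto)
    also have "\<dots> = ennreal (c1 + (Bb + c2 * c3)) * (E1 + E2)" by (simp only: distrib_left)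
    \<comment> \<open>Return from l to l0: l^(-2 m) = 4^m l0^(-2 m), and the threshold l / 2 is l0 /
      4, where the linear term of the weight begins. In that term 1 / l = 2 / l0 is covered by 4^m
      as well.\<close>
    also have "E1 + E2 \<le> ennreal (4 ^ m) * (\<integral>\<^sup>+x. ennreal (marcinkiewicz_weight (real (2 * m)) l0 \<bar>f x\<bar>) \<partial>lborel)"
    proof -
      have "E1 + E2 = (\<integral>\<^sup>+x. ennreal (l powr (- real (2 * m)) * \<bar>f x\<bar> ^ (2 * m)) * indicator {x. \<bar>f x\<bar> \<le> l} x + ennreal (\<bar>f x\<bar> / l) * indicator {x. \<bar>f x\<bar> > l / 2} x \<partial>lborel)"
        unfolding E1_def E2_def by (rule nn_integral_add[symmetric]) measurable
      also have "\<dots> \<le> (\<integral>\<^sup>+x. ennreal (4 ^ m) * ennreal (marcinkiewicz_weight (real (2 * m)) l0 \<bar>f x\<bar>) \<partial>lborel)"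
      proof (rule nn_integral_mono)
        fix x
        define s where "s = \<bar>f x\<bar>"
        have s: "s \<ge> 0" by (simp add: s_def)
        have m0: "2 * m \<noteq> 0" by (simp add: m_def)
        have sp: "s powr real (2 * m) = s ^ (2 * m)"
        proof (cases "s = 0")
          case False
          then have "s > 0" using s by simp
          then show ?thesis by (rule powr_realpow)
        qed (use m0 in simp)
        have "ennreal (l powr (- real (2 * m)) * s ^ (2 * m)) * indicator {x. \<bar>f x\<bar> \<le> l} x + ennreal (s / l) * indicator {x. \<bar>f x\<bar> > l / 2} x
          = ennreal ((if s \<le> l then l powr (- real (2 * m)) * s ^ (2 * m) else 0) + (if s > l / 2 then s / l else 0))"
          using s l by (auto simp: s_def indicator_def)
        also have "\<dots> \<le> ennreal (4 ^ m * marcinkiewicz_weight (real (2 * m)) l0 s)"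
        proof (rule ennreal_leI)
          have 1: "(if s \<le> l then l powr (- real (2 * m)) * s ^ (2 * m) else 0) \<le> 4 ^ m * (if s \<le> l0 then l0 powr (- real (2 * m)) * s powr real (2 * m) else 0)"
          proof (cases "s \<le> l")
            case True
            have l0m: "l0 powr (- real (2 * m)) = 1 / l0 ^ (2 * m)"
              using l0 by (simp only: powr_minus powr_realpow inverse_eq_divide)
            have eq: "l powr (- real (2 * m)) * s ^ (2 * m) = 4 ^ m * (l0 powr (- real (2 * m)) * s ^ (2 * m))"
              unfolding lm l0m using l0 by (simp add: l_def power_divide power_mult)
            have "s \<le> l0" using True l0 by (simp add: l_def)
            then show ?thesis using True unfolding sp eq by (simp only: if_True order_refl)
          qed (use s in simp)
          have "(2::real) \<le> 4 ^ m" using power_increasing[of 1 m "4::real"] by (simp add: m_def)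
          then have "2 * (s / l0) \<le> 4 ^ m * (s / l0)" using s l0 by (intro mult_right_mono) auto
          then have 2: "(if s > l / 2 then s / l else 0) \<le> 4 ^ m * (if l0 / 4 < s then s / l0 else 0)"
            by (simp add: l_def mult.commute)
          show "(if s \<le> l then l powr (- real (2 * m)) * s ^ (2 * m) else 0) + (if s > l / 2 then s / l else 0) \<le> 4 ^ m * marcinkiewicz_weight (real (2 * m)) l0 s"
            unfolding marcinkiewicz_weight_def distrib_left using 1 2 by (rule add_mono)
        qed
        also have "\<dots> = ennreal (4 ^ m) * ennreal (marcinkiewicz_weight (real (2 * m)) l0 s)"
          by (rule ennreal_mult) (use marcinkiewicz_weight_nonneg l0 s in auto)
        finally show "ennreal (l powr (- real (2 * m)) * \<bar>f x\<bar> ^ (2 * m)) * indicator {x. \<bar>f x\<bar> \<le> l} x + ennreal (\<bar>f x\<bar> / l) * indicator {x. \<bar>f x\<bar> > l / 2} x \<le> ennreal (4 ^ m) * ennreal (marcinkiewicz_weight (real (2 * m)) l0 \<bar>f x\<bar>)"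
          unfolding s_def .
      qed
      also have "\<dots> = ennreal (4 ^ m) * (\<integral>\<^sup>+x. ennreal (marcinkiewicz_weight (real (2 * m)) l0 \<bar>f x\<bar>) \<partial>lborel)"
        unfolding marcinkiewicz_weight_def by (rule nn_integral_cmult) measurable
      finally show ?thesis .
    qed
    also have "ennreal (c1 + (Bb + c2 * c3)) * (ennreal (4 ^ m) * (\<integral>\<^sup>+x. ennreal (marcinkiewicz_weight (real (2 * m)) l0 \<bar>f x\<bar>) \<partial>lborel))
      = ennreal B * (\<integral>\<^sup>+x. ennreal (marcinkiewicz_weight (real (2 * m)) l0 \<bar>f x\<bar>) \<partial>lborel)"
    proof -
      have "ennreal B = ennreal (c1 + (Bb + c2 * c3)) * ennreal (4 ^ m)"
        unfolding B_def using c Bb by (intro ennreal_mult) auto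
      then show ?thesis by (simp only: mult.assoc)
    qed
    finally show ?thesis by (simp add: mult_left_mono)
  qed
  then show thesis using B0 that unfolding m_def by blast
qed

subsection \<open>Modular inequality\<close>

lemma SUP_power2_le:
  fixes F :: "'i \<Rightarrow> ennreal"
  assumes "\<And>i. i \<in> I \<Longrightarrow> (F i)\<^sup>2 \<le> c"
  shows "(SUP i\<in>I. F i)\<^sup>2 \<le> c"
proof (cases c)
  case (real r)
  have "F i \<le> ennreal (sqrt r)" if "i \<in> I" for i
  proof (rule ccontr)
    assume "\<not> F i \<le> ennreal (sqrt r)"
    then have lt: "ennreal (sqrt r) < F i" by simp
    show False
    proof (cases "F i")
      case (real s)
      then have "sqrt r < s" using lt \<open>0 \<le> r\<close> by (simp add: ennreal_less_iff)
      then have "r < s\<^sup>2" using \<open>0 \<le> r\<close> by (metis real_sqrt_less_iff real_sqrt_abs abs_of_nonneg real(1))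
      moreover have "ennreal (s\<^sup>2) \<le> ennreal r" using assms[OF that] real \<open>c = ennreal r\<close> by (simp add: ennreal_power)
      ultimately show False using \<open>0 \<le> r\<close> by (simp add: ennreal_le_iff)
    next
      case top
      then show False using assms[OF that] \<open>c = ennreal r\<close> by (simp add: power2_eq_square top_unique)
    qed
  qed
  then have "(SUP i\<in>I. F i)\<^sup>2 \<le> (ennreal (sqrt r))\<^sup>2" by (intro power_mono SUP_least) auto
  then show ?thesis using real by (simp add: ennreal_power)
qed simp

lemma ennreal_mult_liminf_le:
  fixes c :: ennreal
  shows "c * liminf u \<le> liminf (\<lambda>j. c * u j)"
  unfolding liminf_SUP_INF SUP_mult_left_ennreal
  by (intro SUP_mono' INF_greatest mult_left_mono INF_lower) auto

text \<open>Dominated convergence makes each single convolution converge; a supremum of limits is at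
  most the lower limit of the suprema, and Fatou's lemma handles the integral in t.\<close>

lemma g_sq_Fatou:
  fixes f :: "'a::euclidean_space \<Rightarrow> 'b::{banach, second_countable_topology}" and F :: "nat \<Rightarrow> 'a \<Rightarrow> 'b"
  assumes a: "0 < \<alpha>" "\<alpha> \<le> 1" and f: "locally_integrable f" and F: "\<And>j. locally_integrable (F j)"
    and lim: "\<And>z. (\<lambda>j. F j z) \<longlonglongrightarrow> f z" and dom: "\<And>j z. norm (F j z) \<le> norm (f z)"
  shows "g_sq \<alpha> f {0<..} x \<le> liminf (\<lambda>j. g_sq \<alpha> (F j) {0<..} x)"
proof -
  have pw: "(A_sup \<alpha> f t x)\<^sup>2 \<le> liminf (\<lambda>j. (A_sup \<alpha> (F j) t x)\<^sup>2)" if t: "t > 0" for t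
    unfolding A_sup_def[of _ f]
  proof (rule SUP_power2_le)
    fix \<psi> :: "'a \<Rightarrow> real" assume psi: "\<psi> \<in> C_class \<alpha>"
    have "(\<lambda>j. conv (F j) (dilate t \<psi>) x) \<longlonglongrightarrow> conv f (dilate t \<psi>) x"
      unfolding conv_def
    proof (rule integral_dominated_convergence[where w="\<lambda>z. norm (dilate t \<psi> (x - z) *\<^sub>R f z)"])
      show "(\<lambda>z. dilate t \<psi> (x - z) *\<^sub>R f z) \<in> borel_measurable lebesgue"
        using conv_integrable[OF f psi a t] by auto
      show "(\<lambda>z. dilate t \<psi> (x - z) *\<^sub>R F j z) \<in> borel_measurable lebesgue" for j
        using conv_integrable[OF F psi a t] by auto
      show "integrable lebesgue (\<lambda>z. norm (dilate t \<psi> (x - z) *\<^sub>R f z))"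
        by (rule integrable_norm[OF conv_integrable[OF f psi a t]])
      show "AE z in lebesgue. (\<lambda>j. dilate t \<psi> (x - z) *\<^sub>R F j z) \<longlonglongrightarrow> dilate t \<psi> (x - z) *\<^sub>R f z"
        by (intro AE_I2 tendsto_intros lim)
      show "AE z in lebesgue. norm (dilate t \<psi> (x - z) *\<^sub>R F j z) \<le> norm (dilate t \<psi> (x - z) *\<^sub>R f z)" for j
        by (intro AE_I2) (simp add: dom mult_left_mono)
    qed
    then have "(\<lambda>j. ennreal ((norm (conv (F j) (dilate t \<psi>) x))\<^sup>2)) \<longlonglongrightarrow> ennreal ((norm (conv f (dilate t \<psi>) x))\<^sup>2)"
      by (intro tendsto_ennrealI tendsto_intros)
    then have "ennreal ((norm (conv f (dilate t \<psi>) x))\<^sup>2) = liminf (\<lambda>j. ennreal ((norm (conv (F j) (dilate t \<psi>) x))\<^sup>2))"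
      by (intro lim_imp_Liminf[symmetric]) auto
    also have "\<dots> \<le> liminf (\<lambda>j. (A_sup \<alpha> (F j) t x)\<^sup>2)"
    proof (intro Liminf_mono always_eventually allI)
      fix j
      have "ennreal (norm (conv (F j) (dilate t \<psi>) x)) \<le> A_sup \<alpha> (F j) t x"
        unfolding A_sup_def by (rule SUP_upper[OF psi])
      then have "(ennreal (norm (conv (F j) (dilate t \<psi>) x)))\<^sup>2 \<le> (A_sup \<alpha> (F j) t x)\<^sup>2" by (rule power_mono) simp
      then show "ennreal ((norm (conv (F j) (dilate t \<psi>) x))\<^sup>2) \<le> (A_sup \<alpha> (F j) t x)\<^sup>2" by (simp add: ennreal_power)
    qed
    finally show "(ennreal (norm (conv f (dilate t \<psi>) x)))\<^sup>2 \<le> liminf (\<lambda>j. (A_sup \<alpha> (F j) t x)\<^sup>2)"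
      by (simp add: ennreal_power)
  qed
  define H where "H = (\<lambda>j t. (A_sup \<alpha> (F j) t x * indicator {0<..} t)\<^sup>2 * ennreal (1 / t))"
  have [measurable]: "H j \<in> borel_measurable borel" for j
    unfolding H_def using A_sup_measurable_fst[OF F a, of j x] by measurable
  have "g_sq \<alpha> f {0<..} x \<le> (\<integral>\<^sup>+t. liminf (\<lambda>j. H j t) \<partial>lborel)"
    unfolding g_sq_def
  proof (rule nn_integral_mono)
    fix t :: real
    show "(A_sup \<alpha> f t x)\<^sup>2 * ennreal (1 / t) * indicator {0<..} t \<le> liminf (\<lambda>j. H j t)"
    proof (cases "t > 0")
      case True
      have "ennreal (1 / t) * (A_sup \<alpha> f t x)\<^sup>2 \<le> ennreal (1 / t) * liminf (\<lambda>j. (A_sup \<alpha> (F j) t x)\<^sup>2)"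
        by (rule mult_left_mono[OF pw[OF True]]) simp
      also have "\<dots> \<le> liminf (\<lambda>j. ennreal (1 / t) * (A_sup \<alpha> (F j) t x)\<^sup>2)"
        by (rule ennreal_mult_liminf_le)
      finally show ?thesis using True by (simp add: H_def mult.commute)
    qed simp
  qed
  also have "\<dots> \<le> liminf (\<lambda>j. \<integral>\<^sup>+t. H j t \<partial>lborel)"
    by (rule nn_integral_liminf) auto
  also have "(\<lambda>j. \<integral>\<^sup>+t. H j t \<partial>lborel) = (\<lambda>j. g_sq \<alpha> (F j) {0<..} x)"
    unfolding g_sq_def H_def fun_eq_iff by (intro allI nn_integral_cong) (auto simp: indicator_def)
  finally show ?thesis .
qed

text \<open>The truncations equal f or 0, and the weight vanishes at 0, so their right sides are
  dominated by that of f. A strict inequality for the square function of f persists for almost all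
  truncations, so Fatou's lemma transfers the bound to the measure of the superlevel set.\<close>

lemma g_sq_distribution_locally_integrable:
  fixes f :: "'a::euclidean_space \<Rightarrow> real"
  assumes a: "0 < \<alpha>" "\<alpha> \<le> 1" and q: "q > 0"
    and B: "\<And>(f :: 'a \<Rightarrow> real) l. bounded_support f \<Longrightarrow> l > 0 \<Longrightarrow>
      emeasure lborel {x. g_sq \<alpha> f {0<..} x > ennreal (l\<^sup>2)}
      \<le> ennreal B * (\<integral>\<^sup>+x. ennreal (marcinkiewicz_weight q l \<bar>f x\<bar>) \<partial>lborel)"
    and f: "locally_integrable f" and fm[measurable]: "f \<in> borel_measurable borel" and l: "l > 0"
  shows "emeasure lborel {x. g_sq \<alpha> f {0<..} x > ennreal (l\<^sup>2)}
      \<le> ennreal B * (\<integral>\<^sup>+x. ennreal (marcinkiewicz_weight q l \<bar>f x\<bar>) \<partial>lborel)"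
proof -
  define F where "F = (\<lambda>(j::nat) x. if norm x \<le> real j \<and> \<bar>f x\<bar> \<le> real j then f x else 0)"
  have F: "bounded_support (F j)" for j
    by (rule bounded_supportI[of _ "real j"]) (auto simp: F_def)
  note lF = bounded_support_locally_integrable[OF F]
  have lim: "(\<lambda>j. F j z) \<longlonglongrightarrow> f z" for z
  proof (rule tendsto_eventually)
    obtain N :: nat where N: "max (norm z) \<bar>f z\<bar> < real N" using reals_Archimedean2 by blast
    show "\<forall>\<^sub>F j in sequentially. F j z = f z"
      using eventually_ge_at_top[of N]
    proof eventually_elim
      case (elim j)
      then have "real N \<le> real j" by simp
      then show ?case using N by (simp add: F_def)
    qed
  qed
  define S where "S = (\<lambda>j. {x. g_sq \<alpha> (F j) {0<..} x > ennreal (l\<^sup>2)})"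
  have gm[measurable]: "g_sq \<alpha> (F j) {0<..} \<in> borel_measurable borel" for j
    by (rule g_sq_measurable[OF lF a]) auto
  have gmf[measurable]: "g_sq \<alpha> f {0<..} \<in> borel_measurable borel"
    by (rule g_sq_measurable[OF f a]) auto
  have Sm[measurable]: "S j \<in> sets borel" for j unfolding S_def by measurable
  have "emeasure lborel {x. g_sq \<alpha> f {0<..} x > ennreal (l\<^sup>2)} = (\<integral>\<^sup>+x. indicator {x. g_sq \<alpha> f {0<..} x > ennreal (l\<^sup>2)} x \<partial>lborel)"
    by simp
  also have "\<dots> \<le> (\<integral>\<^sup>+x. liminf (\<lambda>j. indicator (S j) x) \<partial>lborel)"
  proof (rule nn_integral_mono)
    fix x
    show "indicator {x. g_sq \<alpha> f {0<..} x > ennreal (l\<^sup>2)} x \<le> liminf (\<lambda>j. indicator (S j) x :: ennreal)"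
    proof (cases "g_sq \<alpha> f {0<..} x > ennreal (l\<^sup>2)")
      case True
      have "ennreal (l\<^sup>2) < liminf (\<lambda>j. g_sq \<alpha> (F j) {0<..} x)"
        using True by (rule less_le_trans) (rule g_sq_Fatou[OF a f lF lim], simp add: F_def)
      then have "\<forall>\<^sub>F j in sequentially. x \<in> S j"
        unfolding S_def by (auto dest: less_LiminfD)
      then have "\<forall>\<^sub>F j in sequentially. (1::ennreal) \<le> indicator (S j) x" by eventually_elim simp
      then have "(1::ennreal) \<le> liminf (\<lambda>j. indicator (S j) x)" by (rule Liminf_bounded)
      then show ?thesis using True by simp
    qed simp
  qed
  also have "\<dots> \<le> liminf (\<lambda>j. \<integral>\<^sup>+x. indicator (S j) x \<partial>lborel)"
    by (rule nn_integral_liminf) auto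
  also have "\<dots> \<le> ennreal B * (\<integral>\<^sup>+x. ennreal (marcinkiewicz_weight q l \<bar>f x\<bar>) \<partial>lborel)"
  proof (rule order_trans[OF Liminf_le_Limsup Limsup_bounded])
    show "\<forall>\<^sub>F j in sequentially. (\<integral>\<^sup>+x. indicator (S j) x \<partial>lborel) \<le> ennreal B * (\<integral>\<^sup>+x. ennreal (marcinkiewicz_weight q l \<bar>f x\<bar>) \<partial>lborel)"
    proof (intro always_eventually allI)
      fix j
      have "(\<integral>\<^sup>+x. indicator (S j) x \<partial>lborel) = emeasure lborel (S j)" by simp
      also have "\<dots> \<le> ennreal B * (\<integral>\<^sup>+x. ennreal (marcinkiewicz_weight q l \<bar>F j x\<bar>) \<partial>lborel)"
        unfolding S_def by (rule B[OF F l])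
      also have "\<dots> \<le> ennreal B * (\<integral>\<^sup>+x. ennreal (marcinkiewicz_weight q l \<bar>f x\<bar>) \<partial>lborel)"
        using l q marcinkiewicz_weight_nonneg[OF l, of _ q]
        by (intro mult_left_mono nn_integral_mono ennreal_leI) (auto simp: F_def marcinkiewicz_weight_def)
      finally show "(\<integral>\<^sup>+x. indicator (S j) x \<partial>lborel) \<le> \<dots>" .
    qed
  qed simp
  finally show ?thesis .
qed

lemma less_ennreal_sqrt_iff:
  assumes "l \<ge> 0"
  shows "ennreal l < ennreal_sqrt u \<longleftrightarrow> ennreal (l\<^sup>2) < u"
proof (cases u)
  case (real r)
  have "l < sqrt r \<longleftrightarrow> l\<^sup>2 < r" using assms real by (metis real_sqrt_less_iff real_sqrt_abs abs_of_nonneg)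
  then show ?thesis using real assms by (simp add: ennreal_sqrt_def ennreal_less_iff)
qed (simp add: ennreal_sqrt_def)

lemma ennreal_sqrt_mono: "u \<le> v \<Longrightarrow> ennreal_sqrt u \<le> ennreal_sqrt v"
  by (auto simp: ennreal_sqrt_def top_unique top.not_eq_extremum intro!: ennreal_leI enn2real_mono)

lemma ennreal_sqrt_measurable[measurable]: "ennreal_sqrt \<in> borel_measurable borel"
  unfolding ennreal_sqrt_def[abs_def] by measurable

lemma g_fun_eq: "g_fun \<alpha> f x = ennreal_sqrt (g_sq \<alpha> f {0<..} x)"
  by (simp add: g_fun_def g_sq_def nn_integral_completion)

lemma g_fun_measurable:
  fixes f :: "'a::euclidean_space \<Rightarrow> 'b::{banach, second_countable_topology}"
  assumes a: "0 < \<alpha>" "\<alpha> \<le> 1" and f: "locally_integrable f"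
  shows "g_fun \<alpha> f \<in> borel_measurable borel"
proof -
  have [measurable]: "g_sq \<alpha> f {0<..} \<in> borel_measurable borel" by (rule g_sq_measurable[OF f a]) auto
  have "(\<lambda>x. ennreal_sqrt (g_sq \<alpha> f {0<..} x)) \<in> borel_measurable borel" by measurable
  then show ?thesis by (simp add: g_fun_eq[abs_def])
qed

lemma A_sup_cong_AE:
  assumes "AE z in lebesgue. f z = g z" and "f \<in> borel_measurable lebesgue" "g \<in> borel_measurable lebesgue"
    and a: "0 < \<alpha>"
  shows "A_sup \<alpha> f t x = A_sup \<alpha> g t x"
  unfolding A_sup_def
proof (intro SUP_cong refl)
  fix \<psi> :: "'a \<Rightarrow> real" assume psi: "\<psi> \<in> C_class \<alpha>"
  have m: "(\<lambda>z. dilate t \<psi> (x - z)) \<in> borel_measurable lebesgue"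
    using dilate_measurable(2)[OF psi a] by (intro measurable_completion) simp
  have "conv f (dilate t \<psi>) x = conv g (dilate t \<psi>) x"
    unfolding conv_def
  proof (rule integral_cong_AE)
    show "AE z in lebesgue. dilate t \<psi> (x - z) *\<^sub>R f z = dilate t \<psi> (x - z) *\<^sub>R g z"
      using assms(1) by eventually_elim simp
  qed (use m assms in auto)
  then show "ennreal (norm (conv f (dilate t \<psi>) x)) = ennreal (norm (conv g (dilate t \<psi>) x))" by simp
qed

text \<open>The even exponent is chosen after \<Phi>: any q = 2 (k + 2) above p1 serves, and the
  distribution inequality for that q enters the modular interpolation with the function
  \<open>g_fun\<close> itself, heights being squared for \<open>g_sq\<close>.\<close>

theorem g_fun_modular_real:
  fixes \<Phi> :: "real \<Rightarrow> ennreal"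
  assumes a: "0 < \<alpha>" "\<alpha> \<le> 1"
    and mono: "\<And>a b. 0 \<le> a \<Longrightarrow> a \<le> b \<Longrightarrow> \<Phi> a \<le> \<Phi> b"
    and zero: "\<Phi> 0 = 0" and inf: "(\<Phi> \<longlongrightarrow> \<infinity>) at_top"
    and low: "lower_type p0 \<Phi>" and up: "upper_type p1 \<Phi>" and p: "1 < p0"
  obtains D where "D > 0"
    "\<And>f :: 'a::euclidean_space \<Rightarrow> real. locally_integrable f \<Longrightarrow>
      (\<integral>\<^sup>+x. \<Phi> (enn2real (g_fun \<alpha> f x)) \<partial>lborel) \<le> ennreal D * (\<integral>\<^sup>+x. \<Phi> \<bar>f x\<bar> \<partial>lborel) \<and>
      ((\<integral>\<^sup>+x. \<Phi> \<bar>f x\<bar> \<partial>lborel) < \<infinity> \<longrightarrow> (AE x in lborel. g_fun \<alpha> f x < \<infinity>))"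
proof -
  obtain k :: nat where k: "p1 < real k" using reals_Archimedean2 by blast
  define q where "q = real (2 * (k + 2))"
  have q: "p1 < q" "q > 0" using k by (auto simp: q_def)
  obtain B where B: "B \<ge> 0" "\<And>(f :: 'a \<Rightarrow> real) l. bounded_support f \<Longrightarrow> l > 0 \<Longrightarrow>
      emeasure lborel {x. g_sq \<alpha> f {0<..} x > ennreal (l\<^sup>2)}
      \<le> ennreal B * (\<integral>\<^sup>+x. ennreal (marcinkiewicz_weight q l \<bar>f x\<bar>) \<partial>lborel)"
    using g_sq_distribution[OF a, of k, where 'a='a] unfolding q_def by blast
  obtain D where D: "D > 0"
    "\<And>(h :: 'a \<Rightarrow> ennreal) (f :: 'a \<Rightarrow> real). h \<in> borel_measurable borel \<Longrightarrow> f \<in> borel_measurable borel \<Longrightarrow>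
      (\<And>x. f x \<ge> 0) \<Longrightarrow>
      (\<And>l. l > 0 \<Longrightarrow> emeasure lborel {x. h x > ennreal l} \<le> ennreal B * (\<integral>\<^sup>+x. ennreal (marcinkiewicz_weight q l (f x)) \<partial>lborel)) \<Longrightarrow>
      (\<integral>\<^sup>+x. \<Phi> (enn2real (h x)) \<partial>lborel) \<le> ennreal D * (\<integral>\<^sup>+x. \<Phi> (f x) \<partial>lborel) \<and>
      ((\<integral>\<^sup>+x. \<Phi> (f x) \<partial>lborel) < \<infinity> \<longrightarrow> (AE x in lborel. h x < \<infinity>))"
    using marcinkiewicz_modular[OF mono zero inf low up p q(1) B(1), where 'a='a] by metis
  have "(\<integral>\<^sup>+x. \<Phi> (enn2real (g_fun \<alpha> f x)) \<partial>lborel) \<le> ennreal D * (\<integral>\<^sup>+x. \<Phi> \<bar>f x\<bar> \<partial>lborel) \<and>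
      ((\<integral>\<^sup>+x. \<Phi> \<bar>f x\<bar> \<partial>lborel) < \<infinity> \<longrightarrow> (AE x in lborel. g_fun \<alpha> f x < \<infinity>))"
    if f: "locally_integrable f" for f :: "'a \<Rightarrow> real"
  proof -
    have fm: "f \<in> borel_measurable lebesgue" by (rule locally_integrable_measurable[OF f])
    \<comment> \<open>The distribution inequality asks for a Borel function. A change on a null set
      alters no convolution, so \<open>g_fun\<close> is the same at every point.\<close>
    obtain f' where f'[measurable]: "f' \<in> borel_measurable lborel" and ae: "AE x in lborel. f x = f' x"
      using completion_ex_borel_measurable_real[OF fm] by blast
    have f'l: "f' \<in> borel_measurable lebesgue" by (rule measurable_completion[OF f'])
    have ael: "AE x in lebesgue. f x = f' x" using ae by (rule AE_completion)
    have lf': "locally_integrable f'"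
      unfolding locally_integrable_def set_integrable_def
    proof (intro allI)
      fix x r
      have i: "integrable lebesgue (\<lambda>z. indicator (ball x r) z *\<^sub>R f z)"
        using f by (simp add: locally_integrable_def set_integrable_def)
      have im: "(indicator (ball x r) :: 'a \<Rightarrow> real) \<in> borel_measurable lebesgue"
        by (intro measurable_completion borel_measurable_indicator) auto
      show "integrable lebesgue (\<lambda>z. indicator (ball x r) z *\<^sub>R f' z)"
        by (rule integrable_cong_AE_imp[OF i]) (use im f'l ael in auto)
    qed
    have A: "A_sup \<alpha> f t x = A_sup \<alpha> f' t x" for t x
      by (rule A_sup_cong_AE[OF ael fm f'l a(1)])
    have g: "g_fun \<alpha> f x = g_fun \<alpha> f' x" for x unfolding g_fun_def A ..
    have I: "(\<integral>\<^sup>+x. \<Phi> \<bar>f x\<bar> \<partial>lborel) = (\<integral>\<^sup>+x. \<Phi> \<bar>f' x\<bar> \<partial>lborel)"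
      by (rule nn_integral_cong_AE) (use ae in eventually_elim, simp)
    have "emeasure lborel {x. g_fun \<alpha> f' x > ennreal l} \<le> ennreal B * (\<integral>\<^sup>+x. ennreal (marcinkiewicz_weight q l \<bar>f' x\<bar>) \<partial>lborel)" if l: "l > 0" for l
      using g_sq_distribution_locally_integrable[OF a q(2) B(2) lf' _ l] f' l
      by (simp add: g_fun_eq less_ennreal_sqrt_iff)
    then show ?thesis unfolding g I
      using D(2)[of "g_fun \<alpha> f'" "\<lambda>x. \<bar>f' x\<bar>"] g_fun_measurable[OF a lf'] f' by simp
  qed
  then show thesis using D(1) that by blast
qed

text \<open>The kernels are real, so real and imaginary parts commute with convolution, and the
  squared modulus is the sum of their squares.\<close>

lemma g_sq_complex_le:
  fixes f :: "'a::euclidean_space \<Rightarrow> complex"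
  assumes a: "0 < \<alpha>" "\<alpha> \<le> 1" and f: "locally_integrable f"
  shows "locally_integrable (\<lambda>x. Re (f x))" "locally_integrable (\<lambda>x. Im (f x))"
    and "g_sq \<alpha> f {0<..} x \<le> g_sq \<alpha> (\<lambda>x. Re (f x)) {0<..} x + g_sq \<alpha> (\<lambda>x. Im (f x)) {0<..} x"
proof -
  have i: "integrable lebesgue (\<lambda>z. indicator (ball x r) z *\<^sub>R f z)" for x r
    using f by (simp add: locally_integrable_def set_integrable_def)
  show re: "locally_integrable (\<lambda>x. Re (f x))"
    unfolding locally_integrable_def set_integrable_def using integrable_Re[OF i] by simp
  show im: "locally_integrable (\<lambda>x. Im (f x))"
    unfolding locally_integrable_def set_integrable_def using integrable_Im[OF i] by simp
  have pw: "(A_sup \<alpha> f t x)\<^sup>2 \<le> (A_sup \<alpha> (\<lambda>x. Re (f x)) t x)\<^sup>2 + (A_sup \<alpha> (\<lambda>x. Im (f x)) t x)\<^sup>2" if t: "t > 0" for t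
    unfolding A_sup_def[of _ f]
  proof (rule SUP_power2_le)
    fix \<psi> :: "'a \<Rightarrow> real" assume psi: "\<psi> \<in> C_class \<alpha>"
    let ?c = "conv f (dilate t \<psi>) x"
    note ci = conv_integrable[OF f psi a t, of x]
    have "Re ?c = conv (\<lambda>x. Re (f x)) (dilate t \<psi>) x" "Im ?c = conv (\<lambda>x. Im (f x)) (dilate t \<psi>) x"
      unfolding conv_def by (simp_all add: integral_Re[OF ci, symmetric] integral_Im[OF ci, symmetric])
    then have "ennreal \<bar>Re ?c\<bar> \<le> A_sup \<alpha> (\<lambda>x. Re (f x)) t x" "ennreal \<bar>Im ?c\<bar> \<le> A_sup \<alpha> (\<lambda>x. Im (f x)) t x"
      unfolding A_sup_def real_norm_def[symmetric] by (simp_all only:) (rule SUP_upper[OF psi])+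
    then have "(ennreal \<bar>Re ?c\<bar>)\<^sup>2 + (ennreal \<bar>Im ?c\<bar>)\<^sup>2 \<le> (A_sup \<alpha> (\<lambda>x. Re (f x)) t x)\<^sup>2 + (A_sup \<alpha> (\<lambda>x. Im (f x)) t x)\<^sup>2"
      by (intro add_mono power_mono) auto
    moreover have "(ennreal (norm ?c))\<^sup>2 = (ennreal \<bar>Re ?c\<bar>)\<^sup>2 + (ennreal \<bar>Im ?c\<bar>)\<^sup>2"
      by (simp add: ennreal_power cmod_power2)
    ultimately show "(ennreal (norm ?c))\<^sup>2 \<le> (A_sup \<alpha> (\<lambda>x. Re (f x)) t x)\<^sup>2 + (A_sup \<alpha> (\<lambda>x. Im (f x)) t x)\<^sup>2" by simp
  qed
  define F where "F = (\<lambda>t. (A_sup \<alpha> (\<lambda>x. Re (f x)) t x * indicator {0<..} t)\<^sup>2 * ennreal (1 / t))"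
  define G where "G = (\<lambda>t. (A_sup \<alpha> (\<lambda>x. Im (f x)) t x * indicator {0<..} t)\<^sup>2 * ennreal (1 / t))"
  have [measurable]: "F \<in> borel_measurable borel" "G \<in> borel_measurable borel"
    unfolding F_def G_def using A_sup_measurable_fst[OF re a, of x] A_sup_measurable_fst[OF im a, of x] by measurable
  have "g_sq \<alpha> f {0<..} x \<le> (\<integral>\<^sup>+t. F t + G t \<partial>lborel)"
    unfolding g_sq_def
  proof (rule nn_integral_mono)
    fix t :: real
    show "(A_sup \<alpha> f t x)\<^sup>2 * ennreal (1 / t) * indicator {0<..} t \<le> F t + G t"
    proof (cases "t > 0")
      case True
      show ?thesis using mult_right_mono[OF pw[OF True], of "ennreal (1 / t)"] True by (simp add: F_def G_def distrib_right)
    qed simp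
  qed
  also have "\<dots> = (\<integral>\<^sup>+t. F t \<partial>lborel) + (\<integral>\<^sup>+t. G t \<partial>lborel)" by (rule nn_integral_add) auto
  also have "(\<integral>\<^sup>+t. F t \<partial>lborel) = g_sq \<alpha> (\<lambda>x. Re (f x)) {0<..} x"
    unfolding g_sq_def F_def by (intro nn_integral_cong) (auto simp: indicator_def)
  also have "(\<integral>\<^sup>+t. G t \<partial>lborel) = g_sq \<alpha> (\<lambda>x. Im (f x)) {0<..} x"
    unfolding g_sq_def G_def by (intro nn_integral_cong) (auto simp: indicator_def)
  finally show "g_sq \<alpha> f {0<..} x \<le> g_sq \<alpha> (\<lambda>x. Re (f x)) {0<..} x + g_sq \<alpha> (\<lambda>x. Im (f x)) {0<..} x" .
qed

lemma ennreal_sqrt_add_le: "ennreal_sqrt (u + v) \<le> ennreal_sqrt u + ennreal_sqrt v"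
proof (cases u; cases v)
  fix r s assume "u = ennreal r" "0 \<le> r" "v = ennreal s" "0 \<le> s"
  then show ?thesis
    using sqrt_add_le_add_sqrt[of r s] by (simp add: ennreal_sqrt_def ennreal_leI flip: ennreal_plus)
qed (auto simp: ennreal_sqrt_def)

text \<open>Real and imaginary parts are treated separately; r + s \<le> 2 max r s, and the upper
  type absorbs the 2. A finite modular makes both pieces finite almost everywhere, so
  \<open>enn2real\<close> is monotone where it is used.\<close>

theorem g_fun_modular:
  fixes \<Phi> :: "real \<Rightarrow> ennreal"
  assumes a: "0 < \<alpha>" "\<alpha> \<le> 1"
    and mono: "\<And>a b. 0 \<le> a \<Longrightarrow> a \<le> b \<Longrightarrow> \<Phi> a \<le> \<Phi> b"
    and zero: "\<Phi> 0 = 0" and inf: "(\<Phi> \<longlongrightarrow> \<infinity>) at_top"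
    and low: "lower_type p0 \<Phi>" and up: "upper_type p1 \<Phi>" and p: "1 < p0"
  obtains D where "D > 0"
    "\<And>f :: 'a::euclidean_space \<Rightarrow> complex. locally_integrable f \<Longrightarrow> (\<integral>\<^sup>+x. \<Phi> (norm (f x)) \<partial>lborel) < \<infinity> \<Longrightarrow>
      (\<integral>\<^sup>+x. \<Phi> (enn2real (g_fun \<alpha> f x)) \<partial>lborel) \<le> ennreal D * (\<integral>\<^sup>+x. \<Phi> (norm (f x)) \<partial>lborel) \<and>
      (AE x in lborel. g_fun \<alpha> f x < \<infinity>)"
proof -
  obtain D where D: "D > 0" "\<And>f :: 'a \<Rightarrow> real. locally_integrable f \<Longrightarrow>
      (\<integral>\<^sup>+x. \<Phi> (enn2real (g_fun \<alpha> f x)) \<partial>lborel) \<le> ennreal D * (\<integral>\<^sup>+x. \<Phi> \<bar>f x\<bar> \<partial>lborel) \<and>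
      ((\<integral>\<^sup>+x. \<Phi> \<bar>f x\<bar> \<partial>lborel) < \<infinity> \<longrightarrow> (AE x in lborel. g_fun \<alpha> f x < \<infinity>))"
    using g_fun_modular_real[OF a mono zero inf low up p, where 'a='a] by metis
  obtain C1 where C1: "C1 > 0" "\<And>t s. t \<ge> 1 \<Longrightarrow> s \<ge> 0 \<Longrightarrow> \<Phi> (s * t) \<le> ennreal (C1 * t powr p1) * \<Phi> s"
    using up by (auto simp: upper_type_def)
  define E where "E = C1 * 2 powr p1"
  have E: "E > 0" using C1 by (simp add: E_def)
  have "(\<integral>\<^sup>+x. \<Phi> (enn2real (g_fun \<alpha> f x)) \<partial>lborel) \<le> ennreal (2 * E * D) * (\<integral>\<^sup>+x. \<Phi> (norm (f x)) \<partial>lborel) \<and>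
      (AE x in lborel. g_fun \<alpha> f x < \<infinity>)"
    if f: "locally_integrable f" and fin: "(\<integral>\<^sup>+x. \<Phi> (norm (f x)) \<partial>lborel) < \<infinity>" for f :: "'a \<Rightarrow> complex"
  proof -
    define u where "u = (\<lambda>x. Re (f x))"
    define v where "v = (\<lambda>x. Im (f x))"
    have lu: "locally_integrable u" and lv: "locally_integrable v"
      unfolding u_def v_def by (rule g_sq_complex_le[OF a f])+
    have g: "g_fun \<alpha> f x \<le> g_fun \<alpha> u x + g_fun \<alpha> v x" for x
      unfolding g_fun_eq u_def v_def
      by (rule order_trans[OF ennreal_sqrt_mono[OF g_sq_complex_le(3)[OF a f]] ennreal_sqrt_add_le])
    define I where "I = (\<integral>\<^sup>+x. \<Phi> (norm (f x)) \<partial>lborel)"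
    have Iu: "(\<integral>\<^sup>+x. \<Phi> \<bar>u x\<bar> \<partial>lborel) \<le> I" and Iv: "(\<integral>\<^sup>+x. \<Phi> \<bar>v x\<bar> \<partial>lborel) \<le> I"
      unfolding I_def u_def v_def by (intro nn_integral_mono mono abs_Re_le_cmod abs_Im_le_cmod abs_ge_zero)+
    have aeu: "AE x in lborel. g_fun \<alpha> u x < \<infinity>" and aev: "AE x in lborel. g_fun \<alpha> v x < \<infinity>"
      using D(2)[OF lu] D(2)[OF lv] Iu Iv fin unfolding I_def by (auto intro: le_less_trans)
    have ae: "AE x in lborel. g_fun \<alpha> f x < \<infinity>"
      using aeu aev
    proof eventually_elim
      case (elim x)
      then show ?case by (intro le_less_trans[OF g]) simp
    qed
    have gum[measurable]: "g_fun \<alpha> u \<in> borel_measurable borel" "g_fun \<alpha> v \<in> borel_measurable borel"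
      by (rule g_fun_measurable[OF a lu] g_fun_measurable[OF a lv])+
    have Pu[measurable]: "(\<lambda>x. \<Phi> (enn2real (g_fun \<alpha> u x))) \<in> borel_measurable borel"
      by (rule mono_nonneg_measurable[OF mono]) auto
    have Pv[measurable]: "(\<lambda>x. \<Phi> (enn2real (g_fun \<alpha> v x))) \<in> borel_measurable borel"
      by (rule mono_nonneg_measurable[OF mono]) auto
    have "(\<integral>\<^sup>+x. \<Phi> (enn2real (g_fun \<alpha> f x)) \<partial>lborel) \<le> (\<integral>\<^sup>+x. ennreal E * (\<Phi> (enn2real (g_fun \<alpha> u x)) + \<Phi> (enn2real (g_fun \<alpha> v x))) \<partial>lborel)"
    proof (rule nn_integral_mono_AE)
      show "AE x in lborel. \<Phi> (enn2real (g_fun \<alpha> f x)) \<le> ennreal E * (\<Phi> (enn2real (g_fun \<alpha> u x)) + \<Phi> (enn2real (g_fun \<alpha> v x)))"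
        using aeu aev
      proof eventually_elim
        case (elim x)
        define r where "r = enn2real (g_fun \<alpha> u x)"
        define s where "s = enn2real (g_fun \<alpha> v x)"
        have rs: "r \<ge> 0" "s \<ge> 0" "g_fun \<alpha> u x = ennreal r" "g_fun \<alpha> v x = ennreal s"
          using elim by (auto simp: r_def s_def)
        have "enn2real (g_fun \<alpha> f x) \<le> enn2real (g_fun \<alpha> u x + g_fun \<alpha> v x)"
          using elim g[of x] by (intro enn2real_mono) auto
        also have "\<dots> = r + s" using rs by (simp flip: ennreal_plus)
        also have "\<dots> \<le> max r s * 2" by simp
        finally have "\<Phi> (enn2real (g_fun \<alpha> f x)) \<le> \<Phi> (max r s * 2)" by (intro mono) auto
        also have "\<dots> \<le> ennreal E * \<Phi> (max r s)" unfolding E_def using rs by (intro C1(2)) auto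
        also have "\<dots> \<le> ennreal E * (\<Phi> r + \<Phi> s)"
          by (intro mult_left_mono) (auto simp: max_def add_increasing add_increasing2)
        finally show ?case unfolding r_def s_def .
      qed
    qed
    also have "\<dots> = ennreal E * ((\<integral>\<^sup>+x. \<Phi> (enn2real (g_fun \<alpha> u x)) \<partial>lborel) + (\<integral>\<^sup>+x. \<Phi> (enn2real (g_fun \<alpha> v x)) \<partial>lborel))"
      by (simp add: nn_integral_cmult nn_integral_add)
    also have "\<dots> \<le> ennreal E * (ennreal D * I + ennreal D * I)"
      by (intro mult_left_mono add_mono order_trans[OF conjunct1[OF D(2)[OF lu]]] order_trans[OF conjunct1[OF D(2)[OF lv]]] Iu Iv) auto
    also have "\<dots> = ennreal (2 * E * D) * I"
      using E D(1) by (simp add: ennreal_mult mult.assoc flip: mult_2)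
        (simp add: mult_ac)
    finally show ?thesis using ae unfolding I_def by simp
  qed
  moreover have "2 * E * D > 0" using E D(1) by simp
  ultimately show thesis using that by blast
qed

subsection \<open>Orlicz norms\<close>

lemma ennreal_le_mult_Inf:
  assumes "k > 0" "\<And>c. c \<in> S \<Longrightarrow> X \<le> ennreal k * c"
  shows "X \<le> ennreal k * Inf S"
proof -
  have "X / ennreal k \<le> Inf S" by (intro Inf_greatest) (simp add: ennreal_divide_le_iff[OF assms(1)] assms(2))
  then show ?thesis by (simp add: ennreal_divide_le_iff[OF assms(1)])
qed

lemma ennreal_le_add_Inf:
  fixes X :: ennreal
  assumes "\<And>a b. a \<in> S \<Longrightarrow> b \<in> T \<Longrightarrow> X \<le> a + b"
  shows "X \<le> Inf S + Inf T"
proof -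
  have "X - a \<le> Inf T" if "a \<in> S" "a \<noteq> top" for a
    using assms[OF that(1)] that(2) by (intro Inf_greatest) (simp add: ennreal_minus_le_iff)
  then have "X \<le> a + Inf T" if "a \<in> S" for a
    using that by (cases "a = top") (auto simp: ennreal_minus_le_iff)
  then have *: "X \<le> Inf T + a" if "a \<in> S" for a using that by (simp add: add.commute)
  show ?thesis
  proof (cases "Inf T = top")
    case False
    have "X - Inf T \<le> Inf S"
    proof (rule Inf_greatest)
      fix a assume "a \<in> S"
      from *[OF this] show "X - Inf T \<le> a" using False ennreal_minus_le_iff[of X "Inf T" a] by blast
    qed
    then have "X \<le> Inf T + Inf S" using False ennreal_minus_le_iff[of X "Inf T" "Inf S"] by blast
    then show ?thesis by (simp only: add.commute)
  next
    case True
    show ?thesis unfolding True by simp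
  qed
qed

locale young_types =
  fixes \<Phi> :: "real \<Rightarrow> ennreal" and p0 p1 :: real
  assumes young: "young_function \<Phi>" and p0: "1 < p0" and low: "lower_type p0 \<Phi>" and up: "upper_type p1 \<Phi>"
begin

lemma zero: "\<Phi> 0 = 0"
  using young by (simp add: young_function_def)

lemma infinity: "(\<Phi> \<longlongrightarrow> \<infinity>) at_top"
  using young by (simp add: young_function_def)

lemma convex: "r \<ge> 0 \<Longrightarrow> s \<ge> 0 \<Longrightarrow> u \<in> {0..1} \<Longrightarrow> \<Phi> ((1 - u) * r + u * s) \<le> ennreal (1 - u) * \<Phi> r + ennreal u * \<Phi> s"
  using young by (simp add: young_function_def)

lemma shrink: "s \<ge> 0 \<Longrightarrow> u \<in> {0..1} \<Longrightarrow> \<Phi> (u * s) \<le> ennreal u * \<Phi> s"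
  using convex[of 0 s u] by (simp add: zero)

lemma mono: assumes "0 \<le> a" "a \<le> b" shows "\<Phi> a \<le> \<Phi> b"
proof (cases "b = 0")
  case False
  then have b: "b > 0" using assms by simp
  have "\<Phi> (a / b * b) \<le> ennreal (a / b) * \<Phi> b" by (rule shrink) (use assms b in auto)
  also have "\<dots> \<le> ennreal 1 * \<Phi> b" using assms b by (intro mult_right_mono ennreal_leI) auto
  finally show ?thesis using b by simp
qed (use assms in auto)

lemma upper: obtains C where "C > 0" "\<And>t s. t \<ge> 1 \<Longrightarrow> s \<ge> 0 \<Longrightarrow> \<Phi> (s * t) \<le> ennreal (C * t powr p1) * \<Phi> s"
  using up by (auto simp: upper_type_def)

lemma small: assumes "e > 0" obtains s where "s > 0" "\<Phi> s < ennreal e"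
proof -
  have "(\<Phi> \<longlongrightarrow> 0) (at_right 0)" using young by (simp add: young_function_def)
  then have "\<forall>\<^sub>F s in at_right 0. \<Phi> s < ennreal e" by (rule order_tendstoD) (use assms in simp)
  then have "\<forall>\<^sub>F s in at_right 0. \<Phi> s < ennreal e \<and> s > 0"
    using eventually_at_right_less[of "0::real"] by eventually_elim simp
  then show thesis using that eventually_happens'[OF trivial_limit_at_right_real] by blast
qed

lemma large: obtains s where "s > 0" "\<Phi> s > ennreal e"
proof -
  have "\<forall>\<^sub>F s in at_top. \<Phi> s > ennreal e" using infinity by (rule order_tendstoD) simp
  then have "\<forall>\<^sub>F s in at_top. \<Phi> s > ennreal e \<and> s > 0"
    using eventually_gt_at_top[of "0::real"] by eventually_elim simp
  then show thesis using that eventually_happens'[OF trivial_limit_at_top_linorder] by blast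
qed

text \<open>A Young function may jump to infinity, but \<Phi> is finite near 0, where it tends to 0,
  and the upper type carries finiteness to every argument.\<close>

lemma finite: assumes "s \<ge> 0" shows "\<Phi> s < \<infinity>"
proof -
  obtain s0 where s0: "s0 > 0" "\<Phi> s0 < ennreal 1" using small[of 1] by auto
  obtain C where C: "C > 0" "\<And>t s. t \<ge> 1 \<Longrightarrow> s \<ge> 0 \<Longrightarrow> \<Phi> (s * t) \<le> ennreal (C * t powr p1) * \<Phi> s" using upper by blast
  define t where "t = max 1 (s / s0)"
  have "s \<le> s0 * t" using s0 by (simp add: t_def max_def field_simps)
  then have "\<Phi> s \<le> \<Phi> (s0 * t)" using assms by (intro mono)
  also have "\<dots> \<le> ennreal (C * t powr p1) * \<Phi> s0" by (rule C(2)) (use s0 in \<open>auto simp: t_def\<close>)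
  also have "\<dots> < \<infinity>"
    using less_trans[OF s0(2), of top] by (simp add: ennreal_mult_less_top)
  finally show ?thesis .
qed

abbreviation "inv_\<Phi> \<equiv> young_inv \<Phi>"

lemma le_inv: assumes "a \<ge> 0" "\<Phi> a \<le> ennreal s" shows "ennreal a \<le> inv_\<Phi> s"
  unfolding young_inv_def
proof (rule Inf_greatest, clarify)
  fix r assume r: "0 \<le> r" "ennreal s < \<Phi> r"
  then have "\<not> r \<le> a" using mono[of r a] assms by (auto dest: order_trans)
  then show "ennreal a \<le> ennreal r" by (intro ennreal_leI) simp
qed

lemma inv_le: "r \<ge> 0 \<Longrightarrow> \<Phi> r > ennreal s \<Longrightarrow> inv_\<Phi> s \<le> ennreal r"
  unfolding young_inv_def by (rule Inf_lower) auto

lemma inv_finite: "inv_\<Phi> s < \<infinity>"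
proof -
  obtain r where "r > 0" "\<Phi> r > ennreal s" using large .
  then have "inv_\<Phi> s \<le> ennreal r" by (intro inv_le) auto
  then show ?thesis by (rule le_less_trans) simp
qed

lemma inv_pos: assumes "s > 0" shows "inv_\<Phi> s > 0"
proof -
  obtain a where a: "a > 0" "\<Phi> a < ennreal s" using small[OF assms] .
  then have "ennreal a \<le> inv_\<Phi> s" by (intro le_inv) auto
  then show ?thesis using a by (auto intro: less_le_trans[rotated])
qed

lemma inv_mono: assumes "s \<le> s'" shows "inv_\<Phi> s \<le> inv_\<Phi> s'"
  unfolding young_inv_def by (rule Inf_superset_mono) (auto intro: le_less_trans[OF ennreal_leI[OF assms]])

text \<open>Convexity and \<Phi> 0 = 0 give \<Phi>(K r) \<ge> K \<Phi>(r), so the inverse grows at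
  most linearly. This is what compares the inverse at t^(-n) with the inverse at the reciprocal
  volume of a ball.\<close>

lemma inv_scale: assumes K: "K \<ge> 1" and s: "s \<ge> 0" shows "inv_\<Phi> (K * s) \<le> ennreal K * inv_\<Phi> s"
  unfolding young_inv_def[of _ s]
proof (rule ennreal_le_mult_Inf)
  fix c assume "c \<in> ennreal ` {r. 0 \<le> r \<and> ennreal s < \<Phi> r}"
  then obtain r where r: "c = ennreal r" "0 \<le> r" "ennreal s < \<Phi> r" by auto
  have "\<Phi> r \<le> ennreal (1 / K) * \<Phi> (K * r)" using shrink[of "K * r" "1 / K"] K r by simp
  then have "ennreal s < ennreal (1 / K) * \<Phi> (K * r)" using r(3) by simp
  then have "ennreal K * ennreal s < ennreal K * (ennreal (1 / K) * \<Phi> (K * r))"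
    using K by (intro ennreal_mult_strict_left_mono) auto
  also have "ennreal K * (ennreal (1 / K) * \<Phi> (K * r)) = \<Phi> (K * r)"
    using K by (simp flip: mult.assoc ennreal_mult)
  finally have "ennreal (K * s) < \<Phi> (K * r)" using K s by (simp add: ennreal_mult)
  then have "inv_\<Phi> (K * s) \<le> ennreal (K * r)" using K r by (intro inv_le) auto
  then show "inv_\<Phi> (K * s) \<le> ennreal K * c" using K r by (simp add: ennreal_mult)
qed (use K in simp)

lemma inv_scale': assumes K: "K > 0" and s: "s \<ge> 0" shows "inv_\<Phi> (K * s) \<le> ennreal (max 1 K) * inv_\<Phi> s"
proof -
  have "inv_\<Phi> (K * s) \<le> inv_\<Phi> (max 1 K * s)" using s by (intro inv_mono mult_right_mono) auto
  also have "\<dots> \<le> ennreal (max 1 K) * inv_\<Phi> s" by (rule inv_scale) (use s in auto)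
  finally show ?thesis .
qed

lemma comp_measurable: "u \<in> borel_measurable M \<Longrightarrow> (\<And>x. u x \<ge> 0) \<Longrightarrow> (\<lambda>x. \<Phi> (u x)) \<in> borel_measurable M"
  by (rule mono_nonneg_measurable[OF mono])

text \<open>The Luxemburg norm for real functions over \<open>lborel\<close>. It is applied to
  moduli and to \<open>enn2real\<close> of \<open>g_fun\<close>, and agrees with
  \<open>luxemburg_norm\<close> because completion leaves \<open>nn_integral\<close>
  unchanged.\<close>

definition lux :: "('a::euclidean_space \<Rightarrow> real) \<Rightarrow> ennreal" where
  "lux h = Inf (ennreal ` {c. c > 0 \<and> (\<integral>\<^sup>+x. \<Phi> (h x / c) \<partial>lborel) \<le> 1})"

lemma luxemburg_norm_eq: "luxemburg_norm \<Phi> f = lux (\<lambda>x. norm (f x))"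
  by (simp add: luxemburg_norm_def lux_def nn_integral_completion)

lemma lux_le: "c > 0 \<Longrightarrow> (\<integral>\<^sup>+x. \<Phi> (h x / c) \<partial>lborel) \<le> 1 \<Longrightarrow> lux h \<le> ennreal c"
  unfolding lux_def by (rule Inf_lower) auto

lemma lux_mono:
  assumes "AE x in lborel. 0 \<le> h x \<and> h x \<le> h' x"
  shows "lux h \<le> lux h'"
  unfolding lux_def
proof (rule Inf_superset_mono, clarify, intro image_eqI refl CollectI conjI)
  fix c :: real assume c: "c > 0" "(\<integral>\<^sup>+x. \<Phi> (h' x / c) \<partial>lborel) \<le> 1"
  have "(\<integral>\<^sup>+x. \<Phi> (h x / c) \<partial>lborel) \<le> (\<integral>\<^sup>+x. \<Phi> (h' x / c) \<partial>lborel)"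
    by (rule nn_integral_mono_AE) (use assms in eventually_elim, use c in \<open>auto intro!: mono divide_right_mono\<close>)
  then show "(\<integral>\<^sup>+x. \<Phi> (h x / c) \<partial>lborel) \<le> 1" using c by simp
qed auto

lemma lux_scale:
  assumes k: "k > 0"
  shows "lux (\<lambda>x. k * h x) \<le> ennreal k * lux h"
  unfolding lux_def[of h]
proof (rule ennreal_le_mult_Inf[OF k])
  fix c assume "c \<in> ennreal ` {c. c > 0 \<and> (\<integral>\<^sup>+x. \<Phi> (h x / c) \<partial>lborel) \<le> 1}"
  then obtain r where r: "c = ennreal r" "r > 0" "(\<integral>\<^sup>+x. \<Phi> (h x / r) \<partial>lborel) \<le> 1" by auto
  have "lux (\<lambda>x. k * h x) \<le> ennreal (k * r)" using k r by (intro lux_le) auto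
  then show "lux (\<lambda>x. k * h x) \<le> ennreal k * c" using k r by (simp add: ennreal_mult)
qed

text \<open>(h1 + h2) / (c1 + c2) is the convex combination of h1 / c1 and h2 / c2 with weights c1 /
  (c1 + c2) and c2 / (c1 + c2).\<close>

lemma lux_triangle:
  fixes h1 h2 :: "'a::euclidean_space \<Rightarrow> real"
  assumes [measurable]: "h1 \<in> borel_measurable lborel" "h2 \<in> borel_measurable lborel" and nn: "\<And>x. h1 x \<ge> 0" "\<And>x. h2 x \<ge> 0"
  shows "lux (\<lambda>x. h1 x + h2 x) \<le> lux h1 + lux h2"
  unfolding lux_def[of h1] lux_def[of h2]
proof (rule ennreal_le_add_Inf, clarify)
  fix c1 c2 :: real
  assume c: "c1 > 0" "(\<integral>\<^sup>+x. \<Phi> (h1 x / c1) \<partial>lborel) \<le> 1" "c2 > 0" "(\<integral>\<^sup>+x. \<Phi> (h2 x / c2) \<partial>lborel) \<le> 1"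
  define u where "u = c2 / (c1 + c2)"
  have u: "u \<in> {0..1}" "1 - u = c1 / (c1 + c2)" using c by (auto simp: u_def field_simps)
  have m1: "(\<lambda>x. \<Phi> (h1 x / c1)) \<in> borel_measurable lborel" by (rule comp_measurable) (use nn c in auto)
  have m2: "(\<lambda>x. \<Phi> (h2 x / c2)) \<in> borel_measurable lborel" by (rule comp_measurable) (use nn c in auto)
  have "(\<integral>\<^sup>+x. \<Phi> ((h1 x + h2 x) / (c1 + c2)) \<partial>lborel) \<le> (\<integral>\<^sup>+x. ennreal (1 - u) * \<Phi> (h1 x / c1) + ennreal u * \<Phi> (h2 x / c2) \<partial>lborel)"
  proof (rule nn_integral_mono)
    fix x
    have "(h1 x + h2 x) / (c1 + c2) = (1 - u) * (h1 x / c1) + u * (h2 x / c2)"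
      unfolding u(2) using c by (simp add: u_def add_divide_distrib)
    then show "\<Phi> ((h1 x + h2 x) / (c1 + c2)) \<le> ennreal (1 - u) * \<Phi> (h1 x / c1) + ennreal u * \<Phi> (h2 x / c2)"
      using convex[of "h1 x / c1" "h2 x / c2" u] nn c u(1) by simp
  qed
  also have "\<dots> = ennreal (1 - u) * (\<integral>\<^sup>+x. \<Phi> (h1 x / c1) \<partial>lborel) + ennreal u * (\<integral>\<^sup>+x. \<Phi> (h2 x / c2) \<partial>lborel)"
    using m1 m2 by (simp add: nn_integral_add nn_integral_cmult)
  also have "\<dots> \<le> ennreal (1 - u) * 1 + ennreal u * 1" using c by (intro add_mono mult_left_mono) auto
  also have "\<dots> = 1" using u(1) by (simp flip: ennreal_plus)
  finally have "lux (\<lambda>x. h1 x + h2 x) \<le> ennreal (c1 + c2)" using c by (intro lux_le) auto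
  then show "lux (\<lambda>x. h1 x + h2 x) \<le> ennreal c1 + ennreal c2" using c by (simp add: ennreal_plus)
qed

text \<open>Elementary substitute for Jensen's inequality: \<open>s \<le> R + R \<Phi>(s) / \<Phi>(R)\<close> for every \<open>R\<close>.\<close>

lemma L1_le_lux:
  fixes h :: "'a::euclidean_space \<Rightarrow> real"
  assumes [measurable]: "h \<in> borel_measurable lborel" "B \<in> sets borel" and nn: "\<And>x. h x \<ge> 0"
    and b: "emeasure lborel B = ennreal b" "b > 0"
  shows "(\<integral>\<^sup>+x\<in>B. ennreal (h x) \<partial>lborel) \<le> ennreal (2 * b) * inv_\<Phi> (1 / b) * lux (\<lambda>x. indicator B x * h x)"
proof -
  have ge: "(\<integral>\<^sup>+x\<in>B. ennreal (h x) \<partial>lborel) \<le> ennreal (2 * b * c) * inv_\<Phi> (1 / b)"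
    if c: "c > 0" "(\<integral>\<^sup>+x. \<Phi> (indicator B x * h x / c) \<partial>lborel) \<le> 1" for c
    unfolding young_inv_def
  proof (rule ennreal_le_mult_Inf)
    fix r assume "r \<in> ennreal ` {r. 0 \<le> r \<and> ennreal (1 / b) < \<Phi> r}"
    then obtain R where R: "r = ennreal R" "0 \<le> R" "ennreal (1 / b) < \<Phi> R" by auto
    have R0: "R > 0" using R zero by (cases "R = 0") auto
    obtain F where F: "\<Phi> R = ennreal F" "F \<ge> 0" using finite[OF R(2)] by (cases "\<Phi> R") auto
    have Fb: "1 / b < F" using R(3) F b by (simp add: ennreal_less_iff)
    then have F0: "F > 0" using b by (smt (verit) divide_pos_pos)
    have m: "(\<lambda>x. \<Phi> (indicator B x * h x / c)) \<in> borel_measurable lborel"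
      by (rule comp_measurable) (use nn c in auto)
    have "(\<integral>\<^sup>+x\<in>B. ennreal (h x) \<partial>lborel) \<le> (\<integral>\<^sup>+x. ennreal (c * R) * indicator B x + ennreal (c * R / F) * \<Phi> (indicator B x * h x / c) \<partial>lborel)"
    proof (rule nn_integral_mono)
      fix x
      show "ennreal (h x) * indicator B x \<le> ennreal (c * R) * indicator B x + ennreal (c * R / F) * \<Phi> (indicator B x * h x / c)"
      proof (cases "x \<in> B")
        case True
        define s where "s = h x / c"
        have s: "s \<ge> 0" "h x = c * s" using c nn by (auto simp: s_def)
        have "ennreal (h x) \<le> ennreal (c * R) + ennreal (c * R / F) * \<Phi> s"
        proof (cases "s \<le> R")
          case True
          then have "ennreal (h x) \<le> ennreal (c * R)" unfolding s(2) using c by (intro ennreal_leI mult_left_mono) auto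
          then show ?thesis by (rule add_increasing2[rotated]) simp
        next
          case False
          then have s0: "s > 0" using R0 by simp
          obtain G where G: "\<Phi> s = ennreal G" "G \<ge> 0" using finite[OF s(1)] by (cases "\<Phi> s") auto
          have "\<Phi> (R / s * s) \<le> ennreal (R / s) * \<Phi> s" by (rule shrink) (use s0 R0 False in auto)
          then have "ennreal F \<le> ennreal (R / s) * ennreal G" using s0 F G by simp
          also have "\<dots> = ennreal (R / s * G)" using s0 R0 G by (intro ennreal_mult[symmetric]) auto
          finally have "ennreal F \<le> ennreal (R / s * G)" .
          then have "F \<le> R / s * G" using R0 s0 G by (subst (asm) ennreal_le_iff) auto
          then have "s \<le> R / F * G" using s0 F0 by (simp add: field_simps)
          then have "c * s \<le> c * (R / F * G)" using c by (intro mult_left_mono) auto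
          then have "ennreal (h x) \<le> ennreal (c * R / F * G)" unfolding s(2) by (intro ennreal_leI) simp
          also have "\<dots> = ennreal (c * R / F) * \<Phi> s" unfolding G using c R0 F0 G by (intro ennreal_mult) auto
          finally show ?thesis by (rule add_increasing[rotated]) simp
        qed
        then show ?thesis using True by (simp add: s_def)
      qed simp
    qed
    also have "\<dots> = ennreal (c * R) * ennreal b + ennreal (c * R / F) * (\<integral>\<^sup>+x. \<Phi> (indicator B x * h x / c) \<partial>lborel)"
      using m b by (subst nn_integral_add) (auto simp: nn_integral_cmult nn_integral_cmult_indicator)
    also have "\<dots> \<le> ennreal (c * R) * ennreal b + ennreal (c * R / F) * 1"
      using c by (intro add_left_mono mult_left_mono) auto
    also have "\<dots> = ennreal (c * R * b + c * R / F)"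
      using c R0 F0 b by (simp add: ennreal_mult)
    \<comment> \<open>R is any argument with \<Phi> R = F > 1 / b, so the second term is no larger
      than the first; the infimum over such R is the generalized inverse at 1 / b.\<close>
    also have "\<dots> \<le> ennreal (c * R * b + c * R * b)"
    proof (intro ennreal_leI add_left_mono)
      have "1 / F \<le> b" using Fb F0 b by (simp add: field_simps)
      then have "c * R * (1 / F) \<le> c * R * b" using c R0 by (intro mult_left_mono) auto
      then show "c * R / F \<le> c * R * b" by simp
    qed
    also have "c * R * b + c * R * b = 2 * b * c * R" by simp
    also have "ennreal (2 * b * c * R) = ennreal (2 * b * c) * r" unfolding R(1) using b c R0 by (intro ennreal_mult) auto
    finally show "(\<integral>\<^sup>+x\<in>B. ennreal (h x) \<partial>lborel) \<le> ennreal (2 * b * c) * r" .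
  qed (use b c in simp)
  obtain i where i: "inv_\<Phi> (1 / b) = ennreal i" "i > 0"
    using inv_finite[of "1 / b"] inv_pos[of "1 / b"] b by (cases "inv_\<Phi> (1 / b)") (auto simp: less_le)
  have "(\<integral>\<^sup>+x\<in>B. ennreal (h x) \<partial>lborel) \<le> ennreal (2 * b * i) * lux (\<lambda>x. indicator B x * h x)"
    unfolding lux_def
  proof (rule ennreal_le_mult_Inf)
    fix c assume "c \<in> ennreal ` {c. c > 0 \<and> (\<integral>\<^sup>+x. \<Phi> (indicator B x * h x / c) \<partial>lborel) \<le> 1}"
    then obtain r where r: "c = ennreal r" "r > 0" "(\<integral>\<^sup>+x. \<Phi> (indicator B x * h x / r) \<partial>lborel) \<le> 1" by auto
    have "ennreal (2 * b * r) * inv_\<Phi> (1 / b) = ennreal (2 * b * i) * c"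
      unfolding i r(1) using i r b by (simp add: ennreal_mult[symmetric] mult_ac)
    then show "(\<integral>\<^sup>+x\<in>B. ennreal (h x) \<partial>lborel) \<le> ennreal (2 * b * i) * c" using ge[OF r(2,3)] by simp
  qed (use b i in simp)
  also have "ennreal (2 * b * i) = ennreal (2 * b) * inv_\<Phi> (1 / b)" unfolding i using b i by (intro ennreal_mult) auto
  finally show ?thesis .
qed

text \<open>The norm of the indicator of B is comparable with the reciprocal of i, the inverse at 1
  / b. Half of i lies strictly below the infimum defining the inverse, so \<Phi>(i / 2) \<le> 1 / b;
  this costs the factor 2.\<close>

lemma lux_const_le:
  fixes B :: "'a::euclidean_space set"
  assumes [measurable]: "B \<in> sets borel" and b: "emeasure lborel B = ennreal b" "b > 0" and J: "J \<ge> 0"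
  shows "lux (\<lambda>x. indicator B x * J) * inv_\<Phi> (1 / b) \<le> ennreal (2 * J)"
proof -
  obtain i where i: "inv_\<Phi> (1 / b) = ennreal i" "i > 0"
    using inv_finite[of "1 / b"] inv_pos[of "1 / b"] b by (cases "inv_\<Phi> (1 / b)") (auto simp: less_le)
  have half: "\<Phi> (i / 2) \<le> ennreal (1 / b)"
  proof (rule ccontr)
    assume "\<not> ?thesis"
    then have "inv_\<Phi> (1 / b) \<le> ennreal (i / 2)" using i by (intro inv_le) auto
    then show False using i by (simp add: ennreal_le_iff)
  qed
  have adm: "lux (\<lambda>x. indicator B x * J) \<le> ennreal c" if c: "c > 0" "2 * J \<le> c * i" for c
  proof (rule lux_le[OF c(1)])
    have "(\<integral>\<^sup>+x. \<Phi> (indicator B x * J / c) \<partial>lborel) \<le> (\<integral>\<^sup>+x. ennreal (1 / b) * indicator B x \<partial>lborel)"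
    proof (rule nn_integral_mono)
      fix x
      have "\<Phi> (J / c) \<le> \<Phi> (i / 2)" using c J by (intro mono) (auto simp: field_simps)
      then show "\<Phi> (indicator B x * J / c) \<le> ennreal (1 / b) * indicator B x"
        using half by (cases "x \<in> B") (auto simp: zero)
    qed
    also have "\<dots> = ennreal (1 / b) * ennreal b" using b by (simp add: nn_integral_cmult_indicator)
    also have "\<dots> = 1" using b by (simp flip: ennreal_mult)
    finally show "(\<integral>\<^sup>+x. \<Phi> (indicator B x * J / c) \<partial>lborel) \<le> 1" .
  qed
  \<comment> \<open>The additional e keeps the candidate c positive when J = 0.\<close>
  have eps: "lux (\<lambda>x. indicator B x * J) * inv_\<Phi> (1 / b) \<le> ennreal (2 * J) + ennreal e" if e: "e > 0" for e
  proof -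
    define c where "c = (2 * J + e) / i"
    have c: "c > 0" "2 * J \<le> c * i" using J e i by (auto simp: c_def add_nonneg_pos)
    have "lux (\<lambda>x. indicator B x * J) * inv_\<Phi> (1 / b) \<le> ennreal c * ennreal i"
      unfolding i by (rule mult_right_mono[OF adm[OF c]]) simp
    also have "\<dots> = ennreal (2 * J + e)" using c i by (simp add: c_def flip: ennreal_mult')
    also have "\<dots> = ennreal (2 * J) + ennreal e" using J e by (intro ennreal_plus) auto
    finally show ?thesis .
  qed
  show ?thesis by (rule ennreal_le_epsilon) (rule eps)
qed

lemma lux_finite_witness:
  assumes "lux h < \<infinity>"
  obtains c where "c > 0" "(\<integral>\<^sup>+x. \<Phi> (h x / c) \<partial>lborel) \<le> 1"
proof -
  have "{c. c > 0 \<and> (\<integral>\<^sup>+x. \<Phi> (h x / c) \<partial>lborel) \<le> 1} \<noteq> {}"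
  proof
    assume *: "{c. c > 0 \<and> (\<integral>\<^sup>+x. \<Phi> (h x / c) \<partial>lborel) \<le> 1} = {}"
    have "lux h = top" unfolding lux_def * by (simp only: image_empty Inf_empty)
    then show False using assms by simp
  qed
  then show thesis using that by auto
qed

end

section \<open>Homogeneity and the norm inequality on the whole space\<close>

lemma A_sup_scale:
  fixes f :: "'a::euclidean_space \<Rightarrow> 'b::{banach, second_countable_topology}"
  assumes "c > 0"
  shows "A_sup \<alpha> (\<lambda>x. c *\<^sub>R f x) t y = ennreal c * A_sup \<alpha> f t y"
proof -
  have "conv (\<lambda>x. c *\<^sub>R f x) \<psi> y = c *\<^sub>R conv f \<psi> y" for \<psi>
  proof -
    have "conv (\<lambda>x. c *\<^sub>R f x) \<psi> y = (\<integral>z. c *\<^sub>R (\<psi> (y - z) *\<^sub>R f z) \<partial>lebesgue)"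
      unfolding conv_def by (simp only: scaleR_left_commute)
    then show ?thesis by (simp add: conv_def del: scaleR_scaleR)
  qed
  then show ?thesis unfolding A_sup_def using assms by (simp add: ennreal_mult SUP_mult_left_ennreal)
qed

lemma g_fun_scale:
  fixes f :: "'a::euclidean_space \<Rightarrow> 'b::{banach, second_countable_topology}"
  assumes a: "0 < \<alpha>" "\<alpha> \<le> 1" and f: "locally_integrable f" and c: "c > 0"
  shows "g_fun \<alpha> (\<lambda>x. c *\<^sub>R f x) x = ennreal c * g_fun \<alpha> f x"
proof -
  define F where "F = (\<lambda>t. (A_sup \<alpha> f t x * indicator {0<..} t)\<^sup>2 * ennreal (1 / t))"
  have [measurable]: "F \<in> borel_measurable borel"
    unfolding F_def using A_sup_measurable_fst[OF f a, of x] by measurable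
  have "g_sq \<alpha> (\<lambda>x. c *\<^sub>R f x) {0<..} x = (\<integral>\<^sup>+t. ennreal (c\<^sup>2) * F t \<partial>lborel)"
    unfolding g_sq_def A_sup_scale[OF c] F_def using c
    by (intro nn_integral_cong) (auto simp: indicator_def power_mult_distrib ennreal_power mult_ac)
  also have "\<dots> = ennreal (c\<^sup>2) * (\<integral>\<^sup>+t. F t \<partial>lborel)" by (rule nn_integral_cmult) measurable
  also have "(\<integral>\<^sup>+t. F t \<partial>lborel) = g_sq \<alpha> f {0<..} x"
    unfolding g_sq_def F_def by (intro nn_integral_cong) (auto simp: indicator_def)
  finally have "g_fun \<alpha> (\<lambda>x. c *\<^sub>R f x) x = ennreal_sqrt (ennreal (c\<^sup>2) * g_sq \<alpha> f {0<..} x)"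
    by (simp add: g_fun_eq)
  also have "\<dots> = ennreal c * ennreal_sqrt (g_sq \<alpha> f {0<..} x)"
  proof (cases "g_sq \<alpha> f {0<..} x")
    case (real r)
    then show ?thesis using c by (simp add: ennreal_sqrt_def real_sqrt_mult flip: ennreal_mult)
  next
    case top
    then show ?thesis using c by (simp add: ennreal_sqrt_def ennreal_mult_top)
  qed
  finally show ?thesis by (simp add: g_fun_eq)
qed

context young_types
begin

text \<open>By homogeneity f may be divided by an admissible c, which makes its modular at most 1
  and that of the image at most D. Convexity, \<Phi>(u / D) \<le> \<Phi>(u) / D, then shows that D c
  is admissible for the image.\<close>

theorem g_fun_lux:
  assumes a: "0 < \<alpha>" "\<alpha> \<le> 1"
  obtains D where "D > 0" "\<And>f :: 'a::euclidean_space \<Rightarrow> complex. locally_integrable f \<Longrightarrow>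
     lux (\<lambda>x. enn2real (g_fun \<alpha> f x)) \<le> ennreal D * lux (\<lambda>x. norm (f x)) \<and>
     (lux (\<lambda>x. norm (f x)) < \<infinity> \<longrightarrow> (AE x in lborel. g_fun \<alpha> f x < \<infinity>))"
proof -
  obtain D0 where D0: "D0 > 0"
    "\<And>f :: 'a \<Rightarrow> complex. locally_integrable f \<Longrightarrow> (\<integral>\<^sup>+x. \<Phi> (norm (f x)) \<partial>lborel) < \<infinity> \<Longrightarrow>
      (\<integral>\<^sup>+x. \<Phi> (enn2real (g_fun \<alpha> f x)) \<partial>lborel) \<le> ennreal D0 * (\<integral>\<^sup>+x. \<Phi> (norm (f x)) \<partial>lborel) \<and>
      (AE x in lborel. g_fun \<alpha> f x < \<infinity>)"
    using g_fun_modular[OF a mono zero infinity low up p0, where 'a='a] by metis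
  \<comment> \<open>At least 1, so that 1 / D is a fraction to which \<open>shrink\<close>
    applies.\<close>
  define D where "D = max 1 D0"
  have D: "D \<ge> 1" "D \<ge> D0" by (auto simp: D_def)
  have adm: "(\<integral>\<^sup>+x. \<Phi> (enn2real (g_fun \<alpha> f x) / (D * c)) \<partial>lborel) \<le> 1 \<and> (AE x in lborel. g_fun \<alpha> f x < \<infinity>)"
    if f: "locally_integrable f" and c: "c > 0" "(\<integral>\<^sup>+x. \<Phi> (norm (f x) / c) \<partial>lborel) \<le> 1" for f :: "'a \<Rightarrow> complex" and c
  proof -
    define F where "F = (\<lambda>x. (1 / c) *\<^sub>R f x)"
    have lF: "locally_integrable F"
      using f unfolding locally_integrable_def F_def by (simp add: set_integrable_scaleR_right)
    have g: "g_fun \<alpha> F x = ennreal (1 / c) * g_fun \<alpha> f x" for x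
      unfolding F_def by (rule g_fun_scale[OF a f]) (use c in simp)
    have "norm (F x) = norm (f x) / c" for x using c by (simp add: F_def)
    then have I: "(\<integral>\<^sup>+x. \<Phi> (norm (F x)) \<partial>lborel) \<le> 1" using c by simp
    then have "(\<integral>\<^sup>+x. \<Phi> (norm (F x)) \<partial>lborel) < \<infinity>" by (rule le_less_trans) simp
    from D0(2)[OF lF this] have *: "(\<integral>\<^sup>+x. \<Phi> (enn2real (g_fun \<alpha> F x)) \<partial>lborel) \<le> ennreal D0 * (\<integral>\<^sup>+x. \<Phi> (norm (F x)) \<partial>lborel)"
      and ae: "AE x in lborel. g_fun \<alpha> F x < \<infinity>" by auto
    have [measurable]: "g_fun \<alpha> F \<in> borel_measurable borel" by (rule g_fun_measurable[OF a lF])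
    have m: "(\<lambda>x. \<Phi> (enn2real (g_fun \<alpha> F x))) \<in> borel_measurable lborel" by (rule comp_measurable) auto
    have "(\<integral>\<^sup>+x. \<Phi> (enn2real (g_fun \<alpha> f x) / (D * c)) \<partial>lborel) \<le> (\<integral>\<^sup>+x. ennreal (1 / D) * \<Phi> (enn2real (g_fun \<alpha> F x)) \<partial>lborel)"
    proof (rule nn_integral_mono)
      fix x
      have "enn2real (g_fun \<alpha> f x) / (D * c) = 1 / D * enn2real (g_fun \<alpha> F x)"
        using c by (simp add: g enn2real_mult)
      then show "\<Phi> (enn2real (g_fun \<alpha> f x) / (D * c)) \<le> ennreal (1 / D) * \<Phi> (enn2real (g_fun \<alpha> F x))"
        using shrink[of "enn2real (g_fun \<alpha> F x)" "1 / D"] D by simp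
    qed
    also have "\<dots> = ennreal (1 / D) * (\<integral>\<^sup>+x. \<Phi> (enn2real (g_fun \<alpha> F x)) \<partial>lborel)"
      by (rule nn_integral_cmult[OF m])
    also have "\<dots> \<le> ennreal (1 / D) * (ennreal D * 1)"
      by (intro mult_left_mono order_trans[OF * mult_mono] ennreal_leI D I) auto
    also have "\<dots> = 1" using D by (simp flip: ennreal_mult)
    finally have "(\<integral>\<^sup>+x. \<Phi> (enn2real (g_fun \<alpha> f x) / (D * c)) \<partial>lborel) \<le> 1" .
    moreover have "AE x in lborel. g_fun \<alpha> f x < \<infinity>"
      using ae by eventually_elim (use c in \<open>auto simp: g ennreal_mult_less_top\<close>)
    ultimately show ?thesis by simp
  qed
  have "lux (\<lambda>x. enn2real (g_fun \<alpha> f x)) \<le> ennreal D * lux (\<lambda>x. norm (f x)) \<and>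
     (lux (\<lambda>x. norm (f x)) < \<infinity> \<longrightarrow> (AE x in lborel. g_fun \<alpha> f x < \<infinity>))" if f: "locally_integrable f" for f :: "'a \<Rightarrow> complex"
  proof (intro conjI impI)
    show "lux (\<lambda>x. enn2real (g_fun \<alpha> f x)) \<le> ennreal D * lux (\<lambda>x. norm (f x))"
      unfolding lux_def[of "\<lambda>x. norm (f x)"]
    proof (rule ennreal_le_mult_Inf)
      fix c assume "c \<in> ennreal ` {c. c > 0 \<and> (\<integral>\<^sup>+x. \<Phi> (norm (f x) / c) \<partial>lborel) \<le> 1}"
      then obtain r where r: "c = ennreal r" "r > 0" "(\<integral>\<^sup>+x. \<Phi> (norm (f x) / r) \<partial>lborel) \<le> 1" by auto
      have "lux (\<lambda>x. enn2real (g_fun \<alpha> f x)) \<le> ennreal (D * r)"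
        by (rule lux_le) (use adm[OF f r(2,3)] D r in auto)
      then show "lux (\<lambda>x. enn2real (g_fun \<alpha> f x)) \<le> ennreal D * c" using D r by (simp add: ennreal_mult)
    qed (use D in simp)
    assume "lux (\<lambda>x. norm (f x)) < \<infinity>"
    then obtain c where "c > 0" "(\<integral>\<^sup>+x. \<Phi> (norm (f x) / c) \<partial>lborel) \<le> 1" using lux_finite_witness by blast
    then show "AE x in lborel. g_fun \<alpha> f x < \<infinity>" using adm[OF f] by blast
  qed
  then show thesis using D that[of D] by simp
qed

end

subsection \<open>Local estimate\<close>

lemma locally_integrable_cut_off:
  fixes f :: "'a::euclidean_space \<Rightarrow> 'b::{banach, second_countable_topology}"
  assumes f: "locally_integrable f" and S: "S \<in> sets borel"
  shows "locally_integrable (cut_off S f)"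
  unfolding locally_integrable_def set_integrable_def
proof (intro allI)
  fix x r
  have "integrable lebesgue (\<lambda>z. indicator S z *\<^sub>R (indicator (ball x r) z *\<^sub>R f z))"
    by (rule integrable_mult_indicator) (use f S in \<open>auto simp: locally_integrable_def set_integrable_def sets_completionI_sets\<close>)
  then show "integrable lebesgue (\<lambda>z. indicator (ball x r) z *\<^sub>R cut_off S f z)"
    by (simp add: cut_off_def mult.commute)
qed

lemma enn2real_le_add:
  fixes u v :: ennreal
  assumes "u \<le> 2 * v + ennreal c" "v < \<infinity>" "c \<ge> 0"
  shows "enn2real u \<le> 2 * enn2real v + c"
proof -
  obtain r where r: "v = ennreal r" "r \<ge> 0" using assms(2) by (cases v) auto
  have "2 * v + ennreal c = ennreal (2 * r + c)" using r assms(3) by (simp add: ennreal_mult)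
  then have "enn2real u \<le> enn2real (ennreal (2 * r + c))" using assms(1) by (intro enn2real_mono) auto
  also have "\<dots> = 2 * r + c" using r assms(3) by (intro enn2real_ennreal) simp
  finally show ?thesis using r by simp
qed

lemma ennreal_sqrt_ennreal: "r \<ge> 0 \<Longrightarrow> ennreal_sqrt (ennreal r) = ennreal (sqrt r)"
  by (simp add: ennreal_sqrt_def)

lemma g_fun_add:
  fixes f g :: "'a::euclidean_space \<Rightarrow> 'b::{banach, second_countable_topology}"
  assumes a: "0 < \<alpha>" "\<alpha> \<le> 1" and f: "locally_integrable f" and g: "locally_integrable g"
  shows "g_fun \<alpha> (\<lambda>x. f x + g x) x \<le> 2 * g_fun \<alpha> f x + 2 * g_fun \<alpha> g x"
proof -
  have s: "ennreal_sqrt (2 * u) \<le> 2 * ennreal_sqrt u" for u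
  proof (cases u)
    case (real r)
    have "sqrt (2 * r) \<le> sqrt (4 * r)" using real by (intro real_sqrt_le_mono) auto
    also have "\<dots> = 2 * sqrt r" by (simp add: real_sqrt_mult)
    finally have "ennreal (sqrt (2 * r)) \<le> ennreal (2 * sqrt r)" by (rule ennreal_leI)
    moreover have "ennreal_sqrt (ennreal (2 * r)) = ennreal (sqrt (2 * r))" "ennreal_sqrt u = ennreal (sqrt r)"
      using real by (auto intro: ennreal_sqrt_ennreal)
    moreover have "2 * u = ennreal (2 * r)" "ennreal (2 * sqrt r) = 2 * ennreal (sqrt r)" using real by (simp_all add: ennreal_mult)
    ultimately show ?thesis by (simp only:)
  qed (simp add: ennreal_sqrt_def ennreal_mult_top)
  have "g_fun \<alpha> (\<lambda>x. f x + g x) x \<le> ennreal_sqrt (2 * g_sq \<alpha> f {0<..} x + 2 * g_sq \<alpha> g {0<..} x)"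
    unfolding g_fun_eq by (intro ennreal_sqrt_mono g_sq_add[OF a f g])
  also have "\<dots> \<le> ennreal_sqrt (2 * g_sq \<alpha> f {0<..} x) + ennreal_sqrt (2 * g_sq \<alpha> g {0<..} x)"
    by (rule ennreal_sqrt_add_le)
  also have "\<dots> \<le> 2 * g_fun \<alpha> f x + 2 * g_fun \<alpha> g x"
    unfolding g_fun_eq by (intro add_mono s)
  finally show ?thesis .
qed

lemma g_fun_le_of_g_sq_le:
  assumes "g_sq \<alpha> f {0<..} x \<le> (ennreal c)\<^sup>2" "c \<ge> 0"
  shows "g_fun \<alpha> f x \<le> ennreal c"
proof -
  have "g_fun \<alpha> f x \<le> ennreal_sqrt ((ennreal c)\<^sup>2)" unfolding g_fun_eq using assms(1) by (rule ennreal_sqrt_mono)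
  also have "\<dots> = ennreal c" using assms(2) by (simp add: ennreal_sqrt_def ennreal_power)
  finally show ?thesis .
qed

context young_types
begin

definition local_lux :: "('a::euclidean_space \<Rightarrow> 'b::{banach, second_countable_topology}) \<Rightarrow> 'a \<Rightarrow> real \<Rightarrow> ennreal" where
  "local_lux f x t = lux (\<lambda>y. indicator (ball x t) y * norm (f y))"

text \<open>The integral over large balls through which f enters the local estimate. Its integrand
  has the shape of the one in the hypothesis on the two weights, with the local norm of f in place
  of the essential infimum.\<close>

definition tail :: "('a::euclidean_space \<Rightarrow> 'b::{banach, second_countable_topology}) \<Rightarrow> 'a \<Rightarrow> real \<Rightarrow> ennreal" where
  "tail f x r = (\<integral>\<^sup>+t\<in>{r<..}. local_lux f x t * inv_\<Phi> (t powr (- real DIM('a))) * ennreal (1 / t) \<partial>lborel)"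

lemma local_lux_mono: "s \<le> t \<Longrightarrow> local_lux f x s \<le> local_lux f x t"
  unfolding local_lux_def by (intro lux_mono AE_I2) (auto simp: indicator_def)

lemma local_lux_measurable: "local_lux f x \<in> borel_measurable borel"
  by (rule mono_ennreal_measurable) (auto simp: mono_def local_lux_mono)

text \<open>With max r t the base of the power stays positive, so the composition is antitone on the
  whole line; it agrees with the wanted function for t > r.\<close>

lemma inv_powr_measurable:
  assumes "r > 0"
  shows "(\<lambda>t. inv_\<Phi> ((max r t) powr (- real n))) \<in> borel_measurable borel"
proof (rule antimono_ennreal_measurable)
  show "antimono (\<lambda>t. inv_\<Phi> ((max r t) powr (- real n)))"
    unfolding antimono_def using assms by (intro allI impI inv_mono powr_mono2') auto
qed

text \<open>\<open>L1_le_lux\<close> for a ball produces the inverse at 1 / (V t^n);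
  \<open>inv_scale'\<close> exchanges it for the inverse at t^(-n) at the cost of max 1 (1 / V). The
  modulus is first replaced by a Borel representative.\<close>

lemma ball_L1_le:
  fixes f :: "'a::euclidean_space \<Rightarrow> 'b::{banach, second_countable_topology}"
  assumes f: "f \<in> borel_measurable lebesgue" and t: "t > 0" and V: "V = unit_ball_vol (real DIM('a))"
  shows "(\<integral>\<^sup>+z\<in>ball x t. ennreal (norm (f z)) \<partial>lborel)
    \<le> ennreal (2 * V * max 1 (1 / V)) * (ennreal (t ^ DIM('a)) * (local_lux f x t * inv_\<Phi> (t powr (- real DIM('a)))))"
proof -
  have V0: "V > 0" by (simp add: V)
  define b where "b = V * t ^ DIM('a)"
  have b: "b > 0" using V0 t by (simp add: b_def)
  obtain h0 where h0: "h0 \<in> borel_measurable lborel" "AE z in lborel. norm (f z) = h0 z"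
    using completion_ex_borel_measurable_real[of "\<lambda>z. norm (f z)" lborel] f by auto
  define h where "h = (\<lambda>z. \<bar>h0 z\<bar>)"
  have h: "h \<in> borel_measurable lborel" "\<And>z. h z \<ge> 0" "AE z in lborel. norm (f z) = h z"
  proof -
    show "h \<in> borel_measurable lborel" unfolding h_def using h0(1) by measurable
    show "AE z in lborel. norm (f z) = h z" using h0(2)
    proof eventually_elim
      case (elim z)
      then show ?case using norm_ge_zero[of "f z"] by (simp add: h_def)
    qed
  qed (simp add: h_def)
  have "(\<integral>\<^sup>+z\<in>ball x t. ennreal (norm (f z)) \<partial>lborel) = (\<integral>\<^sup>+z\<in>ball x t. ennreal (h z) \<partial>lborel)"
    by (rule nn_integral_cong_AE) (use h(3) in eventually_elim, simp)
  also have "\<dots> \<le> ennreal (2 * b) * inv_\<Phi> (1 / b) * lux (\<lambda>z. indicator (ball x t) z * h z)"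
    by (rule L1_le_lux) (use h b t in \<open>auto simp: emeasure_ball_eq b_def V\<close>)
  also have "lux (\<lambda>z. indicator (ball x t) z * h z) \<le> local_lux f x t"
    unfolding local_lux_def by (rule lux_mono) (use h(3) in eventually_elim, auto simp: h_def)
  also have "inv_\<Phi> (1 / b) \<le> ennreal (max 1 (1 / V)) * inv_\<Phi> (t powr (- real DIM('a)))"
  proof -
    have "1 / b = 1 / V * t powr (- real DIM('a))" using t by (simp add: b_def powr_minus_DIM field_simps)
    then show ?thesis using inv_scale'[of "1 / V" "t powr (- real DIM('a))"] V0 by simp
  qed
  also have "ennreal (2 * b) * (ennreal (max 1 (1 / V)) * inv_\<Phi> (t powr (- real DIM('a)))) * local_lux f x t
    = ennreal (2 * V * max 1 (1 / V)) * (ennreal (t ^ DIM('a)) * (local_lux f x t * inv_\<Phi> (t powr (- real DIM('a)))))"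
  proof -
    have "ennreal (2 * b) * ennreal (max 1 (1 / V)) = ennreal (2 * V * max 1 (1 / V)) * ennreal (t ^ DIM('a))"
      unfolding b_def using V0 t by (subst (1 2) ennreal_mult[symmetric]) (auto simp: mult_ac)
    then show ?thesis by (simp only: mult.assoc[symmetric]) (simp only: mult_ac)
  qed
  finally show ?thesis by (simp add: mult_left_mono mult_right_mono)
qed

text \<open>Puts the near part under the same right side as the far part. For t in [2 r, 4 r) the
  integrand of the tail is at least 1 / t times the norm on the ball of radius 2 r times the inverse
  at (4 r)^(-n). The 2 comes from \<open>nn_integral_inverse_interval\<close>, the 4^n from
  returning to r^(-n).\<close>

lemma tail_ge:
  fixes f :: "'a::euclidean_space \<Rightarrow> 'b::{banach, second_countable_topology}"
  assumes r: "r > 0"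
  shows "local_lux f x (2 * r) * inv_\<Phi> (r powr (- real DIM('a))) \<le> ennreal (2 * 4 ^ DIM('a)) * tail f x r"
proof -
  define n where "n = DIM('a)"
  define c where "c = local_lux f x (2 * r) * inv_\<Phi> ((4 * r) powr (- real n))"
  have "c \<le> 2 * (\<integral>\<^sup>+t\<in>{4 * r / 2..<4 * r}. local_lux f x t * inv_\<Phi> (t powr (- real n)) * ennreal (1 / t) \<partial>lborel)"
  proof (rule nn_integral_inverse_interval)
    fix t assume t: "4 * r / 2 \<le> t" "t < 4 * r"
    then have t0: "t > 0" using r by simp
    have "ennreal (1 / t) * ennreal t = ennreal (1 / t * t)" using t0 by (intro ennreal_mult[symmetric]) auto
    then have one: "ennreal (1 / t) * ennreal t = 1" using t0 by simp
    have "c \<le> local_lux f x t * inv_\<Phi> (t powr (- real n))"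
      unfolding c_def using t t0 r by (intro mult_mono local_lux_mono inv_mono powr_mono2') auto
    then show "c \<le> local_lux f x t * inv_\<Phi> (t powr (- real n)) * ennreal (1 / t) * ennreal t"
      using one by (simp add: mult.assoc)
  qed (use r in simp)
  also have "\<dots> \<le> 2 * tail f x r"
    unfolding tail_def n_def using r by (intro mult_left_mono nn_integral_mono) (auto simp: indicator_def)
  finally have c: "c \<le> 2 * tail f x r" .
  have "r powr (- real n) = 4 ^ n * (4 * r) powr (- real n)"
    using r by (simp add: powr_minus_DIM power_mult_distrib)
  then have "inv_\<Phi> (r powr (- real n)) \<le> ennreal (4 ^ n) * inv_\<Phi> ((4 * r) powr (- real n))"
    using inv_scale[of "4 ^ n" "(4 * r) powr (- real n)"] by simp
  then have "local_lux f x (2 * r) * inv_\<Phi> (r powr (- real n)) \<le> local_lux f x (2 * r) * (ennreal (4 ^ n) * inv_\<Phi> ((4 * r) powr (- real n)))"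
    by (rule mult_left_mono) simp
  also have "\<dots> = ennreal (4 ^ n) * c" by (simp only: c_def mult_ac)
  also have "\<dots> \<le> ennreal (4 ^ n) * (2 * tail f x r)" using c by (rule mult_left_mono) simp
  also have "\<dots> = ennreal (2 * 4 ^ n) * tail f x r" by (simp add: ennreal_mult mult_ac)
  finally show ?thesis unfolding n_def .
qed

text \<open>Seen from x in the ball of radius r about x0, a kernel of scale t < r does not leave the
  ball of radius 2 r, where the far part vanishes; a kernel of scale t \<ge> r stays inside the ball
  of radius 2 t about x0. The mean of |f| over that ball increases after removing t^(-n), so
  \<open>square_integral_monotone_kernel\<close> applies with exponent n, and
  \<open>ball_L1_le\<close> turns the result into the tail.\<close>

lemma g_sq_far:
  fixes f :: "'a::euclidean_space \<Rightarrow> 'b::{banach, second_countable_topology}"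
  assumes a: "0 < \<alpha>" "\<alpha> \<le> 1" and f: "f \<in> borel_measurable lebesgue" and r: "r > 0" and x: "x \<in> ball x0 r"
    and V: "V = unit_ball_vol (real DIM('a))"
  shows "g_sq \<alpha> (cut_off (- ball x0 (2 * r)) f) {0<..} x
    \<le> ennreal (real DIM('a)) * (ennreal (3 * (2 * V * max 1 (1 / V)) * 2 ^ DIM('a)) * tail f x0 r)\<^sup>2"
proof -
  define n where "n = DIM('a)"
  have n: "n > 0" by (simp add: n_def)
  have V0: "V > 0" by (simp add: V)
  define K where "K = 2 * V * max 1 (1 / V)"
  have K: "K \<ge> 0" using V0 by (simp add: K_def)
  define f2 where "f2 = cut_off (- ball x0 (2 * r)) f"
  define U where "U = (\<lambda>t. ennreal 3 * (\<integral>\<^sup>+z\<in>ball x0 (2 * t). ennreal (norm (f z)) \<partial>lborel))"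
  have Um: "mono U" unfolding mono_def U_def
    by (intro allI impI mult_left_mono nn_integral_mono) (auto simp: indicator_def)
  have A: "A_sup \<alpha> f2 t x \<le> ennreal (t powr (- real n)) * U t * indicator {r..} t" if t: "t > 0" for t
  proof -
    have "A_sup \<alpha> f2 t x \<le> (\<integral>\<^sup>+z. ennreal (3 * t powr (- real n)) * (ennreal (norm (f2 z)) * indicator (cball x t) z) \<partial>lborel)"
      unfolding n_def by (rule A_sup_le[OF a t])
    also have "\<dots> \<le> ennreal (t powr (- real n)) * U t * indicator {r..} t"
    proof (cases "t \<ge> r")
      case True
      have le: "(\<integral>\<^sup>+z. ennreal (3 * t powr (- real n)) * (ennreal (norm (f2 z)) * indicator (cball x t) z) \<partial>lborel)
         \<le> (\<integral>\<^sup>+z. ennreal (3 * t powr (- real n)) * (ennreal (norm (f z)) * indicator (ball x0 (2 * t)) z) \<partial>lebesgue)"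
        unfolding nn_integral_completion
      proof (intro nn_integral_mono mult_left_mono)
        fix z
        show "ennreal (norm (f2 z)) * indicator (cball x t) z \<le> ennreal (norm (f z)) * indicator (ball x0 (2 * t)) z"
        proof (cases "z \<in> cball x t")
          case zt: True
          then have "dist x0 z < 2 * t" using x True dist_triangle[of x0 z x] by auto
          then show ?thesis by (auto simp: f2_def cut_off_def indicator_def)
        qed simp
      qed simp
      also have "\<dots> = ennreal (3 * t powr (- real n)) * (\<integral>\<^sup>+z\<in>ball x0 (2 * t). ennreal (norm (f z)) \<partial>lebesgue)"
      proof (rule nn_integral_cmult)
        have "(indicator (ball x0 (2 * t)) :: 'a \<Rightarrow> ennreal) \<in> borel_measurable lebesgue"
          by (intro measurable_completion borel_measurable_indicator) auto
        then show "(\<lambda>z. ennreal (norm (f z)) * indicator (ball x0 (2 * t)) z) \<in> borel_measurable lebesgue"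
          using f by measurable
      qed
      also have "\<dots> = ennreal (t powr (- real n)) * U t"
        unfolding U_def nn_integral_completion by (simp add: ennreal_mult mult_ac)
      finally show ?thesis using True by simp
    next
      case False
      have "(\<integral>\<^sup>+z. ennreal (3 * t powr (- real n)) * (ennreal (norm (f2 z)) * indicator (cball x t) z) \<partial>lborel) = (\<integral>\<^sup>+z. 0 \<partial>(lborel :: 'a measure))"
      proof (rule nn_integral_cong)
        fix z
        show "ennreal (3 * t powr (- real n)) * (ennreal (norm (f2 z)) * indicator (cball x t) z) = 0"
        proof (cases "z \<in> cball x t")
          case True
          then have "dist x0 z < 2 * r" using x False dist_triangle[of x0 z x] by auto
          then show ?thesis by (simp add: f2_def cut_off_def)
        qed simp
      qed
      then show ?thesis by simp
    qed
    finally show ?thesis .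
  qed
  \<comment> \<open>Scales below r contribute nothing. The lower limit r / 2 is taken because the
    balls have radius 2 t: the substitution s = 2 t turns it into r, the lower limit of
    \<open>tail\<close>.\<close>
  have "g_sq \<alpha> f2 {0<..} x \<le> (\<integral>\<^sup>+t\<in>{r / 2<..}. (ennreal (t powr (- real n)) * U t)\<^sup>2 * ennreal (1 / t) \<partial>lborel)"
    unfolding g_sq_def
  proof (rule nn_integral_mono)
    fix t :: real
    show "(A_sup \<alpha> f2 t x)\<^sup>2 * ennreal (1 / t) * indicator {0<..} t \<le> (ennreal (t powr (- real n)) * U t)\<^sup>2 * ennreal (1 / t) * indicator {r / 2<..} t"
    proof (cases "t > 0")
      case True
      show ?thesis
      proof (cases "t \<ge> r")
        case tr: True
        have "A_sup \<alpha> f2 t x \<le> ennreal (t powr (- real n)) * U t" using A[OF True] tr by simp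
        then have "(A_sup \<alpha> f2 t x)\<^sup>2 * ennreal (1 / t) \<le> (ennreal (t powr (- real n)) * U t)\<^sup>2 * ennreal (1 / t)"
          by (intro mult_right_mono power_mono) auto
        then show ?thesis using tr r by simp
      next
        case False
        then have "A_sup \<alpha> f2 t x = 0" using A[OF True] by simp
        then show ?thesis by simp
      qed
    qed simp
  qed
  also have "\<dots> \<le> ennreal (real n) * (\<integral>\<^sup>+t\<in>{r / 2<..}. ennreal (t powr (- real n - 1)) * U t \<partial>lborel)\<^sup>2"
    by (rule square_integral_monotone_kernel[OF Um]) (use n r in auto)
  also have "(\<integral>\<^sup>+t\<in>{r / 2<..}. ennreal (t powr (- real n - 1)) * U t \<partial>lborel) \<le> ennreal (3 * K * 2 ^ n) * tail f x0 r"
  proof -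
    define F where "F = (\<lambda>s. local_lux f x0 s * inv_\<Phi> ((max r s) powr (- real n)) * ennreal (1 / s) * indicator {r<..} s)"
    have [measurable]: "F \<in> borel_measurable borel"
      unfolding F_def using local_lux_measurable[of f x0] inv_powr_measurable[OF r, of n] by measurable
    have "(\<integral>\<^sup>+t\<in>{r / 2<..}. ennreal (t powr (- real n - 1)) * U t \<partial>lborel) \<le> (\<integral>\<^sup>+t. ennreal (3 * K * 2 ^ n) * (ennreal \<bar>2\<bar> * F (0 + 2 * t)) \<partial>lborel)"
    proof (rule nn_integral_mono)
      fix t :: real
      show "ennreal (t powr (- real n - 1)) * U t * indicator {r / 2<..} t \<le> ennreal (3 * K * 2 ^ n) * (ennreal \<bar>2\<bar> * F (0 + 2 * t))"
      proof (cases "t > r / 2")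
        case True
        then have t: "t > 0" using r by simp
        define Y where "Y = local_lux f x0 (2 * t) * inv_\<Phi> ((2 * t) powr (- real n))"
        have "ennreal (t powr (- real n - 1)) * U t \<le> ennreal (t powr (- real n - 1)) * (ennreal 3 * (ennreal K * (ennreal ((2 * t) ^ n) * Y)))"
          unfolding U_def K_def Y_def n_def using t by (intro mult_left_mono ball_L1_le f V) auto
        also have "\<dots> = (ennreal (t powr (- real n - 1)) * ennreal 3 * ennreal K * ennreal ((2 * t) ^ n)) * Y"
          by (simp only: mult.assoc)
        also have "ennreal (t powr (- real n - 1)) * ennreal 3 * ennreal K * ennreal ((2 * t) ^ n) = ennreal (t powr (- real n - 1) * 3 * K * (2 * t) ^ n)"
          using t K by (simp only: ennreal_mult mult_nonneg_nonneg powr_ge_zero zero_le_power zero_le_numeral less_imp_le)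
        also have "t powr (- real n - 1) * 3 * K * (2 * t) ^ n = 3 * K * 2 ^ n * (1 / t)"
          using t by (simp add: powr_diff powr_minus_DIM power_mult_distrib field_simps)
        also have "\<dots> = 3 * K * 2 ^ n * (2 * (1 / (2 * t)))" using t by simp
        also have "ennreal (3 * K * 2 ^ n * (2 * (1 / (2 * t)))) = ennreal (3 * K * 2 ^ n) * (ennreal 2 * ennreal (1 / (2 * t)))"
          using t K by (simp only: ennreal_mult mult_nonneg_nonneg divide_nonneg_nonneg zero_le_one zero_le_power zero_le_numeral less_imp_le)
        also have "\<dots> * Y = ennreal (3 * K * 2 ^ n) * (ennreal \<bar>2\<bar> * F (0 + 2 * t))"
          using True by (simp add: F_def Y_def max_def mult_ac)
        finally show ?thesis using True by simp
      qed simp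
    qed
    also have "\<dots> = ennreal (3 * K * 2 ^ n) * (ennreal \<bar>2\<bar> * (\<integral>\<^sup>+t. F (0 + 2 * t) \<partial>lborel))"
      by (simp add: nn_integral_cmult)
    also have "ennreal \<bar>2\<bar> * (\<integral>\<^sup>+t. F (0 + 2 * t) \<partial>lborel) = (\<integral>\<^sup>+s. F s \<partial>lborel)"
      by (rule nn_integral_real_affine[symmetric]) auto
    also have "\<dots> = tail f x0 r"
      unfolding F_def tail_def n_def by (intro nn_integral_cong) (auto simp: indicator_def max_def)
    finally show ?thesis .
  qed
  finally show ?thesis unfolding f2_def n_def K_def by (simp add: power_mono mult_left_mono)
qed

text \<open>An infinite tail leaves nothing to prove. Otherwise the near part has finite norm and
  \<open>g_fun_lux\<close> applies to it, while on the ball the far part is bounded by a multiple of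
  the tail, a constant whose norm is computed by \<open>lux_const_le\<close>.\<close>

theorem g_fun_local_estimate:
  assumes a: "0 < \<alpha>" "\<alpha> \<le> 1"
  obtains C where "C > 0" "\<And>(f :: 'a::euclidean_space \<Rightarrow> complex) x0 r. locally_integrable f \<Longrightarrow> r > 0 \<Longrightarrow>
     lux (\<lambda>x. indicator (ball x0 r) x * enn2real (g_fun \<alpha> f x)) * inv_\<Phi> (r powr (- real DIM('a))) \<le> ennreal C * tail f x0 r \<and>
     (tail f x0 r < \<infinity> \<longrightarrow> (AE x in lborel. x \<in> ball x0 r \<longrightarrow> g_fun \<alpha> f x < \<infinity>))"
proof -
  define V where "V = unit_ball_vol (real DIM('a))"
  have V0: "V > 0" by (simp add: V_def)
  define n where "n = DIM('a)"
  define K where "K = sqrt (real n) * (3 * (2 * V * max 1 (1 / V)) * 2 ^ n)"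
  have K: "K \<ge> 0" using V0 by (simp add: K_def)
  obtain D where D: "D > 0" "\<And>f :: 'a::euclidean_space \<Rightarrow> complex. locally_integrable f \<Longrightarrow>
     lux (\<lambda>x. enn2real (g_fun \<alpha> f x)) \<le> ennreal D * lux (\<lambda>x. norm (f x)) \<and>
     (lux (\<lambda>x. norm (f x)) < \<infinity> \<longrightarrow> (AE x in lborel. g_fun \<alpha> f x < \<infinity>))"
    using g_fun_lux[OF a, where 'a='a] by metis
  \<comment> \<open>The first summand is for the near part: 2 from \<open>g_fun_add\<close>, D from
    \<open>g_fun_lux\<close>, the rest from \<open>tail_ge\<close>. The second is for the far part:
    2 from \<open>g_fun_add\<close>, 2 from \<open>lux_const_le\<close>, and max 1 V from comparing
    r^(-n) with the reciprocal volume.\<close>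
  define C where "C = 2 * D * (2 * 4 ^ n) + 4 * K * max 1 V"
  have C: "C > 0" using D K by (simp add: C_def add_pos_nonneg)
  have "lux (\<lambda>x. indicator (ball x0 r) x * enn2real (g_fun \<alpha> f x)) * inv_\<Phi> (r powr (- real n)) \<le> ennreal C * tail f x0 r \<and>
     (tail f x0 r < \<infinity> \<longrightarrow> (AE x in lborel. x \<in> ball x0 r \<longrightarrow> g_fun \<alpha> f x < \<infinity>))"
    if f: "locally_integrable f" and r: "r > 0" for f :: "'a \<Rightarrow> complex" and x0 r
  proof (cases "tail f x0 r")
    case top
    then show ?thesis using C by (simp add: ennreal_mult_top)
  next
    case (real j)
    have fm: "f \<in> borel_measurable lebesgue" by (rule locally_integrable_measurable[OF f])
    define f1 where "f1 = cut_off (ball x0 (2 * r)) f"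
    define f2 where "f2 = cut_off (- ball x0 (2 * r)) f"
    have l1: "locally_integrable f1" and l2: "locally_integrable f2"
      unfolding f1_def f2_def by (intro locally_integrable_cut_off f; simp)+
    have f12: "f = (\<lambda>x. f1 x + f2 x)" by (auto simp: f1_def f2_def cut_off_def indicator_def fun_eq_iff)
    have near: "lux (\<lambda>x. norm (f1 x)) * inv_\<Phi> (r powr (- real n)) \<le> ennreal (2 * 4 ^ n) * ennreal j"
      using tail_ge[OF r, of f x0] real unfolding n_def local_lux_def by (simp add: f1_def cut_off_def)
    have ip: "inv_\<Phi> (r powr (- real n)) > 0" using r by (intro inv_pos) simp
    have "lux (\<lambda>x. norm (f1 x)) * inv_\<Phi> (r powr (- real n)) < \<infinity>"
      using near by (rule le_less_trans) (simp add: ennreal_mult_less_top)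
    then have "lux (\<lambda>x. norm (f1 x)) < \<infinity>" using ip by (auto simp: ennreal_mult_less_top)
    then have ae1: "AE x in lborel. g_fun \<alpha> f1 x < \<infinity>" using D(2)[OF l1] by blast
    have far: "g_fun \<alpha> f2 x \<le> ennreal (K * j)" if x: "x \<in> ball x0 r" for x
    proof (rule g_fun_le_of_g_sq_le)
      have "g_sq \<alpha> f2 {0<..} x \<le> ennreal (real n) * (ennreal (3 * (2 * V * max 1 (1 / V)) * 2 ^ n) * ennreal j)\<^sup>2"
        using g_sq_far[OF a fm r x V_def] real unfolding f2_def n_def by simp
      also have "ennreal (3 * (2 * V * max 1 (1 / V)) * 2 ^ n) * ennreal j = ennreal (3 * (2 * V * max 1 (1 / V)) * 2 ^ n * j)"
        using V0 real by (intro ennreal_mult[symmetric]) auto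
      also have "ennreal (real n) * (ennreal (3 * (2 * V * max 1 (1 / V)) * 2 ^ n * j))\<^sup>2 = ennreal (real n * (3 * (2 * V * max 1 (1 / V)) * 2 ^ n * j)\<^sup>2)"
      proof -
        have "ennreal (real n) * (ennreal q)\<^sup>2 = ennreal (real n * q\<^sup>2)" if "q \<ge> 0" for q
          using that by (simp add: ennreal_power ennreal_mult)
        then show ?thesis using V0 real by simp
      qed
      also have "real n * (3 * (2 * V * max 1 (1 / V)) * 2 ^ n * j)\<^sup>2 = (K * j)\<^sup>2"
        by (simp add: K_def power_mult_distrib)
      also have "ennreal ((K * j)\<^sup>2) = (ennreal (K * j))\<^sup>2" using K real by (simp add: ennreal_power)
      finally show "g_sq \<alpha> f2 {0<..} x \<le> (ennreal (K * j))\<^sup>2" .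
    qed (use K real in simp)
    have pw: "g_fun \<alpha> f x \<le> 2 * g_fun \<alpha> f1 x + ennreal (2 * K * j)" if x: "x \<in> ball x0 r" for x
    proof -
      have "g_fun \<alpha> f x \<le> 2 * g_fun \<alpha> f1 x + 2 * g_fun \<alpha> f2 x"
        by (subst f12) (rule g_fun_add[OF a l1 l2])
      also have "\<dots> \<le> 2 * g_fun \<alpha> f1 x + 2 * ennreal (K * j)" by (intro add_left_mono mult_left_mono far x) simp
      also have "2 * ennreal (K * j) = ennreal (2 * K * j)" using K real by (simp add: ennreal_mult mult.assoc)
      finally show ?thesis .
    qed
    have fin: "AE x in lborel. x \<in> ball x0 r \<longrightarrow> g_fun \<alpha> f x < \<infinity>"
      using ae1
    proof eventually_elim
      case (elim x)
      then have "2 * g_fun \<alpha> f1 x + ennreal (2 * K * j) < \<infinity>" by (simp add: ennreal_mult_less_top)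
      then show ?case using pw[of x] by (auto intro: le_less_trans)
    qed
    have [measurable]: "g_fun \<alpha> f1 \<in> borel_measurable borel" by (rule g_fun_measurable[OF a l1])
    define b where "b = V * r ^ n"
    have b: "b > 0" using V0 r by (simp add: b_def)
    have Bm[measurable]: "ball x0 r \<in> sets borel" by simp
    have "lux (\<lambda>x. indicator (ball x0 r) x * enn2real (g_fun \<alpha> f x)) \<le> lux (\<lambda>x. 2 * enn2real (g_fun \<alpha> f1 x) + indicator (ball x0 r) x * (2 * K * j))"
    proof (rule lux_mono)
      show "AE x in lborel. 0 \<le> indicator (ball x0 r) x * enn2real (g_fun \<alpha> f x) \<and> indicator (ball x0 r) x * enn2real (g_fun \<alpha> f x) \<le> 2 * enn2real (g_fun \<alpha> f1 x) + indicator (ball x0 r) x * (2 * K * j)"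
        using ae1
      proof eventually_elim
        case (elim x)
        show ?case
        proof (cases "x \<in> ball x0 r")
          case True
          have "enn2real (g_fun \<alpha> f x) \<le> 2 * enn2real (g_fun \<alpha> f1 x) + 2 * K * j"
            by (rule enn2real_le_add[OF pw[OF True] elim]) (use K real in simp)
          then show ?thesis using True by simp
        qed simp
      qed
    qed
    also have "\<dots> \<le> lux (\<lambda>x. 2 * enn2real (g_fun \<alpha> f1 x)) + lux (\<lambda>x. indicator (ball x0 r) x * (2 * K * j))"
      by (rule lux_triangle) (use K real in \<open>auto intro!: borel_measurable_times borel_measurable_indicator\<close>)
    also have "lux (\<lambda>x. 2 * enn2real (g_fun \<alpha> f1 x)) \<le> ennreal 2 * lux (\<lambda>x. enn2real (g_fun \<alpha> f1 x))"
      by (rule lux_scale) simp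
    also have "lux (\<lambda>x. enn2real (g_fun \<alpha> f1 x)) \<le> ennreal D * lux (\<lambda>x. norm (f1 x))"
      using D(2)[OF l1] by blast
    finally have main: "lux (\<lambda>x. indicator (ball x0 r) x * enn2real (g_fun \<alpha> f x)) \<le> ennreal 2 * (ennreal D * lux (\<lambda>x. norm (f1 x))) + lux (\<lambda>x. indicator (ball x0 r) x * (2 * K * j))"
      by (simp add: add_right_mono mult_left_mono)
    have const: "lux (\<lambda>x. indicator (ball x0 r) x * (2 * K * j)) * inv_\<Phi> (r powr (- real n)) \<le> ennreal (4 * K * max 1 V) * ennreal j"
    proof -
      have "r powr (- real n) = V * (1 / b)" using r V0 by (simp add: b_def powr_minus_DIM field_simps)
      then have "inv_\<Phi> (r powr (- real n)) \<le> ennreal (max 1 V) * inv_\<Phi> (1 / b)"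
        using inv_scale'[of V "1 / b"] V0 b by simp
      then have "lux (\<lambda>x. indicator (ball x0 r) x * (2 * K * j)) * inv_\<Phi> (r powr (- real n)) \<le> lux (\<lambda>x. indicator (ball x0 r) x * (2 * K * j)) * (ennreal (max 1 V) * inv_\<Phi> (1 / b))"
        by (rule mult_left_mono) simp
      also have "\<dots> = ennreal (max 1 V) * (lux (\<lambda>x. indicator (ball x0 r) x * (2 * K * j)) * inv_\<Phi> (1 / b))"
        by (simp only: mult_ac)
      also have "\<dots> \<le> ennreal (max 1 V) * ennreal (2 * (2 * K * j))"
        by (intro mult_left_mono lux_const_le) (use b r K real in \<open>auto simp: b_def V_def n_def emeasure_ball_eq\<close>)
      also have "\<dots> = ennreal (max 1 V * (2 * (2 * K * j)))" using K real by (intro ennreal_mult[symmetric]) auto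
      also have "max 1 V * (2 * (2 * K * j)) = (4 * K * max 1 V) * j" by simp
      also have "ennreal ((4 * K * max 1 V) * j) = ennreal (4 * K * max 1 V) * ennreal j" using K real by (intro ennreal_mult) auto
      finally show ?thesis .
    qed
    have "lux (\<lambda>x. indicator (ball x0 r) x * enn2real (g_fun \<alpha> f x)) * inv_\<Phi> (r powr (- real n))
      \<le> (ennreal 2 * (ennreal D * lux (\<lambda>x. norm (f1 x))) + lux (\<lambda>x. indicator (ball x0 r) x * (2 * K * j))) * inv_\<Phi> (r powr (- real n))"
      using main by (rule mult_right_mono) simp
    also have "\<dots> = ennreal 2 * ennreal D * (lux (\<lambda>x. norm (f1 x)) * inv_\<Phi> (r powr (- real n))) + lux (\<lambda>x. indicator (ball x0 r) x * (2 * K * j)) * inv_\<Phi> (r powr (- real n))"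
      by (simp only: distrib_right mult.assoc)
    also have "\<dots> \<le> ennreal 2 * ennreal D * (ennreal (2 * 4 ^ n) * ennreal j) + ennreal (4 * K * max 1 V) * ennreal j"
      by (intro add_mono mult_left_mono near const) simp
    also have "\<dots> = ennreal C * ennreal j"
    proof -
      have "ennreal C = ennreal (2 * D * (2 * 4 ^ n)) + ennreal (4 * K * max 1 V)"
        unfolding C_def using D K by (intro ennreal_plus) auto
      also have "ennreal (2 * D * (2 * 4 ^ n)) = ennreal 2 * ennreal D * ennreal (2 * 4 ^ n)"
        using D by (simp only: ennreal_mult mult_nonneg_nonneg zero_le_power zero_le_numeral less_imp_le)
      finally show ?thesis by (simp only: distrib_right mult.assoc)
    qed
    finally show ?thesis using real fin by simp
  qed
  then show thesis using C that unfolding n_def by blast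
qed

end

section \<open>Boundedness between the two Morrey spaces\<close>

theorem corollary3p6:
  fixes \<alpha> p0 p1 :: real
    and \<Phi> :: "real \<Rightarrow> ennreal"
    and \<phi>1 \<phi>2 :: "'a::euclidean_space \<Rightarrow> real \<Rightarrow> real"
  assumes "0 < \<alpha>" and "\<alpha> \<le> 1"
    and "young_function \<Phi>"
    and "1 < p0" and "p0 \<le> p1"
    and "lower_type p0 \<Phi>" and "upper_type p1 \<Phi>"
    and "positive_measurable_weight \<phi>1" and "positive_measurable_weight \<phi>2"
    and "\<exists>C::real. \<forall>x. \<forall>r>0.
           (\<integral>\<^sup>+t\<in>{r<..}.
              essinf (lebesgue_on {t<..})
                (\<lambda>s. ennreal (\<phi>1 x s) / young_inv \<Phi> (s powr (- real DIM('a)))) *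
              young_inv \<Phi> (t powr (- real DIM('a))) * ennreal (1 / t) \<partial>lebesgue)
           \<le> ennreal (C * \<phi>2 x r)"
  shows "\<exists>C'::real. C' \<ge> 0 \<and>
           (\<forall>f :: 'a \<Rightarrow> complex. f \<in> orlicz_morrey \<Phi> \<phi>1 \<longrightarrow>
              (AE x in lebesgue. g_fun \<alpha> f x < \<infinity>) \<and>
              (\<lambda>x. enn2real (g_fun \<alpha> f x)) \<in> orlicz_morrey \<Phi> \<phi>2 \<and>
              orlicz_morrey_norm \<Phi> \<phi>2 (\<lambda>x. enn2real (g_fun \<alpha> f x))
                \<le> ennreal C' * orlicz_morrey_norm \<Phi> \<phi>1 f)"
proof -
  interpret young_types \<Phi> p0 p1 by standard fact+
  obtain C where C: "C > 0" "\<And>(f :: 'a \<Rightarrow> complex) x0 r. locally_integrable f \<Longrightarrow> r > 0 \<Longrightarrow>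
     lux (\<lambda>x. indicator (ball x0 r) x * enn2real (g_fun \<alpha> f x)) * inv_\<Phi> (r powr (- real DIM('a))) \<le> ennreal C * tail f x0 r \<and>
     (tail f x0 r < \<infinity> \<longrightarrow> (AE x in lborel. x \<in> ball x0 r \<longrightarrow> g_fun \<alpha> f x < \<infinity>))"
    using g_fun_local_estimate[OF assms(1,2), where 'a='a] by blast
  obtain C0 where C0: "\<And>x r. r > 0 \<Longrightarrow>
      (\<integral>\<^sup>+t\<in>{r<..}. essinf (lebesgue_on {t<..}) (\<lambda>s. ennreal (\<phi>1 x s) / inv_\<Phi> (s powr (- real DIM('a)))) *
         inv_\<Phi> (t powr (- real DIM('a))) * ennreal (1 / t) \<partial>lborel) \<le> ennreal (C0 * \<phi>2 x r)"
  proof -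
    from assms(10)[unfolded nn_integral_completion] obtain c :: real where
      "\<forall>x. \<forall>r>0. (\<integral>\<^sup>+t\<in>{r<..}. essinf (lebesgue_on {t<..}) (\<lambda>s. ennreal (\<phi>1 x s) / inv_\<Phi> (s powr (- real DIM('a)))) *
         inv_\<Phi> (t powr (- real DIM('a))) * ennreal (1 / t) \<partial>lborel) \<le> ennreal (c * \<phi>2 x r)" ..
    then show ?thesis by (intro that[of c]) simp
  qed
  \<comment> \<open>The hypothesis does not fix the sign of its constant; a negative one would read
    as 0 under \<open>ennreal\<close>.\<close>
  define K where "K = max 0 C0"
  have phi1: "\<phi>1 x r > 0" and phi2: "\<phi>2 x r > 0" if "r > 0" for x r
    using assms(8,9) that by (auto simp: positive_measurable_weight_def)
  have ip: "inv_\<Phi> (r powr (- real DIM('a))) > 0" "inv_\<Phi> (r powr (- real DIM('a))) < top" if "r > 0" for r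
    using that inv_pos[of "r powr (- real DIM('a))"] inv_finite[of "r powr (- real DIM('a))"] by auto
  have main: "(AE x in lebesgue. g_fun \<alpha> f x < \<infinity>) \<and>
        (\<lambda>x. enn2real (g_fun \<alpha> f x)) \<in> orlicz_morrey \<Phi> \<phi>2 \<and>
        orlicz_morrey_norm \<Phi> \<phi>2 (\<lambda>x. enn2real (g_fun \<alpha> f x)) \<le> ennreal (C * K) * orlicz_morrey_norm \<Phi> \<phi>1 f"
    if f: "f \<in> orlicz_morrey \<Phi> \<phi>1" for f :: "'a \<Rightarrow> complex"
  proof -
    define M where "M = orlicz_morrey_norm \<Phi> \<phi>1 f"
    have M: "M < \<infinity>" and loc: "f \<in> orlicz_loc \<Phi>" using f by (auto simp: orlicz_morrey_def M_def)
    have lf: "locally_integrable f"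
      unfolding locally_integrable_def
    proof (intro allI)
      fix x r
      show "set_integrable lebesgue (ball x r) f"
      proof (cases "r > 0")
        case True
        then have "locally_integrable (cut_off (ball x r) f)" using loc by (auto simp: orlicz_loc_def orlicz_space_def)
        then have "integrable lebesgue (\<lambda>z. indicator (ball x r) z *\<^sub>R cut_off (ball x r) f z)"
          by (simp add: locally_integrable_def set_integrable_def)
        moreover have "(\<lambda>z. indicator (ball x r) z *\<^sub>R cut_off (ball x r) f z) = (\<lambda>z. indicator (ball x r) z *\<^sub>R f z)"
          by (auto simp: cut_off_def indicator_def fun_eq_iff)
        ultimately show ?thesis by (simp add: set_integrable_def)
      next
        case False
        then have "ball x r = {}" by (intro ball_empty) simp
        then have "indicator (ball x r) z = (0 :: real)" for z by (simp only: indicator_def empty_iff of_bool_eq)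
        then show ?thesis by (simp add: set_integrable_def)
      qed
    qed
    have lux_cut: "luxemburg_norm \<Phi> (cut_off (ball x s) h) = local_lux h x s" for h :: "'a \<Rightarrow> 'c::{banach, second_countable_topology}" and x s
      by (simp add: luxemburg_norm_eq local_lux_def cut_off_def)
    \<comment> \<open>One member of the supremum in the Morrey norm, solved for the local norm; both
      factors are positive and finite.\<close>
    have Ms: "local_lux f x s \<le> M * (ennreal (\<phi>1 x s) / inv_\<Phi> (s powr (- real DIM('a))))" if s: "s > 0" for x s
    proof -
      obtain i where i: "inv_\<Phi> (s powr (- real DIM('a))) = ennreal i" "i > 0"
        using ip[OF s] by (cases "inv_\<Phi> (s powr (- real DIM('a)))") auto
      define p where "p = \<phi>1 x s"
      have p: "p > 0" using phi1[OF s] by (simp add: p_def)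
      have "inverse (ennreal p) * ennreal i * local_lux f x s \<le> M"
        unfolding M_def orlicz_morrey_norm_def lux_cut p_def i(1)[symmetric]
        by (rule SUP_upper2[of x], simp, rule SUP_upper2[of s]) (use s in auto)
      then have "ennreal (i / p) * local_lux f x s \<le> M"
        using p i by (simp add: inverse_ennreal ennreal_mult[symmetric] divide_inverse mult.commute)
      then have "ennreal (p / i) * (ennreal (i / p) * local_lux f x s) \<le> ennreal (p / i) * M" by (rule mult_left_mono) simp
      moreover have "ennreal (p / i) * ennreal (i / p) = ennreal (p / i * (i / p))" using p i by (intro ennreal_mult[symmetric]) auto
      then have "ennreal (p / i) * ennreal (i / p) = 1" using p i by simp
      ultimately have "local_lux f x s \<le> ennreal (p / i) * M" by (simp flip: mult.assoc)
      also have "ennreal (p / i) = ennreal p / ennreal i" using p i by (intro divide_ennreal[symmetric]) auto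
      finally show ?thesis unfolding p_def i(1) by (simp only: mult.commute)
    qed
    have tail: "tail f x r \<le> M * ennreal (K * \<phi>2 x r)" if r: "r > 0" for x r
    proof -
      obtain m where m: "M = ennreal m" "m \<ge> 0" using M by (cases M) auto
      \<comment> \<open>The case M = 0 is separate because the local norms are divided by M
        below.\<close>
      show ?thesis
      proof (cases "m = 0")
        case True
        then have "local_lux f x s = 0" if "s > 0" for s using Ms[OF that, of x] m by simp
        then have "tail f x r = (\<integral>\<^sup>+t. 0 \<partial>(lborel :: real measure))"
          unfolding tail_def using r by (intro nn_integral_cong) (auto simp: indicator_def)
        then show ?thesis by simp
      next
        case False
        then have m0: "m > 0" using m by simp
        \<comment> \<open>Dividing by M on the left keeps the essential infimum on the right exactly
          as it stands in the hypothesis. The bound holds for every s > t, since the local norm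
          increases from t to s.\<close>
        have le: "local_lux f x t / M \<le> essinf (lebesgue_on {t<..}) (\<lambda>s. ennreal (\<phi>1 x s) / inv_\<Phi> (s powr (- real DIM('a))))" if t: "t > 0" for t
          unfolding essinf_def
        proof (rule Liminf_bounded)
          show "AE s in lebesgue_on {t<..}. local_lux f x t / M \<le> ennreal (\<phi>1 x s) / inv_\<Phi> (s powr (- real DIM('a)))"
          proof (rule AE_I2)
            fix s assume "s \<in> space (lebesgue_on {t<..})"
            then have s: "s > t" by simp
            have "local_lux f x t \<le> local_lux f x s" using s by (intro local_lux_mono) simp
            also have "\<dots> \<le> M * (ennreal (\<phi>1 x s) / inv_\<Phi> (s powr (- real DIM('a))))" by (rule Ms) (use s t in simp)
            finally show "local_lux f x t / M \<le> ennreal (\<phi>1 x s) / inv_\<Phi> (s powr (- real DIM('a)))"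
              unfolding m(1) by (simp add: ennreal_divide_le_iff[OF m0])
          qed
        qed
        \<comment> \<open>A measurable form of the integrand of the tail divided by M, so that M can
          be taken out of the integral before the pointwise comparison with the essential
          infimum.\<close>
        define F where "F = (\<lambda>t. local_lux f x t / M * inv_\<Phi> ((max r t) powr (- real DIM('a))) * ennreal (1 / t) * indicator {r<..} t)"
        have [measurable]: "F \<in> borel_measurable borel"
          unfolding F_def using local_lux_measurable[of f x] inv_powr_measurable[OF r, of "DIM('a)"] by measurable
        have "tail f x r = (\<integral>\<^sup>+t. M * F t \<partial>lborel)"
          unfolding tail_def F_def
        proof (rule nn_integral_cong)
          fix t
          have "M * (local_lux f x t / M) = local_lux f x t"
            unfolding m(1) unfolding ennreal_times_divide mult.commute[of "ennreal m"]
              by (rule ennreal_mult_divide_eq) (use m0 in auto)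
          then show "local_lux f x t * inv_\<Phi> (t powr (- real DIM('a))) * ennreal (1 / t) * indicator {r<..} t
            = M * (local_lux f x t / M * inv_\<Phi> ((max r t) powr (- real DIM('a))) * ennreal (1 / t) * indicator {r<..} t)"
            by (cases "t > r") (simp_all add: max_def flip: mult.assoc)
        qed
        also have "\<dots> = M * (\<integral>\<^sup>+t. F t \<partial>lborel)" by (rule nn_integral_cmult) simp
        also have "(\<integral>\<^sup>+t. F t \<partial>lborel) \<le> (\<integral>\<^sup>+t\<in>{r<..}. essinf (lebesgue_on {t<..}) (\<lambda>s. ennreal (\<phi>1 x s) / inv_\<Phi> (s powr (- real DIM('a)))) *
         inv_\<Phi> (t powr (- real DIM('a))) * ennreal (1 / t) \<partial>lborel)"
        proof (rule nn_integral_mono)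
          fix t
          show "F t \<le> essinf (lebesgue_on {t<..}) (\<lambda>s. ennreal (\<phi>1 x s) / inv_\<Phi> (s powr (- real DIM('a)))) *
             inv_\<Phi> (t powr (- real DIM('a))) * ennreal (1 / t) * indicator {r<..} t"
          proof (cases "t > r")
            case True
            then have "t > 0" "max r t = t" using r by auto
            then show ?thesis unfolding F_def by (simp only:) (intro mult_right_mono le, auto)
          qed (simp add: F_def)
        qed
        also have "\<dots> \<le> ennreal (C0 * \<phi>2 x r)" by (rule C0[OF r])
        also have "\<dots> \<le> ennreal (K * \<phi>2 x r)"
          using phi2[OF r, of x] by (intro ennreal_leI mult_right_mono) (auto simp: K_def)
        finally show ?thesis by (simp add: mult_left_mono)
      qed
    qed
    have tail_fin: "tail f x r < \<infinity>" if "r > 0" for x r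
      using tail[OF that, of x] by (rule le_less_trans) (use M in \<open>simp add: ennreal_mult_less_top\<close>)
    define G where "G = (\<lambda>x. enn2real (g_fun \<alpha> f x))"
    have [measurable]: "g_fun \<alpha> f \<in> borel_measurable borel" by (rule g_fun_measurable[OF assms(1,2) lf])
    have Gm[measurable]: "G \<in> borel_measurable borel" unfolding G_def by measurable
    have G0: "G x \<ge> 0" for x by (simp add: G_def)
    have local_G: "local_lux G x r = lux (\<lambda>y. indicator (ball x r) y * enn2real (g_fun \<alpha> f y))" for x r
      by (simp add: local_lux_def G_def)
    have est: "local_lux G x r * inv_\<Phi> (r powr (- real DIM('a))) \<le> ennreal C * (M * ennreal (K * \<phi>2 x r))" if r: "r > 0" for x r
      unfolding local_G by (rule order_trans[OF conjunct1[OF C(2)[OF lf r]] mult_left_mono[OF tail[OF r]]]) simp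
    have norm_le: "orlicz_morrey_norm \<Phi> \<phi>2 G \<le> ennreal (C * K) * M"
      unfolding orlicz_morrey_norm_def lux_cut
    proof (intro SUP_least)
      fix x :: 'a and r :: real assume "r \<in> {0<..}"
      then have r: "r > 0" by simp
      define p where "p = \<phi>2 x r"
      have p: "p > 0" using phi2[OF r] by (simp add: p_def)
      have "inverse (ennreal p) * inv_\<Phi> (r powr (- real DIM('a))) * local_lux G x r
        = inverse (ennreal p) * (local_lux G x r * inv_\<Phi> (r powr (- real DIM('a))))" by (simp only: mult_ac)
      also have "\<dots> \<le> inverse (ennreal p) * (ennreal C * (M * ennreal (K * p)))"
        unfolding p_def by (intro mult_left_mono est r) simp
      also have "\<dots> = (inverse (ennreal p) * ennreal (K * p) * ennreal C) * M" by (simp only: mult_ac)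
      also have "inverse (ennreal p) * ennreal (K * p) * ennreal C = ennreal (inverse p * (K * p) * C)"
        using p C(1) by (simp add: inverse_ennreal K_def ennreal_mult)
      also have "inverse p * (K * p) * C = C * K" using p by simp
      finally show "inverse (ennreal (\<phi>2 x r)) * inv_\<Phi> (r powr (- real DIM('a))) * local_lux G x r \<le> ennreal (C * K) * M"
        by (simp only: p_def)
    qed
    have lux_fin: "local_lux G x r < \<infinity>" if r: "r > 0" for x r
    proof -
      have "local_lux G x r * inv_\<Phi> (r powr (- real DIM('a))) < \<infinity>"
        using est[OF r, of x] by (rule le_less_trans) (use M in \<open>simp add: ennreal_mult_less_top\<close>)
      then show ?thesis using ip[OF r] by (auto simp: ennreal_mult_less_top)
    qed
    \<comment> \<open>Membership in the Orlicz space includes local integrability; on each ball it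
      follows from the finite local norm by \<open>ball_L1_le\<close>.\<close>
    have Gl: "locally_integrable G"
      unfolding locally_integrable_def set_integrable_def
    proof (intro allI)
      fix x r
      show "integrable lebesgue (\<lambda>z. indicator (ball x r) z *\<^sub>R G z)"
      proof (cases "r > 0")
        case True
        have m: "(\<lambda>z. indicator (ball x r) z *\<^sub>R G z) \<in> borel_measurable borel"
          by (intro borel_measurable_scaleR borel_measurable_indicator Gm) simp
        have "G \<in> borel_measurable lebesgue" by (intro measurable_completion) simp
        then have le: "(\<integral>\<^sup>+z\<in>ball x r. ennreal (norm (G z)) \<partial>lborel) \<le> ennreal (2 * unit_ball_vol (real DIM('a)) * max 1 (1 / unit_ball_vol (real DIM('a)))) * (ennreal (r ^ DIM('a)) * (local_lux G x r * inv_\<Phi> (r powr (- real DIM('a)))))"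
          by (rule ball_L1_le[OF _ True refl])
        have "(\<integral>\<^sup>+z. ennreal (norm (indicator (ball x r) z *\<^sub>R G z)) \<partial>lborel) = (\<integral>\<^sup>+z\<in>ball x r. ennreal (norm (G z)) \<partial>lborel)"
          by (rule nn_integral_cong) (auto simp: indicator_def)
        also have "\<dots> < \<infinity>" using le by (rule le_less_trans) (use lux_fin[OF True, of x] ip[OF True] in \<open>simp add: ennreal_mult_less_top\<close>)
        finally have "integrable lborel (\<lambda>z. indicator (ball x r) z *\<^sub>R G z)" using m by (intro integrableI_bounded) auto
        then show ?thesis by (subst integrable_completion) (use m in auto)
      next
        case False
        then have "ball x r = {}" by (intro ball_empty) simp
        then have "indicator (ball x r) z = (0 :: real)" for z by (simp only: indicator_def empty_iff of_bool_eq)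
        then show ?thesis by simp
      qed
    qed
    have "G \<in> orlicz_loc \<Phi>"
      unfolding orlicz_loc_def
    proof (intro CollectI allI impI)
      fix x :: 'a and r :: real assume r: "r > 0"
      obtain c where c: "c > 0" "(\<integral>\<^sup>+y. \<Phi> (indicator (ball x r) y * norm (G y) / c) \<partial>lborel) \<le> 1"
        using lux_fin[OF r, of x] lux_finite_witness unfolding local_lux_def by blast
      have "(\<integral>\<^sup>+y. \<Phi> (1 / c * norm (cut_off (ball x r) G y)) \<partial>lebesgue) \<le> 1"
        using c unfolding nn_integral_completion by (simp add: cut_off_def abs_mult)
      then have "(\<integral>\<^sup>+y. \<Phi> (1 / c * norm (cut_off (ball x r) G y)) \<partial>lebesgue) < \<infinity>" by (rule le_less_trans) simp
      then show "cut_off (ball x r) G \<in> orlicz_space \<Phi>"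
        unfolding orlicz_space_def using locally_integrable_cut_off[OF Gl, of "ball x r"] c(1)
        by (intro CollectI conjI exI[of _ "1 / c"]) auto
    qed
    moreover have "orlicz_morrey_norm \<Phi> \<phi>2 G < \<infinity>"
      using norm_le by (rule le_less_trans) (use M in \<open>simp add: ennreal_mult_less_top\<close>)
    ultimately have GM: "G \<in> orlicz_morrey \<Phi> \<phi>2" by (simp add: orlicz_morrey_def)
    \<comment> \<open>The local estimate gives finiteness almost everywhere on one ball; countably
      many balls exhaust the space.\<close>
    have "AE x in lborel. \<forall>k::nat. x \<in> ball 0 (real (Suc k)) \<longrightarrow> g_fun \<alpha> f x < \<infinity>"
      unfolding AE_all_countable using C(2)[OF lf] tail_fin by (metis of_nat_0_less_iff zero_less_Suc)
    then have "AE x in lborel. g_fun \<alpha> f x < \<infinity>"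
    proof eventually_elim
      case (elim x)
      obtain k :: nat where "norm x < real k" using reals_Archimedean2 by blast
      then have "x \<in> ball 0 (real (Suc k))" by simp
      then show ?case using elim by blast
    qed
    then have "AE x in lebesgue. g_fun \<alpha> f x < \<infinity>" by (rule AE_completion)
    then show ?thesis using GM norm_le unfolding G_def M_def by blast
  qed
  show ?thesis
  proof (rule exI[of _ "C * K"], intro conjI allI impI)
    show "C * K \<ge> 0" using C(1) by (simp add: K_def)
  qed (use main in blast)+
qed

end
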